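(* Let $k$ be a field and let $S_1\subseteq S_0\subseteq\mathbb{P}'_k$. (a) If $S_0$ contains no complex place and $S_1$ contains no infinite place, then $T_{k,S_0,S_1}$ is model complete and complete. (b) If $S_0$ contains no complex place and $S_1=\emptyset$, then $T_{k,S_0,S_1}$ has quantifier elimination.
   Context: Places of $k$ are equivalence classes of nontrivial absolute values; finite = ultrametric, infinite = archimedean, real/complex according to whether the completion is $\mathbb{R}$ or $\mathbb{C}$; a finite place is discrete if $|k^\times|_\mathfrak{p}$ is discrete in $\mathbb{R}_{>0}$. $\mathbb{P}'_k$ is the set of places that are infinite, or finite and discrete. For a finite discrete $\mathfrak{p}$, $v_\mathfrak{p}$ is its normalized discrete valuation (ring $\mathcal{O}$, residue field $\kappa$); for real $\mathfrak{p}$, $\le_\mathfrak{p}$ is the induced ordering of $k$. Base language $\mathcal{L}_k=\{+,0,1,(\cdot_\lambda)_{\lambda\in k}\}$ with $T_k$ the theory of $k$-vector spaces. Finite discrete $\mathfrak{p}$: two-sorted theory $T_{k,v_\mathfrak{p}}$ (vector sort with $\mathcal{L}_k$; value sort $\Gamma$ with $<,\infty,s$; map $v$; "$\gamma=s^n(\delta)$" means $s^{-n}(\gamma)=\delta$ for $n<0$ and $\gamma=\infty$ for $n=\infty$): $T_k$; $0\ne1$; $(\Gamma,<)$ discretely ordered with largest element $\infty$; $v$ surjective; $v(x+y)\ge\min(v(x),v(y))$, $v(x)=\infty\leftrightarrow x=0$; $s(\infty)=\infty$ and for $\gamma\ne\infty$ $s(\gamma)$ is the immediate successor of $\gamma$;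 $v(\lambda x)=s^{v_\mathfrak{p}(\lambda)}(v(x))$ for $\lambda\in k$; if $\kappa$ finite, $\forall x,y(v(x)=v(y)\ne\infty\to\bigvee_{\omega\in\Omega}v(\omega x+y)>v(x))$ with $\Omega\subseteq\mathcal{O}^\times$ representatives of $\kappa^\times$; if $\kappa$ infinite, for all $n$: $\forall x,\bar y(\bigwedge_jv(x)\le v(y_j)\to\bigvee_{i=0}^n\bigwedge_{j=1}^nv(\omega_ix+y_j)=v(x))$ with $\omega_i\in\mathcal{O}^\times$ of distinct residues. $T^+_{k,v_\mathfrak{p}}$ adds on $\Gamma$ symbols $0,1,+,P_n$ and axioms: $v(1)=0$, $s(0)=1$; $(\Gamma\setminus\{\infty\},+,0,<)$ ordered abelian group with $\gamma+\infty=\infty+\gamma=\infty$; $\forall\gamma\exists\delta\bigvee_{i=1}^n\gamma=n\delta+i1$ for each $n$; $P_n(\gamma)\leftrightarrow\exists\delta\,\gamma=n\delta$. $T_{k,\mathfrak{p}}$ (in $\mathcal{L}_k\cup\{L\}$) resp. $T^+_{k,\mathfrak{p}}$ (in $\mathcal{L}_k\cup\{L,M,(Q_n)_n\}$) is the theory whose models are exactly the structures $K$ for which some model $(K,\Gamma,v)$ of $T_{k,v_\mathfrak{p}}$ resp. $T^+_{k,v_\mathfrak{p}}$ on the same vector sort satisfies $L(x,y)\Leftrightarrow v(x)\ge v(y)$ (and $M(x,y,z)\Leftrightarrow v(x)+v(y)=v(z)$, $Q_n(x)\Leftrightarrow P_n(v(x))$). Real $\mathfrak{p}$: $T_{k,\mathfrak{p}}$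 (in $\mathcal{L}_k\cup\{L\}$) is the theory whose models are the $k$-vector spaces $(K,L)$ such that with $x\le y:\Leftrightarrow L(y-x-1,y-x+1)$: $0<1$, $(K,0,+,<)$ is an ordered abelian group, $x\le y\to\lambda x\le\lambda y$ for every $\lambda\in k$ with $\lambda\ge_\mathfrak{p}0$, and $L(x,y)\leftrightarrow(y\ge x\ge0\vee y\ge-x\ge0\vee-y\ge x\ge0\vee-y\ge-x\ge0)$. $\mathcal{L}_{k,S_0,S_1}$ is $\mathcal{L}_k$ together with, for each $\mathfrak{p}\in S_0$, a binary symbol $L^\mathfrak{p}$, and for each $\mathfrak{p}\in S_1$ also symbols $M^\mathfrak{p},(Q^\mathfrak{p}_n)_n$ (distinct for distinct places). When $S_0$ has no complex and $S_1$ no infinite places, $T_{k,S_0,S_1}$ is $T_k\cup\bigcup_{\mathfrak{p}\in S_0}T_{k,\mathfrak{p}}\cup\bigcup_{\mathfrak{p}\in S_1}T^+_{k,\mathfrak{p}}$ (symbols labelled by $\mathfrak{p}$) together with the weak approximation scheme: for every finite $\{\mathfrak{p}_1,\dots,\mathfrak{p}_r\}\subseteq S_0$ and every $A\in k^{m\times n}$, the axiom: for all $b\in K^m$, $c_1,\dots,c_r\in K\setminus\{0\}$ and $x_1,\dots,x_r\in K^n$ with $Ax_i=b$ for all $i$, there is $y\in K^n$ with $Ay=b$ and $L^{\mathfrak{p}_i}(y_j-x_{i,j},c_i)$ for all $i\le r$, $j\le n$.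
   Formalization: S_0 is assumed nonempty (for S_0 empty, T_k has the zero space as a model and (a), (b) fail); weak approximation is taken for r≥1; models have carriers in an arbitrary fixed type, which by Löwenheim–Skolem covers all models. *)

theory Defs
  imports "HOL-Analysis.Isolated"
begin

section \<open>First-order logic\<close>

datatype 'f trm = Var nat | Fun 'f "'f trm list"

datatype ('f, 'r) fm =
    Eq "'f trm" "'f trm"
  | Rel 'r "'f trm list"
  | Bot
  | Imp "('f, 'r) fm" "('f, 'r) fm"
  | All nat "('f, 'r) fm"

abbreviation Neg :: "('f, 'r) fm \<Rightarrow> ('f, 'r) fm" where "Neg A \<equiv> Imp A Bot"
abbreviation Or :: "('f, 'r) fm \<Rightarrow> ('f, 'r) fm \<Rightarrow> ('f, 'r) fm" where "Or A B \<equiv> Imp (Neg A) B"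
abbreviation And :: "('f, 'r) fm \<Rightarrow> ('f, 'r) fm \<Rightarrow> ('f, 'r) fm" where "And A B \<equiv> Neg (Imp A (Neg B))"
abbreviation Iff :: "('f, 'r) fm \<Rightarrow> ('f, 'r) fm \<Rightarrow> ('f, 'r) fm" where "Iff A B \<equiv> And (Imp A B) (Imp B A)"
abbreviation Ex :: "nat \<Rightarrow> ('f, 'r) fm \<Rightarrow> ('f, 'r) fm" where "Ex n A \<equiv> Neg (All n (Neg A))"

definition Conj :: "('f, 'r) fm list \<Rightarrow> ('f, 'r) fm" where "Conj As = foldr And As (Neg Bot)"
definition Disj :: "('f, 'r) fm list \<Rightarrow> ('f, 'r) fm" where "Disj As = foldr Or As Bot"
definition Alls :: "nat list \<Rightarrow> ('f, 'r) fm \<Rightarrow> ('f, 'r) fm" where "Alls ns A = foldr All ns A"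
definition Exs :: "nat list \<Rightarrow> ('f, 'r) fm \<Rightarrow> ('f, 'r) fm" where "Exs ns A = foldr Ex ns A"

fun fvt :: "'f trm \<Rightarrow> nat set" where
  "fvt (Var n) = {n}"
| "fvt (Fun f ts) = (\<Union>t\<in>set ts. fvt t)"

fun fv :: "('f, 'r) fm \<Rightarrow> nat set" where
  "fv (Eq s t) = fvt s \<union> fvt t"
| "fv (Rel R ts) = (\<Union>t\<in>set ts. fvt t)"
| "fv Bot = {}"
| "fv (Imp A B) = fv A \<union> fv B"
| "fv (All n A) = fv A - {n}"

fun qfree :: "('f, 'r) fm \<Rightarrow> bool" where
  "qfree (Imp A B) \<longleftrightarrow> qfree A \<and> qfree B"
| "qfree (All n A) \<longleftrightarrow> False"
| "qfree _ \<longleftrightarrow> True"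

text \<open>A language is a set of function symbols and a set of relation symbols, each with its arity.\<close>

type_synonym ('f, 'r) lang = "('f \<times> nat) set \<times> ('r \<times> nat) set"

fun trm_in :: "('f, 'r) lang \<Rightarrow> 'f trm \<Rightarrow> bool" where
  "trm_in L (Var n) \<longleftrightarrow> True"
| "trm_in L (Fun f ts) \<longleftrightarrow> (f, length ts) \<in> fst L \<and> (\<forall>t\<in>set ts. trm_in L t)"

fun fm_in :: "('f, 'r) lang \<Rightarrow> ('f, 'r) fm \<Rightarrow> bool" where
  "fm_in L (Eq s t) \<longleftrightarrow> trm_in L s \<and> trm_in L t"
| "fm_in L (Rel R ts) \<longleftrightarrow> (R, length ts) \<in> snd L \<and> (\<forall>t\<in>set ts. trm_in L t)"
| "fm_in L Bot \<longleftrightarrow> True"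
| "fm_in L (Imp A B) \<longleftrightarrow> fm_in L A \<and> fm_in L B"
| "fm_in L (All n A) \<longleftrightarrow> fm_in L A"

definition sentence_in :: "('f, 'r) lang \<Rightarrow> ('f, 'r) fm \<Rightarrow> bool" where
  "sentence_in L A \<longleftrightarrow> fm_in L A \<and> fv A = {}"

record ('f, 'r, 'u) struct =
  univ :: "'u set"
  fint :: "'f \<Rightarrow> 'u list \<Rightarrow> 'u"
  rint :: "'r \<Rightarrow> 'u list \<Rightarrow> bool"

definition struct_in :: "('f, 'r) lang \<Rightarrow> ('f, 'r, 'u) struct \<Rightarrow> bool" where
  "struct_in L M \<longleftrightarrow> univ M \<noteq> {} \<and>
     (\<forall>(f, n)\<in>fst L. \<forall>xs. length xs = n \<longrightarrow> set xs \<subseteq> univ M \<longrightarrow> fint M f xs \<in> univ M)"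

fun evalt :: "('f, 'r, 'u) struct \<Rightarrow> (nat \<Rightarrow> 'u) \<Rightarrow> 'f trm \<Rightarrow> 'u" where
  "evalt M e (Var n) = e n"
| "evalt M e (Fun f ts) = fint M f (map (evalt M e) ts)"

fun sat :: "('f, 'r, 'u) struct \<Rightarrow> (nat \<Rightarrow> 'u) \<Rightarrow> ('f, 'r) fm \<Rightarrow> bool" where
  "sat M e (Eq s t) \<longleftrightarrow> evalt M e s = evalt M e t"
| "sat M e (Rel R ts) \<longleftrightarrow> rint M R (map (evalt M e) ts)"
| "sat M e Bot \<longleftrightarrow> False"
| "sat M e (Imp A B) \<longleftrightarrow> (sat M e A \<longrightarrow> sat M e B)"
| "sat M e (All n A) \<longleftrightarrow> (\<forall>a\<in>univ M. sat M (e(n := a)) A)"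

definition models :: "('f, 'r, 'u) struct \<Rightarrow> ('f, 'r) fm set \<Rightarrow> bool" where
  "models M T \<longleftrightarrow> (\<forall>A\<in>T. \<forall>e. range e \<subseteq> univ M \<longrightarrow> sat M e A)"

definition substruct :: "('f, 'r) lang \<Rightarrow> ('f, 'r, 'u) struct \<Rightarrow> ('f, 'r, 'u) struct \<Rightarrow> bool" where
  "substruct L M N \<longleftrightarrow> univ M \<subseteq> univ N \<and>
     (\<forall>(f, n)\<in>fst L. \<forall>xs. length xs = n \<longrightarrow> set xs \<subseteq> univ M \<longrightarrow> fint M f xs = fint N f xs) \<and>
     (\<forall>(R, n)\<in>snd L. \<forall>xs. length xs = n \<longrightarrow> set xs \<subseteq> univ M \<longrightarrow> rint M R xs = rint N R xs)"

definition elem_substruct :: "('f, 'r) lang \<Rightarrow> ('f, 'r, 'u) struct \<Rightarrow> ('f, 'r, 'u) struct \<Rightarrow> bool" where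
  "elem_substruct L M N \<longleftrightarrow> substruct L M N \<and>
     (\<forall>A e. fm_in L A \<longrightarrow> range e \<subseteq> univ M \<longrightarrow> (sat M e A \<longleftrightarrow> sat N e A))"

text \<open>Definitions in HOL cannot quantify over all carrier types. The notions below are therefore
relative to the type \<^typ>\<open>'u\<close> from which the carriers of structures are taken (as subsets); a theorem
that leaves \<^typ>\<open>'u\<close> free makes the assertion for structures on every type. Satisfiability needs no
such parameter: by the downward Loewenheim-Skolem theorem a theory that has a model has one whose
carrier consists of formulas of the language.\<close>

definition entails :: "'u itself \<Rightarrow> ('f, 'r) lang \<Rightarrow> ('f, 'r) fm set \<Rightarrow> ('f, 'r) fm \<Rightarrow> bool" where
  "entails _ L T A \<longleftrightarrow>
     (\<forall>M :: ('f, 'r, 'u) struct. struct_in L M \<longrightarrow> models M T \<longrightarrow>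
        (\<forall>e. range e \<subseteq> univ M \<longrightarrow> sat M e A))"

definition satisfiable :: "('f, 'r) lang \<Rightarrow> ('f, 'r) fm set \<Rightarrow> bool" where
  "satisfiable L T \<longleftrightarrow> (\<exists>M :: ('f, 'r, ('f, 'r) fm) struct. struct_in L M \<and> models M T)"

definition complete_theory :: "'u itself \<Rightarrow> ('f, 'r) lang \<Rightarrow> ('f, 'r) fm set \<Rightarrow> bool" where
  "complete_theory U L T \<longleftrightarrow> satisfiable L T \<and>
     (\<forall>A. sentence_in L A \<longrightarrow> entails U L T A \<or> entails U L T (Neg A))"

definition model_complete :: "'u itself \<Rightarrow> ('f, 'r) lang \<Rightarrow> ('f, 'r) fm set \<Rightarrow> bool" where
  "model_complete _ L T \<longleftrightarrow>
     (\<forall>M N :: ('f, 'r, 'u) struct. struct_in L M \<longrightarrow> struct_in L N \<longrightarrow> models M T \<longrightarrow> models N T \<longrightarrow>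
        substruct L M N \<longrightarrow> elem_substruct L M N)"

definition quantifier_elimination :: "'u itself \<Rightarrow> ('f, 'r) lang \<Rightarrow> ('f, 'r) fm set \<Rightarrow> bool" where
  "quantifier_elimination U L T \<longleftrightarrow>
     (\<forall>A. fm_in L A \<longrightarrow>
        (\<exists>B. fm_in L B \<and> qfree B \<and> fv B \<subseteq> fv A \<and> entails U L T (Iff A B)))"


section \<open>Places\<close>

definition absolute_value :: "('k::field \<Rightarrow> real) \<Rightarrow> bool" where
  "absolute_value a \<longleftrightarrow> (\<forall>x. a x \<ge> 0) \<and> (\<forall>x. a x = 0 \<longleftrightarrow> x = 0) \<and>
     (\<forall>x y. a (x * y) = a x * a y) \<and> (\<forall>x y. a (x + y) \<le> a x + a y)"

definition nontrivial_av :: "('k::field \<Rightarrow> real) \<Rightarrow> bool" where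
  "nontrivial_av a \<longleftrightarrow> (\<exists>x. x \<noteq> 0 \<and> a x \<noteq> 1)"

definition ultrametric_av :: "('k::field \<Rightarrow> real) \<Rightarrow> bool" where
  "ultrametric_av a \<longleftrightarrow> (\<forall>x y. a (x + y) \<le> max (a x) (a y))"

definition equiv_av :: "('k::field \<Rightarrow> real) \<Rightarrow> ('k \<Rightarrow> real) \<Rightarrow> bool" where
  "equiv_av a b \<longleftrightarrow> (\<exists>s>0. \<forall>x. b x = a x powr s)"

type_synonym 'k place = "('k \<Rightarrow> real) set"

definition places :: "'k::field place set" where
  "places = {{b. absolute_value b \<and> equiv_av a b} | a. absolute_value a \<and> nontrivial_av a}"

definition finite_place :: "'k::field place \<Rightarrow> bool" where
  "finite_place p \<longleftrightarrow> p \<in> places \<and> (\<forall>a\<in>p. ultrametric_av a)"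

definition infinite_place :: "'k::field place \<Rightarrow> bool" where
  "infinite_place p \<longleftrightarrow> p \<in> places \<and> \<not> (\<forall>a\<in>p. ultrametric_av a)"

definition discrete_place :: "'k::field place \<Rightarrow> bool" where
  "discrete_place p \<longleftrightarrow> (\<forall>a\<in>p. discrete (a ` {x. x \<noteq> 0}))"

text \<open>For a complete valued field \<^typ>\<open>'c\<close> this says that \<open>\<sigma>\<close> exhibits \<^typ>\<open>'c\<close> as the completion at \<open>p\<close>.\<close>

definition completion_map :: "'k::field place \<Rightarrow> ('k \<Rightarrow> 'c::real_normed_field) \<Rightarrow> bool" where
  "completion_map p \<sigma> \<longleftrightarrow>
     \<sigma> 1 = 1 \<and> (\<forall>x y. \<sigma> (x + y) = \<sigma> x + \<sigma> y) \<and> (\<forall>x y. \<sigma> (x * y) = \<sigma> x * \<sigma> y) \<and>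
     (\<lambda>x. norm (\<sigma> x)) \<in> p \<and> closure (range \<sigma>) = UNIV"

definition real_place :: "'k::field place \<Rightarrow> bool" where
  "real_place p \<longleftrightarrow> infinite_place p \<and> (\<exists>\<sigma> :: 'k \<Rightarrow> real. completion_map p \<sigma>)"

definition complex_place :: "'k::field place \<Rightarrow> bool" where
  "complex_place p \<longleftrightarrow> infinite_place p \<and> (\<exists>\<sigma> :: 'k \<Rightarrow> complex. completion_map p \<sigma>)"

definition places' :: "'k::field place set" where
  "places' = {p. infinite_place p \<or> finite_place p \<and> discrete_place p}"

definition place_nonneg :: "'k::field place \<Rightarrow> 'k \<Rightarrow> bool" where
  "place_nonneg p c \<longleftrightarrow> (\<exists>\<sigma> :: 'k \<Rightarrow> real. completion_map p \<sigma> \<and> 0 \<le> \<sigma> c)"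

definition uniformizer :: "'k::field place \<Rightarrow> 'k \<Rightarrow> bool" where
  "uniformizer p \<pi> \<longleftrightarrow> (\<exists>a\<in>p. \<pi> \<noteq> 0 \<and> a \<pi> < 1 \<and> (\<forall>x. a x < 1 \<longrightarrow> a x \<le> a \<pi>))"

text \<open>Only meaningful for nonzero arguments; \<open>v(0) = \<infinity>\<close> is treated separately throughout.\<close>

definition pval :: "'k::field place \<Rightarrow> 'k \<Rightarrow> int" where
  "pval p x = (THE n. \<exists>a\<in>p. \<exists>\<pi>. uniformizer p \<pi> \<and> a x = a \<pi> powi n)"

definition vring :: "'k::field place \<Rightarrow> 'k set" where
  "vring p = {x. x = 0 \<or> pval p x \<ge> 0}"

definition vunits :: "'k::field place \<Rightarrow> 'k set" where
  "vunits p = {x. x \<noteq> 0 \<and> pval p x = 0}"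

definition same_residue :: "'k::field place \<Rightarrow> 'k \<Rightarrow> 'k \<Rightarrow> bool" where
  "same_residue p x y \<longleftrightarrow> x = y \<or> pval p (x - y) > 0"

definition residue_field :: "'k::field place \<Rightarrow> 'k set set" where
  "residue_field p = vring p // {(x, y). x \<in> vring p \<and> y \<in> vring p \<and> same_residue p x y}"

definition residue_reps :: "'k::field place \<Rightarrow> 'k list \<Rightarrow> bool" where
  "residue_reps p ws \<longleftrightarrow> distinct ws \<and> set ws \<subseteq> vunits p \<and>
     (\<forall>u\<in>vunits p. \<exists>!w. w \<in> set ws \<and> same_residue p u w)"

definition distinct_residues :: "'k::field place \<Rightarrow> 'k list \<Rightarrow> bool" where
  "distinct_residues p ws \<longleftrightarrow> set ws \<subseteq> vunits p \<and>
     (\<forall>i<length ws. \<forall>j<length ws. i \<noteq> j \<longrightarrow> \<not> same_residue p (ws ! i) (ws ! j))"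


section \<open>Languages\<close>

datatype 'k fsym = Plus | Zero | One | Scale 'k

datatype 'k rsym = RL "'k place" | RM "'k place" | RQ "'k place" nat

definition lang_k :: "('k fsym, 'k rsym) lang" where
  "lang_k = ({(Plus, 2), (Zero, 0), (One, 0)} \<union> {(Scale c, 1) | c. True}, {})"

definition lang_kS :: "'k place set \<Rightarrow> 'k place set \<Rightarrow> ('k fsym, 'k rsym) lang" where
  "lang_kS S0 S1 = (fst lang_k,
     {(RL p, 2) | p. p \<in> S0} \<union> {(RM p, 3) | p. p \<in> S1} \<union> {(RQ p n, 1) | p n. p \<in> S1 \<and> n \<ge> 1})"

abbreviation V :: "nat \<Rightarrow> 'k fsym trm" where "V \<equiv> Var"
abbreviation tadd :: "'k fsym trm \<Rightarrow> 'k fsym trm \<Rightarrow> 'k fsym trm" where "tadd s t \<equiv> Fun Plus [s, t]"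
abbreviation tzero :: "'k fsym trm" where "tzero \<equiv> Fun Zero []"
abbreviation tone :: "'k fsym trm" where "tone \<equiv> Fun One []"
abbreviation tscale :: "'k \<Rightarrow> 'k fsym trm \<Rightarrow> 'k fsym trm" where "tscale c t \<equiv> Fun (Scale c) [t]"
abbreviation tneg :: "'k::field fsym trm \<Rightarrow> 'k fsym trm" where "tneg t \<equiv> tscale (- 1) t"
abbreviation tsub :: "'k::field fsym trm \<Rightarrow> 'k fsym trm \<Rightarrow> 'k fsym trm" where "tsub s t \<equiv> tadd s (tneg t)"

type_synonym 'k form = "('k fsym, 'k rsym) fm"

text \<open>The symbol \<open>L\<close> of \<open>p\<close> applied to \<open>s, t\<close>: at a finite place it means \<open>v s \<ge> v t\<close>.\<close>

abbreviation fL :: "'k place \<Rightarrow> 'k fsym trm \<Rightarrow> 'k fsym trm \<Rightarrow> 'k form" where "fL p s t \<equiv> Rel (RL p) [s, t]"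
abbreviation fM :: "'k place \<Rightarrow> 'k fsym trm \<Rightarrow> 'k fsym trm \<Rightarrow> 'k fsym trm \<Rightarrow> 'k form" where
  "fM p s t u \<equiv> Rel (RM p) [s, t, u]"
abbreviation fQ :: "'k place \<Rightarrow> nat \<Rightarrow> 'k fsym trm \<Rightarrow> 'k form" where "fQ p n s \<equiv> Rel (RQ p n) [s]"
abbreviation feqv :: "'k place \<Rightarrow> 'k fsym trm \<Rightarrow> 'k fsym trm \<Rightarrow> 'k form" where
  "feqv p s t \<equiv> And (fL p s t) (fL p t s)"


section \<open>Theories\<close>

definition T_vs :: "'k::field form set" where
  "T_vs =
     { All 0 (All 1 (All 2 (Eq (tadd (tadd (V 0) (V 1)) (V 2)) (tadd (V 0) (tadd (V 1) (V 2)))))),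
       All 0 (All 1 (Eq (tadd (V 0) (V 1)) (tadd (V 1) (V 0)))),
       All 0 (Eq (tadd tzero (V 0)) (V 0)),
       All 0 (Eq (tadd (V 0) (tneg (V 0))) tzero),
       All 0 (Eq (tscale 1 (V 0)) (V 0)) }
   \<union> {All 0 (All 1 (Eq (tscale c (tadd (V 0) (V 1))) (tadd (tscale c (V 0)) (tscale c (V 1))))) | c. True}
   \<union> {All 0 (Eq (tscale (c + d) (V 0)) (tadd (tscale c (V 0)) (tscale d (V 0)))) | c d. True}
   \<union> {All 0 (Eq (tscale (c * d) (V 0)) (tscale c (tscale d (V 0)))) | c d. True}"

text \<open>At a finite discrete place the value sort is eliminated: its elements are the classes of
vectors under \<open>L(x,y) \<and> L(y,x)\<close>, and \<open>s(v(x)) = v(\<pi>x)\<close> for any \<open>\<pi>\<close> of value \<open>1\<close>. That the models of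
\<open>T_fin p\<close> and \<open>T_fin_plus p\<close> are exactly the structures induced by models of the two-sorted theories
is proved below (\<open>models_T_fin\<close>, \<open>models_T_fin_plus\<close>). The residue field axioms are imposed for
all choices of representatives; modulo the other axioms any one choice implies the others.\<close>

definition T_fin :: "'k::field place \<Rightarrow> 'k form set" where
  "T_fin p = T_vs \<union>
     { Neg (Eq tzero tone),
       All 0 (All 1 (Or (fL p (V 0) (V 1)) (fL p (V 1) (V 0)))),
       All 0 (All 1 (All 2 (Imp (fL p (V 0) (V 1)) (Imp (fL p (V 1) (V 2)) (fL p (V 0) (V 2)))))),
       All 0 (fL p tzero (V 0)),
       All 0 (Imp (fL p (V 0) tzero) (Eq (V 0) tzero)),
       All 0 (All 1 (All 2 (Imp (fL p (V 0) (V 2)) (Imp (fL p (V 1) (V 2)) (fL p (tadd (V 0) (V 1)) (V 2)))))) }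
   \<union> {All 0 (feqv p (tscale c (V 0)) (tscale d (V 0))) | c d. c \<noteq> 0 \<and> d \<noteq> 0 \<and> pval p c = pval p d}
   \<union> {All 0 (Imp (Neg (Eq (V 0) tzero))
         (And (Neg (fL p (V 0) (tscale \<pi> (V 0))))
              (All 1 (Imp (Neg (fL p (V 0) (V 1))) (fL p (V 1) (tscale \<pi> (V 0))))))) | \<pi>. \<pi> \<noteq> 0 \<and> pval p \<pi> = 1}
   \<union> {All 0 (All 1 (Imp (And (feqv p (V 0) (V 1)) (Neg (Eq (V 0) tzero)))
         (Disj (map (\<lambda>w. Neg (fL p (V 0) (tadd (tscale w (V 0)) (V 1)))) ws)))) | ws.
         finite (residue_field p) \<and> residue_reps p ws}
   \<union> {Alls [0..<Suc n] (Imp (Conj (map (\<lambda>j. fL p (V j) (V 0)) [1..<Suc n]))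
         (Disj (map (\<lambda>w. Conj (map (\<lambda>j. feqv p (tadd (tscale w (V 0)) (V j)) (V 0)) [1..<Suc n])) ws))) | n ws.
         infinite (residue_field p) \<and> length ws = Suc n \<and> distinct_residues p ws}"

text \<open>\<open>multiple_chain p n\<close> says that \<open>v\<close> of variable \<open>i\<close> is \<open>i\<close> times \<open>v\<close> of variable \<open>1\<close>, for \<open>1 \<le> i \<le> n\<close>.\<close>

definition multiple_chain :: "'k place \<Rightarrow> nat \<Rightarrow> 'k form" where
  "multiple_chain p n = Conj (map (\<lambda>i. fM p (V i) (V 1) (V (Suc i))) [1..<n])"

definition T_fin_plus :: "'k::field place \<Rightarrow> 'k form set" where
  "T_fin_plus p = T_fin p \<union>
     { All 0 (All 1 (Ex 2 (fM p (V 0) (V 1) (V 2)))),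
       Alls [0..<6] (Imp (And (feqv p (V 0) (V 3)) (And (feqv p (V 1) (V 4)) (fM p (V 0) (V 1) (V 2))))
                         (Iff (feqv p (V 2) (V 5)) (fM p (V 3) (V 4) (V 5)))),
       All 0 (All 1 (All 2 (Imp (fM p (V 0) (V 1) (V 2)) (fM p (V 1) (V 0) (V 2))))),
       Alls [0..<6] (Imp (And (fM p (V 0) (V 1) (V 3)) (And (fM p (V 3) (V 2) (V 5)) (fM p (V 1) (V 2) (V 4))))
                         (fM p (V 0) (V 4) (V 5))),
       All 0 (fM p tone (V 0) (V 0)),
       All 0 (fM p (V 0) tzero tzero),
       All 0 (Imp (Neg (Eq (V 0) tzero)) (Ex 1 (fM p (V 0) (V 1) tone))),
       All 0 (All 1 (Imp (Neg (Eq (V 0) tzero)) (Imp (Neg (Eq (V 1) tzero)) (Neg (fM p (V 0) (V 1) tzero))))),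
       Alls [0..<5] (Imp (And (fL p (V 0) (V 1)) (And (fM p (V 0) (V 2) (V 3)) (fM p (V 1) (V 2) (V 4))))
                         (fL p (V 3) (V 4))) }
   \<union> {All 0 (Exs [1..<Suc n] (And (multiple_chain p n)
          (Disj (map (\<lambda>i. fM p (V n) (tscale (\<pi> ^ i) tone) (V 0)) [1..<Suc n])))) | n \<pi>.
        n \<ge> 1 \<and> \<pi> \<noteq> 0 \<and> pval p \<pi> = 1}
   \<union> {All 0 (Iff (fQ p n (V 0)) (Exs [1..<Suc n] (And (multiple_chain p n) (feqv p (V n) (V 0))))) | n. n \<ge> 1}"

text \<open>\<open>fle p s t\<close> is the defined relation \<open>s \<le> t\<close> at a real place.\<close>

definition fle :: "'k::field place \<Rightarrow> 'k fsym trm \<Rightarrow> 'k fsym trm \<Rightarrow> 'k form" where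
  "fle p s t = fL p (tsub (tsub t s) tone) (tadd (tsub t s) tone)"

definition T_real :: "'k::field place \<Rightarrow> 'k form set" where
  "T_real p = T_vs \<union>
     { And (fle p tzero tone) (Neg (Eq tzero tone)),
       All 0 (fle p (V 0) (V 0)),
       All 0 (All 1 (Imp (fle p (V 0) (V 1)) (Imp (fle p (V 1) (V 0)) (Eq (V 0) (V 1))))),
       All 0 (All 1 (All 2 (Imp (fle p (V 0) (V 1)) (Imp (fle p (V 1) (V 2)) (fle p (V 0) (V 2)))))),
       All 0 (All 1 (Or (fle p (V 0) (V 1)) (fle p (V 1) (V 0)))),
       All 0 (All 1 (All 2 (Imp (fle p (V 0) (V 1)) (fle p (tadd (V 0) (V 2)) (tadd (V 1) (V 2)))))),
       All 0 (All 1 (Iff (fL p (V 0) (V 1))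
         (Disj [And (fle p tzero (V 0)) (fle p (V 0) (V 1)),
                And (fle p tzero (tneg (V 0))) (fle p (tneg (V 0)) (V 1)),
                And (fle p tzero (V 0)) (fle p (V 0) (tneg (V 1))),
                And (fle p tzero (tneg (V 0))) (fle p (tneg (V 0)) (tneg (V 1)))]))) }
   \<union> {All 0 (All 1 (Imp (fle p (V 0) (V 1)) (fle p (tscale c (V 0)) (tscale c (V 1))))) | c. place_nonneg p c}"

definition T_place :: "'k::field place \<Rightarrow> 'k form set" where
  "T_place p = (if real_place p then T_real p else T_fin p)"

primrec tlin :: "(nat \<Rightarrow> 'k) \<Rightarrow> (nat \<Rightarrow> nat) \<Rightarrow> nat \<Rightarrow> 'k fsym trm" where
  "tlin c f 0 = tzero"
| "tlin c f (Suc n) = tadd (tlin c f n) (tscale (c n) (V (f n)))"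

definition lin_sys :: "nat \<Rightarrow> nat \<Rightarrow> (nat \<Rightarrow> nat \<Rightarrow> 'k) \<Rightarrow> (nat \<Rightarrow> nat) \<Rightarrow> (nat \<Rightarrow> nat) \<Rightarrow> 'k form" where
  "lin_sys m n A f g = Conj (map (\<lambda>l. Eq (tlin (A l) f n) (V (g l))) [0..<m])"

text \<open>The weak approximation axiom for \<open>ps = [p\<^sub>0, \<dots>, p\<^sub>r\<^sub>-\<^sub>1]\<close> and the \<open>m \<times> n\<close> matrix \<open>A\<close>. The variables
are laid out as follows: \<open>y\<^sub>j\<close> is \<open>V j\<close>, \<open>x\<^sub>i\<^sub>j\<close> is \<open>V (n * (i + 1) + j)\<close>, \<open>c\<^sub>i\<close> is \<open>V (n * (r + 1) + i)\<close>
and \<open>b\<^sub>l\<close> is \<open>V (n * (r + 1) + r + l)\<close>.\<close>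

definition weak_approx :: "'k::field place list \<Rightarrow> nat \<Rightarrow> nat \<Rightarrow> (nat \<Rightarrow> nat \<Rightarrow> 'k) \<Rightarrow> 'k form" where
  "weak_approx ps m n A =
     (let r = length ps;
          x = (\<lambda>i j. n * (i + 1) + j);
          c = (\<lambda>i. n * (r + 1) + i);
          b = (\<lambda>l. n * (r + 1) + r + l)
      in Alls [n..<n * (r + 1) + r + m]
           (Imp (And (Conj (map (\<lambda>i. Neg (Eq (V (c i)) tzero)) [0..<r]))
                     (Conj (map (\<lambda>i. lin_sys m n A (x i) b) [0..<r])))
                (Exs [0..<n]
                   (And (lin_sys m n A (\<lambda>j. j) b)
                        (Conj (map (\<lambda>i. Conj (map (\<lambda>j. fL (ps ! i) (tsub (V j) (V (x i j))) (V (c i))) [0..<n])) [0..<r]))))))"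

text \<open>The families of places in the weak approximation scheme are nonempty (\<open>r \<ge> 1\<close>): for \<open>r = 0\<close>
the axiom would say that every linear system is solvable, which contradicts \<open>0 \<noteq> 1\<close>. For \<open>S0 = {}\<close>
the theory is then just the theory of vector spaces over \<open>k\<close> with an arbitrary constant \<open>1\<close>, which
has the zero space as a model and is neither complete nor model complete, and does not eliminate
quantifiers (\<open>T_kS_empty\<close> below).\<close>

definition T_kS :: "'k::field place set \<Rightarrow> 'k place set \<Rightarrow> 'k form set" where
  "T_kS S0 S1 = T_vs \<union> (\<Union>p\<in>S0. T_place p) \<union> (\<Union>p\<in>S1. T_fin_plus p) \<union>
     {weak_approx ps m n A | ps m n A. ps \<noteq> [] \<and> distinct ps \<and> set ps \<subseteq> S0}"


section \<open>The models of the axioms\<close>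

subsection \<open>Preliminaries\<close>

lemma sat_Conj [simp]: "sat M e (Conj As) \<longleftrightarrow> (\<forall>A\<in>set As. sat M e A)"
  by (induction As) (auto simp: Conj_def)

lemma sat_Disj [simp]: "sat M e (Disj As) \<longleftrightarrow> (\<exists>A\<in>set As. sat M e A)"
  by (induction As) (auto simp: Disj_def)

lemma sat_Alls:
  "sat M e (Alls ns A) \<longleftrightarrow>
     (\<forall>f. (\<forall>i\<in>set ns. f i \<in> univ M) \<longrightarrow> sat M (\<lambda>i. if i \<in> set ns then f i else e i) A)"
proof (induction ns arbitrary: e)
  case Nil
  then show ?case by (simp add: Alls_def)
next
  case (Cons n ns)
  have "sat M e (Alls (n # ns) A) \<longleftrightarrow> (\<forall>a\<in>univ M. sat M (e(n := a)) (Alls ns A))"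
    by (simp add: Alls_def)
  also have "\<dots> \<longleftrightarrow> (\<forall>a\<in>univ M. \<forall>f. (\<forall>i\<in>set ns. f i \<in> univ M) \<longrightarrow>
      sat M (\<lambda>i. if i \<in> set ns then f i else (e(n := a)) i) A)"
    by (simp only: Cons.IH)
  also have "\<dots> \<longleftrightarrow> (\<forall>f. (\<forall>i\<in>set (n # ns). f i \<in> univ M) \<longrightarrow>
      sat M (\<lambda>i. if i \<in> set (n # ns) then f i else e i) A)" (is "?l = ?r")
  proof
    assume l: ?l
    show ?r
    proof (intro allI impI)
      fix f assume f: "\<forall>i\<in>set (n # ns). f i \<in> univ M"
      have "sat M (\<lambda>i. if i \<in> set ns then f i else (e(n := f n)) i) A" using l f by auto
      moreover have "(\<lambda>i. if i \<in> set ns then f i else (e(n := f n)) i) =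
        (\<lambda>i. if i \<in> set (n # ns) then f i else e i)" by auto
      ultimately show "sat M (\<lambda>i. if i \<in> set (n # ns) then f i else e i) A" by simp
    qed
  next
    assume r: ?r
    show ?l
    proof (intro ballI allI impI)
      fix a f assume a: "a \<in> univ M" and f: "\<forall>i\<in>set ns. f i \<in> univ M"
      have "sat M (\<lambda>i. if i \<in> set (n # ns) then (if i \<in> set ns then f i else a) else e i) A"
        using r[rule_format, of "\<lambda>i. if i \<in> set ns then f i else a"] a f by auto
      moreover have "(\<lambda>i. if i \<in> set (n # ns) then (if i \<in> set ns then f i else a) else e i) =
         (\<lambda>i. if i \<in> set ns then f i else (e(n := a)) i)" by auto
      ultimately show "sat M (\<lambda>i. if i \<in> set ns then f i else (e(n := a)) i) A" by simp
    qed
  qed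
  finally show ?case .
qed

lemma sat_Exs:
  "sat M e (Exs ns A) \<longleftrightarrow>
     (\<exists>f. (\<forall>i\<in>set ns. f i \<in> univ M) \<and> sat M (\<lambda>i. if i \<in> set ns then f i else e i) A)"
proof -
  have "sat M e (Exs ns A) \<longleftrightarrow> \<not> sat M e (Alls ns (Neg A))" for e
    by (induction ns arbitrary: e) (auto simp: Exs_def Alls_def)
  then show ?thesis by (auto simp: sat_Alls)
qed

lemma place_base:
  fixes p :: "'k::field place"
  assumes "p \<in> places"
  obtains a where "a \<in> p" "absolute_value a" "nontrivial_av a" "\<And>b. b \<in> p \<Longrightarrow> \<exists>s>0. \<forall>x. b x = a x powr s"
proof -
  obtain a where a: "p = {b. absolute_value b \<and> equiv_av a b}" "absolute_value a" "nontrivial_av a"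
    using assms unfolding places_def by auto
  have "a \<in> p"
    using a unfolding equiv_av_def absolute_value_def by (auto intro!: exI[of _ 1])
  then show ?thesis using that a unfolding equiv_av_def by auto
qed

lemma pval_base:
  fixes p :: "'k::field place"
  assumes p: "finite_place p" "discrete_place p"
  obtains a c \<pi> where "a \<in> p" "absolute_value a" "(0::real) < c" "c < 1"
    "\<And>x. x \<noteq> 0 \<Longrightarrow> a x = c powi pval p x" "\<pi> \<noteq> 0" "pval p \<pi> = 1"
proof -
  obtain a where a: "a \<in> p" "absolute_value a" "nontrivial_av a"
    and pow: "\<And>b. b \<in> p \<Longrightarrow> \<exists>s>0. \<forall>x. b x = a x powr s"
    using place_base p unfolding finite_place_def by metis
  note av = a(2)[unfolded absolute_value_def]
  have a0: "a 0 = 0" and an0: "\<And>x. x \<noteq> 0 \<Longrightarrow> a x > 0" and am: "\<And>x y. a (x * y) = a x * a y"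
    using av by (auto simp: order_less_le)
  have a1: "a 1 = 1" using am[of 1 1] an0[of 1] by simp
  have ai: "a (inverse x) = inverse (a x)" for x
  proof (cases "x = 0")
    case False
    then have "a x * a (inverse x) = 1" using am[of x "inverse x"] a1 by simp
    then show ?thesis by (metis inverse_unique)
  qed (simp add: a0)
  have ad: "a (x / y) = a x / a y" for x y by (simp add: divide_inverse am ai)
  have apw: "a (x ^ n) = a x ^ n" for x n by (induction n) (simp_all add: a1 am)
  have api: "a (x powi n) = a x powi n" for x n
    by (cases "n \<ge> 0") (auto simp: power_int_def apw ai)
  let ?S = "a ` {x. x \<noteq> 0}"
  have "discrete ?S" using p(2) a(1) unfolding discrete_place_def by blast
  moreover have "1 \<in> ?S" using a1 by force
  ultimately have "1 isolated_in ?S" by (rule discreteD)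
  then obtain e where e: "e > 0" "\<And>y. y \<in> ?S \<Longrightarrow> dist 1 y < e \<Longrightarrow> y = 1"
    unfolding isolated_in_dist_Ex_iff by blast
  obtain z where z: "z \<noteq> 0" "a z < 1"
  proof -
    obtain x where "x \<noteq> 0" "a x \<noteq> 1" using a(3) unfolding nontrivial_av_def by auto
    then show ?thesis
    proof (cases "a x < 1")
      case False
      then have "inverse (a x) < 1" using \<open>a x \<noteq> 1\<close> by (simp add: inverse_less_1_iff)
      then show ?thesis using that[of "inverse x"] \<open>x \<noteq> 0\<close> by (simp only: ai) simp
    qed (use that in auto)
  qed
  define B where "B = a ` {x. x \<noteq> 0 \<and> a x < 1}"
  have Bne: "B \<noteq> {}" using z unfolding B_def by auto
  have Bbd: "bdd_above B" unfolding B_def by (auto intro!: bdd_aboveI[of _ 1])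
  define c where "c = Sup B"
  have cpos: "c > 0"
  proof -
    have "a z \<le> c" unfolding c_def using z Bbd by (intro cSup_upper) (auto simp: B_def)
    then show ?thesis using an0[OF z(1)] by linarith
  qed
  obtain \<pi> where \<pi>: "\<pi> \<noteq> 0" "a \<pi> < 1" "a \<pi> = c"
  proof -
    define d where "d = c * (1 - min e 1 / 2)"
    have "d < c" using cpos e(1) unfolding d_def by (auto simp: field_simps)
    then obtain x where x: "x \<noteq> 0" "a x < 1" "a x > d"
      unfolding c_def using less_cSup_iff[OF Bne Bbd] unfolding B_def by auto
    have "a y \<le> a x" if y: "y \<noteq> 0" "a y < 1" for y
    proof (rule ccontr)
      assume "\<not> a y \<le> a x"
      then have lt: "a x < a y" by simp
      have "a y \<le> c" unfolding c_def using y Bbd by (intro cSup_upper) (auto simp: B_def)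
      then have "d * a y \<le> a x * c"
        using x an0[OF x(1)] an0[OF y(1)] cpos by (intro mult_mono) auto
      then have "c * ((1 - min e 1 / 2) * a y) \<le> c * a x" unfolding d_def by (simp add: mult_ac)
      then have le: "(1 - min e 1 / 2) * a y \<le> a x" using cpos by simp
      then have "1 - min e 1 / 2 \<le> a (x / y)" using an0[OF y(1)] by (simp add: ad field_simps)
      moreover have "a (x / y) < 1" using lt an0[OF y(1)] by (simp add: ad)
      ultimately have "dist 1 (a (x / y)) < e" "a (x / y) \<noteq> 1" using e(1) by (auto simp: dist_real_def)
      moreover have "a (x / y) \<in> ?S" using x y by auto
      ultimately show False using e(2) by blast
    qed
    then have "c = a x" unfolding c_def using x Bne
      by (intro cSup_eq_maximum) (auto simp: B_def)
    then show ?thesis using that x by auto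
  qed
  have \<pi>max: "a y \<le> c" if "a y < 1" for y
  proof (cases "y = 0")
    case False
    then show ?thesis unfolding c_def using that Bbd by (intro cSup_upper) (auto simp: B_def)
  qed (use a0 cpos in auto)
  have c1: "c < 1" using \<pi> by simp
  have unif: "uniformizer p \<pi>" unfolding uniformizer_def using a(1) \<pi> \<pi>max by auto
  have unif': "a \<pi>' = c" if u: "uniformizer p \<pi>'" for \<pi>'
  proof -
    obtain b where b: "b \<in> p" "\<pi>' \<noteq> 0" "b \<pi>' < 1" "\<And>x. b x < 1 \<Longrightarrow> b x \<le> b \<pi>'"
      using u unfolding uniformizer_def by auto
    obtain s where s: "s > 0" "\<And>x. b x = a x powr s" using pow[OF b(1)] by auto
    have lt: "b x < 1 \<longleftrightarrow> a x < 1" for x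
      using s(1) av powr_less_mono2[of s "a x" 1] powr_mono2[of s 1 "a x"]
      unfolding s(2) by (smt (verit) powr_one_eq_one)
    have "a \<pi>' \<le> c" using lt b(3) \<pi>max by auto
    moreover have "c powr s \<le> a \<pi>' powr s" using b(4)[of \<pi>] lt \<pi> s by auto
    then have "c \<le> a \<pi>'" using s(1) an0[OF b(2)] powr_less_mono2[of s "a \<pi>'" c] by linarith
    ultimately show ?thesis by simp
  qed
  have inj: "m = n" if "c powi m = c powi n" for m n
  proof (rule ccontr)
    assume "m \<noteq> n"
    then consider "m < n" | "n < m" by linarith
    then show False
      using that cpos c1 power_int_strict_decreasing[of m n c] power_int_strict_decreasing[of n m c]
      by cases auto
  qed
  have ex: "\<exists>n. a x = c powi n" if x: "x \<noteq> 0" for x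
  proof -
    define n where "n = \<lfloor>log c (a x)\<rfloor>"
    define y where "y = x * \<pi> powi (- n)"
    have ay: "a y = a x * c powi (- n)" unfolding y_def by (simp add: am api \<pi>)
    have lx: "a x = c powr (log c (a x))" using an0[OF x] cpos c1 by simp
    have pp: "c powi k = c powr (of_int k)" for k using cpos by (simp add: powr_real_of_int')
    have "a y = c powr (log c (a x) - of_int n)"
      unfolding ay pp by (subst lx) (simp add: powr_add[symmetric])
    moreover have "0 \<le> log c (a x) - of_int n" "log c (a x) - of_int n < 1"
      unfolding n_def by linarith+
    ultimately have y1: "a y \<le> 1" "c < a y"
      using cpos c1 powr_le_one_le powr_mono'[of 0 "log c (a x) - of_int n" c]
        powr_less_mono'[of c "log c (a x) - of_int n" 1] by auto
    then have "a y = 1" using \<pi>max[of y] by (cases "a y < 1") auto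
    then have "a x * c powi (- n) = 1" using ay by simp
    then have "a x = c powi n" using cpos by (simp add: power_int_minus field_simps)
    then show ?thesis by blast
  qed
  have pv: "a x = c powi pval p x" if x: "x \<noteq> 0" for x
  proof -
    obtain n where n: "a x = c powi n" using ex[OF x] by auto
    have "pval p x = n" unfolding pval_def
    proof (rule the_equality)
      show "\<exists>a\<in>p. \<exists>\<pi>. uniformizer p \<pi> \<and> a x = a \<pi> powi n"
        using a(1) unif n \<pi>(3) by (intro bexI[of _ a] exI[of _ \<pi>]) auto
    next
      fix m assume "\<exists>b\<in>p. \<exists>\<pi>'. uniformizer p \<pi>' \<and> b x = b \<pi>' powi m"
      then obtain b \<pi>' where b: "b \<in> p" "uniformizer p \<pi>'" "b x = b \<pi>' powi m" by auto
      obtain s where s: "s > 0" "\<And>x. b x = a x powr s" using pow[OF b(1)] by auto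
      have "a x powr s = (c powr s) powi m" using b(3) s(2) unif'[OF b(2)] by simp
      also have "\<dots> = (c powi m) powr s"
        using cpos by (simp add: powr_real_of_int'[symmetric] powr_powr mult.commute)
      finally have "a x = c powi m"
        using s(1) an0[OF x] zero_less_power_int[OF cpos, of m]
        powr_less_mono2[of s "a x" "c powi m"] powr_less_mono2[of s "c powi m" "a x"]
      by linarith
      then show "m = n" using n inj by simp
    qed
    then show ?thesis using n by simp
  qed
  have "pval p \<pi> = 1" using pv[OF \<pi>(1)] \<pi> inj[of 1 "pval p \<pi>"] by simp
  then show ?thesis using that[OF a(1,2) cpos c1 pv \<pi>(1)] by auto
qed

lemma pval_mult:
  fixes p :: "'k::field place"
  assumes p: "finite_place p" "discrete_place p" and "x \<noteq> 0" "y \<noteq> 0"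
  shows "pval p (x * y) = pval p x + pval p y"
proof -
  obtain a c \<pi> where a: "a \<in> p" "absolute_value a" "(0::real) < c" "c < 1"
    "\<And>x. x \<noteq> 0 \<Longrightarrow> a x = c powi pval p x" by (rule pval_base[OF p]) blast
  have "c powi pval p (x * y) = c powi (pval p x + pval p y)"
    using a(2) a(5)[of x] a(5)[of y] a(5)[of "x * y"] assms a(3)
    by (simp add: absolute_value_def power_int_add)
  then show ?thesis
    using a(3,4) power_int_strict_decreasing[of "pval p (x * y)" "pval p x + pval p y" c]
      power_int_strict_decreasing[of "pval p x + pval p y" "pval p (x * y)" c]
    by (cases "pval p (x * y)" "pval p x + pval p y" rule: linorder_cases) auto
qed

lemma pval_one:
  fixes p :: "'k::field place"
  assumes p: "finite_place p" "discrete_place p"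
  shows "pval p 1 = 0"
  using pval_mult[OF p, of 1 1] by simp

lemma pval_power:
  fixes p :: "'k::field place"
  assumes p: "finite_place p" "discrete_place p" and "x \<noteq> 0"
  shows "pval p (x ^ n) = int n * pval p x"
  by (induction n) (simp_all add: pval_one[OF p] pval_mult[OF p] assms(3) algebra_simps)


subsection \<open>The two-sorted theory at a finite discrete place\<close>

abbreviation madd :: "('k fsym, 'r, 'u) struct \<Rightarrow> 'u \<Rightarrow> 'u \<Rightarrow> 'u" where "madd M x y \<equiv> fint M Plus [x, y]"
abbreviation mzero :: "('k fsym, 'r, 'u) struct \<Rightarrow> 'u" where "mzero M \<equiv> fint M Zero []"
abbreviation mone :: "('k fsym, 'r, 'u) struct \<Rightarrow> 'u" where "mone M \<equiv> fint M One []"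
abbreviation mscale :: "('k fsym, 'r, 'u) struct \<Rightarrow> 'k \<Rightarrow> 'u \<Rightarrow> 'u" where "mscale M c x \<equiv> fint M (Scale c) [x]"
abbreviation mL :: "'k place \<Rightarrow> ('f, 'k rsym, 'u) struct \<Rightarrow> 'u \<Rightarrow> 'u \<Rightarrow> bool" where "mL p M x y \<equiv> rint M (RL p) [x, y]"
abbreviation mM :: "'k place \<Rightarrow> ('f, 'k rsym, 'u) struct \<Rightarrow> 'u \<Rightarrow> 'u \<Rightarrow> 'u \<Rightarrow> bool" where "mM p M x y z \<equiv> rint M (RM p) [x, y, z]"
abbreviation mQ :: "'k place \<Rightarrow> nat \<Rightarrow> ('f, 'k rsym, 'u) struct \<Rightarrow> 'u \<Rightarrow> bool" where "mQ p n M x \<equiv> rint M (RQ p n) [x]"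

definition vector_space_struct :: "('k::field fsym, 'r, 'u) struct \<Rightarrow> bool" where
  "vector_space_struct M \<longleftrightarrow>
     mzero M \<in> univ M \<and> mone M \<in> univ M \<and>
     (\<forall>x\<in>univ M. \<forall>y\<in>univ M. madd M x y \<in> univ M) \<and>
     (\<forall>c. \<forall>x\<in>univ M. mscale M c x \<in> univ M) \<and>
     (\<forall>x\<in>univ M. \<forall>y\<in>univ M. \<forall>z\<in>univ M. madd M (madd M x y) z = madd M x (madd M y z)) \<and>
     (\<forall>x\<in>univ M. \<forall>y\<in>univ M. madd M x y = madd M y x) \<and>
     (\<forall>x\<in>univ M. madd M (mzero M) x = x) \<and>
     (\<forall>x\<in>univ M. madd M x (mscale M (- 1) x) = mzero M) \<and>
     (\<forall>x\<in>univ M. mscale M 1 x = x) \<and>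
     (\<forall>c. \<forall>x\<in>univ M. \<forall>y\<in>univ M. mscale M c (madd M x y) = madd M (mscale M c x) (mscale M c y)) \<and>
     (\<forall>c d. \<forall>x\<in>univ M. mscale M (c + d) x = madd M (mscale M c x) (mscale M d x)) \<and>
     (\<forall>c d. \<forall>x\<in>univ M. mscale M (c * d) x = mscale M c (mscale M d x))"

text \<open>The value sort of a two-sorted structure \<open>(K, \<Gamma>, v)\<close> whose vector sort is a given structure:
carrier \<open>\<Gamma>\<close>, the symbols \<open><\<close>, \<open>\<infinity>\<close>, \<open>s\<close>, and the map \<open>v\<close>. "Discretely ordered" refers to
\<open>\<Gamma> - {\<infinity>}\<close>; the element \<open>\<infinity>\<close> has no immediate predecessor.\<close>

record ('u, 'g) vstruct =
  vals :: "'g set"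
  vless :: "'g \<Rightarrow> 'g \<Rightarrow> bool"
  vinf :: 'g
  vsucc :: "'g \<Rightarrow> 'g"
  vmap :: "'u \<Rightarrow> 'g"

definition vle :: "('u, 'g, 'z) vstruct_scheme \<Rightarrow> 'g \<Rightarrow> 'g \<Rightarrow> bool" where
  "vle G a b \<longleftrightarrow> vless G a b \<or> a = b"

definition imm_succ :: "('u, 'g, 'z) vstruct_scheme \<Rightarrow> 'g \<Rightarrow> 'g \<Rightarrow> bool" where
  "imm_succ G a b \<longleftrightarrow> a \<in> vals G \<and> b \<in> vals G \<and> vless G a b \<and> \<not> (\<exists>d\<in>vals G. vless G a d \<and> vless G d b)"

text \<open>\<open>shifted G n \<gamma> \<delta>\<close> is \<open>\<gamma> = s\<^sup>n(\<delta>)\<close>.\<close>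

definition shifted :: "('u, 'g, 'z) vstruct_scheme \<Rightarrow> int \<Rightarrow> 'g \<Rightarrow> 'g \<Rightarrow> bool" where
  "shifted G n a b \<longleftrightarrow> (if n \<ge> 0 then a = (vsucc G ^^ nat n) b else (vsucc G ^^ nat (- n)) a = b)"

definition model_T_kv ::
  "'k::field place \<Rightarrow> ('k fsym, 'k rsym, 'u) struct \<Rightarrow> ('u, 'g, 'z) vstruct_scheme \<Rightarrow> bool" where
  "model_T_kv p M G \<longleftrightarrow>
     vector_space_struct M \<and> mzero M \<noteq> mone M \<and>
     (\<forall>a\<in>vals G. \<not> vless G a a) \<and>
     (\<forall>a\<in>vals G. \<forall>b\<in>vals G. \<forall>d\<in>vals G. vless G a b \<longrightarrow> vless G b d \<longrightarrow> vless G a d) \<and>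
     (\<forall>a\<in>vals G. \<forall>b\<in>vals G. vless G a b \<or> a = b \<or> vless G b a) \<and>
     (\<forall>a\<in>vals G - {vinf G}. \<exists>b\<in>vals G - {vinf G}. imm_succ G a b) \<and>
     (\<forall>b\<in>vals G - {vinf G}. (\<exists>a\<in>vals G. vless G a b) \<longrightarrow> (\<exists>a\<in>vals G - {vinf G}. imm_succ G a b)) \<and>
     vinf G \<in> vals G \<and> (\<forall>a\<in>vals G. vle G a (vinf G)) \<and>
     vmap G ` univ M = vals G \<and>
     (\<forall>x\<in>univ M. \<forall>y\<in>univ M. vle G (vmap G x) (vmap G (madd M x y)) \<or> vle G (vmap G y) (vmap G (madd M x y))) \<and>
     (\<forall>x\<in>univ M. vmap G x = vinf G \<longleftrightarrow> x = mzero M) \<and>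
     vsucc G (vinf G) = vinf G \<and>
     (\<forall>a\<in>vals G - {vinf G}. imm_succ G a (vsucc G a)) \<and>
     (\<forall>x\<in>univ M. vmap G (mscale M 0 x) = vinf G) \<and>
     (\<forall>c. c \<noteq> 0 \<longrightarrow> (\<forall>x\<in>univ M. shifted G (pval p c) (vmap G (mscale M c x)) (vmap G x))) \<and>
     (finite (residue_field p) \<longrightarrow> (\<forall>ws. residue_reps p ws \<longrightarrow>
        (\<forall>x\<in>univ M. \<forall>y\<in>univ M. vmap G x = vmap G y \<and> vmap G y \<noteq> vinf G \<longrightarrow>
           (\<exists>w\<in>set ws. vless G (vmap G x) (vmap G (madd M (mscale M w x) y)))))) \<and>
     (infinite (residue_field p) \<longrightarrow> (\<forall>n ws. length ws = Suc n \<and> distinct_residues p ws \<longrightarrow>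
        (\<forall>x\<in>univ M. \<forall>y. (\<forall>j\<in>{1..n}. y j \<in> univ M \<and> vle G (vmap G x) (vmap G (y j))) \<longrightarrow>
           (\<exists>w\<in>set ws. \<forall>j\<in>{1..n}. vmap G (madd M (mscale M w x) (y j)) = vmap G x))))"

lemma struct_in_lang_k: "struct_in (lang_kS S0 S1) M \<longleftrightarrow> struct_in lang_k M"
  by (simp add: struct_in_def lang_kS_def)

lemma struct_in_closed:
  assumes "struct_in lang_k M"
  shows "univ M \<noteq> {}" "mzero M \<in> univ M" "mone M \<in> univ M"
    "\<And>x y. x \<in> univ M \<Longrightarrow> y \<in> univ M \<Longrightarrow> madd M x y \<in> univ M"
    "\<And>c x. x \<in> univ M \<Longrightarrow> mscale M c x \<in> univ M"
proof -
  have *: "fint M f xs \<in> univ M" if "(f, length xs) \<in> fst lang_k" "set xs \<subseteq> univ M" for f xs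
    using assms that unfolding struct_in_def by auto
  show "univ M \<noteq> {}" using assms by (simp add: struct_in_def)
  show "mzero M \<in> univ M" "mone M \<in> univ M"
    by (rule *; simp add: lang_k_def)+
  show "madd M x y \<in> univ M" if "x \<in> univ M" "y \<in> univ M" for x y
    by (rule *) (use that in \<open>auto simp: lang_k_def\<close>)
  show "mscale M c x \<in> univ M" if "x \<in> univ M" for c x
    by (rule *) (use that in \<open>auto simp: lang_k_def\<close>)
qed

lemma models_simps:
  "models M {}"
  "models M (A \<union> B) \<longleftrightarrow> models M A \<and> models M B"
  "models M (insert F A) \<longleftrightarrow> (\<forall>e. range e \<subseteq> univ M \<longrightarrow> sat M e F) \<and> models M A"
  by (auto simp: models_def)

lemma models_Collect:
  "models M {f c | c. P c} \<longleftrightarrow> (\<forall>c. P c \<longrightarrow> (\<forall>e. range e \<subseteq> univ M \<longrightarrow> sat M e (f c)))"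
  "models M {f2 c d | c d. P2 c d} \<longleftrightarrow> (\<forall>c d. P2 c d \<longrightarrow> (\<forall>e. range e \<subseteq> univ M \<longrightarrow> sat M e (f2 c d)))"
  by (auto simp: models_def)

lemma ex_assignment: "univ M \<noteq> {} \<Longrightarrow> \<exists>e::nat \<Rightarrow> 'u. range e \<subseteq> univ M"
proof -
  assume "univ M \<noteq> {}"
  then obtain a where "a \<in> univ M" by auto
  then show ?thesis by (intro exI[of _ "\<lambda>n. a"]) auto
qed

lemma models_T_vs:
  assumes "struct_in lang_k M"
  shows "models M T_vs \<longleftrightarrow> vector_space_struct M"
  using struct_in_closed[OF assms] unfolding T_vs_def vector_space_struct_def models_simps models_Collect
  by (simp add: ex_assignment models_simps(1))

text \<open>The content of \<open>T_fin p\<close> as a condition on structures; only used in proofs.\<close>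

definition fin_ax :: "'k::field place \<Rightarrow> ('k fsym, 'k rsym, 'u) struct \<Rightarrow> bool" where
  "fin_ax p M \<longleftrightarrow> vector_space_struct M \<and> mzero M \<noteq> mone M \<and>
     (\<forall>x\<in>univ M. \<forall>y\<in>univ M. mL p M x y \<or> mL p M y x) \<and>
     (\<forall>x\<in>univ M. \<forall>y\<in>univ M. \<forall>z\<in>univ M. mL p M x y \<longrightarrow> mL p M y z \<longrightarrow> mL p M x z) \<and>
     (\<forall>x\<in>univ M. mL p M (mzero M) x) \<and>
     (\<forall>x\<in>univ M. mL p M x (mzero M) \<longrightarrow> x = mzero M) \<and>
     (\<forall>x\<in>univ M. \<forall>y\<in>univ M. \<forall>z\<in>univ M. mL p M x z \<longrightarrow> mL p M y z \<longrightarrow> mL p M (madd M x y) z) \<and>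
     (\<forall>c d. c \<noteq> 0 \<and> d \<noteq> 0 \<and> pval p c = pval p d \<longrightarrow> (\<forall>x\<in>univ M. 
        mL p M (mscale M c x) (mscale M d x) \<and> mL p M (mscale M d x) (mscale M c x))) \<and>
     (\<forall>\<pi>. \<pi> \<noteq> 0 \<and> pval p \<pi> = 1 \<longrightarrow> (\<forall>x\<in>univ M. x \<noteq> mzero M \<longrightarrow>
        \<not> mL p M x (mscale M \<pi> x) \<and> (\<forall>y\<in>univ M. \<not> mL p M x y \<longrightarrow> mL p M y (mscale M \<pi> x)))) \<and>
     (\<forall>ws. finite (residue_field p) \<and> residue_reps p ws \<longrightarrow>
        (\<forall>x\<in>univ M. \<forall>y\<in>univ M. mL p M x y \<and> mL p M y x \<and> x \<noteq> mzero M \<longrightarrow>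
           (\<exists>w\<in>set ws. \<not> mL p M x (madd M (mscale M w x) y)))) \<and>
     (\<forall>n ws. infinite (residue_field p) \<and> length ws = Suc n \<and> distinct_residues p ws \<longrightarrow>
        (\<forall>x\<in>univ M. \<forall>y. (\<forall>j\<in>{1..n}. y j \<in> univ M \<and> mL p M (y j) x) \<longrightarrow>
           (\<exists>w\<in>set ws. \<forall>j\<in>{1..n}. mL p M (madd M (mscale M w x) (y j)) x \<and>
               mL p M x (madd M (mscale M w x) (y j)))))"

lemma alls_zero:
  "(\<forall>f. (\<forall>i\<in>set [0..<Suc n]. f i \<in> U) \<longrightarrow> P (f (0::nat)) f) \<longleftrightarrow>
   (\<forall>x\<in>U. \<forall>y. (\<forall>j\<in>{1..n}. y j \<in> U) \<longrightarrow> P x (y(0 := x)))"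
proof
  assume l: "\<forall>f. (\<forall>i\<in>set [0..<Suc n]. f i \<in> U) \<longrightarrow> P (f 0) f"
  show "\<forall>x\<in>U. \<forall>y. (\<forall>j\<in>{1..n}. y j \<in> U) \<longrightarrow> P x (y(0 := x))"
  proof (intro ballI allI impI)
    fix x y assume "x \<in> U" "\<forall>j\<in>{1..n}. y j \<in> U"
    then have "\<forall>i\<in>set [0..<Suc n]. (y(0 := x)) i \<in> U" by auto
    then have "P ((y(0 := x)) 0) (y(0 := x))" using l by blast
    then show "P x (y(0 := x))" by simp
  qed
next
  assume r: "\<forall>x\<in>U. \<forall>y. (\<forall>j\<in>{1..n}. y j \<in> U) \<longrightarrow> P x (y(0 := x))"
  show "\<forall>f. (\<forall>i\<in>set [0..<Suc n]. f i \<in> U) \<longrightarrow> P (f 0) f"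
  proof (intro allI impI)
    fix f assume f: "\<forall>i\<in>set [0..<Suc n]. f i \<in> U"
    then have "f 0 \<in> U" "\<forall>j\<in>{1..n}. f j \<in> U" by auto
    then have "P (f 0) (f(0 := f 0))" using r by blast
    then show "P (f 0) f" by simp
  qed
qed

lemma models_fin_ax:
  assumes "struct_in lang_k M"
  shows "models M (T_fin p) \<longleftrightarrow> fin_ax p M"
proof -
  note cl = struct_in_closed[OF assms]
  have inf: "(\<forall>e. range e \<subseteq> univ M \<longrightarrow> sat M e
      (Alls [0..<Suc n] (Imp (Conj (map (\<lambda>j. fL p (V j) (V 0)) [1..<Suc n]))
         (Disj (map (\<lambda>w. Conj (map (\<lambda>j. feqv p (tadd (tscale w (V 0)) (V j)) (V 0)) [1..<Suc n])) ws))))) \<longleftrightarrow>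
      (\<forall>x\<in>univ M. \<forall>y. (\<forall>j\<in>{1..n}. y j \<in> univ M \<and> mL p M (y j) x) \<longrightarrow>
           (\<exists>w\<in>set ws. \<forall>j\<in>{1..n}. mL p M (madd M (mscale M w x) (y j)) x \<and>
               mL p M x (madd M (mscale M w x) (y j))))" (is "?l \<longleftrightarrow> ?r") for n ws
  proof -
    have "?l \<longleftrightarrow> (\<forall>f. (\<forall>i\<in>set [0..<Suc n]. f i \<in> univ M) \<longrightarrow>
       (\<forall>j\<in>{1..n}. mL p M (f j) (f 0)) \<longrightarrow> 
           (\<exists>w\<in>set ws. \<forall>j\<in>{1..n}. mL p M (madd M (mscale M w (f 0)) (f j)) (f 0) \<and>
               mL p M (f 0) (madd M (mscale M w (f 0)) (f j))))"
      unfolding sat_Alls sat.simps sat_Conj sat_Disj set_map ball_simps bex_simps set_upt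
        atLeastLessThanSuc_atLeastAtMost
      by (simp add: ex_assignment[OF cl(1)] cong: ball_cong_simp)
    also have "\<dots> \<longleftrightarrow> ?r"
      by (subst alls_zero[where P = "\<lambda>x f. (\<forall>j\<in>{1..n}. mL p M (f j) x) \<longrightarrow> 
           (\<exists>w\<in>set ws. \<forall>j\<in>{1..n}. mL p M (madd M (mscale M w x) (f j)) x \<and>
               mL p M x (madd M (mscale M w x) (f j)))"]) auto
    finally show ?thesis .
  qed
  show ?thesis
    unfolding T_fin_def fin_ax_def models_simps models_Collect models_T_vs[OF assms] inf
    by (simp add: ex_assignment[OF cl(1)] disj_imp models_simps(1))
qed

definition induces_L :: "'k place \<Rightarrow> ('f, 'k rsym, 'u) struct \<Rightarrow> ('u, 'g, 'z) vstruct_scheme \<Rightarrow> bool" where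
  "induces_L p M G \<longleftrightarrow> (\<forall>x\<in>univ M. \<forall>y\<in>univ M. mL p M x y \<longleftrightarrow> vle G (vmap G y) (vmap G x))"

lemma vector_space_structD:
  assumes "vector_space_struct M"
  shows "mzero M \<in> univ M"
    and "\<And>x y. x \<in> univ M \<Longrightarrow> y \<in> univ M \<Longrightarrow> madd M x y \<in> univ M"
    and "\<And>c x. x \<in> univ M \<Longrightarrow> mscale M c x \<in> univ M"
    and "\<And>x. x \<in> univ M \<Longrightarrow> mscale M 1 x = x"
    and "\<And>c d x. x \<in> univ M \<Longrightarrow> mscale M (c * d) x = mscale M c (mscale M d x)"
    and "\<And>x. x \<in> univ M \<Longrightarrow> madd M (mzero M) x = x"
    and "\<And>c x y. x \<in> univ M \<Longrightarrow> y \<in> univ M \<Longrightarrow> mscale M c (madd M x y) = madd M (mscale M c x) (mscale M c y)"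
    and "\<And>c d x. x \<in> univ M \<Longrightarrow> mscale M (c + d) x = madd M (mscale M c x) (mscale M d x)"
    and "\<And>x y z. x \<in> univ M \<Longrightarrow> y \<in> univ M \<Longrightarrow> z \<in> univ M \<Longrightarrow> madd M (madd M x y) z = madd M x (madd M y z)"
    and "\<And>x. x \<in> univ M \<Longrightarrow> madd M x (mscale M (- 1) x) = mzero M"
    and "\<And>x y. x \<in> univ M \<Longrightarrow> y \<in> univ M \<Longrightarrow> madd M x y = madd M y x"
    and "mone M \<in> univ M"
proof -
  note D = assms[unfolded vector_space_struct_def]
  note d1 = D[THEN conjunct1]
  note d2 = D[THEN conjunct2, THEN conjunct1]
  note d3 = D[THEN conjunct2, THEN conjunct2, THEN conjunct1]
  note d4 = D[THEN conjunct2, THEN conjunct2, THEN conjunct2, THEN conjunct1]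
  note d5 = D[THEN conjunct2, THEN conjunct2, THEN conjunct2, THEN conjunct2, THEN conjunct1]
  note d6 = D[THEN conjunct2, THEN conjunct2, THEN conjunct2, THEN conjunct2, THEN conjunct2, THEN conjunct1]
  note d7 = D[THEN conjunct2, THEN conjunct2, THEN conjunct2, THEN conjunct2, THEN conjunct2, THEN conjunct2, THEN conjunct1]
  note d8 = D[THEN conjunct2, THEN conjunct2, THEN conjunct2, THEN conjunct2, THEN conjunct2, THEN conjunct2, THEN conjunct2, THEN conjunct1]
  note d9 = D[THEN conjunct2, THEN conjunct2, THEN conjunct2, THEN conjunct2, THEN conjunct2, THEN conjunct2, THEN conjunct2, THEN conjunct2, THEN conjunct1]
  note d10 = D[THEN conjunct2, THEN conjunct2, THEN conjunct2, THEN conjunct2, THEN conjunct2, THEN conjunct2, THEN conjunct2, THEN conjunct2, THEN conjunct2, THEN conjunct1]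
  note d11 = D[THEN conjunct2, THEN conjunct2, THEN conjunct2, THEN conjunct2, THEN conjunct2, THEN conjunct2, THEN conjunct2, THEN conjunct2, THEN conjunct2, THEN conjunct2, THEN conjunct1]
  note d12 = D[THEN conjunct2, THEN conjunct2, THEN conjunct2, THEN conjunct2, THEN conjunct2, THEN conjunct2, THEN conjunct2, THEN conjunct2, THEN conjunct2, THEN conjunct2, THEN conjunct2]
  show "mzero M \<in> univ M" using d1 .
  show "madd M x y \<in> univ M" if "x \<in> univ M" "y \<in> univ M" for x y using d3 that by simp
  show "mscale M c x \<in> univ M" if "x \<in> univ M" for c x using d4 that by simp
  show "mscale M 1 x = x" if "x \<in> univ M" for x using d9 that by simp
  show "mscale M (c * d) x = mscale M c (mscale M d x)" if "x \<in> univ M" for c d x using d12 that by simp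
  show "madd M (mzero M) x = x" if "x \<in> univ M" for x using d7 that by simp
  show "mscale M c (madd M x y) = madd M (mscale M c x) (mscale M c y)" if "x \<in> univ M" "y \<in> univ M" for c x y using d10 that by simp
  show "mscale M (c + d) x = madd M (mscale M c x) (mscale M d x)" if "x \<in> univ M" for c d x using d11 that by simp
  show "madd M (madd M x y) z = madd M x (madd M y z)" if "x \<in> univ M" "y \<in> univ M" "z \<in> univ M" for x y z using d5 that by simp
  show "madd M x (mscale M (- 1) x) = mzero M" if "x \<in> univ M" for x using d8 that by simp
  show "madd M x y = madd M y x" if "x \<in> univ M" "y \<in> univ M" for x y using d6 that by simp
  show "mone M \<in> univ M" using d2 .
qed

lemma funpow_closed: "(\<And>a. a \<in> A \<Longrightarrow> s a \<in> A) \<Longrightarrow> a \<in> A \<Longrightarrow> (s ^^ n) a \<in> A"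
  by (induction n) auto

lemma model_T_kv_fin_ax:
  fixes p :: "'k::field place" and G :: "('u, 'g, 'z) vstruct_scheme"
  assumes m: "model_T_kv p M G" and L: "induces_L p M G"
  shows "fin_ax p M"
proof -
  let ?U = "univ M" and ?v = "vmap G"
  note D = m[unfolded model_T_kv_def]
  note d1 = D[THEN conjunct1]
  note d2 = D[THEN conjunct2, THEN conjunct1]
  note d3 = D[THEN conjunct2, THEN conjunct2, THEN conjunct1]
  note d4 = D[THEN conjunct2, THEN conjunct2, THEN conjunct2, THEN conjunct1]
  note d5 = D[THEN conjunct2, THEN conjunct2, THEN conjunct2, THEN conjunct2, THEN conjunct1]
  note d6 = D[THEN conjunct2, THEN conjunct2, THEN conjunct2, THEN conjunct2, THEN conjunct2, THEN conjunct1]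
  note d7 = D[THEN conjunct2, THEN conjunct2, THEN conjunct2, THEN conjunct2, THEN conjunct2, THEN conjunct2, THEN conjunct1]
  note d8 = D[THEN conjunct2, THEN conjunct2, THEN conjunct2, THEN conjunct2, THEN conjunct2, THEN conjunct2, THEN conjunct2, THEN conjunct1]
  note d9 = D[THEN conjunct2, THEN conjunct2, THEN conjunct2, THEN conjunct2, THEN conjunct2, THEN conjunct2, THEN conjunct2, THEN conjunct2, THEN conjunct1]
  note d10 = D[THEN conjunct2, THEN conjunct2, THEN conjunct2, THEN conjunct2, THEN conjunct2, THEN conjunct2, THEN conjunct2, THEN conjunct2, THEN conjunct2, THEN conjunct1]
  note d11 = D[THEN conjunct2, THEN conjunct2, THEN conjunct2, THEN conjunct2, THEN conjunct2, THEN conjunct2, THEN conjunct2, THEN conjunct2, THEN conjunct2, THEN conjunct2, THEN conjunct1]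
  note d12 = D[THEN conjunct2, THEN conjunct2, THEN conjunct2, THEN conjunct2, THEN conjunct2, THEN conjunct2, THEN conjunct2, THEN conjunct2, THEN conjunct2, THEN conjunct2, THEN conjunct2, THEN conjunct1]
  note d13 = D[THEN conjunct2, THEN conjunct2, THEN conjunct2, THEN conjunct2, THEN conjunct2, THEN conjunct2, THEN conjunct2, THEN conjunct2, THEN conjunct2, THEN conjunct2, THEN conjunct2, THEN conjunct2, THEN conjunct1]
  note d14 = D[THEN conjunct2, THEN conjunct2, THEN conjunct2, THEN conjunct2, THEN conjunct2, THEN conjunct2, THEN conjunct2, THEN conjunct2, THEN conjunct2, THEN conjunct2, THEN conjunct2, THEN conjunct2, THEN conjunct2, THEN conjunct1]
  note d15 = D[THEN conjunct2, THEN conjunct2, THEN conjunct2, THEN conjunct2, THEN conjunct2, THEN conjunct2, THEN conjunct2, THEN conjunct2, THEN conjunct2, THEN conjunct2, THEN conjunct2, THEN conjunct2, THEN conjunct2, THEN conjunct2, THEN conjunct1]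
  note d16 = D[THEN conjunct2, THEN conjunct2, THEN conjunct2, THEN conjunct2, THEN conjunct2, THEN conjunct2, THEN conjunct2, THEN conjunct2, THEN conjunct2, THEN conjunct2, THEN conjunct2, THEN conjunct2, THEN conjunct2, THEN conjunct2, THEN conjunct2, THEN conjunct1]
  note d17 = D[THEN conjunct2, THEN conjunct2, THEN conjunct2, THEN conjunct2, THEN conjunct2, THEN conjunct2, THEN conjunct2, THEN conjunct2, THEN conjunct2, THEN conjunct2, THEN conjunct2, THEN conjunct2, THEN conjunct2, THEN conjunct2, THEN conjunct2, THEN conjunct2, THEN conjunct1]
  note d18 = D[THEN conjunct2, THEN conjunct2, THEN conjunct2, THEN conjunct2, THEN conjunct2, THEN conjunct2, THEN conjunct2, THEN conjunct2, THEN conjunct2, THEN conjunct2, THEN conjunct2, THEN conjunct2, THEN conjunct2, THEN conjunct2, THEN conjunct2, THEN conjunct2, THEN conjunct2]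
  have irr: "\<And>a. a \<in> vals G \<Longrightarrow> \<not> vless G a a" using d3 by blast
  have tr: "\<And>a b d. a \<in> vals G \<Longrightarrow> b \<in> vals G \<Longrightarrow> d \<in> vals G \<Longrightarrow> vless G a b \<Longrightarrow> vless G b d \<Longrightarrow> vless G a d" using d4 by blast
  have tot: "\<And>a b. a \<in> vals G \<Longrightarrow> b \<in> vals G \<Longrightarrow> vless G a b \<or> a = b \<or> vless G b a" using d5 by blast

  have vs: "vector_space_struct M" using d1 by blast
  have "01": "mzero M \<noteq> mone M" using d2 by blast
  have infv: "vinf G \<in> vals G" "\<And>a. a \<in> vals G \<Longrightarrow> vle G a (vinf G)" using d8 d9 by blast+
  have surj: "?v ` ?U = vals G" using d10 by blast
  have um: "\<And>x y. x \<in> ?U \<Longrightarrow> y \<in> ?U \<Longrightarrow> vle G (?v x) (?v (madd M x y)) \<or> vle G (?v y) (?v (madd M x y))" using d11 by blast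
  have v0: "\<And>x. x \<in> ?U \<Longrightarrow> ?v x = vinf G \<longleftrightarrow> x = mzero M" using d12 by blast
  have sinf: "vsucc G (vinf G) = vinf G" using d13 by blast
  have ss: "\<And>a. a \<in> vals G - {vinf G} \<Longrightarrow> imm_succ G a (vsucc G a)" using d14 by blast
  have sc: "\<And>c x. c \<noteq> 0 \<Longrightarrow> x \<in> ?U \<Longrightarrow> shifted G (pval p c) (?v (mscale M c x)) (?v x)" using d16 by blast
  have rf: "\<And>ws x y. finite (residue_field p) \<Longrightarrow> residue_reps p ws \<Longrightarrow> x \<in> ?U \<Longrightarrow> y \<in> ?U \<Longrightarrow>
        ?v x = ?v y \<Longrightarrow> ?v y \<noteq> vinf G \<Longrightarrow> \<exists>w\<in>set ws. vless G (?v x) (?v (madd M (mscale M w x) y))" using d17 by blast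
  have ri: "\<And>n ws x y. infinite (residue_field p) \<Longrightarrow> length ws = Suc n \<Longrightarrow> distinct_residues p ws \<Longrightarrow> x \<in> ?U \<Longrightarrow>
        \<forall>j\<in>{1..n}. y j \<in> ?U \<and> vle G (?v x) (?v (y j)) \<Longrightarrow>
        \<exists>w\<in>set ws. \<forall>j\<in>{1..n}. ?v (madd M (mscale M w x) (y j)) = ?v x" using d18 by blast

  note cl = vector_space_structD(1,2,3)[OF vs]
  have vG: "\<And>x. x \<in> ?U \<Longrightarrow> ?v x \<in> vals G" using surj by blast
  have sG: "vsucc G a \<in> vals G" if "a \<in> vals G" for a
    using ss[of a] sinf that unfolding imm_succ_def by (cases "a = vinf G") auto
  have sGn: "(vsucc G ^^ n) a \<in> vals G" if "a \<in> vals G" for a n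
    using funpow_closed[of "vals G" "vsucc G"] sG that by blast
  have smono: "vless G (vsucc G a) (vsucc G b)" if ab: "a \<in> vals G" "b \<in> vals G" "vless G a b" for a b
  proof -
    have an: "a \<noteq> vinf G" 
    proof
      assume a: "a = vinf G"
      have "vless G b a \<or> b = a" using infv(2)[OF ab(2)] unfolding a vle_def .
      then show False using irr[OF ab(1)] tr[OF ab(1,2,1) ab(3)] ab(3) by blast
    qed
    show ?thesis
    proof (cases "b = vinf G")
      case True
      have "vsucc G a \<noteq> vinf G"
      proof -
        obtain d where d: "d \<in> vals G - {vinf G}" "imm_succ G a d" using bspec[OF d6, of a] an ab(1) by auto
        have "imm_succ G a (vsucc G a)" using ss an ab(1) by blast
        then have "d = vsucc G a" using d(2) tot[of d "vsucc G a"] unfolding imm_succ_def by blast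
        then show ?thesis using d by blast
      qed
      then have "vless G (vsucc G a) (vinf G)" using infv(2)[OF sG[OF ab(1)]] unfolding vle_def by simp
      then show ?thesis using True sinf by simp
    next
      case False
      have a: "imm_succ G a (vsucc G a)" and b: "imm_succ G b (vsucc G b)" using ss an False ab by auto
      have "\<not> vless G b (vsucc G a)" using a ab unfolding imm_succ_def by blast
      then have "vsucc G a = b \<or> vless G (vsucc G a) b" using tot[OF sG[OF ab(1)] ab(2)] by blast
      then show ?thesis using b tr[OF sG[OF ab(1)] ab(2) sG[OF ab(2)]] unfolding imm_succ_def by auto
    qed
  qed
  have sinj: "a = b" if "a \<in> vals G" "b \<in> vals G" "vsucc G a = vsucc G b" for a b
    using tot[OF that(1,2)] smono[OF that(1,2)] smono[OF that(2,1)] irr[OF sG[OF that(1)]] that(3) by auto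
  have sninj: "a = b" if "a \<in> vals G" "b \<in> vals G" "(vsucc G ^^ n) a = (vsucc G ^^ n) b" for a b n
    using that
  proof (induction n)
    case (Suc n)
    then show ?case using sinj[OF sGn sGn, of a b n n] by simp
  qed simp
  have sh: "a = b" if "a \<in> vals G" "b \<in> vals G" "d \<in> vals G" "shifted G n a d" "shifted G n b d" for a b d n
    using that sninj[of a b "nat (- n)"] unfolding shifted_def by (cases "n \<ge> 0") auto
  have LL: "\<And>x y. x \<in> ?U \<Longrightarrow> y \<in> ?U \<Longrightarrow> mL p M x y \<longleftrightarrow> vle G (?v y) (?v x)"
    using L unfolding induces_L_def by blast
  have nL: "\<not> mL p M x y \<longleftrightarrow> vless G (?v x) (?v y)" if "x \<in> ?U" "y \<in> ?U" for x y
    using LL[OF that] tot[OF vG[OF that(1)] vG[OF that(2)]] irr[OF vG[OF that(1)]] tr[OF vG[OF that(1)] vG[OF that(2)] vG[OF that(1)]]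
      irr[OF vG[OF that(2)]]
    unfolding vle_def by metis
  have eqv: "mL p M x y \<and> mL p M y x \<longleftrightarrow> ?v x = ?v y" if "x \<in> ?U" "y \<in> ?U" for x y
    using nL[OF that] nL[OF that(2,1)] tot[OF vG[OF that(1)] vG[OF that(2)]] irr[OF vG[OF that(1)]] by metis
  have vlet: "vle G a d" if "a \<in> vals G" "b \<in> vals G" "d \<in> vals G" "vle G a b" "vle G b d" for a b d
    using tr[OF that(1-3)] that(4,5) unfolding vle_def by metis
  have pi: "vmap G (mscale M \<pi> x) = vsucc G (?v x)" if "\<pi> \<noteq> 0" "pval p \<pi> = 1" "x \<in> ?U" for \<pi> x
    using sc[OF that(1,3)] that(2) unfolding shifted_def by simp
  show ?thesis
    unfolding fin_ax_def
  proof (intro conjI)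
    show "\<forall>x\<in>?U. \<forall>y\<in>?U. mL p M x y \<or> mL p M y x"
    proof (intro ballI)
      fix x y assume "x \<in> ?U" "y \<in> ?U"
      then show "mL p M x y \<or> mL p M y x"
        using nL[of x y] LL[of y x] unfolding vle_def by blast
    qed
    show "\<forall>x\<in>?U. \<forall>y\<in>?U. \<forall>z\<in>?U. mL p M x y \<longrightarrow> mL p M y z \<longrightarrow> mL p M x z"
    proof (intro ballI impI)
      fix x y z assume h: "x \<in> ?U" "y \<in> ?U" "z \<in> ?U" "mL p M x y" "mL p M y z"
      show "mL p M x z"
        using vlet[OF vG[OF h(3)] vG[OF h(2)] vG[OF h(1)]] LL[OF h(1,2)] LL[OF h(2,3)] LL[OF h(1,3)] h(4,5) by blast
    qed
    have Lz: "mL p M (mzero M) x" if "x \<in> ?U" for x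
      using LL[OF cl(1) that] v0[OF cl(1)] infv(2)[OF vG[OF that]] by simp
    then show "\<forall>x\<in>?U. mL p M (mzero M) x" by blast
    show "\<forall>x\<in>?U. mL p M x (mzero M) \<longrightarrow> x = mzero M"
    proof (intro ballI impI)
      fix x assume x: "x \<in> ?U" "mL p M x (mzero M)"
      then have "mL p M (mzero M) x \<and> mL p M x (mzero M)"
        using Lz by blast
      then have "?v x = vinf G" using eqv[OF cl(1) x(1)] v0[OF cl(1)] by simp
      then show "x = mzero M" using v0[OF x(1)] by simp
    qed
    show "\<forall>x\<in>?U. \<forall>y\<in>?U. \<forall>z\<in>?U. mL p M x z \<longrightarrow> mL p M y z \<longrightarrow> mL p M (madd M x y) z"
    proof (intro ballI impI)
      fix x y z assume h: "x \<in> ?U" "y \<in> ?U" "z \<in> ?U" "mL p M x z" "mL p M y z"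
      show "mL p M (madd M x y) z"
        using um[OF h(1,2)] h(4,5) LL[OF h(1,3)] LL[OF h(2,3)] LL[OF cl(2)[OF h(1,2)] h(3)]
          vlet[OF vG[OF h(3)] vG[OF h(1)] vG[OF cl(2)[OF h(1,2)]]]
          vlet[OF vG[OF h(3)] vG[OF h(2)] vG[OF cl(2)[OF h(1,2)]]] by blast
    qed
    show "\<forall>c d. c \<noteq> 0 \<and> d \<noteq> 0 \<and> pval p c = pval p d \<longrightarrow> (\<forall>x\<in>?U. 
        mL p M (mscale M c x) (mscale M d x) \<and> mL p M (mscale M d x) (mscale M c x))"
    proof (intro allI impI ballI)
      fix c d x assume c: "c \<noteq> 0 \<and> d \<noteq> 0 \<and> pval p c = pval p d" and x: "x \<in> ?U"
      have "?v (mscale M c x) = ?v (mscale M d x)"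
        using sh[OF vG[OF cl(3)[OF x]] vG[OF cl(3)[OF x]] vG[OF x] sc[of c x] , of d] sc[of d x] c x by auto
      then show "mL p M (mscale M c x) (mscale M d x) \<and> mL p M (mscale M d x) (mscale M c x)"
        using eqv[OF cl(3)[OF x] cl(3)[OF x]] by simp
    qed
    show "\<forall>\<pi>. \<pi> \<noteq> 0 \<and> pval p \<pi> = 1 \<longrightarrow> (\<forall>x\<in>?U. x \<noteq> mzero M \<longrightarrow>
        \<not> mL p M x (mscale M \<pi> x) \<and> (\<forall>y\<in>?U. \<not> mL p M x y \<longrightarrow> mL p M y (mscale M \<pi> x)))"
    proof (intro allI impI ballI conjI)
      fix \<pi> x assume h: "\<pi> \<noteq> 0 \<and> pval p \<pi> = 1" "x \<in> ?U" "x \<noteq> mzero M"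
      have i: "imm_succ G (?v x) (?v (mscale M \<pi> x))"
        using ss[of "?v x"] pi[of \<pi> x] h v0[OF h(2)] vG[OF h(2)] by simp
      then show "\<not> mL p M x (mscale M \<pi> x)" using nL[OF h(2) cl(3)[OF h(2)]] unfolding imm_succ_def by blast
      fix y assume y: "y \<in> ?U" "\<not> mL p M x y"
      then have "vless G (?v x) (?v y)" using nL[OF h(2) y(1)] by blast
      then have "\<not> vless G (?v y) (?v (mscale M \<pi> x))" using i vG[OF y(1)] unfolding imm_succ_def by blast
      then show "mL p M y (mscale M \<pi> x)" using nL[OF y(1) cl(3)[OF h(2)]] by blast
    qed
    show "\<forall>ws. finite (residue_field p) \<and> residue_reps p ws \<longrightarrow>
        (\<forall>x\<in>?U. \<forall>y\<in>?U. mL p M x y \<and> mL p M y x \<and> x \<noteq> mzero M \<longrightarrow>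
           (\<exists>w\<in>set ws. \<not> mL p M x (madd M (mscale M w x) y)))"
    proof (intro allI impI ballI)
      fix ws x y
      assume h: "finite (residue_field p) \<and> residue_reps p ws" "x \<in> ?U" "y \<in> ?U"
        "mL p M x y \<and> mL p M y x \<and> x \<noteq> mzero M"
      have "?v x = ?v y" "?v y \<noteq> vinf G" using h(4) eqv[OF h(2,3)] v0[OF h(2)] by auto
      then obtain w where "w \<in> set ws" "vless G (?v x) (?v (madd M (mscale M w x) y))"
        using rf[of ws x y] h by blast
      then show "\<exists>w\<in>set ws. \<not> mL p M x (madd M (mscale M w x) y)"
        using nL[OF h(2) cl(2)[OF cl(3)[OF h(2)] h(3)]] by blast
    qed
    show "\<forall>n ws. infinite (residue_field p) \<and> length ws = Suc n \<and> distinct_residues p ws \<longrightarrow>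
        (\<forall>x\<in>?U. \<forall>y. (\<forall>j\<in>{1..n}. y j \<in> ?U \<and> mL p M (y j) x) \<longrightarrow>
           (\<exists>w\<in>set ws. \<forall>j\<in>{1..n}. mL p M (madd M (mscale M w x) (y j)) x \<and>
               mL p M x (madd M (mscale M w x) (y j))))"
    proof (intro allI impI ballI)
      fix n ws x y
      assume h: "infinite (residue_field p) \<and> length ws = Suc n \<and> distinct_residues p ws" "x \<in> ?U"
        "\<forall>j\<in>{1..n}. y j \<in> ?U \<and> mL p M (y j) x"
      then have y: "\<forall>j\<in>{1..n}. y j \<in> ?U \<and> vle G (?v x) (?v (y j))" using LL by blast
      obtain w where w: "w \<in> set ws" "\<forall>j\<in>{1..n}. ?v (madd M (mscale M w x) (y j)) = ?v x"
        using ri[of ws n x y] h y by blast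
      show "\<exists>w\<in>set ws. \<forall>j\<in>{1..n}. mL p M (madd M (mscale M w x) (y j)) x \<and>
               mL p M x (madd M (mscale M w x) (y j))"
      proof (intro bexI[of _ w] ballI)
        fix j assume "j \<in> {1..n}"
        then show "mL p M (madd M (mscale M w x) (y j)) x \<and> mL p M x (madd M (mscale M w x) (y j))"
          using w(2) h(3) eqv[OF cl(2)[OF cl(3)[OF h(2)], of "y j" w] h(2)] by blast
      qed (rule w)
    qed
  qed (rule vs, rule "01")
qed

lemma fin_ax_model_T_kv:
  fixes p :: "'k::field place" and M :: "('k fsym, 'k rsym, 'u) struct"
  assumes p: "finite_place p" "discrete_place p" and ax: "fin_ax p M"
  shows "\<exists>G :: ('u, 'u) vstruct. model_T_kv p M G \<and> induces_L p M G"
proof -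
  let ?U = "univ M"
  note D = ax[unfolded fin_ax_def]
  note d1 = D[THEN conjunct1]
  note d2 = D[THEN conjunct2, THEN conjunct1]
  note d3 = D[THEN conjunct2, THEN conjunct2, THEN conjunct1]
  note d4 = D[THEN conjunct2, THEN conjunct2, THEN conjunct2, THEN conjunct1]
  note d5 = D[THEN conjunct2, THEN conjunct2, THEN conjunct2, THEN conjunct2, THEN conjunct1]
  note d6 = D[THEN conjunct2, THEN conjunct2, THEN conjunct2, THEN conjunct2, THEN conjunct2, THEN conjunct1]
  note d7 = D[THEN conjunct2, THEN conjunct2, THEN conjunct2, THEN conjunct2, THEN conjunct2, THEN conjunct2, THEN conjunct1]
  note d8 = D[THEN conjunct2, THEN conjunct2, THEN conjunct2, THEN conjunct2, THEN conjunct2, THEN conjunct2, THEN conjunct2, THEN conjunct1]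
  note d9 = D[THEN conjunct2, THEN conjunct2, THEN conjunct2, THEN conjunct2, THEN conjunct2, THEN conjunct2, THEN conjunct2, THEN conjunct2, THEN conjunct1]
  note d10 = D[THEN conjunct2, THEN conjunct2, THEN conjunct2, THEN conjunct2, THEN conjunct2, THEN conjunct2, THEN conjunct2, THEN conjunct2, THEN conjunct2, THEN conjunct1]
  note d11 = D[THEN conjunct2, THEN conjunct2, THEN conjunct2, THEN conjunct2, THEN conjunct2, THEN conjunct2, THEN conjunct2, THEN conjunct2, THEN conjunct2, THEN conjunct2]
  have vs: "vector_space_struct M" using d1 by blast
  have "01": "mzero M \<noteq> mone M" using d2 by blast
  have tot: "\<And>x y. x \<in> ?U \<Longrightarrow> y \<in> ?U \<Longrightarrow> mL p M x y \<or> mL p M y x" using d3 by blast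
  have tr: "\<And>x y z. x \<in> ?U \<Longrightarrow> y \<in> ?U \<Longrightarrow> z \<in> ?U \<Longrightarrow> mL p M x y \<Longrightarrow> mL p M y z \<Longrightarrow> mL p M x z" using d4 by blast
  have L0: "\<And>x. x \<in> ?U \<Longrightarrow> mL p M (mzero M) x" using d5 by blast
  have L0': "\<And>x. x \<in> ?U \<Longrightarrow> mL p M x (mzero M) \<Longrightarrow> x = mzero M" using d6 by blast
  have um: "\<And>x y z. x \<in> ?U \<Longrightarrow> y \<in> ?U \<Longrightarrow> z \<in> ?U \<Longrightarrow> mL p M x z \<Longrightarrow> mL p M y z \<Longrightarrow> mL p M (madd M x y) z" using d7 by blast
  have sc: "\<And>c d x. c \<noteq> 0 \<Longrightarrow> d \<noteq> 0 \<Longrightarrow> pval p c = pval p d \<Longrightarrow> x \<in> ?U \<Longrightarrow>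
        mL p M (mscale M c x) (mscale M d x)" using d8 by blast
  have su: "\<And>\<pi> x. \<pi> \<noteq> 0 \<Longrightarrow> pval p \<pi> = 1 \<Longrightarrow> x \<in> ?U \<Longrightarrow> x \<noteq> mzero M \<Longrightarrow> \<not> mL p M x (mscale M \<pi> x)" using d9 by blast
  have su': "\<And>\<pi> x y. \<pi> \<noteq> 0 \<Longrightarrow> pval p \<pi> = 1 \<Longrightarrow> x \<in> ?U \<Longrightarrow> x \<noteq> mzero M \<Longrightarrow> y \<in> ?U \<Longrightarrow> \<not> mL p M x y \<Longrightarrow>
        mL p M y (mscale M \<pi> x)" using d9 by blast
  have rf: "\<And>ws x y. finite (residue_field p) \<Longrightarrow> residue_reps p ws \<Longrightarrow> x \<in> ?U \<Longrightarrow> y \<in> ?U \<Longrightarrow>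
        mL p M x y \<Longrightarrow> mL p M y x \<Longrightarrow> x \<noteq> mzero M \<Longrightarrow> \<exists>w\<in>set ws. \<not> mL p M x (madd M (mscale M w x) y)" using d10 by blast
  have ri: "\<And>n ws x y. infinite (residue_field p) \<Longrightarrow> length ws = Suc n \<Longrightarrow> distinct_residues p ws \<Longrightarrow> x \<in> ?U \<Longrightarrow>
        \<forall>j\<in>{1..n}. y j \<in> ?U \<and> mL p M (y j) x \<Longrightarrow>
        \<exists>w\<in>set ws. \<forall>j\<in>{1..n}. mL p M (madd M (mscale M w x) (y j)) x \<and> mL p M x (madd M (mscale M w x) (y j))" using d11 by blast

  note cl = vector_space_structD(1,2,3)[OF vs]
  note sc1 = vector_space_structD(4)[OF vs]
  note scm = vector_space_structD(5)[OF vs]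
  note zl = vector_space_structD(6)[OF vs]
  note sa = vector_space_structD(7)[OF vs]
  note sd = vector_space_structD(8)[OF vs]
  note ass = vector_space_structD(9)[OF vs]
  note ne = vector_space_structD(10)[OF vs]
  note comm = vector_space_structD(11)[OF vs]
  have idem: "x = mzero M" if x: "x \<in> ?U" and xx: "madd M x x = x" for x
  proof -
    have n: "mscale M (- 1) x \<in> ?U" using cl(3) x .
    have "x = madd M x (madd M x (mscale M (- 1) x))"
      using ne[OF x] comm[OF x cl(1)] zl[OF x] by simp
    also have "\<dots> = madd M (madd M x x) (mscale M (- 1) x)" using ass[OF x x n] by simp
    also have "\<dots> = mzero M" using xx ne[OF x] by simp
    finally show ?thesis .
  qed
  have s0x: "mscale M 0 x = mzero M" if "x \<in> ?U" for x
    using idem[OF cl(3)[OF that]] sd[OF that, of 0 0] by simp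
  have sz: "mscale M c (mzero M) = mzero M" for c
    using idem[OF cl(3)[OF cl(1)]] sa[OF cl(1) cl(1), of c] zl[OF cl(1)] by simp
  have snz: "mscale M c x \<noteq> mzero M" if "c \<noteq> 0" "x \<in> ?U" "x \<noteq> mzero M" for c x
    using scm[OF that(2), of "inverse c" c] sc1[OF that(2)] sz that by auto
  obtain \<pi> where \<pi>: "\<pi> \<noteq> 0" "pval p \<pi> = 1" using pval_base[OF p] by metis
  define eqv where "eqv x y \<longleftrightarrow> mL p M x y \<and> mL p M y x" for x y
  have refl: "mL p M x x" if "x \<in> ?U" for x using tot that by blast
  define rep where "rep x = (SOME y. y \<in> ?U \<and> eqv x y)" for x
  have rep: "rep x \<in> ?U \<and> eqv x (rep x)" if "x \<in> ?U" for x
    unfolding rep_def by (rule someI[of _ x]) (use that refl in \<open>auto simp: eqv_def\<close>)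
  have repL: "mL p M (rep x) (rep y) \<longleftrightarrow> mL p M x y" if "x \<in> ?U" "y \<in> ?U" for x y
    using rep[OF that(1)] rep[OF that(2)] that tr unfolding eqv_def by meson
  have rep_eq: "rep x = rep y \<longleftrightarrow> eqv x y" if "x \<in> ?U" "y \<in> ?U" for x y
  proof
    assume "rep x = rep y"
    then show "eqv x y" using repL[OF that] repL[OF that(2,1)] refl rep that unfolding eqv_def by metis
  next
    assume "eqv x y"
    then have "(\<lambda>z. z \<in> ?U \<and> eqv x z) = (\<lambda>z. z \<in> ?U \<and> eqv y z)"
      using tr that unfolding eqv_def by (intro ext) meson
    then show "rep x = rep y" unfolding rep_def by simp
  qed
  define G :: "('u, 'u) vstruct" where
    "G = \<lparr>vals = rep ` ?U, vless = (\<lambda>a b. \<not> mL p M a b), vinf = rep (mzero M),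
       vsucc = (\<lambda>a. rep (mscale M \<pi> a)), vmap = rep\<rparr>"
  have Gs [simp]: "vals G = rep ` ?U" "vless G a b \<longleftrightarrow> \<not> mL p M a b" "vinf G = rep (mzero M)"
    "vsucc G a = rep (mscale M \<pi> a)" "vmap G = rep" for a b
    unfolding G_def by auto
  have rU: "rep x \<in> ?U" if "x \<in> ?U" for x using rep that by blast
  have lt: "vless G (rep x) (rep y) \<longleftrightarrow> \<not> mL p M x y" if "x \<in> ?U" "y \<in> ?U" for x y
    using repL[OF that] by simp
  have le: "vle G (rep x) (rep y) \<longleftrightarrow> mL p M y x" if "x \<in> ?U" "y \<in> ?U" for x y
    using lt[OF that] rep_eq[OF that] tot[OF that] unfolding vle_def eqv_def by auto
  have pimono: "mL p M (mscale M \<pi> x) (mscale M \<pi> y)" if "x \<in> ?U" "y \<in> ?U" "mL p M x y" for x y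
  proof (cases "y = mzero M \<or> x = mzero M")
    case True
    then show ?thesis using that L0' L0 refl cl sz by metis
  next
    case False
    have "\<not> mL p M x (mscale M \<pi> x)" using su[OF \<pi> that(1)] False by blast
    then have "\<not> mL p M y (mscale M \<pi> x)" using tr that cl(3) by blast
    then show ?thesis using su'[OF \<pi> that(2) _ cl(3)[OF that(1)]] False by blast
  qed
  have succ: "vsucc G (rep x) = rep (mscale M \<pi> x)" if "x \<in> ?U" for x
    using rep_eq[of "mscale M \<pi> (rep x)" "mscale M \<pi> x"] rep[OF that] pimono[of x "rep x"] pimono[of "rep x" x] that cl(3)
    unfolding eqv_def by simp
  have succn: "(vsucc G ^^ n) (rep x) = rep (mscale M (\<pi> ^ n) x)" if "x \<in> ?U" for x n
  proof (induction n)
    case 0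
    then show ?case using sc1 that by simp
  next
    case (Suc n)
    then show ?case using succ[OF cl(3)[OF that]] scm[OF that, of \<pi> "\<pi> ^ n"] by simp
  qed
  have ssu: "imm_succ G (rep x) (rep (mscale M \<pi> x))" if "x \<in> ?U" "x \<noteq> mzero M" for x
    unfolding imm_succ_def using that su[OF \<pi> that] su'[OF \<pi> that] cl(3) repL by auto
  have rep0: "rep x = rep (mzero M) \<longleftrightarrow> x = mzero M" if "x \<in> ?U" for x
    using rep_eq[OF that cl(1)] L0 L0' that unfolding eqv_def by auto
  have m1: "model_T_kv p M G"
    unfolding model_T_kv_def
  proof (intro conjI)
    show "\<forall>a\<in>vals G. \<not> vless G a a" using refl rU by auto
    show "\<forall>a\<in>vals G. \<forall>b\<in>vals G. \<forall>d\<in>vals G. vless G a b \<longrightarrow> vless G b d \<longrightarrow> vless G a d"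
    proof (intro ballI impI)
      fix a b d assume "a \<in> vals G" "b \<in> vals G" "d \<in> vals G" and ab: "vless G a b" and bd: "vless G b d"
      then have U: "a \<in> ?U" "b \<in> ?U" "d \<in> ?U" using rU by auto
      show "vless G a d"
        using tr[OF U(2,1,3)] tot[OF U(1,2)] tot[OF U(2,3)] tr[OF U(1,3,2)] ab bd by auto
    qed
    show "\<forall>a\<in>vals G. \<forall>b\<in>vals G. vless G a b \<or> a = b \<or> vless G b a"
    proof (intro ballI)
      fix a b assume "a \<in> vals G" "b \<in> vals G"
      then obtain x y where x: "x \<in> ?U" "a = rep x" "y \<in> ?U" "b = rep y" by auto
      show "vless G a b \<or> a = b \<or> vless G b a"
        using rep_eq[OF x(1,3)] lt[OF x(1,3)] lt[OF x(3,1)] unfolding x(2,4) eqv_def by blast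
    qed
    show "\<forall>a\<in>vals G - {vinf G}. \<exists>b\<in>vals G - {vinf G}. imm_succ G a b"
    proof
      fix a assume "a \<in> vals G - {vinf G}"
      then obtain x where x: "x \<in> ?U" "a = rep x" "x \<noteq> mzero M" by auto
      then show "\<exists>b\<in>vals G - {vinf G}. imm_succ G a b"
        using ssu[OF x(1,3)] rep0[OF cl(3)[OF x(1)]] snz[OF \<pi>(1) x(1,3)] cl(3)[OF x(1)]
        by (intro bexI[of _ "rep (mscale M \<pi> x)"]) auto
    qed
    show "\<forall>b\<in>vals G - {vinf G}. (\<exists>a\<in>vals G. vless G a b) \<longrightarrow> (\<exists>a\<in>vals G - {vinf G}. imm_succ G a b)"
    proof (intro ballI impI)
      fix b assume "b \<in> vals G - {vinf G}"
      then obtain x where x: "x \<in> ?U" "b = rep x" "x \<noteq> mzero M" by auto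
      let ?y = "mscale M (inverse \<pi>) x"
      have y: "?y \<in> ?U" "?y \<noteq> mzero M" using cl(3) x snz[of "inverse \<pi>" x] \<pi> by auto
      have "mscale M \<pi> ?y = x" using scm[OF x(1), of \<pi> "inverse \<pi>"] sc1[OF x(1)] \<pi> by simp
      then show "\<exists>a\<in>vals G - {vinf G}. imm_succ G a b"
        using ssu[OF y] rep0[OF y(1)] y x(2) by (intro bexI[of _ "rep ?y"]) auto
    qed
    show "vinf G \<in> vals G" using cl by simp
    show "\<forall>a\<in>vals G. vle G a (vinf G)" using le L0 cl(1) by auto
    show "\<forall>x\<in>?U. \<forall>y\<in>?U. vle G (vmap G x) (vmap G (madd M x y)) \<or> vle G (vmap G y) (vmap G (madd M x y))"
    proof (intro ballI)
      fix x y assume h: "x \<in> ?U" "y \<in> ?U"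
      show "vle G (vmap G x) (vmap G (madd M x y)) \<or> vle G (vmap G y) (vmap G (madd M x y))"
        using le[OF h(1) cl(2)[OF h]] le[OF h(2) cl(2)[OF h]] um[OF h h(1)] um[OF h h(2)] tot[OF h] refl h by auto
    qed
    show "\<forall>x\<in>?U. vmap G x = vinf G \<longleftrightarrow> x = mzero M" using rep0 by simp
    show "vsucc G (vinf G) = vinf G" using succ[OF cl(1)] sz by simp
    show "\<forall>a\<in>vals G - {vinf G}. imm_succ G a (vsucc G a)"
    proof
      fix a assume "a \<in> vals G - {vinf G}"
      then obtain x where x: "x \<in> ?U" "a = rep x" "x \<noteq> mzero M" by auto
      then show "imm_succ G a (vsucc G a)" using ssu[OF x(1,3)] succ[OF x(1)] by (simp del: Gs)
    qed
    show "\<forall>x\<in>?U. vmap G (mscale M 0 x) = vinf G" using s0x by simp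
    show "\<forall>c. c \<noteq> 0 \<longrightarrow> (\<forall>x\<in>?U. shifted G (pval p c) (vmap G (mscale M c x)) (vmap G x))"
    proof (intro allI impI ballI)
      fix c :: 'k and x assume c: "c \<noteq> 0" and x: "x \<in> ?U"
      show "shifted G (pval p c) (vmap G (mscale M c x)) (vmap G x)"
      proof (cases "pval p c \<ge> 0")
        case True
        have "pval p c = pval p (\<pi> ^ nat (pval p c))" using pval_power[OF p \<pi>(1)] \<pi>(2) True by simp
        then have "rep (mscale M c x) = rep (mscale M (\<pi> ^ nat (pval p c)) x)"
          using sc[of c "\<pi> ^ nat (pval p c)" x] sc[of "\<pi> ^ nat (pval p c)" c x] c x \<pi>(1) cl(3)
          by (subst rep_eq) (auto simp: eqv_def)
        then show ?thesis using succn[OF x, of "nat (pval p c)"] True unfolding shifted_def by (simp del: Gs(4))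
      next
        case False
        let ?n = "nat (- pval p c)"
        have "pval p (\<pi> ^ ?n * c) = pval p 1"
          using pval_mult[OF p, of "\<pi> ^ ?n" c] pval_power[OF p \<pi>(1), of ?n] \<pi> c False pval_one[OF p] by simp
        then have "rep (mscale M (\<pi> ^ ?n * c) x) = rep (mscale M 1 x)"
          using sc[of "\<pi> ^ ?n * c" 1 x] sc[of 1 "\<pi> ^ ?n * c" x] c x \<pi>(1) cl(3)
          by (subst rep_eq) (auto simp: eqv_def)
        then have "(vsucc G ^^ ?n) (rep (mscale M c x)) = rep x"
          using succn[OF cl(3)[OF x], of ?n c] scm[OF x, of "\<pi> ^ ?n" c] sc1[OF x] by (simp del: Gs(4))
        then show ?thesis using False unfolding shifted_def by (simp del: Gs(4))
      qed
    qed
    show "finite (residue_field p) \<longrightarrow> (\<forall>ws. residue_reps p ws \<longrightarrow>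
        (\<forall>x\<in>?U. \<forall>y\<in>?U. vmap G x = vmap G y \<and> vmap G y \<noteq> vinf G \<longrightarrow>
           (\<exists>w\<in>set ws. vless G (vmap G x) (vmap G (madd M (mscale M w x) y)))))"
    proof (intro allI impI ballI)
      fix ws x y
      assume h: "finite (residue_field p)" "residue_reps p ws" "x \<in> ?U" "y \<in> ?U"
        "vmap G x = vmap G y \<and> vmap G y \<noteq> vinf G"
      have e: "eqv x y" "x \<noteq> mzero M" using h(5) rep_eq[OF h(3,4)] rep0[OF h(3)] by simp_all
      then obtain w where "w \<in> set ws" "\<not> mL p M x (madd M (mscale M w x) y)"
        using rf[OF h(1-4)] unfolding eqv_def by blast
      then show "\<exists>w\<in>set ws. vless G (vmap G x) (vmap G (madd M (mscale M w x) y))"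
        using repL[OF h(3) cl(2)[OF cl(3)[OF h(3)] h(4)]] by auto
    qed
    show "infinite (residue_field p) \<longrightarrow> (\<forall>n ws. length ws = Suc n \<and> distinct_residues p ws \<longrightarrow>
        (\<forall>x\<in>?U. \<forall>y. (\<forall>j\<in>{1..n}. y j \<in> ?U \<and> vle G (vmap G x) (vmap G (y j))) \<longrightarrow>
           (\<exists>w\<in>set ws. \<forall>j\<in>{1..n}. vmap G (madd M (mscale M w x) (y j)) = vmap G x)))"
    proof (intro allI impI ballI)
      fix n ws x y
      assume h: "infinite (residue_field p)" "length ws = Suc n \<and> distinct_residues p ws" "x \<in> ?U"
        "\<forall>j\<in>{1..n}. y j \<in> ?U \<and> vle G (vmap G x) (vmap G (y j))"
      then have y: "\<forall>j\<in>{1..n}. y j \<in> ?U \<and> mL p M (y j) x" using le[OF h(3)] h(4) unfolding Gs(5) by blast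
      obtain w where w: "w \<in> set ws" "\<forall>j\<in>{1..n}. mL p M (madd M (mscale M w x) (y j)) x \<and> mL p M x (madd M (mscale M w x) (y j))"
        using ri[of ws n x y] h y by blast
      show "\<exists>w\<in>set ws. \<forall>j\<in>{1..n}. vmap G (madd M (mscale M w x) (y j)) = vmap G x"
      proof (intro bexI[of _ w] ballI)
        fix j assume j: "j \<in> {1..n}"
        then show "vmap G (madd M (mscale M w x) (y j)) = vmap G x"
          using w(2) y h(3) cl rep_eq[of "madd M (mscale M w x) (y j)" x] unfolding eqv_def by simp
      qed (use w in auto)
    qed
  qed (use vs "01" in auto)
  have "induces_L p M G" unfolding induces_L_def using le by simp
  with m1 show ?thesis by blast
qed

text \<open>Since \<open>v\<close> is surjective, value sorts on the type \<^typ>\<open>'u\<close> of vectors suffice for the first part;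
the second part admits an arbitrary type of values.\<close>

theorem models_T_fin:
  fixes p :: "'k::field place" and M :: "('k fsym, 'k rsym, 'u) struct"
  assumes "finite_place p" "discrete_place p" "struct_in (lang_kS {p} {}) M"
  shows "models M (T_fin p) \<longleftrightarrow> (\<exists>G :: ('u, 'u) vstruct. model_T_kv p M G \<and> induces_L p M G)"
    and "model_T_kv p M (G :: ('u, 'g) vstruct) \<Longrightarrow> induces_L p M G \<Longrightarrow> models M (T_fin p)"
proof -
  have *: "models M (T_fin p) \<longleftrightarrow> fin_ax p M"
    using models_fin_ax[of M p] assms(3) unfolding struct_in_lang_k by simp
  show "models M (T_fin p) \<longleftrightarrow> (\<exists>G :: ('u, 'u) vstruct. model_T_kv p M G \<and> induces_L p M G)"
    unfolding *
  proof
    assume "fin_ax p M"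
    then show "\<exists>G :: ('u, 'u) vstruct. model_T_kv p M G \<and> induces_L p M G"
      by (rule fin_ax_model_T_kv[OF assms(1,2)])
  next
    assume "\<exists>G :: ('u, 'u) vstruct. model_T_kv p M G \<and> induces_L p M G"
    then obtain G :: "('u, 'u) vstruct" where "model_T_kv p M G" "induces_L p M G" by (elim exE conjE)
    then show "fin_ax p M" by (rule model_T_kv_fin_ax)
  qed
  show "models M (T_fin p)" if "model_T_kv p M G" "induces_L p M G"
    unfolding * using that by (rule model_T_kv_fin_ax)
qed


subsection \<open>The two-sorted theory with addition on the value sort\<close>

record ('u, 'g) pstruct = "('u, 'g) vstruct" +
  vplus :: "'g \<Rightarrow> 'g \<Rightarrow> 'g"
  vzero :: 'g
  vone :: 'g
  vP :: "nat \<Rightarrow> 'g \<Rightarrow> bool"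

primrec vmult :: "('u, 'g, 'z) pstruct_scheme \<Rightarrow> nat \<Rightarrow> 'g \<Rightarrow> 'g" where
  "vmult G 0 a = vzero G"
| "vmult G (Suc n) a = vplus G (vmult G n a) a"

text \<open>\<open>\<Gamma> - {\<infinity>}\<close> is an ordered abelian group.\<close>

definition ordered_value_group :: "('u, 'g, 'z) pstruct_scheme \<Rightarrow> bool" where
  "ordered_value_group G \<longleftrightarrow>
     vzero G \<in> vals G - {vinf G} \<and>
     (\<forall>a\<in>vals G - {vinf G}. \<forall>b\<in>vals G - {vinf G}. vplus G a b \<in> vals G - {vinf G}) \<and>
     (\<forall>a\<in>vals G - {vinf G}. \<forall>b\<in>vals G - {vinf G}. \<forall>c\<in>vals G - {vinf G}.
        vplus G (vplus G a b) c = vplus G a (vplus G b c)) \<and>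
     (\<forall>a\<in>vals G - {vinf G}. \<forall>b\<in>vals G - {vinf G}. vplus G a b = vplus G b a) \<and>
     (\<forall>a\<in>vals G - {vinf G}. vplus G (vzero G) a = a) \<and>
     (\<forall>a\<in>vals G - {vinf G}. \<exists>b\<in>vals G - {vinf G}. vplus G a b = vzero G) \<and>
     (\<forall>a\<in>vals G - {vinf G}. \<forall>b\<in>vals G - {vinf G}. \<forall>c\<in>vals G - {vinf G}.
        vless G a b \<longrightarrow> vless G (vplus G a c) (vplus G b c))"

definition model_T_kv_plus ::
  "'k::field place \<Rightarrow> ('k fsym, 'k rsym, 'u) struct \<Rightarrow> ('u, 'g, 'z) pstruct_scheme \<Rightarrow> bool" where
  "model_T_kv_plus p M G \<longleftrightarrow> model_T_kv p M G \<and> ordered_value_group G \<and>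
     vone G \<in> vals G \<and> vmap G (mone M) = vzero G \<and> vsucc G (vzero G) = vone G \<and>
     (\<forall>a\<in>vals G. vplus G a (vinf G) = vinf G \<and> vplus G (vinf G) a = vinf G) \<and>
     (\<forall>n\<ge>1. \<forall>a\<in>vals G. \<exists>b\<in>vals G. \<exists>i\<in>{1..n}. a = vplus G (vmult G n b) (vmult G i (vone G))) \<and>
     (\<forall>n\<ge>1. \<forall>a\<in>vals G. vP G n a \<longleftrightarrow> (\<exists>b\<in>vals G. a = vmult G n b))"

definition induces_MQ :: "'k place \<Rightarrow> ('f, 'k rsym, 'u) struct \<Rightarrow> ('u, 'g, 'z) pstruct_scheme \<Rightarrow> bool" where
  "induces_MQ p M G \<longleftrightarrow>
     (\<forall>x\<in>univ M. \<forall>y\<in>univ M. \<forall>z\<in>univ M. mM p M x y z \<longleftrightarrow> vplus G (vmap G x) (vmap G y) = vmap G z) \<and>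
     (\<forall>n\<ge>1. \<forall>x\<in>univ M. mQ p n M x \<longleftrightarrow> vP G n (vmap G x))"

definition mchain :: "'k place \<Rightarrow> ('f, 'k rsym, 'u) struct \<Rightarrow> nat \<Rightarrow> (nat \<Rightarrow> 'u) \<Rightarrow> bool" where
  "mchain p M n f \<longleftrightarrow> (\<forall>i\<in>{1..n}. f i \<in> univ M) \<and> (\<forall>i\<in>{1..<n}. mM p M (f i) (f 1) (f (Suc i)))"

text \<open>The same for the axioms that \<open>T_fin_plus p\<close> adds; only used in proofs.\<close>

definition plus_ax :: "'k::field place \<Rightarrow> ('k fsym, 'k rsym, 'u) struct \<Rightarrow> bool" where
  "plus_ax p M \<longleftrightarrow>
     (\<forall>x\<in>univ M. \<forall>y\<in>univ M. \<exists>z\<in>univ M. mM p M x y z) \<and>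
     (\<forall>x\<in>univ M. \<forall>y\<in>univ M. \<forall>z\<in>univ M. \<forall>x'\<in>univ M. \<forall>y'\<in>univ M. \<forall>z'\<in>univ M.
        (mL p M x x' \<and> mL p M x' x) \<and> (mL p M y y' \<and> mL p M y' y) \<and> mM p M x y z \<longrightarrow>
        (mL p M z z' \<and> mL p M z' z \<longleftrightarrow> mM p M x' y' z')) \<and>
     (\<forall>x\<in>univ M. \<forall>y\<in>univ M. \<forall>z\<in>univ M. mM p M x y z \<longrightarrow> mM p M y x z) \<and>
     (\<forall>x\<in>univ M. \<forall>y\<in>univ M. \<forall>z\<in>univ M. \<forall>x'\<in>univ M. \<forall>y'\<in>univ M. \<forall>z'\<in>univ M.
        mM p M x y x' \<and> mM p M x' z z' \<and> mM p M y z y' \<longrightarrow> mM p M x y' z') \<and>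
     (\<forall>x\<in>univ M. mM p M (mone M) x x) \<and>
     (\<forall>x\<in>univ M. mM p M x (mzero M) (mzero M)) \<and>
     (\<forall>x\<in>univ M. x \<noteq> mzero M \<longrightarrow> (\<exists>y\<in>univ M. mM p M x y (mone M))) \<and>
     (\<forall>x\<in>univ M. \<forall>y\<in>univ M. x \<noteq> mzero M \<longrightarrow> y \<noteq> mzero M \<longrightarrow> \<not> mM p M x y (mzero M)) \<and>
     (\<forall>x\<in>univ M. \<forall>y\<in>univ M. \<forall>z\<in>univ M. \<forall>x'\<in>univ M. \<forall>y'\<in>univ M.
        mL p M x y \<and> mM p M x z x' \<and> mM p M y z y' \<longrightarrow> mL p M x' y') \<and>
     (\<forall>n \<pi>. n \<ge> 1 \<and> \<pi> \<noteq> 0 \<and> pval p \<pi> = 1 \<longrightarrow> (\<forall>x\<in>univ M. \<exists>f. mchain p M n f \<and>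
        (\<exists>i\<in>{1..n}. mM p M (f n) (mscale M (\<pi> ^ i) (mone M)) x))) \<and>
     (\<forall>n. n \<ge> 1 \<longrightarrow> (\<forall>x\<in>univ M. mQ p n M x \<longleftrightarrow> (\<exists>f. mchain p M n f \<and> mL p M (f n) x \<and> mL p M x (f n))))"

lemma sat_multiple_chain:
  "sat M e (multiple_chain p n) \<longleftrightarrow> (\<forall>i\<in>{1..<n}. mM p M (e i) (e 1) (e (Suc i)))"
  by (auto simp: multiple_chain_def)

lemma sat_chain:
  assumes "n \<ge> 1"
  shows "sat M e (Exs [1..<Suc n] (And (multiple_chain p n) A)) \<longleftrightarrow>
    (\<exists>f. mchain p M n f \<and> sat M (\<lambda>i. if i \<in> {1..n} then f i else e i) A)"
proof -
  have "sat M (\<lambda>i. if i \<in> {1..n} then f i else e i) (multiple_chain p n) \<longleftrightarrow>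
        (\<forall>i\<in>{1..<n}. mM p M (f i) (f 1) (f (Suc i)))" for f
    unfolding sat_multiple_chain using assms by (intro ball_cong) auto
  then show ?thesis
    unfolding sat_Exs mchain_def set_upt atLeastLessThanSuc_atLeastAtMost by auto
qed

lemma models_plus_ax:
  assumes "struct_in lang_k M"
  shows "models M (T_fin_plus p) \<longleftrightarrow> models M (T_fin p) \<and> plus_ax p M"
proof -
  note cl = struct_in_closed[OF assms]
  have u: "[0..<6] = [0, 1, 2, 3, 4, Suc 4]" "[0..<5] = [0, 1, 2, 3, 4]"
    by (simp_all add: upt_rec)
  have dv: "(\<forall>e. range e \<subseteq> univ M \<longrightarrow> sat M e (All 0 (Exs [1..<Suc n] (And (multiple_chain p n)
          (Disj (map (\<lambda>i. fM p (V n) (tscale (\<pi> ^ i) tone) (V 0)) [1..<Suc n])))))) \<longleftrightarrow>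
       (\<forall>x\<in>univ M. \<exists>f. mchain p M n f \<and> (\<exists>i\<in>{1..n}. mM p M (f n) (mscale M (\<pi> ^ i) (mone M)) x))"
    if "n \<ge> 1" for n \<pi>
    using that ex_assignment[OF cl(1)]
    unfolding sat.simps sat_chain[OF that] sat_Disj set_map set_upt atLeastLessThanSuc_atLeastAtMost bex_simps
    by simp
  have Qx: "(\<forall>e. range e \<subseteq> univ M \<longrightarrow> sat M e (All 0 (Iff (fQ p n (V 0))
          (Exs [1..<Suc n] (And (multiple_chain p n) (feqv p (V n) (V 0))))))) \<longleftrightarrow>
       (\<forall>x\<in>univ M. mQ p n M x \<longleftrightarrow> (\<exists>f. mchain p M n f \<and> mL p M (f n) x \<and> mL p M x (f n)))"
    if "n \<ge> 1" for n
    using that ex_assignment[OF cl(1)]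
    unfolding sat.simps sat_chain[OF that] sat_Disj set_map set_upt atLeastLessThanSuc_atLeastAtMost bex_simps
    by simp blast
  have C1: "models M {All 0 (Exs [1..<Suc n] (And (multiple_chain p n)
          (Disj (map (\<lambda>i. fM p (V n) (tscale (\<pi> ^ i) tone) (V 0)) [1..<Suc n])))) | n \<pi>.
        n \<ge> 1 \<and> \<pi> \<noteq> 0 \<and> pval p \<pi> = 1} \<longleftrightarrow>
     (\<forall>n \<pi>. n \<ge> 1 \<and> \<pi> \<noteq> 0 \<and> pval p \<pi> = 1 \<longrightarrow> (\<forall>x\<in>univ M. \<exists>f. mchain p M n f \<and>
        (\<exists>i\<in>{1..n}. mM p M (f n) (mscale M (\<pi> ^ i) (mone M)) x)))"
    unfolding models_Collect using dv by meson
  have C2: "models M {All 0 (Iff (fQ p n (V 0)) (Exs [1..<Suc n] (And (multiple_chain p n) (feqv p (V n) (V 0))))) | n. n \<ge> 1}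
     \<longleftrightarrow> (\<forall>n. n \<ge> 1 \<longrightarrow> (\<forall>x\<in>univ M. mQ p n M x \<longleftrightarrow> (\<exists>f. mchain p M n f \<and> mL p M (f n) x \<and> mL p M x (f n))))"
    unfolding models_Collect using Qx by meson
  show ?thesis
    unfolding T_fin_plus_def plus_ax_def models_simps C1 C2 u Alls_def
    apply (simp add: ex_assignment[OF cl(1)] models_simps(1))
    apply (intro conj_cong refl)
    subgoal by blast
    done
qed

lemma vle_antisym_kv:
  assumes "model_T_kv p M G" "a \<in> vals G" "b \<in> vals G" "vle G a b" "vle G b a"
  shows "a = b"
proof -
  note D = assms(1)[unfolded model_T_kv_def]
  note irr = D[THEN conjunct2, THEN conjunct2, THEN conjunct1]
  note tr = D[THEN conjunct2, THEN conjunct2, THEN conjunct2, THEN conjunct1]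
  have "vless G a b \<Longrightarrow> vless G b a \<Longrightarrow> vless G a a" using tr assms(2,3) by blast
  then show ?thesis using assms(2,4,5) irr unfolding vle_def by blast
qed

lemma kv_basic:
  assumes m: "model_T_kv p M G"
  shows "vector_space_struct M" "mzero M \<noteq> mone M"
    "\<And>a. a \<in> vals G \<Longrightarrow> \<not> vless G a a"
    "\<And>a b d. a \<in> vals G \<Longrightarrow> b \<in> vals G \<Longrightarrow> d \<in> vals G \<Longrightarrow> vless G a b \<Longrightarrow> vless G b d \<Longrightarrow> vless G a d"
    "\<And>a b. a \<in> vals G \<Longrightarrow> b \<in> vals G \<Longrightarrow> vless G a b \<or> a = b \<or> vless G b a"
    "vinf G \<in> vals G" "vmap G ` univ M = vals G"
    "\<And>x. x \<in> univ M \<Longrightarrow> vmap G x = vinf G \<longleftrightarrow> x = mzero M"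
    "\<And>a. a \<in> vals G - {vinf G} \<Longrightarrow> imm_succ G a (vsucc G a)"
    "vsucc G (vinf G) = vinf G"
    "\<And>c x. c \<noteq> 0 \<Longrightarrow> x \<in> univ M \<Longrightarrow> shifted G (pval p c) (vmap G (mscale M c x)) (vmap G x)"
    "\<And>a. a \<in> vals G \<Longrightarrow> vle G a (vinf G)"
proof -
  note D = m[unfolded model_T_kv_def]
  note d1 = D[THEN conjunct1]
  note d2 = D[THEN conjunct2, THEN conjunct1]
  note d3 = D[THEN conjunct2, THEN conjunct2, THEN conjunct1]
  note d4 = D[THEN conjunct2, THEN conjunct2, THEN conjunct2, THEN conjunct1]
  note d5 = D[THEN conjunct2, THEN conjunct2, THEN conjunct2, THEN conjunct2, THEN conjunct1]
  note d6 = D[THEN conjunct2, THEN conjunct2, THEN conjunct2, THEN conjunct2, THEN conjunct2, THEN conjunct1]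
  note d7 = D[THEN conjunct2, THEN conjunct2, THEN conjunct2, THEN conjunct2, THEN conjunct2, THEN conjunct2, THEN conjunct1]
  note d8 = D[THEN conjunct2, THEN conjunct2, THEN conjunct2, THEN conjunct2, THEN conjunct2, THEN conjunct2, THEN conjunct2, THEN conjunct1]
  note d9 = D[THEN conjunct2, THEN conjunct2, THEN conjunct2, THEN conjunct2, THEN conjunct2, THEN conjunct2, THEN conjunct2, THEN conjunct2, THEN conjunct1]
  note d10 = D[THEN conjunct2, THEN conjunct2, THEN conjunct2, THEN conjunct2, THEN conjunct2, THEN conjunct2, THEN conjunct2, THEN conjunct2, THEN conjunct2, THEN conjunct1]
  note d11 = D[THEN conjunct2, THEN conjunct2, THEN conjunct2, THEN conjunct2, THEN conjunct2, THEN conjunct2, THEN conjunct2, THEN conjunct2, THEN conjunct2, THEN conjunct2, THEN conjunct1]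
  note d12 = D[THEN conjunct2, THEN conjunct2, THEN conjunct2, THEN conjunct2, THEN conjunct2, THEN conjunct2, THEN conjunct2, THEN conjunct2, THEN conjunct2, THEN conjunct2, THEN conjunct2, THEN conjunct1]
  note d13 = D[THEN conjunct2, THEN conjunct2, THEN conjunct2, THEN conjunct2, THEN conjunct2, THEN conjunct2, THEN conjunct2, THEN conjunct2, THEN conjunct2, THEN conjunct2, THEN conjunct2, THEN conjunct2, THEN conjunct1]
  note d14 = D[THEN conjunct2, THEN conjunct2, THEN conjunct2, THEN conjunct2, THEN conjunct2, THEN conjunct2, THEN conjunct2, THEN conjunct2, THEN conjunct2, THEN conjunct2, THEN conjunct2, THEN conjunct2, THEN conjunct2, THEN conjunct1]
  note d15 = D[THEN conjunct2, THEN conjunct2, THEN conjunct2, THEN conjunct2, THEN conjunct2, THEN conjunct2, THEN conjunct2, THEN conjunct2, THEN conjunct2, THEN conjunct2, THEN conjunct2, THEN conjunct2, THEN conjunct2, THEN conjunct2, THEN conjunct1]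
  note d16 = D[THEN conjunct2, THEN conjunct2, THEN conjunct2, THEN conjunct2, THEN conjunct2, THEN conjunct2, THEN conjunct2, THEN conjunct2, THEN conjunct2, THEN conjunct2, THEN conjunct2, THEN conjunct2, THEN conjunct2, THEN conjunct2, THEN conjunct2, THEN conjunct1]
  note d17 = D[THEN conjunct2, THEN conjunct2, THEN conjunct2, THEN conjunct2, THEN conjunct2, THEN conjunct2, THEN conjunct2, THEN conjunct2, THEN conjunct2, THEN conjunct2, THEN conjunct2, THEN conjunct2, THEN conjunct2, THEN conjunct2, THEN conjunct2, THEN conjunct2, THEN conjunct1]
  note d18 = D[THEN conjunct2, THEN conjunct2, THEN conjunct2, THEN conjunct2, THEN conjunct2, THEN conjunct2, THEN conjunct2, THEN conjunct2, THEN conjunct2, THEN conjunct2, THEN conjunct2, THEN conjunct2, THEN conjunct2, THEN conjunct2, THEN conjunct2, THEN conjunct2, THEN conjunct2]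
  show "vector_space_struct M" "mzero M \<noteq> mone M" using d1 d2 .
  show "\<And>a. a \<in> vals G \<Longrightarrow> \<not> vless G a a" using d3 by simp
  show "\<And>a b d. a \<in> vals G \<Longrightarrow> b \<in> vals G \<Longrightarrow> d \<in> vals G \<Longrightarrow> vless G a b \<Longrightarrow> vless G b d \<Longrightarrow> vless G a d"
    using d4 by blast
  show "\<And>a b. a \<in> vals G \<Longrightarrow> b \<in> vals G \<Longrightarrow> vless G a b \<or> a = b \<or> vless G b a" using d5 by blast
  show "vinf G \<in> vals G" "vmap G ` univ M = vals G" using d8 d10 .
  show "\<And>x. x \<in> univ M \<Longrightarrow> vmap G x = vinf G \<longleftrightarrow> x = mzero M" using d12 by blast
  show "\<And>a. a \<in> vals G - {vinf G} \<Longrightarrow> imm_succ G a (vsucc G a)" using d14 by blast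
  show "vsucc G (vinf G) = vinf G" using d13 .
  show "\<And>c x. c \<noteq> 0 \<Longrightarrow> x \<in> univ M \<Longrightarrow> shifted G (pval p c) (vmap G (mscale M c x)) (vmap G x)" using d16 by blast
  show "\<And>a. a \<in> vals G \<Longrightarrow> vle G a (vinf G)" using d9 by blast
qed

lemma induces_L_eqv:
  assumes m: "model_T_kv p M G" and L: "induces_L p M G" and x: "x \<in> univ M" "y \<in> univ M"
  shows "mL p M x y \<and> mL p M y x \<longleftrightarrow> vmap G x = vmap G y"
proof -
  have U: "vmap G x \<in> vals G" "vmap G y \<in> vals G" using kv_basic(7)[OF m] x by blast+
  have "mL p M x y \<longleftrightarrow> vle G (vmap G y) (vmap G x)" "mL p M y x \<longleftrightarrow> vle G (vmap G x) (vmap G y)"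
    using L x unfolding induces_L_def by blast+
  then show ?thesis using vle_antisym_kv[OF m U] unfolding vle_def by metis
qed

lemma imm_succ_unique:
  assumes m: "model_T_kv p M G" and "imm_succ G a b" "imm_succ G a c"
  shows "b = c"
  using assms(2,3) kv_basic(5)[OF m, of b c] unfolding imm_succ_def by blast

lemma pi_power_value:
  assumes m: "model_T_kv p M G" and pi: "\<pi> \<noteq> 0" "pval p \<pi> = 1" and x: "x \<in> univ M"
  shows "vmap G (mscale M (\<pi> ^ n) x) = (vsucc G ^^ n) (vmap G x)"
proof (induction n)
  case 0
  then show ?case using vector_space_structD(4)[OF kv_basic(1)[OF m] x] by simp
next
  case (Suc n)
  note vs = kv_basic(1)[OF m]
  have U: "mscale M (\<pi> ^ n) x \<in> univ M" using vector_space_structD(3)[OF vs x] .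
  show ?case
    using vector_space_structD(5)[OF vs x, of \<pi> "\<pi> ^ n"] kv_basic(11)[OF m pi(1) U] pi(2) Suc
    unfolding shifted_def by simp
qed

lemma chain_vmult:
  assumes v0': "\<forall>b\<in>vals G. vplus G (vzero G) b = b"
    and MM': "\<forall>x\<in>univ M. \<forall>y\<in>univ M. \<forall>z\<in>univ M. mM p M x y z \<longleftrightarrow> vplus G (vmap G x) (vmap G y) = vmap G z"
    and surj: "vmap G ` univ M = vals G"
    and cl': "\<forall>a\<in>vals G. \<forall>b\<in>vals G. vplus G a b \<in> vals G"
    and z: "vzero G \<in> vals G" and n: "n \<ge> 1"
  shows "(\<exists>f. mchain p M n f \<and> Q (f n)) \<longleftrightarrow> (\<exists>b\<in>vals G. \<exists>y\<in>univ M. vmap G y = vmult G n b \<and> Q y)"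
proof -
  have v0: "\<And>b. b \<in> vals G \<Longrightarrow> vplus G (vzero G) b = b"
    and MM: "\<And>x y z. x \<in> univ M \<Longrightarrow> y \<in> univ M \<Longrightarrow> z \<in> univ M \<Longrightarrow>
       mM p M x y z \<longleftrightarrow> vplus G (vmap G x) (vmap G y) = vmap G z"
    and cl: "\<And>a b. a \<in> vals G \<Longrightarrow> b \<in> vals G \<Longrightarrow> vplus G a b \<in> vals G"
    using v0' MM' cl' by blast+
  show ?thesis
proof
  assume "\<exists>f. mchain p M n f \<and> Q (f n)"
  then obtain f where f: "\<And>i. i \<in> {1..n} \<Longrightarrow> f i \<in> univ M" "\<And>i. i \<in> {1..<n} \<Longrightarrow> mM p M (f i) (f 1) (f (Suc i))" "Q (f n)"
    unfolding mchain_def by blast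
  let ?b = "vmap G (f 1)"
  have b: "?b \<in> vals G" using f(1)[of 1] n surj by auto
  have "1 \<le> i \<Longrightarrow> i \<le> n \<Longrightarrow> vmap G (f i) = vmult G i ?b" for i
  proof (induction i rule: nat_induct_at_least)
    case base
    then show ?case using v0[OF b] by simp
  next
    case (Suc i)
    then show ?case using f(2)[of i] MM[OF f(1)[of i] f(1)[of 1] f(1)[of "Suc i"]] by simp
  qed
  then have e: "vmap G (f n) = vmult G n ?b" using n by blast
  have "f n \<in> univ M" using f(1)[of n] n by simp
  with e b f(3) show "\<exists>b\<in>vals G. \<exists>y\<in>univ M. vmap G y = vmult G n b \<and> Q y" by blast
next
  assume "\<exists>b\<in>vals G. \<exists>y\<in>univ M. vmap G y = vmult G n b \<and> Q y"
  then obtain b y where b: "b \<in> vals G" "y \<in> univ M" "vmap G y = vmult G n b" "Q y" by blast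
  have mv: "vmult G i b \<in> vals G" for i by (induction i) (auto simp: z cl b)
  define f where "f i = (if i = n then y else SOME x. x \<in> univ M \<and> vmap G x = vmult G i b)" for i
  have f: "f i \<in> univ M \<and> vmap G (f i) = vmult G i b" for i
  proof (cases "i = n")
    case True
    then show ?thesis using b unfolding f_def by simp
  next
    case False
    have "\<exists>x. x \<in> univ M \<and> vmap G x = vmult G i b" using mv[of i] surj by (metis imageE)
    from someI_ex[OF this] show ?thesis using False unfolding f_def by simp
  qed
  have f1: "vmap G (f 1) = b" using f[of 1] v0[OF b(1)] by simp
  have "mM p M (f i) (f 1) (f (Suc i))" for i
    using MM[of "f i" "f 1" "f (Suc i)"] f[of i] f[of 1] f[of "Suc i"] f1 by simp
  then have "mchain p M n f" unfolding mchain_def using f by blast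
  moreover have "Q (f n)" using b unfolding f_def by simp
  ultimately show "\<exists>f. mchain p M n f \<and> Q (f n)" by blast
qed
qed

lemma ovgD:
  assumes "ordered_value_group G"
  shows "vzero G \<in> vals G" "vzero G \<noteq> vinf G"
    and "\<And>a b. a \<in> vals G - {vinf G} \<Longrightarrow> b \<in> vals G - {vinf G} \<Longrightarrow> vplus G a b \<in> vals G - {vinf G}"
    and "\<And>a b c. a \<in> vals G - {vinf G} \<Longrightarrow> b \<in> vals G - {vinf G} \<Longrightarrow> c \<in> vals G - {vinf G} \<Longrightarrow>
        vplus G (vplus G a b) c = vplus G a (vplus G b c)"
    and "\<And>a b. a \<in> vals G - {vinf G} \<Longrightarrow> b \<in> vals G - {vinf G} \<Longrightarrow> vplus G a b = vplus G b a"
    and "\<And>a. a \<in> vals G - {vinf G} \<Longrightarrow> vplus G (vzero G) a = a"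
    and "\<And>a. a \<in> vals G - {vinf G} \<Longrightarrow> \<exists>b\<in>vals G - {vinf G}. vplus G a b = vzero G"
    and "\<And>a b c. a \<in> vals G - {vinf G} \<Longrightarrow> b \<in> vals G - {vinf G} \<Longrightarrow> c \<in> vals G - {vinf G} \<Longrightarrow>
        vless G a b \<Longrightarrow> vless G (vplus G a c) (vplus G b c)"
proof -
  note D = assms[unfolded ordered_value_group_def]
  note d1 = D[THEN conjunct1]
  note d2 = D[THEN conjunct2, THEN conjunct1]
  note d3 = D[THEN conjunct2, THEN conjunct2, THEN conjunct1]
  note d4 = D[THEN conjunct2, THEN conjunct2, THEN conjunct2, THEN conjunct1]
  note d5 = D[THEN conjunct2, THEN conjunct2, THEN conjunct2, THEN conjunct2, THEN conjunct1]
  note d6 = D[THEN conjunct2, THEN conjunct2, THEN conjunct2, THEN conjunct2, THEN conjunct2, THEN conjunct1]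
  note d7 = D[THEN conjunct2, THEN conjunct2, THEN conjunct2, THEN conjunct2, THEN conjunct2, THEN conjunct2]
  show "vzero G \<in> vals G" "vzero G \<noteq> vinf G" using d1 by auto
  show "\<And>a b. a \<in> vals G - {vinf G} \<Longrightarrow> b \<in> vals G - {vinf G} \<Longrightarrow> vplus G a b \<in> vals G - {vinf G}"
    using d2 by blast
  show "\<And>a b c. a \<in> vals G - {vinf G} \<Longrightarrow> b \<in> vals G - {vinf G} \<Longrightarrow> c \<in> vals G - {vinf G} \<Longrightarrow>
        vplus G (vplus G a b) c = vplus G a (vplus G b c)" using d3 by blast
  show "\<And>a b. a \<in> vals G - {vinf G} \<Longrightarrow> b \<in> vals G - {vinf G} \<Longrightarrow> vplus G a b = vplus G b a"
    using d4 by blast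
  show "\<And>a. a \<in> vals G - {vinf G} \<Longrightarrow> vplus G (vzero G) a = a" using d5 by blast
  show "\<And>a. a \<in> vals G - {vinf G} \<Longrightarrow> \<exists>b\<in>vals G - {vinf G}. vplus G a b = vzero G" using d6 by blast
  show "\<And>a b c. a \<in> vals G - {vinf G} \<Longrightarrow> b \<in> vals G - {vinf G} \<Longrightarrow> c \<in> vals G - {vinf G} \<Longrightarrow>
        vless G a b \<Longrightarrow> vless G (vplus G a c) (vplus G b c)" using d7 by blast
qed

lemma succ_plus_one:
  assumes m: "model_T_kv p M G" and g: "ordered_value_group G" and one: "vsucc G (vzero G) = vone G"
    and a: "a \<in> vals G - {vinf G}"
  shows "vsucc G a = vplus G a (vone G)" "vone G \<in> vals G - {vinf G}"
proof -
  have z: "vzero G \<in> vals G - {vinf G}" using ovgD(1,2)[OF g] by simp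
  have s01: "imm_succ G (vzero G) (vone G)" using kv_basic(9)[OF m z] one by simp
  have ninf: "\<not> vless G (vinf G) b" if b: "b \<in> vals G" for b
    using kv_basic(12)[OF m b] kv_basic(3)[OF m kv_basic(6)[OF m]] kv_basic(4)[OF m kv_basic(6)[OF m] b kv_basic(6)[OF m]]
    unfolding vle_def by blast
  show o: "vone G \<in> vals G - {vinf G}"
  proof -
    note D = m[unfolded model_T_kv_def]
    have "\<exists>b\<in>vals G - {vinf G}. imm_succ G (vzero G) b"
      using D[THEN conjunct2, THEN conjunct2, THEN conjunct2, THEN conjunct2, THEN conjunct2, THEN conjunct1] z by blast
    then show ?thesis using imm_succ_unique[OF m s01] by blast
  qed
  have lt: "vless G (vzero G) (vone G)" using s01 unfolding imm_succ_def by blast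
  have a1: "vplus G a (vone G) \<in> vals G - {vinf G}" using ovgD(3)[OF g a o] .
  have "vless G a (vplus G a (vone G))"
    using ovgD(8)[OF g z o a lt] ovgD(6)[OF g a] ovgD(5)[OF g o a] by simp
  moreover have "\<not> (\<exists>d\<in>vals G. vless G a d \<and> vless G d (vplus G a (vone G)))"
  proof
    assume "\<exists>d\<in>vals G. vless G a d \<and> vless G d (vplus G a (vone G))"
    then obtain d where d: "d \<in> vals G" "vless G a d" "vless G d (vplus G a (vone G))" by blast
    have di: "d \<in> vals G - {vinf G}" using ninf[of "vplus G a (vone G)"] a1 d by blast
    obtain b where b: "b \<in> vals G - {vinf G}" "vplus G a b = vzero G" using ovgD(7)[OF g a] by blast
    have 1: "vless G (vzero G) (vplus G d b)" using ovgD(8)[OF g a di b(1) d(2)] b(2) by simp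
    have "vplus G (vplus G a (vone G)) b = vplus G (vone G) (vplus G a b)"
      using ovgD(5)[OF g a o] ovgD(4)[OF g o a b(1)] by simp
    also have "\<dots> = vone G" using ovgD(5)[OF g z o] ovgD(6)[OF g o] b(2) by simp
    finally have 2: "vless G (vplus G d b) (vone G)" using ovgD(8)[OF g di a1 b(1) d(3)] by simp
    have "vplus G d b \<in> vals G" using ovgD(3)[OF g di b(1)] by blast
    then show False using 1 2 s01 unfolding imm_succ_def by blast
  qed
  ultimately have "imm_succ G a (vplus G a (vone G))" using a a1 unfolding imm_succ_def by blast
  then show "vsucc G a = vplus G a (vone G)" using imm_succ_unique[OF m kv_basic(9)[OF m a]] by blast
qed

lemma succ_pow_vmult:
  assumes m: "model_T_kv p M G" and g: "ordered_value_group G" and one: "vsucc G (vzero G) = vone G"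
  shows "(vsucc G ^^ i) (vzero G) = vmult G i (vone G) \<and> vmult G i (vone G) \<in> vals G - {vinf G}"
proof (induction i)
  case 0
  then show ?case using ovgD(1,2)[OF g] by simp
next
  case (Suc i)
  note o = succ_plus_one(2)[OF m g one]
  have v: "vmult G i (vone G) \<in> vals G - {vinf G}" using Suc by blast
  show ?case using Suc succ_plus_one(1)[OF m g one v] ovgD(3)[OF g v o[OF v]] by simp
qed

lemma total_group:
  assumes m: "model_T_kv p M G" and g: "ordered_value_group G"
    and inf0: "\<forall>a\<in>vals G. vplus G a (vinf G) = vinf G \<and> vplus G (vinf G) a = vinf G"
  shows "\<And>a b. a \<in> vals G \<Longrightarrow> b \<in> vals G \<Longrightarrow> vplus G a b \<in> vals G"
    and "\<And>a b c. a \<in> vals G \<Longrightarrow> b \<in> vals G \<Longrightarrow> c \<in> vals G \<Longrightarrow> vplus G (vplus G a b) c = vplus G a (vplus G b c)"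
    and "\<And>a b. a \<in> vals G \<Longrightarrow> b \<in> vals G \<Longrightarrow> vplus G a b = vplus G b a"
    and "\<And>a. a \<in> vals G \<Longrightarrow> vplus G (vzero G) a = a"
    and "\<And>a b c. a \<in> vals G \<Longrightarrow> b \<in> vals G \<Longrightarrow> c \<in> vals G \<Longrightarrow> vle G a b \<Longrightarrow> vle G (vplus G a c) (vplus G b c)"
proof -
  note i = kv_basic(6)[OF m]
  note inf = bspec[OF inf0]
  show cl: "vplus G a b \<in> vals G" if "a \<in> vals G" "b \<in> vals G" for a b
    using ovgD(3)[OF g, of a b] inf[of a] inf[of b] that i by (cases "a = vinf G \<or> b = vinf G") auto
  show "vplus G (vplus G a b) c = vplus G a (vplus G b c)" if "a \<in> vals G" "b \<in> vals G" "c \<in> vals G" for a b c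
  proof (cases "a = vinf G \<or> b = vinf G \<or> c = vinf G")
    case True
    then show ?thesis using inf[OF that(1)] inf[OF that(2)] inf[OF that(3)] inf[OF cl[OF that(1,2)]] inf[OF cl[OF that(2,3)]] by metis
  next
    case False
    then show ?thesis using ovgD(4)[OF g, of a b c] that by simp
  qed
  show "vplus G a b = vplus G b a" if "a \<in> vals G" "b \<in> vals G" for a b
  proof (cases "a = vinf G \<or> b = vinf G")
    case True
    then show ?thesis using inf[OF that(1)] inf[OF that(2)] by metis
  next
    case False
    then show ?thesis using ovgD(5)[OF g, of a b] that by simp
  qed
  show "vplus G (vzero G) a = a" if "a \<in> vals G" for a
  proof (cases "a = vinf G")
    case True
    then show ?thesis using inf[OF ovgD(1)[OF g]] by simp
  next
    case False
    then show ?thesis using ovgD(6)[OF g, of a] that by simp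
  qed
  show "vle G (vplus G a c) (vplus G b c)" if "a \<in> vals G" "b \<in> vals G" "c \<in> vals G" "vle G a b" for a b c
  proof -
    consider "b = vinf G" | "c = vinf G" | "b \<noteq> vinf G" "a = vinf G" | "a \<noteq> vinf G" "b \<noteq> vinf G" "c \<noteq> vinf G" by blast
    then show ?thesis
    proof cases
      case 1
      then show ?thesis using inf[OF that(3)] kv_basic(12)[OF m cl[OF that(1,3)]] by simp
    next
      case 2
      then show ?thesis using inf[OF that(1)] inf[OF that(2)] unfolding vle_def by simp
    next
      case 3
      then have "vle G b a" using kv_basic(12)[OF m that(2)] by simp
      then have "a = b" using vle_antisym_kv[OF m that(1,2,4)] by simp
      then show ?thesis unfolding vle_def by simp
    next
      case 4
      then show ?thesis using ovgD(8)[OF g, of a b c] that unfolding vle_def by auto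
    qed
  qed
qed

lemma model_plus_ax:
  fixes p :: "'k::field place" and M :: "('k fsym, 'k rsym, 'u) struct"
  assumes mp: "model_T_kv_plus p M G" and L: "induces_L p M G" and MQ: "induces_MQ p M G"
  shows "plus_ax p M"
proof -
  let ?U = "univ M" and ?v = "vmap G"
  note D = mp[unfolded model_T_kv_plus_def]
  note d1 = D[THEN conjunct1]
  note d2 = D[THEN conjunct2, THEN conjunct1]
  note d3 = D[THEN conjunct2, THEN conjunct2, THEN conjunct1]
  note d4 = D[THEN conjunct2, THEN conjunct2, THEN conjunct2, THEN conjunct1]
  note d5 = D[THEN conjunct2, THEN conjunct2, THEN conjunct2, THEN conjunct2, THEN conjunct1]
  note d6 = D[THEN conjunct2, THEN conjunct2, THEN conjunct2, THEN conjunct2, THEN conjunct2, THEN conjunct1]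
  note d7 = D[THEN conjunct2, THEN conjunct2, THEN conjunct2, THEN conjunct2, THEN conjunct2, THEN conjunct2, THEN conjunct1]
  note d8 = D[THEN conjunct2, THEN conjunct2, THEN conjunct2, THEN conjunct2, THEN conjunct2, THEN conjunct2, THEN conjunct2]
  note m = d1 and g = d2
  note vs = kv_basic(1)[OF m]
  note surj = kv_basic(7)[OF m]
  have vG: "?v x \<in> vals G" if "x \<in> ?U" for x using surj that by blast
  have inf: "\<And>a. a \<in> vals G \<Longrightarrow> vplus G a (vinf G) = vinf G \<and> vplus G (vinf G) a = vinf G"
    using d6 by blast
  note T = total_group[OF m g d6]
  have MM: "\<And>x y z. x \<in> ?U \<Longrightarrow> y \<in> ?U \<Longrightarrow> z \<in> ?U \<Longrightarrow> mM p M x y z \<longleftrightarrow> vplus G (?v x) (?v y) = ?v z"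
    and QQ: "\<And>n x. n \<ge> 1 \<Longrightarrow> x \<in> ?U \<Longrightarrow> mQ p n M x \<longleftrightarrow> vP G n (?v x)"
    using MQ unfolding induces_MQ_def by blast+
  note eqv = induces_L_eqv[OF m L]
  note z = vector_space_structD(1)[OF vs] and o = vector_space_structD(12)[OF vs]
  have vz: "?v (mzero M) = vinf G" using kv_basic(8)[OF m z] by simp
  have ch: "(\<exists>f. mchain p M n f \<and> Q (f n)) \<longleftrightarrow> (\<exists>b\<in>vals G. \<exists>y\<in>?U. ?v y = vmult G n b \<and> Q y)" if "n \<ge> 1" for n Q
    by (rule chain_vmult[OF _ _ surj _ ovgD(1)[OF g] that]) (use T(1,4) MM in auto)
  have vm: "vmult G n b \<in> vals G" if "b \<in> vals G" for n b
    by (induction n) (auto simp: ovgD(1)[OF g] T(1) that)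
  have ex: "\<exists>x\<in>?U. ?v x = a" if "a \<in> vals G" for a using surj that by (metis imageE)
  show ?thesis
    unfolding plus_ax_def
  proof (intro conjI)
    show "\<forall>x\<in>?U. \<forall>y\<in>?U. \<exists>z\<in>?U. mM p M x y z"
    proof (intro ballI)
      fix x y assume h: "x \<in> ?U" "y \<in> ?U"
      then obtain z where "z \<in> ?U" "?v z = vplus G (?v x) (?v y)" using ex[OF T(1)[OF vG vG]] by blast
      then show "\<exists>z\<in>?U. mM p M x y z" using MM[OF h] by metis
    qed
    show "\<forall>x\<in>?U. \<forall>y\<in>?U. \<forall>z\<in>?U. \<forall>x'\<in>?U. \<forall>y'\<in>?U. \<forall>z'\<in>?U.
        (mL p M x x' \<and> mL p M x' x) \<and> (mL p M y y' \<and> mL p M y' y) \<and> mM p M x y z \<longrightarrow>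
        (mL p M z z' \<and> mL p M z' z \<longleftrightarrow> mM p M x' y' z')"
      by (intro ballI impI) (simp add: eqv MM, metis)
    show "\<forall>x\<in>?U. \<forall>y\<in>?U. \<forall>z\<in>?U. mM p M x y z \<longrightarrow> mM p M y x z"
    proof (intro ballI impI)
      fix x y z assume h: "x \<in> ?U" "y \<in> ?U" "z \<in> ?U" "mM p M x y z"
      then show "mM p M y x z" using MM[OF h(1-3)] MM[OF h(2,1,3)] T(3)[OF vG[OF h(1)] vG[OF h(2)]] by simp
    qed
    show "\<forall>x\<in>?U. \<forall>y\<in>?U. \<forall>z\<in>?U. \<forall>x'\<in>?U. \<forall>y'\<in>?U. \<forall>z'\<in>?U.
        mM p M x y x' \<and> mM p M x' z z' \<and> mM p M y z y' \<longrightarrow> mM p M x y' z'"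
    proof (intro ballI impI)
      fix x y z x' y' z'
      assume h: "x \<in> ?U" "y \<in> ?U" "z \<in> ?U" "x' \<in> ?U" "y' \<in> ?U" "z' \<in> ?U"
        and "mM p M x y x' \<and> mM p M x' z z' \<and> mM p M y z y'"
      then have "vplus G (?v x) (?v y) = ?v x'" "vplus G (?v x') (?v z) = ?v z'" "vplus G (?v y) (?v z) = ?v y'"
        using MM by blast+
      then have "vplus G (?v x) (?v y') = ?v z'" using T(2)[OF vG[OF h(1)] vG[OF h(2)] vG[OF h(3)]] by simp
      then show "mM p M x y' z'" using MM[OF h(1,5,6)] by simp
    qed
    show "\<forall>x\<in>?U. mM p M (mone M) x x" using MM[OF o] d4 T(4)[OF vG] by simp
    show "\<forall>x\<in>?U. mM p M x (mzero M) (mzero M)" using MM[OF _ z z] vz inf[OF vG] by simp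
    show "\<forall>x\<in>?U. x \<noteq> mzero M \<longrightarrow> (\<exists>y\<in>?U. mM p M x y (mone M))"
    proof (intro ballI impI)
      fix x assume h: "x \<in> ?U" "x \<noteq> mzero M"
      then have "?v x \<in> vals G - {vinf G}" using vG kv_basic(8)[OF m h(1)] by simp
      then obtain b where b: "b \<in> vals G" "vplus G (?v x) b = vzero G" using ovgD(7)[OF g] by blast
      obtain y where y: "y \<in> ?U" "?v y = b" using ex[OF b(1)] by blast
      then show "\<exists>y\<in>?U. mM p M x y (mone M)" using MM[OF h(1) y(1) o] d4 b by metis
    qed
    show "\<forall>x\<in>?U. \<forall>y\<in>?U. x \<noteq> mzero M \<longrightarrow> y \<noteq> mzero M \<longrightarrow> \<not> mM p M x y (mzero M)"
    proof (intro ballI impI)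
      fix x y assume h: "x \<in> ?U" "y \<in> ?U" "x \<noteq> mzero M" "y \<noteq> mzero M"
      then have "vplus G (?v x) (?v y) \<in> vals G - {vinf G}"
        using vG kv_basic(8)[OF m h(1)] kv_basic(8)[OF m h(2)] by (intro ovgD(3)[OF g]) auto
      then show "\<not> mM p M x y (mzero M)" using MM[OF h(1,2) z] vz by simp
    qed
    show "\<forall>x\<in>?U. \<forall>y\<in>?U. \<forall>z\<in>?U. \<forall>x'\<in>?U. \<forall>y'\<in>?U.
        mL p M x y \<and> mM p M x z x' \<and> mM p M y z y' \<longrightarrow> mL p M x' y'"
    proof (intro ballI impI)
      fix x y z x' y'
      assume h: "x \<in> ?U" "y \<in> ?U" "z \<in> ?U" "x' \<in> ?U" "y' \<in> ?U" and
        k: "mL p M x y \<and> mM p M x z x' \<and> mM p M y z y'"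
      have "vle G (?v y) (?v x)" using L h k unfolding induces_L_def by blast
      then have "vle G (vplus G (?v y) (?v z)) (vplus G (?v x) (?v z))" using T(5) vG h by simp
      then have "vle G (?v y') (?v x')" using k MM[OF h(1,3,4)] MM[OF h(2,3,5)] by simp
      then show "mL p M x' y'" using L h unfolding induces_L_def by blast
    qed
    show "\<forall>n \<pi>. n \<ge> 1 \<and> \<pi> \<noteq> 0 \<and> pval p \<pi> = 1 \<longrightarrow> (\<forall>x\<in>?U. \<exists>f. mchain p M n f \<and>
        (\<exists>i\<in>{1..n}. mM p M (f n) (mscale M (\<pi> ^ i) (mone M)) x))"
    proof (intro allI impI ballI)
      fix n :: nat and \<pi> :: 'k and x assume n: "n \<ge> 1 \<and> \<pi> \<noteq> 0 \<and> pval p \<pi> = 1" and x: "x \<in> ?U"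
      obtain b i where b: "b \<in> vals G" "i \<in> {1..n}" "?v x = vplus G (vmult G n b) (vmult G i (vone G))"
        using d7 n vG[OF x] by blast
      obtain y where y: "y \<in> ?U" "?v y = vmult G n b" using ex[OF vm[OF b(1)]] by blast
      have "?v (mscale M (\<pi> ^ i) (mone M)) = vmult G i (vone G)"
        using pi_power_value[OF m _ _ o, of \<pi> i] n succ_pow_vmult[OF m g d5, of i] d4 by simp
      then have "mM p M y (mscale M (\<pi> ^ i) (mone M)) x"
        using MM[OF y(1) vector_space_structD(3)[OF vs o] x] b(3) y(2) by simp
      then have "\<exists>b\<in>vals G. \<exists>y\<in>?U. ?v y = vmult G n b \<and> (\<exists>i\<in>{1..n}. mM p M y (mscale M (\<pi> ^ i) (mone M)) x)"
        using b y by blast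
      then show "\<exists>f. mchain p M n f \<and> (\<exists>i\<in>{1..n}. mM p M (f n) (mscale M (\<pi> ^ i) (mone M)) x)"
        using ch[of n "\<lambda>y. \<exists>i\<in>{1..n}. mM p M y (mscale M (\<pi> ^ i) (mone M)) x"] n by simp
    qed
    show "\<forall>n. n \<ge> 1 \<longrightarrow> (\<forall>x\<in>?U. mQ p n M x \<longleftrightarrow> (\<exists>f. mchain p M n f \<and> mL p M (f n) x \<and> mL p M x (f n)))"
    proof (intro allI impI ballI)
      fix n :: nat and x assume n: "n \<ge> 1" and x: "x \<in> ?U"
      have "(\<exists>f. mchain p M n f \<and> (mL p M (f n) x \<and> mL p M x (f n))) \<longleftrightarrow>
          (\<exists>b\<in>vals G. \<exists>y\<in>?U. ?v y = vmult G n b \<and> (mL p M y x \<and> mL p M x y))"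
        using ch[OF n, of "\<lambda>y. mL p M y x \<and> mL p M x y"] .
      also have "\<dots> \<longleftrightarrow> (\<exists>b\<in>vals G. \<exists>y\<in>?U. ?v y = vmult G n b \<and> ?v y = ?v x)"
        using eqv[OF _ x] by (intro bex_cong refl conj_cong) simp
      also have "\<dots> \<longleftrightarrow> (\<exists>b\<in>vals G. ?v x = vmult G n b)"
        using x by metis
      also have "\<dots> \<longleftrightarrow> mQ p n M x" using d8 n vG[OF x] QQ[OF n x] by blast
      finally show "mQ p n M x \<longleftrightarrow> (\<exists>f. mchain p M n f \<and> mL p M (f n) x \<and> mL p M x (f n))" by simp
    qed
  qed
qed

lemma model_T_kv_extend:
  "model_T_kv p M (vstruct.extend G e :: ('u, 'g) pstruct) \<longleftrightarrow> model_T_kv p M (G :: ('u, 'g) vstruct)"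
  "induces_L p M (vstruct.extend G e :: ('u, 'g) pstruct) \<longleftrightarrow> induces_L p M G"
  unfolding model_T_kv_def induces_L_def imm_succ_def shifted_def vle_def by (simp_all add: vstruct.defs)

lemma plus_ax_model:
  fixes p :: "'k::field place" and M :: "('k fsym, 'k rsym, 'u) struct"
  assumes p: "finite_place p" "discrete_place p" and fa: "fin_ax p M" and pa: "plus_ax p M"
  shows "\<exists>G :: ('u, 'u) pstruct. model_T_kv_plus p M G \<and> induces_L p M G \<and> induces_MQ p M G"
proof -
  let ?U = "univ M"
  obtain H :: "('u, 'u) vstruct" where mH: "model_T_kv p M H" and LH: "induces_L p M H"
    using fin_ax_model_T_kv[OF p fa] by blast
  let ?v = "vmap H"
  note A = pa[unfolded plus_ax_def]
  note d1 = A[THEN conjunct1]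
  note d2 = A[THEN conjunct2, THEN conjunct1]
  note d3 = A[THEN conjunct2, THEN conjunct2, THEN conjunct1]
  note d4 = A[THEN conjunct2, THEN conjunct2, THEN conjunct2, THEN conjunct1]
  note d5 = A[THEN conjunct2, THEN conjunct2, THEN conjunct2, THEN conjunct2, THEN conjunct1]
  note d6 = A[THEN conjunct2, THEN conjunct2, THEN conjunct2, THEN conjunct2, THEN conjunct2, THEN conjunct1]
  note d7 = A[THEN conjunct2, THEN conjunct2, THEN conjunct2, THEN conjunct2, THEN conjunct2, THEN conjunct2, THEN conjunct1]
  note d8 = A[THEN conjunct2, THEN conjunct2, THEN conjunct2, THEN conjunct2, THEN conjunct2, THEN conjunct2, THEN conjunct2, THEN conjunct1]
  note d9 = A[THEN conjunct2, THEN conjunct2, THEN conjunct2, THEN conjunct2, THEN conjunct2, THEN conjunct2, THEN conjunct2, THEN conjunct2, THEN conjunct1]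
  note d10 = A[THEN conjunct2, THEN conjunct2, THEN conjunct2, THEN conjunct2, THEN conjunct2, THEN conjunct2, THEN conjunct2, THEN conjunct2, THEN conjunct2, THEN conjunct1]
  note d11 = A[THEN conjunct2, THEN conjunct2, THEN conjunct2, THEN conjunct2, THEN conjunct2, THEN conjunct2, THEN conjunct2, THEN conjunct2, THEN conjunct2, THEN conjunct2]
  note vs = kv_basic(1)[OF mH]
  note surj = kv_basic(7)[OF mH]
  note zU = vector_space_structD(1)[OF vs] and oU = vector_space_structD(12)[OF vs]
  have vG: "?v x \<in> vals H" if "x \<in> ?U" for x using surj that by blast
  have ex: "\<exists>x\<in>?U. ?v x = a" if "a \<in> vals H" for a using surj that by (metis imageE)
  note eqv = induces_L_eqv[OF mH LH]
  define pl where "pl a b = ?v (SOME z. z \<in> ?U \<and> (\<exists>x\<in>?U. \<exists>y\<in>?U. ?v x = a \<and> ?v y = b \<and> mM p M x y z))" for a b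
  have F: "mM p M x y z \<longleftrightarrow> pl (?v x) (?v y) = ?v z" if h: "x \<in> ?U" "y \<in> ?U" "z \<in> ?U" for x y z
  proof -
    obtain z0 where z0: "z0 \<in> ?U" "mM p M x y z0" using d1 h by blast
    define w where "w = (SOME z. z \<in> ?U \<and> (\<exists>x'\<in>?U. \<exists>y'\<in>?U. ?v x' = ?v x \<and> ?v y' = ?v y \<and> mM p M x' y' z))"
    have "w \<in> ?U \<and> (\<exists>x'\<in>?U. \<exists>y'\<in>?U. ?v x' = ?v x \<and> ?v y' = ?v y \<and> mM p M x' y' w)"
      unfolding w_def by (rule someI[of _ z0]) (use z0 h in blast)
    then obtain x' y' where w: "w \<in> ?U" "x' \<in> ?U" "y' \<in> ?U" "?v x' = ?v x" "?v y' = ?v y" "mM p M x' y' w" by blast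
    have "mL p M x' x \<and> mL p M x x'" "mL p M y' y \<and> mL p M y y'"
      using eqv[OF w(2) h(1)] eqv[OF w(3) h(2)] w(4,5) by simp_all
    then have "mL p M w z \<and> mL p M z w \<longleftrightarrow> mM p M x y z"
      using d2 w(1-3,6) h by blast
    then have "mM p M x y z \<longleftrightarrow> ?v w = ?v z" using eqv[OF w(1) h(3)] by simp
    moreover have "pl (?v x) (?v y) = ?v w" unfolding pl_def w_def ..
    ultimately show ?thesis by simp
  qed
  define G :: "('u, 'u) pstruct" where
    "G = vstruct.extend H \<lparr>vplus = pl, vzero = ?v (mone M), vone = vsucc H (?v (mone M)), vP = (\<lambda>n a. True)\<rparr>"
  define G' where "G' = G\<lparr>vP := (\<lambda>n a. \<exists>b\<in>vals H. a = vmult G n b)\<rparr>"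
  have sel: "vals G' = vals H" "vless G' = vless H" "vinf G' = vinf H" "vsucc G' = vsucc H" "vmap G' = vmap H"
    "vplus G' = pl" "vzero G' = ?v (mone M)" "vone G' = vsucc H (?v (mone M))"
    "vplus G = pl" "vzero G = ?v (mone M)" "vP G' = (\<lambda>n a. \<exists>b\<in>vals H. a = vmult G n b)"
    unfolding G'_def G_def by (simp_all add: vstruct.defs)
  have vmeq: "vmult G n b = vmult G' n b" for n b by (induction n) (simp_all add: sel)
  have G'ext: "G' = vstruct.extend H (vstruct.more G')"
    unfolding G'_def G_def by (simp add: vstruct.defs)
  have m: "model_T_kv p M G'" using model_T_kv_extend(1) mH G'ext by metis
  have L: "induces_L p M G'" using model_T_kv_extend(2) LH G'ext by metis
  have vz: "?v (mzero M) = vinf H" using kv_basic(8)[OF mH zU] by simp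
  have plcl: "pl (?v x) (?v y) \<in> vals H" if h: "x \<in> ?U" "y \<in> ?U" for x y
  proof -
    obtain z where z: "z \<in> ?U" "mM p M x y z" using d1 h by blast
    then show ?thesis using F[OF h z(1)] vG[OF z(1)] by simp
  qed
  have plcl': "pl a b \<in> vals H" if h: "a \<in> vals H" "b \<in> vals H" for a b
  proof -
    obtain x y where x: "x \<in> ?U" "?v x = a" "y \<in> ?U" "?v y = b" using ex[OF h(1)] ex[OF h(2)] by blast
    then show ?thesis using plcl[OF x(1,3)] by simp
  qed
  have plz: "pl a b \<noteq> vinf H" if h: "a \<in> vals H - {vinf H}" "b \<in> vals H - {vinf H}" for a b
  proof -
    obtain x y where x: "x \<in> ?U" "?v x = a" "y \<in> ?U" "?v y = b" using ex[of a] ex[of b] h by blast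
    then have "x \<noteq> mzero M" "y \<noteq> mzero M" using h vz by auto
    then have "\<not> mM p M x y (mzero M)" using d8 x by blast
    then show ?thesis using F[OF x(1,3) zU] x(2,4) vz by simp
  qed
  have plinf: "pl a (vinf H) = vinf H" if h: "a \<in> vals H" for a
  proof -
    obtain x where x: "x \<in> ?U" "?v x = a" using ex[OF h] by blast
    then have "mM p M x (mzero M) (mzero M)" using d6 by blast
    then show ?thesis using F[OF x(1) zU zU] x(2) vz by simp
  qed
  have plcomm: "pl a b = pl b a" if h: "a \<in> vals H" "b \<in> vals H" for a b
  proof -
    obtain x y where x: "x \<in> ?U" "?v x = a" "y \<in> ?U" "?v y = b" using ex[of a] ex[of b] h by blast
    obtain z where z: "z \<in> ?U" "mM p M x y z" using d1 x by blast
    then have "mM p M y x z" using d3 x by blast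
    then show ?thesis using z F[OF x(1,3) z(1)] F[OF x(3,1) z(1)] x by simp
  qed
  have plassoc: "pl (pl a b) c = pl a (pl b c)" if h: "a \<in> vals H" "b \<in> vals H" "c \<in> vals H" for a b c
  proof -
    obtain x y z where x: "x \<in> ?U" "?v x = a" "y \<in> ?U" "?v y = b" "z \<in> ?U" "?v z = c" using ex[of a] ex[of b] ex[of c] h by blast
    obtain x' where x': "x' \<in> ?U" "mM p M x y x'" using d1 x by blast
    obtain z' where z': "z' \<in> ?U" "mM p M x' z z'" using d1 x x' by blast
    obtain y' where y': "y' \<in> ?U" "mM p M y z y'" using d1 x by blast
    have "mM p M x y' z'" using d4 x(1,3,5) x' y' z' by blast
    then show ?thesis
      using F[OF x(1,3) x'(1)] F[OF x'(1) x(5) z'(1)] F[OF x(3,5) y'(1)] F[OF x(1) y'(1) z'(1)] x'(2) y'(2) z'(2)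
      unfolding x(2,4,6) by simp
  qed
  have plz0: "pl (?v (mone M)) a = a" if h: "a \<in> vals H" for a
  proof -
    obtain x where x: "x \<in> ?U" "?v x = a" using ex[OF h] by blast
    then have "mM p M (mone M) x x" using d5 by blast
    then show ?thesis using F[OF oU x(1) x(1)] x(2) by simp
  qed
  have onz: "?v (mone M) \<noteq> vinf H" using kv_basic(8)[OF mH oU] kv_basic(2)[OF mH] by auto
  have plinv: "\<exists>b\<in>vals H - {vinf H}. pl a b = ?v (mone M)" if h: "a \<in> vals H - {vinf H}" for a
  proof -
    obtain x where x: "x \<in> ?U" "?v x = a" using ex[of a] h by blast
    then have "x \<noteq> mzero M" using h vz by auto
    then obtain y where y: "y \<in> ?U" "mM p M x y (mone M)" using d7 x by blast
    then have e: "pl a (?v y) = ?v (mone M)" using F[OF x(1) y(1) oU] x(2) by simp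
    then have "?v y \<noteq> vinf H" using plinf[of a] h onz by auto
    then show ?thesis using e vG[OF y(1)] by blast
  qed
  have Ls: "mL p M x y \<longleftrightarrow> vle H (?v y) (?v x)" if "x \<in> ?U" "y \<in> ?U" for x y
    using LH that unfolding induces_L_def by blast
  have plord: "vless H (pl a c) (pl b c)" if h: "a \<in> vals H - {vinf H}" "b \<in> vals H - {vinf H}" "c \<in> vals H - {vinf H}"
      and lt: "vless H a b" for a b c
  proof -
    obtain x y z where x: "x \<in> ?U" "?v x = a" "y \<in> ?U" "?v y = b" "z \<in> ?U" "?v z = c" using ex[of a] ex[of b] ex[of c] h by blast
    obtain x' where x': "x' \<in> ?U" "mM p M x z x'" using d1 x by blast
    obtain y' where y': "y' \<in> ?U" "mM p M y z y'" using d1 x by blast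
    have "mL p M y x" using Ls[OF x(3,1)] x(2,4) lt unfolding vle_def by simp
    then have "mL p M y' x'" using d9 x(1,3,5) x' y' by blast
    then have "vle H (?v x') (?v y')" using Ls[OF y'(1) x'(1)] by simp
    moreover have vx: "pl a c = ?v x'" "pl b c = ?v y'"
      using F[OF x(1,5) x'(1)] F[OF x(3,5) y'(1)] x' y' x by simp_all
    ultimately have le: "vless H (pl a c) (pl b c) \<or> pl a c = pl b c" unfolding vle_def by simp
    have "a = b" if e: "pl a c = pl b c"
    proof -
      obtain d where d: "d \<in> vals H - {vinf H}" "pl c d = ?v (mone M)" using plinv[OF h(3)] by blast
      have "pl a (pl c d) = pl b (pl c d)"
        using plassoc[of a c d] plassoc[of b c d] h d(1) e by simp
      then show ?thesis using d(2) plcomm[OF _ vG[OF oU]] plz0 h by simp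
    qed
    then show ?thesis using le lt kv_basic(3)[OF mH] h by blast
  qed
  have g: "ordered_value_group G'"
    unfolding ordered_value_group_def sel
  proof (intro conjI)
    show "?v (mone M) \<in> vals H - {vinf H}" using vG[OF oU] onz by simp
    show "\<forall>a\<in>vals H - {vinf H}. \<forall>b\<in>vals H - {vinf H}. pl a b \<in> vals H - {vinf H}"
      using plcl' plz by simp
    show "\<forall>a\<in>vals H - {vinf H}. \<forall>b\<in>vals H - {vinf H}. \<forall>c\<in>vals H - {vinf H}. pl (pl a b) c = pl a (pl b c)"
      using plassoc by simp
    show "\<forall>a\<in>vals H - {vinf H}. \<forall>b\<in>vals H - {vinf H}. pl a b = pl b a"
    proof (intro ballI)
      fix a b assume "a \<in> vals H - {vinf H}" "b \<in> vals H - {vinf H}"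
      then show "pl a b = pl b a" using plcomm[of a b] by blast
    qed
    show "\<forall>a\<in>vals H - {vinf H}. pl (?v (mone M)) a = a" using plz0 by simp
    show "\<forall>a\<in>vals H - {vinf H}. \<exists>b\<in>vals H - {vinf H}. pl a b = ?v (mone M)" using plinv by blast
    show "\<forall>a\<in>vals H - {vinf H}. \<forall>b\<in>vals H - {vinf H}. \<forall>c\<in>vals H - {vinf H}. vless H a b \<longrightarrow> vless H (pl a c) (pl b c)"
      using plord by blast
  qed
  have inf: "\<forall>a\<in>vals G'. vplus G' a (vinf G') = vinf G' \<and> vplus G' (vinf G') a = vinf G'"
    unfolding sel
  proof
    fix a assume "a \<in> vals H"
    then show "pl a (vinf H) = vinf H \<and> pl (vinf H) a = vinf H"
      using plinf[of a] plcomm[of a "vinf H"] kv_basic(6)[OF mH] by simp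
  qed
  note T = total_group[OF m g inf]
  have s01: "vsucc G' (vzero G') = vone G'" unfolding sel ..
  have ch: "(\<exists>f. mchain p M n f \<and> Q (f n)) \<longleftrightarrow> (\<exists>b\<in>vals G'. \<exists>y\<in>?U. vmap G' y = vmult G' n b \<and> Q y)" if "n \<ge> 1" for n Q
  proof (rule chain_vmult[OF _ _ _ _ ovgD(1)[OF g] that])
    show "\<forall>b\<in>vals G'. vplus G' (vzero G') b = b" using T(4) by blast
    show "\<forall>x\<in>?U. \<forall>y\<in>?U. \<forall>z\<in>?U. mM p M x y z \<longleftrightarrow> vplus G' (vmap G' x) (vmap G' y) = vmap G' z"
      unfolding sel using F by simp
    show "vmap G' ` ?U = vals G'" unfolding sel by (rule surj)
    show "\<forall>a\<in>vals G'. \<forall>b\<in>vals G'. vplus G' a b \<in> vals G'" using T(1) by blast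
  qed
  obtain \<pi> where \<pi>: "\<pi> \<noteq> 0" "pval p \<pi> = 1" using pval_base[OF p] by metis
  have MQ: "induces_MQ p M G'"
    unfolding induces_MQ_def
  proof (intro conjI)
    show "\<forall>x\<in>?U. \<forall>y\<in>?U. \<forall>z\<in>?U. mM p M x y z \<longleftrightarrow> vplus G' (vmap G' x) (vmap G' y) = vmap G' z"
      unfolding sel using F by simp
    show "\<forall>n\<ge>1. \<forall>x\<in>?U. mQ p n M x \<longleftrightarrow> vP G' n (vmap G' x)"
    proof (intro allI impI ballI)
      fix n :: nat and x assume n: "n \<ge> 1" and x: "x \<in> ?U"
      have "mQ p n M x \<longleftrightarrow> (\<exists>f. mchain p M n f \<and> (mL p M (f n) x \<and> mL p M x (f n)))"
        using d11 n x by blast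
      also have "\<dots> \<longleftrightarrow> (\<exists>b\<in>vals G'. \<exists>y\<in>?U. vmap G' y = vmult G' n b \<and> (mL p M y x \<and> mL p M x y))"
        using ch[OF n, of "\<lambda>y. mL p M y x \<and> mL p M x y"] .
      also have "\<dots> \<longleftrightarrow> (\<exists>b\<in>vals G'. \<exists>y\<in>?U. vmap G' y = vmult G' n b \<and> vmap G' y = vmap G' x)"
        using induces_L_eqv[OF m L _ x] by (intro bex_cong refl conj_cong) simp
      also have "\<dots> \<longleftrightarrow> vP G' n (vmap G' x)" using x unfolding sel vmeq by metis
      finally show "mQ p n M x \<longleftrightarrow> vP G' n (vmap G' x)" .
    qed
  qed
  have "model_T_kv_plus p M G'"
    unfolding model_T_kv_plus_def
  proof (intro conjI)
    show "vone G' \<in> vals G'" using succ_plus_one(2)[OF m g s01, of "vzero G'"] ovgD(1,2)[OF g] by blast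
    show "vmap G' (mone M) = vzero G'" unfolding sel ..
    show "\<forall>n\<ge>1. \<forall>a\<in>vals G'. \<exists>b\<in>vals G'. \<exists>i\<in>{1..n}. a = vplus G' (vmult G' n b) (vmult G' i (vone G'))"
    proof (intro allI impI ballI)
      fix n :: nat and a assume n: "n \<ge> 1" and a: "a \<in> vals G'"
      obtain x where x: "x \<in> ?U" "vmap G' x = a" using ex a unfolding sel by blast
      have "\<exists>f. mchain p M n f \<and> (\<exists>i\<in>{1..n}. mM p M (f n) (mscale M (\<pi> ^ i) (mone M)) x)"
        using d10 n \<pi> x(1) by blast
      then have "\<exists>b\<in>vals G'. \<exists>y\<in>?U. vmap G' y = vmult G' n b \<and> (\<exists>i\<in>{1..n}. mM p M y (mscale M (\<pi> ^ i) (mone M)) x)"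
        using ch[OF n, of "\<lambda>y. \<exists>i\<in>{1..n}. mM p M y (mscale M (\<pi> ^ i) (mone M)) x"] by simp
      then obtain b y i where b: "b \<in> vals G'" "y \<in> ?U" "vmap G' y = vmult G' n b" "i \<in> {1..n}"
        "mM p M y (mscale M (\<pi> ^ i) (mone M)) x" by blast
      have "vmap G' (mscale M (\<pi> ^ i) (mone M)) = vmult G' i (vone G')"
        using pi_power_value[OF m \<pi> oU, of i] succ_pow_vmult[OF m g s01, of i] sel(5,7) by simp
      moreover have "vplus G' (vmap G' y) (vmap G' (mscale M (\<pi> ^ i) (mone M))) = vmap G' x"
        using F[OF b(2) vector_space_structD(3)[OF vs oU] x(1)] b(5) sel(5,6) by simp
      ultimately have "a = vplus G' (vmult G' n b) (vmult G' i (vone G'))" using b(3) x(2) by simp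
      then show "\<exists>b\<in>vals G'. \<exists>i\<in>{1..n}. a = vplus G' (vmult G' n b) (vmult G' i (vone G'))" using b by blast
    qed
    show "\<forall>n\<ge>1. \<forall>a\<in>vals G'. vP G' n a \<longleftrightarrow> (\<exists>b\<in>vals G'. a = vmult G' n b)"
      unfolding sel vmeq by simp
  qed (fact m g s01 inf)+
  then show ?thesis using L MQ by blast
qed

theorem models_T_fin_plus:
  fixes p :: "'k::field place" and M :: "('k fsym, 'k rsym, 'u) struct"
  assumes "finite_place p" "discrete_place p" "struct_in (lang_kS {p} {p}) M"
  shows "models M (T_fin_plus p) \<longleftrightarrow>
      (\<exists>G :: ('u, 'u) pstruct. model_T_kv_plus p M G \<and> induces_L p M G \<and> induces_MQ p M G)"
    and "model_T_kv_plus p M (G :: ('u, 'g) pstruct) \<Longrightarrow> induces_L p M G \<Longrightarrow> induces_MQ p M G \<Longrightarrow>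
      models M (T_fin_plus p)"
proof -
  have s: "struct_in lang_k M" using assms(3) unfolding struct_in_lang_k .
  have *: "models M (T_fin_plus p) \<longleftrightarrow> fin_ax p M \<and> plus_ax p M"
    using models_plus_ax[OF s] models_fin_ax[OF s] by blast
  have 1: "fin_ax p M \<and> plus_ax p M" if h: "model_T_kv_plus p M G" "induces_L p M G" "induces_MQ p M G"
    for G :: "('u, 'h) pstruct"
    using model_T_kv_fin_ax[of p M G] model_plus_ax[OF h] h unfolding model_T_kv_plus_def by blast
  show "models M (T_fin_plus p) \<longleftrightarrow>
      (\<exists>G :: ('u, 'u) pstruct. model_T_kv_plus p M G \<and> induces_L p M G \<and> induces_MQ p M G)"
    unfolding * using plus_ax_model[OF assms(1,2)] 1 by blast
  show "models M (T_fin_plus p)" if "model_T_kv_plus p M G" "induces_L p M G" "induces_MQ p M G"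
    unfolding * using model_T_kv_fin_ax[of p M G] model_plus_ax[OF that] that unfolding model_T_kv_plus_def by blast
qed


subsection \<open>Real places, weak approximation, well-formedness\<close>

abbreviation msub :: "('k::field fsym, 'r, 'u) struct \<Rightarrow> 'u \<Rightarrow> 'u \<Rightarrow> 'u" where
  "msub M x y \<equiv> madd M x (mscale M (- 1) y)"

definition mle :: "'k::field place \<Rightarrow> ('k fsym, 'k rsym, 'u) struct \<Rightarrow> 'u \<Rightarrow> 'u \<Rightarrow> bool" where
  "mle p M x y \<longleftrightarrow> mL p M (msub M (msub M y x) (mone M)) (madd M (msub M y x) (mone M))"

definition model_T_kreal :: "'k::field place \<Rightarrow> ('k fsym, 'k rsym, 'u) struct \<Rightarrow> bool" where
  "model_T_kreal p M \<longleftrightarrow> vector_space_struct M \<and>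
     mle p M (mzero M) (mone M) \<and> mzero M \<noteq> mone M \<and>
     (\<forall>x\<in>univ M. mle p M x x) \<and>
     (\<forall>x\<in>univ M. \<forall>y\<in>univ M. mle p M x y \<longrightarrow> mle p M y x \<longrightarrow> x = y) \<and>
     (\<forall>x\<in>univ M. \<forall>y\<in>univ M. \<forall>z\<in>univ M. mle p M x y \<longrightarrow> mle p M y z \<longrightarrow> mle p M x z) \<and>
     (\<forall>x\<in>univ M. \<forall>y\<in>univ M. mle p M x y \<or> mle p M y x) \<and>
     (\<forall>x\<in>univ M. \<forall>y\<in>univ M. \<forall>z\<in>univ M. mle p M x y \<longrightarrow> mle p M (madd M x z) (madd M y z)) \<and>
     (\<forall>x\<in>univ M. \<forall>y\<in>univ M. mL p M x y \<longleftrightarrow>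
        (mle p M (mzero M) x \<and> mle p M x y) \<or>
        (mle p M (mzero M) (mscale M (- 1) x) \<and> mle p M (mscale M (- 1) x) y) \<or>
        (mle p M (mzero M) x \<and> mle p M x (mscale M (- 1) y)) \<or>
        (mle p M (mzero M) (mscale M (- 1) x) \<and> mle p M (mscale M (- 1) x) (mscale M (- 1) y))) \<and>
     (\<forall>c. place_nonneg p c \<longrightarrow> (\<forall>x\<in>univ M. \<forall>y\<in>univ M. mle p M x y \<longrightarrow> mle p M (mscale M c x) (mscale M c y)))"

lemma sat_fle: "sat M e (fle p s t) \<longleftrightarrow> mle p M (evalt M e s) (evalt M e t)"
  by (simp add: fle_def mle_def)

theorem models_T_real:
  assumes "struct_in (lang_kS {p} {}) M"
  shows "models M (T_real p) \<longleftrightarrow> model_T_kreal p M"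
proof -
  have s: "struct_in lang_k M" using assms unfolding struct_in_lang_k .
  note cl = struct_in_closed[OF s]
  have dj: "(\<forall>e. range e \<subseteq> univ M \<longrightarrow> sat M e (All 0 (All 1 (Iff (fL p (V 0) (V 1))
         (Disj [And (fle p tzero (V 0)) (fle p (V 0) (V 1)),
                And (fle p tzero (tneg (V 0))) (fle p (tneg (V 0)) (V 1)),
                And (fle p tzero (V 0)) (fle p (V 0) (tneg (V 1))),
                And (fle p tzero (tneg (V 0))) (fle p (tneg (V 0)) (tneg (V 1)))]))))) \<longleftrightarrow>
     (\<forall>x\<in>univ M. \<forall>y\<in>univ M. mL p M x y \<longleftrightarrow>
        (mle p M (mzero M) x \<and> mle p M x y) \<or>
        (mle p M (mzero M) (mscale M (- 1) x) \<and> mle p M (mscale M (- 1) x) y) \<or>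
        (mle p M (mzero M) x \<and> mle p M x (mscale M (- 1) y)) \<or>
        (mle p M (mzero M) (mscale M (- 1) x) \<and> mle p M (mscale M (- 1) x) (mscale M (- 1) y)))"
    by (simp add: ex_assignment[OF cl(1)] sat_fle) blast
  show ?thesis
    unfolding T_real_def model_T_kreal_def models_simps models_Collect models_T_vs[OF s] dj
    by (simp add: ex_assignment[OF cl(1)] models_simps(1) sat_fle disj_imp)
qed

primrec msum :: "('k fsym, 'r, 'u) struct \<Rightarrow> (nat \<Rightarrow> 'k) \<Rightarrow> (nat \<Rightarrow> 'u) \<Rightarrow> nat \<Rightarrow> 'u" where
  "msum M c f 0 = mzero M"
| "msum M c f (Suc n) = madd M (msum M c f n) (mscale M (c n) (f n))"

lemma evalt_tlin: "evalt M e (tlin c f n) = msum M c (\<lambda>j. e (f j)) n"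
  by (induction n) auto

lemma msum_cong: "(\<And>j. j < n \<Longrightarrow> f j = g j) \<Longrightarrow> msum M c f n = msum M c g n"
  by (induction n) auto

lemma sat_lin_sys: "sat M e (lin_sys m n A f g) \<longleftrightarrow> (\<forall>l<m. msum M (A l) (\<lambda>j. e (f j)) n = e (g l))"
  by (auto simp: lin_sys_def evalt_tlin)

theorem models_weak_approx:
  fixes M :: "('k::field fsym, 'k rsym, 'u) struct" and ps :: "'k place list"
  assumes M: "struct_in (lang_kS S0 S1) M"
  defines "r \<equiv> length ps"
  shows "models M {weak_approx ps m n A} \<longleftrightarrow>
    (\<forall>b c x. (\<forall>l<m. b l \<in> univ M) \<longrightarrow> (\<forall>i<r. c i \<in> univ M - {mzero M}) \<longrightarrow>
       (\<forall>i<r. \<forall>j<n. x i j \<in> univ M) \<longrightarrow> (\<forall>i<r. \<forall>l<m. msum M (A l) (x i) n = b l) \<longrightarrow>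
       (\<exists>y. (\<forall>j<n. y j \<in> univ M) \<and> (\<forall>l<m. msum M (A l) y n = b l) \<and>
            (\<forall>i<r. \<forall>j<n. mL (ps ! i) M (msub M (y j) (x i j)) (c i))))"
    (is "_ \<longleftrightarrow> ?R")
proof -
  have ne: "univ M \<noteq> {}" using M by (simp add: struct_in_def)
  define N where "N = n * (r + 1) + r + m"
  define X where "X i j = n * (i + 1) + j" for i j :: nat
  define C where "C i = n * (r + 1) + i" for i :: nat
  define B where "B l = n * (r + 1) + r + l" for l :: nat
  have Xlt: "X i j < n * (r + 1)" "n \<le> X i j" if "i < r" "j < n" for i j
  proof -
    have "X i j < n * (i + 2)" using that unfolding X_def by (simp add: algebra_simps)
    also have "\<dots> \<le> n * (r + 1)" using that by (intro mult_le_mono2) simp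
    finally show "X i j < n * (r + 1)" .
    show "n \<le> X i j" unfolding X_def by simp
  qed
  have rng: "X i j \<in> {n..<N}" if "i < r" "j < n" for i j using Xlt[OF that] unfolding N_def by simp
  have rngC: "C i \<in> {n..<N}" if "i < r" for i using that unfolding C_def N_def by simp
  have rngB: "B l \<in> {n..<N}" if "l < m" for l using that unfolding B_def N_def by simp
  define ev where "ev e f y k = (if k < n then y k else if k < N then f k else e k)" for e f y :: "nat \<Rightarrow> 'u" and k
  define P where "P f \<longleftrightarrow> (\<forall>i<r. f (C i) \<noteq> mzero M) \<and> (\<forall>i<r. \<forall>l<m. msum M (A l) (\<lambda>j. f (X i j)) n = f (B l)) \<longrightarrow>
      (\<exists>y. (\<forall>j<n. y j \<in> univ M) \<and> (\<forall>l<m. msum M (A l) y n = f (B l)) \<and>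
           (\<forall>i<r. \<forall>j<n. mL (ps ! i) M (msub M (y j) (f (X i j))) (f (C i))))" for f :: "nat \<Rightarrow> 'u"
  have sat: "sat M e (weak_approx ps m n A) \<longleftrightarrow> (\<forall>f. (\<forall>k\<in>{n..<N}. f k \<in> univ M) \<longrightarrow> P f)" for e
  proof -
    let ?e = "\<lambda>f k. if k \<in> {n..<N} then f k else e k"
    let ?H = "\<lambda>f. (\<forall>i<r. ?e f (C i) \<noteq> mzero M) \<and> (\<forall>i<r. \<forall>l<m. msum M (A l) (\<lambda>j. ?e f (X i j)) n = ?e f (B l))"
    let ?e2 = "\<lambda>f y k. if k \<in> {0..<n} then y k else ?e f k"
    let ?K = "\<lambda>f y. (\<forall>l<m. msum M (A l) (\<lambda>j. ?e2 f y j) n = ?e2 f y (B l)) \<and>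
        (\<forall>i<r. \<forall>j<n. mL (ps ! i) M (msub M (?e2 f y j) (?e2 f y (X i j))) (?e2 f y (C i)))"
    have gen: "sat M e (Alls ns (Imp F1 (Exs ms F2))) \<longleftrightarrow>
        (\<forall>f. (\<forall>k\<in>set ns. f k \<in> univ M) \<longrightarrow> (sat M (\<lambda>k. if k \<in> set ns then f k else e k) F1 \<longrightarrow>
          (\<exists>y. (\<forall>j\<in>set ms. y j \<in> univ M) \<and>
            sat M (\<lambda>k. if k \<in> set ms then y k else if k \<in> set ns then f k else e k) F2)))" for ns ms F1 F2
      unfolding sat_Alls sat.simps sat_Exs ..
    have XCB: "X = (\<lambda>i j. n * (i + 1) + j)" "C = (\<lambda>i. n * (r + 1) + i)" "B = (\<lambda>l. n * (r + 1) + r + l)"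
      by (simp_all add: fun_eq_iff X_def C_def B_def)
    have wa: "weak_approx ps m n A = Alls [n..<N]
      (Imp (And (Conj (map (\<lambda>i. Neg (Eq (V (C i)) tzero)) [0..<r])) (Conj (map (\<lambda>i. lin_sys m n A (X i) B) [0..<r])))
        (Exs [0..<n] (And (lin_sys m n A (\<lambda>j. j) B)
           (Conj (map (\<lambda>i. Conj (map (\<lambda>j. fL (ps ! i) (tsub (V j) (V (X i j))) (V (C i))) [0..<n])) [0..<r])))))"
      unfolding weak_approx_def Let_def r_def N_def XCB ..
    have inner1: "sat M e (And (Conj (map (\<lambda>i. Neg (Eq (V (C i)) tzero)) [0..<r]))
                     (Conj (map (\<lambda>i. lin_sys m n A (X i) B) [0..<r]))) \<longleftrightarrow>
       (\<forall>i<r. e (C i) \<noteq> mzero M) \<and> (\<forall>i<r. \<forall>l<m. msum M (A l) (\<lambda>j. e (X i j)) n = e (B l))" for e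
      by (auto simp: sat_lin_sys)
    have inner2: "sat M e (And (lin_sys m n A (\<lambda>j. j) B)
         (Conj (map (\<lambda>i. Conj (map (\<lambda>j. fL (ps ! i) (tsub (V j) (V (X i j))) (V (C i))) [0..<n])) [0..<r]))) \<longleftrightarrow>
       (\<forall>l<m. msum M (A l) (\<lambda>j. e j) n = e (B l)) \<and>
        (\<forall>i<r. \<forall>j<n. mL (ps ! i) M (msub M (e j) (e (X i j))) (e (C i)))" for e
      by (auto simp: sat_lin_sys)
    have "sat M e (weak_approx ps m n A) \<longleftrightarrow>
      (\<forall>f. (\<forall>k\<in>{n..<N}. f k \<in> univ M) \<longrightarrow> (?H f \<longrightarrow> (\<exists>y. (\<forall>j\<in>{0..<n}. y j \<in> univ M) \<and> ?K f y)))"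
      unfolding wa gen inner1 inner2 set_upt ..
    also have "\<dots> \<longleftrightarrow> (\<forall>f. (\<forall>k\<in>{n..<N}. f k \<in> univ M) \<longrightarrow> P f)"
    proof (intro all_cong1 imp_cong refl)
      fix f
      have h: "?H f \<longleftrightarrow> (\<forall>i<r. f (C i) \<noteq> mzero M) \<and> (\<forall>i<r. \<forall>l<m. msum M (A l) (\<lambda>j. f (X i j)) n = f (B l))"
      proof -
        have "msum M (A l) (\<lambda>j. ?e f (X i j)) n = msum M (A l) (\<lambda>j. f (X i j)) n" if "i < r" for i l
          using rng that by (intro msum_cong) simp
        then show ?thesis using rngB rngC by simp
      qed
      have k: "?K f y \<longleftrightarrow> (\<forall>l<m. msum M (A l) y n = f (B l)) \<and>
           (\<forall>i<r. \<forall>j<n. mL (ps ! i) M (msub M (y j) (f (X i j))) (f (C i)))" for y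
      proof -
        have a: "msum M (A l) (\<lambda>j. ?e2 f y j) n = msum M (A l) y n" for l by (intro msum_cong) simp
        have b: "?e2 f y (B l) = f (B l)" if "l < m" for l using rngB[OF that] by simp
        have c: "?e2 f y (C i) = f (C i)" if "i < r" for i using rngC[OF that] by simp
        have d: "?e2 f y (X i j) = f (X i j)" if "i < r" "j < n" for i j using rng[OF that] by simp
        have ee: "?e2 f y j = y j" if "j < n" for j using that by simp
        show ?thesis using a b c d ee by simp
      qed
      have "(\<exists>y. (\<forall>j\<in>{0..<n}. y j \<in> univ M) \<and> ?K f y) \<longleftrightarrow>
        (\<exists>y. (\<forall>j<n. y j \<in> univ M) \<and> (\<forall>l<m. msum M (A l) y n = f (B l)) \<and>
           (\<forall>i<r. \<forall>j<n. mL (ps ! i) M (msub M (y j) (f (X i j))) (f (C i))))"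
        unfolding k by (intro ex_cong1 conj_cong refl) auto
      then show "(?H f \<longrightarrow> (\<exists>y. (\<forall>j\<in>{0..<n}. y j \<in> univ M) \<and> ?K f y)) \<longleftrightarrow> P f"
        unfolding P_def h by (rule imp_cong[OF refl])
    qed
    finally show ?thesis .
  qed
  have "models M {weak_approx ps m n A} \<longleftrightarrow> (\<forall>f. (\<forall>k\<in>{n..<N}. f k \<in> univ M) \<longrightarrow> P f)"
    unfolding models_simps sat using ex_assignment[OF ne] models_simps(1) by auto
  also have "\<dots> \<longleftrightarrow> ?R"
  proof
    assume l: "\<forall>f. (\<forall>k\<in>{n..<N}. f k \<in> univ M) \<longrightarrow> P f"
    show ?R
    proof (intro allI impI)
      fix b c x
      assume b: "\<forall>l<m. b l \<in> univ M" and c: "\<forall>i<r. c i \<in> univ M - {mzero M}"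
        and x: "\<forall>i<r. \<forall>j<n. x i j \<in> univ M" and eq: "\<forall>i<r. \<forall>l<m. msum M (A l) (x i) n = b l"
      define f where "f k = (if k < n * (r + 1) then x (k div n - 1) (k mod n)
          else if k < n * (r + 1) + r then c (k - n * (r + 1)) else b (k - (n * (r + 1) + r)))" for k
      have fX: "f (X i j) = x i j" if "i < r" "j < n" for i j
      proof -
        have "X i j div n = i + 1" "X i j mod n = j"
          using that div_mult_self4[of n "i + 1" j] mod_mult_self4[of n "i + 1" j] unfolding X_def by simp_all
        then show ?thesis using Xlt[OF that] unfolding f_def by simp
      qed
      have fC: "f (C i) = c i" if "i < r" for i using that unfolding f_def C_def by simp
      have fB: "f (B l) = b l" for l unfolding f_def B_def by simp
      have "f k \<in> univ M" if k: "k \<in> {n..<N}" for k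
      proof -
        consider "k < n * (r + 1)" | "n * (r + 1) \<le> k" "k < n * (r + 1) + r" | "n * (r + 1) + r \<le> k" by linarith
        then show ?thesis
        proof cases
          case 1
          have n: "n > 0" using 1 by (cases n) auto
          have "k div n < r + 1" using 1 n by (simp add: less_mult_imp_div_less mult.commute)
          moreover have "1 \<le> k div n" using k n by (simp add: div_greater_zero_iff Suc_leI)
          ultimately show ?thesis using x n 1 unfolding f_def by simp
        next
          case 2
          then show ?thesis using c unfolding f_def by auto
        next
          case 3
          then show ?thesis using b k unfolding f_def N_def by auto
        qed
      qed
      then have "P f" using l by blast
      moreover have "msum M (A l) (\<lambda>j. f (X i j)) n = msum M (A l) (x i) n" if "i < r" for i l
        using fX that by (intro msum_cong) simp
      ultimately show "\<exists>y. (\<forall>j<n. y j \<in> univ M) \<and> (\<forall>l<m. msum M (A l) y n = b l) \<and>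
            (\<forall>i<r. \<forall>j<n. mL (ps ! i) M (msub M (y j) (x i j)) (c i))"
        unfolding P_def using fC fB fX c eq by simp
    qed
  next
    assume r: ?R
    show "\<forall>f. (\<forall>k\<in>{n..<N}. f k \<in> univ M) \<longrightarrow> P f"
    proof (intro allI impI)
      fix f assume f: "\<forall>k\<in>{n..<N}. f k \<in> univ M"
      show "P f" unfolding P_def
      proof (intro impI)
        assume h: "(\<forall>i<r. f (C i) \<noteq> mzero M) \<and> (\<forall>i<r. \<forall>l<m. msum M (A l) (\<lambda>j. f (X i j)) n = f (B l))"
        show "\<exists>y. (\<forall>j<n. y j \<in> univ M) \<and> (\<forall>l<m. msum M (A l) y n = f (B l)) \<and>
           (\<forall>i<r. \<forall>j<n. mL (ps ! i) M (msub M (y j) (f (X i j))) (f (C i)))"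
          using r[rule_format, of "\<lambda>l. f (B l)" "\<lambda>i. f (C i)" "\<lambda>i j. f (X i j)"] f h rng rngC rngB by blast
      qed
    qed
  qed
  finally show ?thesis .
qed

lemma fm_in_simps [simp]:
  "fm_in L (Conj As) \<longleftrightarrow> (\<forall>A\<in>set As. fm_in L A)"
  "fm_in L (Disj As) \<longleftrightarrow> (\<forall>A\<in>set As. fm_in L A)"
  "fm_in L (Alls ns B) \<longleftrightarrow> fm_in L B"
  "fm_in L (Exs ns B) \<longleftrightarrow> fm_in L B"
proof -
  show "fm_in L (Conj As) \<longleftrightarrow> (\<forall>A\<in>set As. fm_in L A)" by (induction As) (auto simp: Conj_def)
  show "fm_in L (Disj As) \<longleftrightarrow> (\<forall>A\<in>set As. fm_in L A)" by (induction As) (auto simp: Disj_def)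
  show "fm_in L (Alls ns B) \<longleftrightarrow> fm_in L B" by (induction ns) (auto simp: Alls_def)
  show "fm_in L (Exs ns B) \<longleftrightarrow> fm_in L B" by (induction ns) (auto simp: Exs_def)
qed

lemma fv_simps [simp]:
  "fv (Conj As) = (\<Union>A\<in>set As. fv A)"
  "fv (Disj As) = (\<Union>A\<in>set As. fv A)"
  "fv (Alls ns B) = fv B - set ns"
  "fv (Exs ns B) = fv B - set ns"
proof -
  show "fv (Conj As) = (\<Union>A\<in>set As. fv A)" by (induction As) (auto simp: Conj_def)
  show "fv (Disj As) = (\<Union>A\<in>set As. fv A)" by (induction As) (auto simp: Disj_def)
  show "fv (Alls ns B) = fv B - set ns" by (induction ns) (auto simp: Alls_def)
  show "fv (Exs ns B) = fv B - set ns" by (induction ns) (auto simp: Exs_def)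
qed

lemma lang_simps [simp]:
  "(Plus, Suc (Suc 0)) \<in> fst (lang_kS S0 S1)" "(Zero, 0) \<in> fst (lang_kS S0 S1)" "(One, 0) \<in> fst (lang_kS S0 S1)"
  "(Scale c, Suc 0) \<in> fst (lang_kS S0 S1)"
  "(RL p, Suc (Suc 0)) \<in> snd (lang_kS S0 S1) \<longleftrightarrow> p \<in> S0"
  "(RM p, Suc (Suc (Suc 0))) \<in> snd (lang_kS S0 S1) \<longleftrightarrow> p \<in> S1"
  "(RQ p n, Suc 0) \<in> snd (lang_kS S0 S1) \<longleftrightarrow> p \<in> S1 \<and> n \<ge> 1"
  by (auto simp: lang_kS_def lang_k_def)

lemma T_vs_sentences: "A \<in> T_vs \<Longrightarrow> sentence_in (lang_kS S0 S1) A"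
  by (auto simp: T_vs_def sentence_in_def)

lemma T_fin_sentences: "p \<in> S0 \<Longrightarrow> A \<in> T_fin p \<Longrightarrow> sentence_in (lang_kS S0 S1) A"
  unfolding T_fin_def by (elim UnE; (erule T_vs_sentences)?) (auto simp: sentence_in_def simp del: upt_Suc split: if_splits)

lemma T_real_sentences: "p \<in> S0 \<Longrightarrow> A \<in> T_real p \<Longrightarrow> sentence_in (lang_kS S0 S1) A"
  unfolding T_real_def by (elim UnE; (erule T_vs_sentences)?) (auto simp: sentence_in_def fle_def)

lemma T_fin_plus_sentences: "p \<in> S0 \<Longrightarrow> p \<in> S1 \<Longrightarrow> A \<in> T_fin_plus p \<Longrightarrow> sentence_in (lang_kS S0 S1) A"
  unfolding T_fin_plus_def
  by (elim UnE; (erule (1) T_fin_sentences)?) (auto simp: sentence_in_def multiple_chain_def simp del: upt_Suc split: if_splits)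

lemma tlin_in [simp]: "trm_in (lang_kS S0 S1) (tlin c f n)" "fvt (tlin c f n) = f ` {..<n}"
  by (induction n) (auto simp: lessThan_Suc)

lemma weak_approx_sentence:
  assumes "set ps \<subseteq> S0"
  shows "sentence_in (lang_kS S0 S1) (weak_approx ps m n A)"
proof -
  have 1: "n * (i + 1) + j < n * (length ps + 1)" if "i < length ps" "j < n" for i j
  proof -
    have "n * (i + 1) + j < n * (i + 2)" using that by (simp add: algebra_simps)
    also have "\<dots> \<le> n * (length ps + 1)" using that by (intro mult_le_mono2) simp
    finally show ?thesis .
  qed
  have "fm_in (lang_kS S0 S1) (weak_approx ps m n A)"
    using assms by (auto simp: weak_approx_def Let_def lin_sys_def)
  moreover have "fv (weak_approx ps m n A) = {}"
    using 1 by (fastforce simp: weak_approx_def Let_def lin_sys_def)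
  ultimately show ?thesis unfolding sentence_in_def by blast
qed

theorem T_kS_sentences:
  assumes "S1 \<subseteq> S0" "A \<in> T_kS S0 S1"
  shows "sentence_in (lang_kS S0 S1) A"
proof -
  consider "A \<in> T_vs" | p where "p \<in> S0" "A \<in> T_real p" | p where "p \<in> S0" "A \<in> T_fin p"
    | p where "p \<in> S1" "A \<in> T_fin_plus p" | ps m n B where "set ps \<subseteq> S0" "A = weak_approx ps m n B"
    using assms(2) unfolding T_kS_def T_place_def by (auto split: if_splits)
  then show ?thesis
  proof cases
    case 1
    then show ?thesis by (rule T_vs_sentences)
  next
    case 2
    then show ?thesis by (rule T_real_sentences)
  next
    case 3
    then show ?thesis by (rule T_fin_sentences)
  next
    case 4
    then show ?thesis using T_fin_plus_sentences[OF subsetD[OF assms(1) 4(1)]] by blast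
  next
    case 5
    then show ?thesis using weak_approx_sentence by simp
  qed
qed


subsection \<open>The empty set of places\<close>

definition deg_struct :: "'k::field set \<Rightarrow> ('k fsym, 'k rsym, 'k) struct" where
  "deg_struct U = \<lparr>univ = U, fint = (\<lambda>f xs. case f of Plus \<Rightarrow> xs ! 0 + xs ! 1 | Zero \<Rightarrow> 0 | One \<Rightarrow> 0
      | Scale c \<Rightarrow> c * xs ! 0), rint = (\<lambda>R xs. False)\<rparr>"

theorem T_kS_empty:
  "\<not> model_complete TYPE('k::field) (lang_kS {} {} :: ('k fsym, 'k rsym) lang) (T_kS {} {})"
  "\<not> quantifier_elimination TYPE('k) (lang_kS {} {} :: ('k fsym, 'k rsym) lang) (T_kS {} {})"
  "\<not> complete_theory TYPE('k) (lang_kS {} {} :: ('k fsym, 'k rsym) lang) (T_kS {} {})"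
proof -
  let ?L = "lang_kS {} {} :: ('k fsym, 'k rsym) lang" and ?T = "T_kS {} {} :: 'k form set"
  let ?M = "deg_struct {0::'k}" and ?N = "deg_struct (UNIV :: 'k set)"
  have T: "?T = T_vs" by (auto simp: T_kS_def)
  have L: "fst ?L = {(Plus, 2), (Zero, 0), (One, 0)} \<union> {(Scale c, 1) | c. True}" "snd ?L = {}"
    by (auto simp: lang_kS_def lang_k_def)
  have sM: "struct_in ?L (deg_struct U)" if "U = {0} \<or> U = UNIV" for U :: "'k set"
    using that by (auto simp: struct_in_def L deg_struct_def numeral_2_eq_2 length_Suc_conv)
  have mT: "models (deg_struct U) ?T" if "U = {0} \<or> U = UNIV" for U :: "'k set"
  proof -
    have "vector_space_struct (deg_struct U)"
      using that by (auto simp: vector_space_struct_def deg_struct_def algebra_simps)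
    then show ?thesis using models_T_vs[of "deg_struct U"] sM[OF that] unfolding T struct_in_lang_k by blast
  qed
  have ss: "substruct ?L ?M ?N" by (auto simp: substruct_def L deg_struct_def)
  let ?A = "Ex 0 (Neg (Eq (V 0) tzero)) :: 'k form" and ?e = "\<lambda>n::nat. 0::'k"
  have A: "sentence_in ?L ?A" by (auto simp: sentence_in_def)
  have AM: "\<not> sat ?M e ?A" and AN: "sat ?N e ?A" for e
    by (auto simp: deg_struct_def intro: exI[of _ 1])
  show "\<not> model_complete TYPE('k) ?L ?T"
  proof
    assume "model_complete TYPE('k) ?L ?T"
    then have "elem_substruct ?L ?M ?N" unfolding model_complete_def using sM mT ss by blast
    moreover have "range ?e \<subseteq> univ ?M" by (auto simp: deg_struct_def)
    ultimately have "sat ?M ?e ?A \<longleftrightarrow> sat ?N ?e ?A"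
      using A unfolding elem_substruct_def sentence_in_def by blast
    then show False using AM AN by blast
  qed
  have tz: "evalt (deg_struct U) ?e t = 0" if "trm_in ?L t" for U t
    using that
  proof (induction t)
    case (Fun f ts)
    then show ?case by (cases f) (auto simp: deg_struct_def L numeral_2_eq_2 length_Suc_conv)
  qed simp
  have qf: "sat ?M ?e B \<longleftrightarrow> sat ?N ?e B" if "qfree B" "fm_in ?L B" for B
    using that by (induction B) (auto simp: tz L)
  have re: "range ?e \<subseteq> univ (deg_struct U)" if "U = {0} \<or> U = UNIV" for U using that by (auto simp: deg_struct_def)
  show "\<not> quantifier_elimination TYPE('k) ?L ?T"
  proof
    assume "quantifier_elimination TYPE('k) ?L ?T"
    then obtain B where B: "fm_in ?L B" "qfree B" "entails TYPE('k) ?L ?T (Iff ?A B)"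
      using A unfolding quantifier_elimination_def sentence_in_def by blast
    have "sat (deg_struct U) ?e (Iff ?A B)" if "U = {0} \<or> U = UNIV" for U
      using B(3) sM[OF that] mT[OF that] re[OF that] unfolding entails_def by blast
    then have "sat ?M ?e (Iff ?A B)" "sat ?N ?e (Iff ?A B)" by blast+
    then have "sat ?M ?e ?A \<longleftrightarrow> sat ?M ?e B" "sat ?N ?e ?A \<longleftrightarrow> sat ?N ?e B" unfolding sat.simps by blast+
    then show False using AM AN qf[OF B(2,1)] by blast
  qed
  show "\<not> complete_theory TYPE('k) ?L ?T"
  proof
    assume "complete_theory TYPE('k) ?L ?T"
    then consider "entails TYPE('k) ?L ?T ?A" | "entails TYPE('k) ?L ?T (Neg ?A)"
      using A unfolding complete_theory_def by blast
    then show False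
    proof cases
      case 1
      then have "sat ?M ?e ?A" using sM[of "{0}"] mT[of "{0}"] re[of "{0}"] unfolding entails_def by blast
      then show False using AM by blast
    next
      case 2
      then have "sat ?N ?e (Neg ?A)" using sM[of UNIV] mT[of UNIV] re[of UNIV] unfolding entails_def by blast
      then show False using AN by simp
    qed
  qed
qed

end

theory Submission
  imports Defs "HOL-Computational_Algebra.Fundamental_Theorem_Algebra" "HOL-Library.Function_Algebras"
    "HOL-Algebra.Multiplicative_Group"
begin

text \<open>The idea is a back-and-forth argument with bounded complexity, which needs no compactness. Tuples in two
models agree at a place up to complexity \<open>H\<close> if the signs of their entries coincide (real places), if the values of
the entries compare in the same way up to shifts by at most \<open>H\<close> (finite places), or if the values satisfy the same
Presburger atoms bounded by \<open>H\<close> (finite places in \<open>S1\<close>). Given terms \<open>t = c x + t'\<close> and \<open>H\<close>, there are finitely many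
terms without \<open>x\<close> and a complexity such that agreement on these allows one to match every \<open>x\<close> in one model by
some \<open>y\<close> in the other: either \<open>x\<close> is a root of some \<open>t\<close>, or one finds an open set of suitable \<open>y\<close> at each place
separately and intersects them by the weak approximation axiom. So the truth of a formula depends only on
agreement at finitely many places up to some complexity. Agreement is preserved by embeddings, which gives model
completeness, and amounts to finitely many atomic formulas if \<open>S1\<close> is empty, which gives quantifier elimination.
Completeness follows as the field \<open>k\<close>, with its places, is a model that embeds in every other one; it satisfies
the weak approximation scheme by the Artin-Whaples theorem. Ostrowski's theorem shows that the infinite places
that are not complex are real.\<close>

section \<open>Back and forth for Z-groups\<close>

text \<open>Agreement is measured on finitely many linear terms. If \<open>x\<close> occurs in a
  term, the term is \<open>c (x - a)\<close> with a center \<open>a\<close> free of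
  \<open>x\<close>, so the local problem is the position of \<open>x\<close> relative to finitely
  many centers. At a finite place the ultrametric inequality reduces all values
  \<open>v(x - a)\<close> to one new value \<open>v(x - c)\<close>, for a center \<open>c\<close>
  near \<open>x\<close>, together with the values \<open>v(c - a)\<close> of terms without
  \<open>x\<close>. Extending vectors thus becomes extending values, a problem on discrete orders,
  or on Z-groups at places of \<open>S1\<close>. The way back needs a point \<open>y\<close> in the
  second model such that \<open>y - c\<close> and \<open>c - a\<close> do not cancel. An infinite
  residue field supplies one by avoiding finitely many residues; a finite one does not, and there
  the centers \<open>a + w (a' - a)\<close>, with \<open>w\<close> running through residue
  representatives, are added beforehand. All bounds must depend on the formula alone and not on the
  two models: hence the explicit levels \<open>zlevel\<close>, \<open>sublevel\<close> and
  \<open>extlevel\<close>.\<close>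

locale zgroup = comm_group G for G :: "('a::order, 'b) monoid_scheme" (structure) +
  fixes \<epsilon> :: 'a
  assumes eps: "\<epsilon> \<in> carrier G" "\<one> < \<epsilon>"
    and total: "x \<in> carrier G \<Longrightarrow> y \<in> carrier G \<Longrightarrow> x \<le> y \<or> y \<le> x"
    and mono: "x \<in> carrier G \<Longrightarrow> y \<in> carrier G \<Longrightarrow> z \<in> carrier G \<Longrightarrow> x \<le> y \<Longrightarrow> x \<otimes> z \<le> y \<otimes> z"
    and least: "x \<in> carrier G \<Longrightarrow> \<one> < x \<Longrightarrow> \<epsilon> \<le> x"
    and division: "n \<ge> 1 \<Longrightarrow> x \<in> carrier G \<Longrightarrow>
      \<exists>y\<in>carrier G. \<exists>i\<in>{1..n}. x = y [^] n \<otimes> \<epsilon> [^] (i::int)"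

text \<open>A Presburger term written multiplicatively: an integer combination of the entries plus
  \<open>c\<close> times the least positive element. The order is the one of the carrier type,
  because the value groups will consist of sets ordered by inclusion.\<close>

definition zlin :: "('a, 'b) monoid_scheme \<Rightarrow> 'a \<Rightarrow> 'i set \<Rightarrow> ('i \<Rightarrow> 'a) \<Rightarrow> ('i \<Rightarrow> int) \<Rightarrow> int \<Rightarrow> 'a" where
  "zlin G \<epsilon> X w n c = (\<Otimes>\<^bsub>G\<^esub>i\<in>X. w i [^]\<^bsub>G\<^esub> n i) \<otimes>\<^bsub>G\<^esub> \<epsilon> [^]\<^bsub>G\<^esub> c"

definition zdvd :: "('a, 'b) monoid_scheme \<Rightarrow> int \<Rightarrow> 'a \<Rightarrow> bool" where
  "zdvd G m x \<longleftrightarrow> (\<exists>y\<in>carrier G. x = y [^]\<^bsub>G\<^esub> m)"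

text \<open>Two tuples satisfy the same Presburger atoms with coefficients and moduli bounded by \<open>H\<close>.\<close>

definition zsim :: "int \<Rightarrow> 'i set \<Rightarrow> ('a::order, 'b) monoid_scheme \<Rightarrow> 'a \<Rightarrow> ('i \<Rightarrow> 'a) \<Rightarrow>
    ('c::order, 'd) monoid_scheme \<Rightarrow> 'c \<Rightarrow> ('i \<Rightarrow> 'c) \<Rightarrow> bool" where
  "zsim H X G \<epsilon> w G' \<epsilon>' w' \<longleftrightarrow> (\<forall>n c. (\<forall>i\<in>X. \<bar>n i\<bar> \<le> H) \<longrightarrow> \<bar>c\<bar> \<le> H \<longrightarrow>
     (\<one>\<^bsub>G\<^esub> \<le> zlin G \<epsilon> X w n c \<longleftrightarrow> \<one>\<^bsub>G'\<^esub> \<le> zlin G' \<epsilon>' X w' n c) \<and>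
     (\<forall>m\<in>{1..H}. zdvd G m (zlin G \<epsilon> X w n c) \<longleftrightarrow> zdvd G' m (zlin G' \<epsilon>' X w' n c)))"

lemma zsim_pos:
  "zsim H X G \<epsilon> w G' \<epsilon>' w' \<Longrightarrow> (\<And>i. i \<in> X \<Longrightarrow> \<bar>n i\<bar> \<le> H) \<Longrightarrow> \<bar>c\<bar> \<le> H \<Longrightarrow>
    \<one>\<^bsub>G\<^esub> \<le> zlin G \<epsilon> X w n c \<longleftrightarrow> \<one>\<^bsub>G'\<^esub> \<le> zlin G' \<epsilon>' X w' n c"
  and zsim_dvd:
  "zsim H X G \<epsilon> w G' \<epsilon>' w' \<Longrightarrow> (\<And>i. i \<in> X \<Longrightarrow> \<bar>n i\<bar> \<le> H) \<Longrightarrow> \<bar>c\<bar> \<le> H \<Longrightarrow> 1 \<le> m \<Longrightarrow> m \<le> H \<Longrightarrow>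
    zdvd G m (zlin G \<epsilon> X w n c) \<longleftrightarrow> zdvd G' m (zlin G' \<epsilon>' X w' n c)"
  unfolding zsim_def by auto

lemma zsim_sym: "zsim H X G \<epsilon> w G' \<epsilon>' w' \<Longrightarrow> zsim H X G' \<epsilon>' w' G \<epsilon> w"
  unfolding zsim_def by auto

lemma zsim_mono_level: "zsim H' X G \<epsilon> w G' \<epsilon>' w' \<Longrightarrow> H \<le> H' \<Longrightarrow> zsim H X G \<epsilon> w G' \<epsilon>' w'"
  unfolding zsim_def by (meson atLeastAtMost_iff order_trans)

context zgroup
begin

abbreviation "lin \<equiv> zlin G \<epsilon>"

lemma lin_closed [simp]: "(\<And>i. i \<in> X \<Longrightarrow> w i \<in> carrier G) \<Longrightarrow> lin X w n c \<in> carrier G"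
  unfolding zlin_def using eps(1) by (auto intro!: finprod_closed)

lemma lin_add:
  assumes "\<And>i. i \<in> X \<Longrightarrow> w i \<in> carrier G"
  shows "lin X w n c \<otimes> lin X w n' c' = lin X w (\<lambda>i. n i + n' i) (c + c')"
proof -
  have "(\<Otimes>i\<in>X. w i [^] (n i + n' i)) = (\<Otimes>i\<in>X. w i [^] n i) \<otimes> (\<Otimes>i\<in>X. w i [^] n' i)"
  proof -
    have "(\<Otimes>i\<in>X. w i [^] (n i + n' i)) = (\<Otimes>i\<in>X. w i [^] n i \<otimes> w i [^] n' i)"
      by (intro finprod_cong') (use assms in \<open>auto simp: int_pow_mult\<close>)
    then show ?thesis using assms by (simp add: Pi_def)
  qed
  moreover have "(\<Otimes>i\<in>X. w i [^] n i) \<in> carrier G" "(\<Otimes>i\<in>X. w i [^] n' i) \<in> carrier G"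
    using assms by (auto intro!: finprod_closed)
  ultimately show ?thesis
    unfolding zlin_def using eps(1) by (simp add: int_pow_mult m_ac)
qed

lemma lin_pow:
  assumes "\<And>i. i \<in> X \<Longrightarrow> w i \<in> carrier G"
  shows "lin X w n c [^] (k::int) = lin X w (\<lambda>i. n i * k) (c * k)"
proof -
  have "(\<Otimes>i\<in>X. w i [^] n i) [^] k = (\<Otimes>i\<in>X. w i [^] (n i * k))"
    using assms
  proof (induction X rule: infinite_finite_induct)
    case (insert x F)
    then have "(\<Otimes>i\<in>F. w i [^] n i) \<in> carrier G" by (auto intro!: finprod_closed)
    with insert show ?case
      by (subst (1 2) finprod_insert) (auto simp: int_pow_distrib int_pow_pow)
  qed auto
  moreover have "(\<Otimes>i\<in>X. w i [^] n i) \<in> carrier G" using assms by (auto intro!: finprod_closed)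
  ultimately show ?thesis
    unfolding zlin_def using eps(1) by (simp add: int_pow_distrib int_pow_pow)
qed

lemma lin_eps: "lin X w (\<lambda>_. 0) c = \<epsilon> [^] c"
  unfolding zlin_def using eps(1) by simp

lemma lin_single:
  assumes "finite X" "\<And>i. i \<in> X \<Longrightarrow> w i \<in> carrier G" "j \<in> X"
  shows "lin X w (\<lambda>i. if i = j then 1 else 0) 0 = w j"
proof -
  have "(\<Otimes>i\<in>X. w i [^] (if i = j then 1 else 0::int)) = (\<Otimes>i\<in>X. if j = i then w i else \<one>)"
    using assms(2) by (intro finprod_cong') auto
  also have "\<dots> = w j" using finprod_singleton[of j X w] assms by auto
  finally show ?thesis unfolding zlin_def using assms by simp
qed

lemma lin_option:
  assumes "finite X" "\<And>i. i \<in> X \<Longrightarrow> w i \<in> carrier G" "z \<in> carrier G"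
  shows "lin (insert None (Some ` X)) (case_option z w) n c = z [^] n None \<otimes> lin X w (n \<circ> Some) c"
proof -
  have "(\<Otimes>i\<in>Some ` X. (case i of None \<Rightarrow> z | Some j \<Rightarrow> w j) [^] n i) = (\<Otimes>i\<in>X. w i [^] (n (Some i)))"
    by (subst finprod_reindex) (use assms in \<open>auto intro!: finprod_cong\<close>)
  moreover have "(\<Otimes>i\<in>X. w i [^] n (Some i)) \<in> carrier G" using assms by (auto intro!: finprod_closed)
  ultimately show ?thesis
    unfolding zlin_def using assms eps(1)
    by (subst finprod_insert) (auto simp: m_assoc)
qed

text \<open>Exponents add up along the fibres of \<open>g\<close>: coefficients grow at most by the
  factor \<open>card X\<close>, and the shifts \<open>d t\<close> all go into the constant. This is
  the source of the product in \<open>sublevel\<close>.\<close>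

lemma lin_subst:
  assumes "finite X" "\<And>t. t \<in> X \<Longrightarrow> g t \<in> Y" "finite Y" "\<And>i. i \<in> Y \<Longrightarrow> w i \<in> carrier G"
    and "\<And>t. t \<in> X \<Longrightarrow> u t = w (g t) \<otimes> \<epsilon> [^] (d t)"
  shows "lin X u n c = lin Y w (\<lambda>y. \<Sum>t\<in>{t\<in>X. g t = y}. n t) (c + (\<Sum>t\<in>X. n t * d t))"
  using assms(1,2,5)
proof (induction X arbitrary: c rule: finite_induct)
  case empty
  then show ?case by (simp add: zlin_def assms(4))
next
  case (insert t X)
  have ut: "u s \<in> carrier G" if "s \<in> insert t X" for s using insert that assms(4) eps(1) by auto
  have uc: "lin X u n c \<in> carrier G" using ut by simp
  have fp: "(\<Otimes>i\<in>X. u i [^] n i) \<in> carrier G" using ut by (auto intro!: finprod_closed)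
  have gt: "g t \<in> Y" "w (g t) \<in> carrier G" using insert assms(4) by auto
  have 1: "lin (insert t X) u n c = u t [^] n t \<otimes> lin X u n c"
    unfolding zlin_def using insert(1,2) ut eps(1) fp by (subst finprod_insert) (auto simp: m_assoc)
  have "w (g t) = lin Y w (\<lambda>y. if y = g t then 1 else 0) 0"
    using lin_single[of Y w "g t"] assms(3,4) gt by simp
  then have ut': "u t = lin Y w (\<lambda>y. if y = g t then 1 else 0) (d t)"
    using insert.prems(2)[of t] lin_eps[of Y w "d t"] lin_add[of Y w "\<lambda>y. if y = g t then 1 else 0" 0 "\<lambda>_. 0" "d t"] assms(4)
    by simp
  have IH: "lin X u n c = lin Y w (\<lambda>y. \<Sum>t\<in>{t\<in>X. g t = y}. n t) (c + (\<Sum>t\<in>X. n t * d t))"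
    using insert by auto
  have "lin (insert t X) u n c = lin Y w (\<lambda>y. (if y = g t then 1 else 0) * n t + (\<Sum>t\<in>{t\<in>X. g t = y}. n t))
      (d t * n t + (c + (\<Sum>t\<in>X. n t * d t)))"
    unfolding 1 ut' IH using assms(4) by (simp add: lin_pow lin_add)
  moreover have "(if y = g t then 1 else 0) * n t + (\<Sum>t\<in>{t\<in>X. g t = y}. n t) = (\<Sum>s\<in>{s\<in>insert t X. g s = y}. n s)" for y
  proof (cases "y = g t")
    case True
    then have "{s\<in>insert t X. g s = y} = insert t {s\<in>X. g s = y}" by auto
    then show ?thesis using insert(1,2) True by simp
  next
    case False
    then have "{s\<in>insert t X. g s = y} = {s\<in>X. g s = y}" by auto
    then show ?thesis using False by simp
  qed
  moreover have "d t * n t + (c + (\<Sum>t\<in>X. n t * d t)) = c + (\<Sum>t\<in>insert t X. n t * d t)"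
    using insert(1,2) by (simp add: algebra_simps)
  ultimately show ?case by simp
qed

lemma strict_mono_mult:
  assumes "x \<in> carrier G" "y \<in> carrier G" "z \<in> carrier G" "x < y"
  shows "x \<otimes> z < y \<otimes> z"
  using assms mono[of x y z] right_cancel[of z x y] by (simp add: order_less_le)

lemma le_iff_quotient:
  assumes "x \<in> carrier G" "y \<in> carrier G"
  shows "x \<le> y \<longleftrightarrow> \<one> \<le> y \<otimes> inv x"
  using mono[of x y "inv x"] mono[of \<one> "y \<otimes> inv x" x] assms by (auto simp: m_assoc)

lemma pow_gt_one:
  assumes "x \<in> carrier G" "\<one> < x" "(k::int) \<ge> 1"
  shows "\<one> < x [^] k"
  using assms(3)
proof (induction k rule: int_ge_induct)
  case base
  then show ?case using assms by simp
next
  case (step i)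
  have "\<one> \<otimes> x < x [^] i \<otimes> x" using assms(1) step by (intro strict_mono_mult) auto
  then show ?case using assms by (simp add: int_pow_mult)
qed

lemma pow_ge_one_iff:
  assumes "x \<in> carrier G" "(k::int) \<ge> 1"
  shows "\<one> \<le> x [^] k \<longleftrightarrow> \<one> \<le> x"
proof
  assume "\<one> \<le> x"
  then show "\<one> \<le> x [^] k" using pow_gt_one[OF assms(1) _ assms(2)] by (cases "x = \<one>") (auto simp: order_less_le)
next
  assume l: "\<one> \<le> x [^] k"
  show "\<one> \<le> x"
  proof (rule ccontr)
    assume "\<not> \<one> \<le> x"
    then have "x < \<one>" using total[of \<one> x] assms by (auto simp: order_less_le)
    then have "\<one> < inv x" using strict_mono_mult[of x \<one> "inv x"] assms by auto
    then have "\<one> < inv x [^] k" using pow_gt_one assms by auto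
    then have "\<one> < inv (x [^] k)" using assms by (simp add: int_pow_inv)
    then have "x [^] k < \<one>" using strict_mono_mult[of \<one> "inv (x [^] k)" "x [^] k"] assms by auto
    then show False using l by auto
  qed
qed

lemma pow_inj:
  assumes "x \<in> carrier G" "y \<in> carrier G" "(k::int) \<ge> 1" "x [^] k = y [^] k"
  shows "x = y"
proof -
  have q: "(x \<otimes> inv y) [^] k = \<one>" "(y \<otimes> inv x) [^] k = \<one>"
    using assms by (simp_all add: int_pow_distrib int_pow_inv)
  have "\<one> \<le> x \<otimes> inv y" "\<one> \<le> y \<otimes> inv x"
    using pow_ge_one_iff[OF _ assms(3), of "x \<otimes> inv y"] pow_ge_one_iff[OF _ assms(3), of "y \<otimes> inv x"] q assms by auto
  then show ?thesis using le_iff_quotient assms by (meson order_antisym)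
qed

text \<open>An ordered group has no torsion, so roots are unique by \<open>pow_inj\<close>, and
  divisibility can be tested after raising to a power.\<close>

lemma zdvd_pow:
  assumes "x \<in> carrier G" "(k::int) \<ge> 1"
  shows "zdvd G (j * k) (x [^] k) \<longleftrightarrow> zdvd G j x"
proof
  assume "zdvd G (j * k) (x [^] k)"
  then obtain y where y: "y \<in> carrier G" "x [^] k = y [^] (j * k)" unfolding zdvd_def by auto
  then have "x [^] k = (y [^] j) [^] k" by (simp add: int_pow_pow)
  then show "zdvd G j x" unfolding zdvd_def using pow_inj[OF assms(1) _ assms(2)] y by blast
qed (use assms in \<open>auto simp: zdvd_def int_pow_pow\<close>)

lemma zdvd_shift:
  assumes "x \<in> carrier G" "g \<in> carrier G" "j dvd m"
  shows "zdvd G j (x \<otimes> g [^] (m::int)) \<longleftrightarrow> zdvd G j x"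
proof -
  obtain l where l: "m = l * j" using assms(3) by (metis dvd_def mult.commute)
  show ?thesis
  proof
    assume "zdvd G j x"
    then obtain y where "y \<in> carrier G" "x = y [^] j" unfolding zdvd_def by auto
    then have "x \<otimes> g [^] m = (y \<otimes> g [^] l) [^] j" using assms l by (simp add: int_pow_distrib int_pow_pow)
    then show "zdvd G j (x \<otimes> g [^] m)" unfolding zdvd_def using \<open>y \<in> carrier G\<close> assms by blast
  next
    assume "zdvd G j (x \<otimes> g [^] m)"
    then obtain y where y: "y \<in> carrier G" "x \<otimes> g [^] m = y [^] j" unfolding zdvd_def by auto
    have "x = (x \<otimes> g [^] m) \<otimes> inv (g [^] m)" using assms by (simp add: m_assoc)
    also have "\<dots> = (y \<otimes> inv (g [^] l)) [^] j"
      using assms y l by (simp add: int_pow_distrib int_pow_inv int_pow_pow)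
    finally show "zdvd G j x" unfolding zdvd_def using y assms by blast
  qed
qed

text \<open>The remainders \<open>1..m\<close> of the axiom become \<open>0..m-1\<close> by
  absorbing a full power of \<open>\<epsilon>\<close> into \<open>g\<close>.\<close>

lemma division_remainder:
  assumes "(m::int) \<ge> 1" "x \<in> carrier G"
  obtains g r where "g \<in> carrier G" "0 \<le> r" "r < m" "x = g [^] m \<otimes> \<epsilon> [^] (r::int)"
proof -
  obtain y i where y: "y \<in> carrier G" "i \<in> {1..m}" "x = y [^] m \<otimes> \<epsilon> [^] (i::int)"
    using division[OF assms] by auto
  show ?thesis
  proof (cases "i = m")
    case True
    then have "x = (y \<otimes> \<epsilon>) [^] m \<otimes> \<epsilon> [^] (0::int)" using y eps(1) by (simp add: int_pow_distrib)
    then show ?thesis by (intro that[of "y \<otimes> \<epsilon>" 0]) (use y(1) eps(1) assms(1) in auto)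
  next
    case False
    then show ?thesis by (intro that[of y i]) (use y in auto)
  qed
qed

lemma eps_pow_ge_one: "\<one> \<le> \<epsilon> [^] (c::int) \<longleftrightarrow> 0 \<le> c"
proof -
  have p: "\<one> < \<epsilon> [^] k" if "k \<ge> 1" for k :: int using pow_gt_one eps that by simp
  show ?thesis
  proof (cases "c \<ge> 0")
    case True
    then show ?thesis using p[of c] by (cases "c = 0") auto
  next
    case False
    then have "\<one> < \<epsilon> [^] (- c)" using p[of "- c"] by simp
    then have "\<epsilon> [^] c < \<one>" using strict_mono_mult[of \<one> "\<epsilon> [^] (- c)" "\<epsilon> [^] c"] eps(1) by (auto simp: int_pow_mult[symmetric])
    then show ?thesis using False by auto
  qed
qed

text \<open>Multiples of \<open>m\<close> split off, so let \<open>y\<close> be a root of the power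
  \<open>0 \<le> r < m\<close> of \<open>\<epsilon>\<close>. It is at least one; if it were larger,
  it would be at least \<open>\<epsilon>\<close>, and its power with exponent \<open>m\<close> would
  exceed the exponent \<open>r\<close>. Hence \<open>y\<close> is one and \<open>r\<close> is
  zero.\<close>

lemma zdvd_eps:
  assumes "(m::int) \<ge> 1"
  shows "zdvd G m (\<epsilon> [^] c) \<longleftrightarrow> m dvd c"
proof
  assume "zdvd G m (\<epsilon> [^] c)"
  then have "zdvd G m (\<epsilon> [^] (c mod m) \<otimes> (\<epsilon> [^] (c div m)) [^] m)"
    using eps(1) by (simp add: int_pow_pow int_pow_mult[symmetric])
  then have "zdvd G m (\<epsilon> [^] (c mod m))" using zdvd_shift[of _ _ m m] eps(1) by simp
  then obtain y where y: "y \<in> carrier G" "\<epsilon> [^] (c mod m) = y [^] m" unfolding zdvd_def by auto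
  have r: "0 \<le> c mod m" "c mod m < m" using assms by auto
  have "\<one> \<le> y [^] m" using eps_pow_ge_one[of "c mod m"] r y by simp
  then have "\<one> \<le> y" using pow_ge_one_iff y assms by blast
  moreover have "\<not> \<one> < y"
  proof
    assume "\<one> < y"
    then have "\<epsilon> \<le> y" using least y by simp
    then have "\<one> \<le> y \<otimes> inv \<epsilon>" using le_iff_quotient[of \<epsilon> y] y eps(1) by blast
    then have "\<one> \<le> (y \<otimes> inv \<epsilon>) [^] m" using pow_ge_one_iff[of "y \<otimes> inv \<epsilon>" m] y(1) eps(1) assms by auto
    also have "\<dots> = y [^] m \<otimes> inv (\<epsilon> [^] m)"
      using y(1) eps(1) by (simp add: int_pow_distrib int_pow_inv)
    also have "\<dots> = \<epsilon> [^] (c mod m - m)" unfolding y(2)[symmetric] using eps(1) by (simp only: int_pow_diff)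
    finally show False using eps_pow_ge_one[of "c mod m - m"] r by simp
  qed
  ultimately have "y = \<one>" by auto
  then have "\<epsilon> [^] (- (c mod m)) = \<one>" using y eps(1) by (simp add: int_pow_neg)
  then have "c mod m = 0" using eps_pow_ge_one[of "- (c mod m)"] r by simp
  then show "m dvd c" by auto
next
  assume "m dvd c"
  then obtain l where "c = l * m" by (metis dvd_def mult.commute)
  then show "zdvd G m (\<epsilon> [^] c)" unfolding zdvd_def using eps(1) by (auto intro!: bexI[of _ "\<epsilon> [^] l"] simp: int_pow_pow)
qed

text \<open>The offset \<open>s\<close> is the same in both groups, so that it can be transported.\<close>

lemma threshold_offset:
  assumes T: "finite T" "T \<noteq> {}" "\<And>t. t \<in> T \<Longrightarrow> f t \<in> carrier G" and u: "u \<in> carrier G" and m: "(m::int) \<ge> 1"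
  obtains t s g where "t \<in> T" "g \<in> carrier G" "u = f t \<otimes> \<epsilon> [^] s \<otimes> g [^] m" "\<bar>s\<bar> \<le> m"
    "(0 \<le> s \<and> f t \<otimes> \<epsilon> [^] s \<le> u \<and> (\<forall>t'\<in>T. f t' \<le> u \<longrightarrow> f t' \<le> f t)) \<or>
     (s < 0 \<and> (\<forall>t'\<in>T. \<not> f t' \<le> u \<and> f t \<le> f t'))"
proof -
  have max: "\<exists>t\<in>S. \<forall>t'\<in>S. f t' \<le> f t" and min: "\<exists>t\<in>S. \<forall>t'\<in>S. f t \<le> f t'" if "S \<subseteq> T" "S \<noteq> {}" for S
  proof -
    have "finite S" using that T finite_subset by blast
    then show "\<exists>t\<in>S. \<forall>t'\<in>S. f t' \<le> f t" using that(2,1)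
    proof (induction rule: finite_ne_induct)
      case (insert x F)
      then obtain t where t: "t \<in> F" "\<forall>t'\<in>F. f t' \<le> f t" by auto
      have tx: "f t \<in> carrier G" "f x \<in> carrier G" using insert t T(3) by auto
      from total[OF tx] show ?case
      proof
        assume "f t \<le> f x"
        then show ?thesis using t by (intro bexI[of _ x]) (auto intro: order_trans)
      qed (use t in \<open>auto intro!: bexI[of _ t]\<close>)
    qed auto
    show "\<exists>t\<in>S. \<forall>t'\<in>S. f t \<le> f t'" using \<open>finite S\<close> that(2,1)
    proof (induction rule: finite_ne_induct)
      case (insert x F)
      then obtain t where t: "t \<in> F" "\<forall>t'\<in>F. f t \<le> f t'" by auto
      have tx: "f t \<in> carrier G" "f x \<in> carrier G" using insert t T(3) by auto
      from total[OF tx(2,1)] show ?case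
      proof
        assume "f x \<le> f t"
        then show ?thesis using t by (intro bexI[of _ x]) (auto intro: order_trans)
      qed (use t in \<open>auto intro!: bexI[of _ t]\<close>)
    qed auto
  qed
  have step: "\<exists>g (r::int). g \<in> carrier G \<and> 0 \<le> r \<and> r < m \<and> u = f t \<otimes> \<epsilon> [^] r \<otimes> g [^] m \<and>
      u \<otimes> inv (f t) = g [^] m \<otimes> \<epsilon> [^] r" if t: "t \<in> T" for t
  proof -
    have "u \<otimes> inv (f t) \<in> carrier G" using t T(3) u by auto
    then obtain g r where g: "g \<in> carrier G" "0 \<le> r" "r < m" "u \<otimes> inv (f t) = g [^] m \<otimes> \<epsilon> [^] (r::int)"
      by (rule division_remainder[OF m])
    have "u = f t \<otimes> (u \<otimes> inv (f t))" using t T(3) u by (simp add: m_ac)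
    then have "u = f t \<otimes> \<epsilon> [^] r \<otimes> g [^] m" using g t T(3) eps(1) by (simp add: m_ac)
    then show ?thesis using g by blast
  qed
  \<comment> \<open>The order is discrete below one as well; applied to \<open>g\<close>, this turns
    a wrong sign into a deficit of a full power with exponent \<open>m\<close>.\<close>
  have less_inv: "h \<le> inv \<epsilon>" if "h \<in> carrier G" "\<not> \<one> \<le> h" for h
  proof -
    have "h < \<one>" using total[of h \<one>] that by (auto simp: order_less_le)
    then have "\<one> < inv h" using strict_mono_mult[of h \<one> "inv h"] that by auto
    then have "\<epsilon> \<le> inv h" using least that by auto
    then have "\<epsilon> \<otimes> (h \<otimes> inv \<epsilon>) \<le> inv h \<otimes> (h \<otimes> inv \<epsilon>)" using mono that eps(1) by auto
    moreover have "\<epsilon> \<otimes> (h \<otimes> inv \<epsilon>) = h" using that eps(1) by (metis m_lcomm r_inv r_one inv_closed)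
    moreover have "inv h \<otimes> (h \<otimes> inv \<epsilon>) = inv \<epsilon>" using that eps(1) by (simp add: m_assoc[symmetric])
    ultimately show ?thesis by simp
  qed
  show ?thesis
  proof (cases "\<exists>t\<in>T. f t \<le> u")
    case True
    then have ne: "{t\<in>T. f t \<le> u} \<subseteq> T" "{t\<in>T. f t \<le> u} \<noteq> {}" by auto
    obtain t where t: "t \<in> T" "f t \<le> u" "\<forall>t'\<in>T. f t' \<le> u \<longrightarrow> f t' \<le> f t"
      using max[OF ne] by auto
    obtain g r where g: "g \<in> carrier G" "0 \<le> r" "r < m" "u = f t \<otimes> \<epsilon> [^] r \<otimes> g [^] m"
      "u \<otimes> inv (f t) = g [^] m \<otimes> \<epsilon> [^] r" using step[OF t(1)] by blast
    \<comment> \<open>Otherwise the power of \<open>g\<close> is at most that of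
      \<open>\<epsilon>\<close> with exponent \<open>-m\<close>, and the remainder
      \<open>r < m\<close> cannot lift the quotient of \<open>u\<close> by \<open>f t\<close> back
      to one.\<close>
    have "\<one> \<le> g"
    proof (rule ccontr)
      assume "\<not> \<one> \<le> g"
      then have "\<one> \<le> inv \<epsilon> \<otimes> inv g" using less_inv[of g] g(1) eps(1) le_iff_quotient[of g "inv \<epsilon>"] by blast
      then have "\<one> \<le> (inv \<epsilon> \<otimes> inv g) [^] m" using pow_ge_one_iff[of "inv \<epsilon> \<otimes> inv g" m] g(1) m eps(1) by auto
      moreover have "\<one> \<le> g [^] m \<otimes> \<epsilon> [^] r" using t(2) le_iff_quotient[of "f t" u] g(5) u T(3) t(1) by auto
      ultimately have "\<one> \<otimes> \<one> \<le> (inv \<epsilon> \<otimes> inv g) [^] m \<otimes> (g [^] m \<otimes> \<epsilon> [^] r)"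
        using mono[of \<one> "(inv \<epsilon> \<otimes> inv g) [^] m" "g [^] m \<otimes> \<epsilon> [^] r"] g(1) eps(1) order_trans by fastforce
      also have "\<dots> = (inv (g [^] m) \<otimes> g [^] m) \<otimes> (\<epsilon> [^] r \<otimes> inv (\<epsilon> [^] m))"
        using g(1) eps(1) by (simp add: int_pow_distrib int_pow_inv m_ac del: l_inv)
      also have "\<dots> = \<epsilon> [^] (r - m)" using g(1) eps(1) by (simp add: int_pow_diff)
      finally show False using eps_pow_ge_one[of "r - m"] g(3) by simp
    qed
    then have "\<one> \<le> g [^] m" using pow_ge_one_iff g(1) m by blast
    then have "\<one> \<otimes> (f t \<otimes> \<epsilon> [^] r) \<le> g [^] m \<otimes> (f t \<otimes> \<epsilon> [^] r)"
      using g(1) eps(1) t(1) T(3) by (intro mono) auto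
    then have "f t \<otimes> \<epsilon> [^] r \<le> u" using g(1,4) eps(1) t(1) T(3) by (simp add: m_comm)
    then show ?thesis using that[of t g r] t g by auto
  next
    case False
    obtain t where t: "t \<in> T" "\<forall>t'\<in>T. f t \<le> f t'" using min[of T] T by auto
    obtain g r where g: "g \<in> carrier G" "0 \<le> r" "r < m" "u = f t \<otimes> \<epsilon> [^] r \<otimes> g [^] m" using step[OF t(1)] by blast
    \<comment> \<open>Below all thresholds the remainder is taken negative, so that the element with
      the same offset in the other group lies strictly below the image of the least
      threshold.\<close>
    have "u = f t \<otimes> \<epsilon> [^] (r - m) \<otimes> (g \<otimes> \<epsilon>) [^] m"
    proof -
      have "f t \<otimes> \<epsilon> [^] (r - m) \<otimes> (g \<otimes> \<epsilon>) [^] m = f t \<otimes> (\<epsilon> [^] (r - m) \<otimes> \<epsilon> [^] m) \<otimes> g [^] m"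
        using g(1) eps(1) t(1) T(3) by (simp add: int_pow_distrib m_ac)
      also have "\<dots> = u" using g eps(1) by (simp add: int_pow_mult[symmetric])
      finally show ?thesis by simp
    qed
    then show ?thesis using that[of t "g \<otimes> \<epsilon>" "r - m"] t g False eps(1) by auto
  qed
qed


lemma lin_le_iff:
  assumes "\<And>i. i \<in> X \<Longrightarrow> w i \<in> carrier G"
  shows "lin X w n c \<le> lin X w n' c' \<longleftrightarrow> \<one> \<le> lin X w (\<lambda>i. n' i - n i) (c' - c)"
proof -
  have "lin X w n' c' \<otimes> inv (lin X w n c) = lin X w n' c' \<otimes> lin X w n c [^] (- 1 :: int)"
    using assms by (simp add: int_pow_neg)
  also have "\<dots> = lin X w (\<lambda>i. n' i - n i) (c' - c)"
    using assms by (simp add: lin_pow lin_add)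
  finally show ?thesis using le_iff_quotient[OF lin_closed lin_closed, of X w X w n c n' c'] assms by simp
qed

lemma lin_cong: "(\<And>i. i \<in> X \<Longrightarrow> w i \<in> carrier G) \<Longrightarrow> (\<And>i. i \<in> X \<Longrightarrow> n i = n' i) \<Longrightarrow> lin X w n c = lin X w n' c"
  unfolding zlin_def by (intro arg_cong2[of _ _ _ _ "(\<otimes>)"] finprod_cong') auto

text \<open>Raising to the power \<open>A'\<close> makes the coefficient of \<open>z\<close> equal
  to plus or minus \<open>A\<close>, so the condition concerns only the power of \<open>z\<close>
  with exponent \<open>A\<close>. A negative coefficient gives an upper bound, which by discreteness
  is the failure of the lower bound one step above; hence the summand \<open>1\<close>. Only lower
  thresholds remain.\<close>

lemma pos_option_iff:
  assumes X: "\<And>i. i \<in> X \<Longrightarrow> w i \<in> carrier G" and z: "z \<in> carrier G"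
    and a: "a \<noteq> 0" and A: "A = \<bar>a\<bar> * A'" "A' \<ge> 1"
  shows "\<one> \<le> z [^] (a::int) \<otimes> lin X w n c \<longleftrightarrow>
    (if a > 0 then lin X w (\<lambda>i. - (n i * A')) (- (c * A')) \<le> z [^] A
     else \<not> lin X w (\<lambda>i. n i * A') (c * A' + 1) \<le> z [^] A)"
proof -
  note cl = lin_closed[of X w, OF X]
  define L where "L = lin X w (\<lambda>i. n i * A') (c * A')"
  have L: "L \<in> carrier G" unfolding L_def by (rule cl)
  have "\<one> \<le> z [^] a \<otimes> lin X w n c \<longleftrightarrow> \<one> \<le> (z [^] a \<otimes> lin X w n c) [^] A'"
    using pow_ge_one_iff[OF _ A(2)] z cl by simp
  also have "(z [^] a \<otimes> lin X w n c) [^] A' = z [^] (a * A') \<otimes> L"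
    using z cl lin_pow[of X w, OF X] unfolding L_def by (simp add: int_pow_distrib int_pow_pow)
  finally have 1: "\<one> \<le> z [^] a \<otimes> lin X w n c \<longleftrightarrow> \<one> \<le> z [^] (a * A') \<otimes> L" .
  have inv: "inv L = lin X w (\<lambda>i. - (n i * A')) (- (c * A'))"
    using lin_pow[of X w "\<lambda>i. n i * A'" "c * A'" "- 1", OF X] L unfolding L_def by (simp add: int_pow_neg)
  show ?thesis
  proof (cases "a > 0")
    case True
    then have "z [^] (a * A') \<otimes> L = z [^] A \<otimes> inv (inv L)" using A L by simp
    then have "\<one> \<le> z [^] a \<otimes> lin X w n c \<longleftrightarrow> inv L \<le> z [^] A"
      using 1 le_iff_quotient[of "inv L" "z [^] A"] z L by simp
    then show ?thesis using True inv by simp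
  next
    case False
    then have "z [^] (a * A') = inv (z [^] A)" using A z a by (simp add: int_pow_neg[symmetric])
    then have "\<one> \<le> z [^] (a * A') \<otimes> L \<longleftrightarrow> z [^] A \<le> L"
      using le_iff_quotient[of "z [^] A" L] z L by (simp add: m_comm)
    also have "\<dots> \<longleftrightarrow> \<not> L \<otimes> \<epsilon> \<le> z [^] A"
    proof
      assume l: "z [^] A \<le> L"
      have "L < L \<otimes> \<epsilon>" using strict_mono_mult[of \<one> \<epsilon> L] eps L by (simp add: m_comm)
      then show "\<not> L \<otimes> \<epsilon> \<le> z [^] A" using l by auto
    next
      assume n: "\<not> L \<otimes> \<epsilon> \<le> z [^] A"
      show "z [^] A \<le> L"
      proof (rule ccontr)
        assume "\<not> z [^] A \<le> L"
        then have "L < z [^] A" using total[of L "z [^] A"] L z by auto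
        then have "\<one> < z [^] A \<otimes> inv L" using strict_mono_mult[of L "z [^] A" "inv L"] L z by simp
        then have "\<epsilon> \<le> z [^] A \<otimes> inv L" using least L z by simp
        then have "\<epsilon> \<otimes> L \<le> z [^] A \<otimes> inv L \<otimes> L" using mono L z eps(1) by simp
        moreover have "z [^] A \<otimes> inv L \<otimes> L = z [^] A" using L z by (simp add: m_assoc)
        ultimately show False using n L eps(1) by (simp add: m_comm)
      qed
    qed
    also have "L \<otimes> \<epsilon> = lin X w (\<lambda>i. n i * A') (c * A' + 1)"
      using lin_add[of X w "\<lambda>i. n i * A'" "c * A'" "\<lambda>_. 0" 1, OF X] lin_eps[of X w 1] eps(1) unfolding L_def by simp
    finally show ?thesis using 1 False by simp
  qed
qed

text \<open>After raising to the power \<open>A\<close>, the power of \<open>z\<close> is replaced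
  by its linear representative; the factor that is a power with exponent \<open>m\<close> drops out
  modulo \<open>j * A\<close>, which divides \<open>m\<close>.\<close>

lemma dvd_option_iff:
  assumes X: "\<And>i. i \<in> X \<Longrightarrow> w i \<in> carrier G" and z: "z \<in> carrier G" and g: "g \<in> carrier G"
    and A: "A \<ge> 1" and zA: "z [^] A = lin X w nt ct \<otimes> g [^] (m::int)" "j * A dvd m"
  shows "zdvd G j (z [^] a \<otimes> lin X w n c) \<longleftrightarrow> zdvd G (j * A) (lin X w (\<lambda>i. nt i * a + n i * A) (ct * a + c * A))"
proof -
  note cl = lin_closed[of X w, OF X]
  have "zdvd G j (z [^] a \<otimes> lin X w n c) \<longleftrightarrow> zdvd G (j * A) ((z [^] a \<otimes> lin X w n c) [^] A)"
    using zdvd_pow[OF _ A, of "z [^] a \<otimes> lin X w n c" j] z cl by simp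
  also have "(z [^] a \<otimes> lin X w n c) [^] A = (z [^] A) [^] a \<otimes> lin X w n c [^] A"
    using z cl by (simp add: int_pow_distrib int_pow_pow mult.commute)
  also have "(z [^] A) [^] a = lin X w nt ct [^] a \<otimes> (g [^] a) [^] m"
    unfolding zA(1) using g cl by (simp add: int_pow_distrib int_pow_pow mult.commute)
  also have "lin X w nt ct [^] a \<otimes> (g [^] a) [^] m \<otimes> lin X w n c [^] A =
      lin X w (\<lambda>i. nt i * a + n i * A) (ct * a + c * A) \<otimes> (g [^] a) [^] m"
  proof -
    have "lin X w nt ct [^] a \<otimes> (g [^] a) [^] m \<otimes> lin X w n c [^] A =
        (lin X w nt ct [^] a \<otimes> lin X w n c [^] A) \<otimes> (g [^] a) [^] m"
      using g cl by (simp add: m_ac)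
    then show ?thesis using lin_pow[of X w, OF X] lin_add[of X w, OF X] by simp
  qed
  finally show ?thesis using zdvd_shift[OF _ _ zA(2)] g cl by simp
qed

end

text \<open>\<open>A\<close> is divisible by every nonzero coefficient of absolute value at most
  \<open>H\<close>, so that all conditions on a new element become conditions on its power with
  exponent \<open>A\<close>. \<open>B\<close> bounds the coefficients and constants of the resulting
  thresholds, its summand \<open>1\<close> coming from strict inequalities. \<open>m\<close> is
  divisible by all moduli \<open>j * A\<close> with \<open>j \<le> H\<close>. The sum bounds every
  linear term compared in \<open>zsim_extend\<close>.\<close>

definition zlevel :: "int \<Rightarrow> int" where
  "zlevel H = (let A = fact (nat H); B = A * H + 1; m = A * A in A * H + H * B + H * m + 2 * B + m + H)"

text \<open>Quantifier elimination for Presburger arithmetic in one step. The conditions on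
  \<open>z\<close> depend on its power \<open>u\<close> through the position of \<open>u\<close>
  among finitely many linear thresholds and its class modulo \<open>m\<close>. Both are reproduced
  by \<open>u'\<close>, which is again a power with exponent \<open>A\<close> because
  \<open>A\<close> divides \<open>m\<close>; its root is \<open>z'\<close>.\<close>

lemma zsim_extend:
  fixes G :: "('a::order, 'b) monoid_scheme" and G' :: "('c::order, 'd) monoid_scheme" and X :: "'i set"
  assumes G: "zgroup G \<epsilon>" and G': "zgroup G' \<epsilon>'" and X: "finite X" and H: "H \<ge> 1"
    and w: "\<And>i. i \<in> X \<Longrightarrow> w i \<in> carrier G" and w': "\<And>i. i \<in> X \<Longrightarrow> w' i \<in> carrier G'"
    and sim: "zsim (zlevel H) X G \<epsilon> w G' \<epsilon>' w'" and z: "z \<in> carrier G"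
  obtains z' where "z' \<in> carrier G'"
    "zsim H (insert None (Some ` X)) G \<epsilon> (case_option z w) G' \<epsilon>' (case_option z' w')"
proof -
  interpret G: zgroup G \<epsilon> by (rule G)
  interpret G': zgroup G' \<epsilon>' by (rule G')
  define A :: int where "A = fact (nat H)"
  define B where "B = A * H + 1"
  define m where "m = A * A"
  have A1: "A \<ge> 1" unfolding A_def by simp
  have B0: "0 \<le> B" unfolding B_def using A1 H by simp
  have m1: "m \<ge> 1" unfolding m_def using A1 by (metis mult_le_mono1 mult_1 order_trans mult_mono zero_le_one dual_order.trans)
  have lev: "zlevel H = A * H + H * B + H * m + 2 * B + m + H"
    unfolding zlevel_def Let_def A_def B_def m_def by simp
  have nn: "0 \<le> A * H" "0 \<le> H * B" "0 \<le> H * m" using A1 H B0 m1 by auto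
  have dvdA: "j dvd A" if "1 \<le> j" "j \<le> H" for j
  proof -
    have "nat j dvd fact (nat H)" using that H by (intro dvd_fact) auto
    then have "int (nat j) dvd int (fact (nat H))" by (rule of_nat_dvd_iff[THEN iffD2])
    then show ?thesis unfolding A_def using that by simp
  qed
  define u where "u = z [^]\<^bsub>G\<^esub> A"
  have u: "u \<in> carrier G" unfolding u_def using z by simp
  define T where "T = (X \<rightarrow>\<^sub>E {- B..B}) \<times> {- B..B}"
  define f where "f t = zlin G \<epsilon> X w (fst t) (snd t)" for t
  have "finite T" unfolding T_def using X by (intro finite_cartesian_product finite_PiE) auto
  moreover have "(\<lambda>i\<in>X. 0, 0) \<in> T" unfolding T_def using B0 by auto
  ultimately have T: "finite T" "T \<noteq> {}" by auto
  have fc: "f t \<in> carrier G" for t unfolding f_def using w by simp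
  obtain t s g where t: "t \<in> T" "g \<in> carrier G" "u = f t \<otimes>\<^bsub>G\<^esub> \<epsilon> [^]\<^bsub>G\<^esub> s \<otimes>\<^bsub>G\<^esub> g [^]\<^bsub>G\<^esub> m" "\<bar>s\<bar> \<le> m"
    and pos: "(0 \<le> s \<and> f t \<otimes>\<^bsub>G\<^esub> \<epsilon> [^]\<^bsub>G\<^esub> s \<le> u \<and> (\<forall>t'\<in>T. f t' \<le> u \<longrightarrow> f t' \<le> f t)) \<or>
     (s < 0 \<and> (\<forall>t'\<in>T. \<not> f t' \<le> u \<and> f t \<le> f t'))"
    by (rule G.threshold_offset[OF T fc u m1])
  obtain nt ct where tt: "t = (nt, ct)" by (cases t)
  have bt: "\<bar>nt i\<bar> \<le> B" if "i \<in> X" for i using t(1) that unfolding T_def tt by (auto simp: PiE_def Pi_def)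
  have bc: "\<bar>ct\<bar> \<le> B" using t(1) unfolding T_def tt by auto
  have ft: "f t \<otimes>\<^bsub>G\<^esub> \<epsilon> [^]\<^bsub>G\<^esub> s = zlin G \<epsilon> X w nt (ct + s)"
    unfolding f_def tt using G.lin_add[of X w nt ct "\<lambda>_. 0" s] G.lin_eps[of X w s] w by simp
  have uL: "u = zlin G \<epsilon> X w nt (ct + s) \<otimes>\<^bsub>G\<^esub> g [^]\<^bsub>G\<^esub> m" using t(3) ft by simp
  \<comment> \<open>The power of \<open>g\<close> is left out, as \<open>g\<close> has no
    counterpart in the second group. The class modulo \<open>m\<close> is kept, and the offset
    \<open>s\<close> takes care of the position.\<close>
  define u' where "u' = zlin G' \<epsilon>' X w' nt (ct + s)"
  have u': "u' \<in> carrier G'" unfolding u'_def using w' by simp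
  have tr: "zlin G \<epsilon> X w n c \<le> zlin G \<epsilon> X w n' c' \<longleftrightarrow> zlin G' \<epsilon>' X w' n c \<le> zlin G' \<epsilon>' X w' n' c'"
    if "\<And>i. i \<in> X \<Longrightarrow> \<bar>n i\<bar> \<le> B" "\<And>i. i \<in> X \<Longrightarrow> \<bar>n' i\<bar> \<le> B" "\<bar>c\<bar> \<le> B" "\<bar>c'\<bar> \<le> B + m" for n c n' c'
  proof -
    have "\<bar>n' i - n i\<bar> \<le> zlevel H" if "i \<in> X" for i
      using \<open>\<And>i. i \<in> X \<Longrightarrow> \<bar>n i\<bar> \<le> B\<close>[OF that] \<open>\<And>i. i \<in> X \<Longrightarrow> \<bar>n' i\<bar> \<le> B\<close>[OF that] nn m1 H unfolding lev by linarith
    moreover have "\<bar>c' - c\<bar> \<le> zlevel H" using that(3,4) nn m1 H unfolding lev by linarith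
    ultimately show ?thesis
      using G.lin_le_iff[of X w n c n' c'] G'.lin_le_iff[of X w' n c n' c'] w w'
        zsim_pos[OF sim, of "\<lambda>i. n' i - n i" "c' - c"] by simp
  qed
  \<comment> \<open>If \<open>f t\<close> is the largest threshold up to \<open>u\<close>, no
    threshold lies strictly between them, so \<open>u'\<close> may stay within \<open>m\<close>
    steps of the image of \<open>f t\<close> however far away \<open>u\<close> is.\<close>
  have place: "zlin G \<epsilon> X w n c \<le> u \<longleftrightarrow> zlin G' \<epsilon>' X w' n c \<le> u'"
    if n: "\<And>i. i \<in> X \<Longrightarrow> \<bar>n i\<bar> \<le> B" and c: "\<bar>c\<bar> \<le> B" for n c
  proof -
    have rt: "(restrict n X, c) \<in> T" unfolding T_def using n c by (force simp: abs_le_iff)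
    have fr: "f (restrict n X, c) = zlin G \<epsilon> X w n c"
      unfolding f_def using w by (auto intro: G.lin_cong)
    have cs: "\<bar>ct + s\<bar> \<le> B + m" using bc t(4) by linarith
    have t0: "zlin G \<epsilon> X w n c \<le> f t \<longleftrightarrow> zlin G' \<epsilon>' X w' n c \<le> zlin G' \<epsilon>' X w' nt ct"
      "f t \<le> zlin G \<epsilon> X w n c \<longleftrightarrow> zlin G' \<epsilon>' X w' nt ct \<le> zlin G' \<epsilon>' X w' n c"
      unfolding f_def tt fst_conv snd_conv using tr[of n nt c ct] tr[of nt n ct c] n c bt bc m1 by auto
    have t1: "zlin G \<epsilon> X w n c \<le> f t \<otimes>\<^bsub>G\<^esub> \<epsilon> [^]\<^bsub>G\<^esub> s \<longleftrightarrow> zlin G' \<epsilon>' X w' n c \<le> u'"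
      unfolding ft u'_def using tr[of n nt c "ct + s"] n c bt cs by auto
    have d: "zlin G' \<epsilon>' X w' nt ct \<le> u' \<longleftrightarrow> 0 \<le> s"
      using w' G'.lin_le_iff[of X w' nt ct nt "ct + s"] unfolding u'_def using G'.lin_eps[of X w' s] G'.eps_pow_ge_one[of s] by simp
    from pos show ?thesis
    proof (elim disjE conjE)
      assume s: "0 \<le> s" "f t \<otimes>\<^bsub>G\<^esub> \<epsilon> [^]\<^bsub>G\<^esub> s \<le> u" "\<forall>t'\<in>T. f t' \<le> u \<longrightarrow> f t' \<le> f t"
      show ?thesis
      proof
        assume "zlin G \<epsilon> X w n c \<le> u"
        then have "zlin G \<epsilon> X w n c \<le> f t" using s(3) rt fr by metis
        then show "zlin G' \<epsilon>' X w' n c \<le> u'" using t0 d s(1) order_trans by blast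
      next
        assume "zlin G' \<epsilon>' X w' n c \<le> u'"
        then show "zlin G \<epsilon> X w n c \<le> u" using t1 s(2) order_trans by blast
      qed
    next
      assume s: "s < 0" "\<forall>t'\<in>T. \<not> f t' \<le> u \<and> f t \<le> f t'"
      then have "\<not> zlin G \<epsilon> X w n c \<le> u" "f t \<le> zlin G \<epsilon> X w n c" using rt fr by metis+
      moreover have "\<not> zlin G' \<epsilon>' X w' n c \<le> u'"
        using d s(1) t0(2) calculation(2) order_trans by (metis not_le)
      ultimately show ?thesis by simp
    qed
  qed
  have "zdvd G A (zlin G \<epsilon> X w nt (ct + s))"
  proof -
    have "zdvd G A u" unfolding zdvd_def u_def using z by auto
    then show ?thesis unfolding uL using G.zdvd_shift[of _ g A m] w t(2) unfolding m_def by simp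
  qed
  then have "zdvd G' A u'"
    unfolding u'_def using zsim_dvd[OF sim, of nt "ct + s" A] bt bc t(4) A1 nn m1 H B0 unfolding lev
    by (smt (verit) mult_right_mono mult_le_cancel_left1)
  then obtain z' where z': "z' \<in> carrier G'" "u' = z' [^]\<^bsub>G'\<^esub> A" unfolding zdvd_def by auto
  have opt: "zlin G \<epsilon> (insert None (Some ` X)) (case_option z w) n c = z [^]\<^bsub>G\<^esub> n None \<otimes>\<^bsub>G\<^esub> zlin G \<epsilon> X w (n \<circ> Some) c" for n c
    by (rule G.lin_option[OF X _ z]) (rule w)
  have opt': "zlin G' \<epsilon>' (insert None (Some ` X)) (case_option z' w') n c =
      z' [^]\<^bsub>G'\<^esub> n None \<otimes>\<^bsub>G'\<^esub> zlin G' \<epsilon>' X w' (n \<circ> Some) c" for n c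
    by (rule G'.lin_option[OF X _ z'(1)]) (rule w')
  have "zsim H (insert None (Some ` X)) G \<epsilon> (case_option z w) G' \<epsilon>' (case_option z' w')"
    unfolding zsim_def opt opt'
  proof (intro allI impI conjI ballI)
    fix n :: "'i option \<Rightarrow> int" and c
    assume n: "\<forall>i\<in>insert None (Some ` X). \<bar>n i\<bar> \<le> H" and c: "\<bar>c\<bar> \<le> H"
    have nX: "\<bar>(n \<circ> Some) i\<bar> \<le> H" if "i \<in> X" for i using n that by auto
    have na: "\<bar>n None\<bar> \<le> H" using n by auto
    show "\<one>\<^bsub>G\<^esub> \<le> z [^]\<^bsub>G\<^esub> n None \<otimes>\<^bsub>G\<^esub> zlin G \<epsilon> X w (n \<circ> Some) c \<longleftrightarrow>
      \<one>\<^bsub>G'\<^esub> \<le> z' [^]\<^bsub>G'\<^esub> n None \<otimes>\<^bsub>G'\<^esub> zlin G' \<epsilon>' X w' (n \<circ> Some) c"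
    proof (cases "n None = 0")
      case True
      have "H \<le> zlevel H" using nn B0 m1 unfolding lev by linarith
      then have "\<one>\<^bsub>G\<^esub> \<le> zlin G \<epsilon> X w (n \<circ> Some) c \<longleftrightarrow> \<one>\<^bsub>G'\<^esub> \<le> zlin G' \<epsilon>' X w' (n \<circ> Some) c"
        using zsim_pos[OF sim] nX c order_trans by blast
      then show ?thesis using True w w' by simp
    next
      case False
      then have "\<bar>n None\<bar> dvd A" using na by (intro dvdA) auto
      then obtain A' where A': "A = \<bar>n None\<bar> * A'" by (rule dvdE)
      then have A'1: "A' \<ge> 1" using A1 False by (smt (verit) mult_nonneg_nonpos)
      then have "A' \<le> A" using A' False mult_right_mono[of 1 "\<bar>n None\<bar>" A'] by simp
      then have bd: "\<bar>x * A'\<bar> \<le> A * H" if "\<bar>x\<bar> \<le> H" for x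
        using that A'1 H A1 mult_mono[of "\<bar>x\<bar>" H A' A] by (simp add: abs_mult mult.commute)
      have P1: "\<one>\<^bsub>G\<^esub> \<le> z [^]\<^bsub>G\<^esub> n None \<otimes>\<^bsub>G\<^esub> zlin G \<epsilon> X w (n \<circ> Some) c \<longleftrightarrow>
          (if n None > 0 then zlin G \<epsilon> X w (\<lambda>i. - ((n \<circ> Some) i * A')) (- (c * A')) \<le> u
           else \<not> zlin G \<epsilon> X w (\<lambda>i. (n \<circ> Some) i * A') (c * A' + 1) \<le> u)"
        unfolding u_def by (rule G.pos_option_iff[OF _ z False A' A'1]) (rule w)
      have P2: "\<one>\<^bsub>G'\<^esub> \<le> z' [^]\<^bsub>G'\<^esub> n None \<otimes>\<^bsub>G'\<^esub> zlin G' \<epsilon>' X w' (n \<circ> Some) c \<longleftrightarrow>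
          (if n None > 0 then zlin G' \<epsilon>' X w' (\<lambda>i. - ((n \<circ> Some) i * A')) (- (c * A')) \<le> u'
           else \<not> zlin G' \<epsilon>' X w' (\<lambda>i. (n \<circ> Some) i * A') (c * A' + 1) \<le> u')"
        unfolding z'(2) by (rule G'.pos_option_iff[OF _ z'(1) False A' A'1]) (rule w')
      have nb: "\<bar>- ((n \<circ> Some) i * A')\<bar> \<le> B" "\<bar>(n \<circ> Some) i * A'\<bar> \<le> B" if "i \<in> X" for i
        using bd[OF nX[OF that]] unfolding B_def by linarith+
      have cb: "\<bar>- (c * A')\<bar> \<le> B" "\<bar>c * A' + 1\<bar> \<le> B" using bd[OF c] unfolding B_def by linarith+
      have "zlin G \<epsilon> X w (\<lambda>i. - ((n \<circ> Some) i * A')) (- (c * A')) \<le> u \<longleftrightarrow>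
          zlin G' \<epsilon>' X w' (\<lambda>i. - ((n \<circ> Some) i * A')) (- (c * A')) \<le> u'"
        by (rule place[OF nb(1) cb(1)])
      moreover have "zlin G \<epsilon> X w (\<lambda>i. (n \<circ> Some) i * A') (c * A' + 1) \<le> u \<longleftrightarrow>
          zlin G' \<epsilon>' X w' (\<lambda>i. (n \<circ> Some) i * A') (c * A' + 1) \<le> u'"
        by (rule place[OF nb(2) cb(2)])
      ultimately show ?thesis
        using P1 P2 by simp
    qed
    fix j assume j: "j \<in> {1..H}"
    have jd: "j * A dvd m" unfolding m_def using dvdA j by (intro mult_dvd_mono) auto
    have jA: "1 \<le> j * A" "j * A \<le> A * H" using j A1 H mult_mono[of 1 j 1 A] mult_mono[of j H A A] by (auto simp: mult.commute)
    have jl: "j * A \<le> zlevel H" unfolding lev using jA nn m1 B0 H by linarith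
    have b1: "\<bar>nt i * n None + (n \<circ> Some) i * A\<bar> \<le> zlevel H" if "i \<in> X" for i
    proof -
      have "\<bar>nt i * n None\<bar> \<le> B * H" "\<bar>(n \<circ> Some) i * A\<bar> \<le> H * A"
        unfolding abs_mult using bt[OF that] na nX[OF that] H A1 B0 by (intro mult_mono; simp)+
      then show ?thesis unfolding lev using nn m1 B0 H mult.commute[of B H] mult.commute[of A H] by linarith
    qed
    have b2: "\<bar>(ct + s) * n None + c * A\<bar> \<le> zlevel H"
    proof -
      have "\<bar>ct + s\<bar> \<le> B + m" using bc t(4) by linarith
      then have "\<bar>(ct + s) * n None\<bar> \<le> (B + m) * H"
        unfolding abs_mult using na B0 m1 by (intro mult_mono) auto
      moreover have "\<bar>c * A\<bar> \<le> H * A" unfolding abs_mult using c H A1 by (intro mult_mono) auto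
      moreover have "(B + m) * H = H * B + H * m" "H * A = A * H" by (simp_all add: algebra_simps)
      ultimately show ?thesis unfolding lev using m1 B0 H by linarith
    qed
    have "zdvd G j (z [^]\<^bsub>G\<^esub> n None \<otimes>\<^bsub>G\<^esub> zlin G \<epsilon> X w (n \<circ> Some) c) \<longleftrightarrow>
        zdvd G (j * A) (zlin G \<epsilon> X w (\<lambda>i. nt i * n None + (n \<circ> Some) i * A) ((ct + s) * n None + c * A))"
      by (rule G.dvd_option_iff[OF _ z t(2) A1 uL[unfolded u_def] jd]) (rule w)
    also have "\<dots> \<longleftrightarrow> zdvd G' (j * A) (zlin G' \<epsilon>' X w' (\<lambda>i. nt i * n None + (n \<circ> Some) i * A) ((ct + s) * n None + c * A))"
      by (intro zsim_dvd[OF sim b1 b2 jA(1) jl])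
    \<comment> \<open>\<open>dvd_option_iff\<close> is applied to \<open>z'\<close> with the neutral
      element in place of \<open>g\<close>, since \<open>u'\<close> was defined without such a
      factor.\<close>
    also have "\<dots> \<longleftrightarrow> zdvd G' j (z' [^]\<^bsub>G'\<^esub> n None \<otimes>\<^bsub>G'\<^esub> zlin G' \<epsilon>' X w' (n \<circ> Some) c)"
      using z' w' unfolding u'_def
      by (intro G'.dvd_option_iff[OF _ z'(1) G'.one_closed A1 _ jd, symmetric]) auto
    finally show "zdvd G j (z [^]\<^bsub>G\<^esub> n None \<otimes>\<^bsub>G\<^esub> zlin G \<epsilon> X w (n \<circ> Some) c) \<longleftrightarrow>
      zdvd G' j (z' [^]\<^bsub>G'\<^esub> n None \<otimes>\<^bsub>G'\<^esub> zlin G' \<epsilon>' X w' (n \<circ> Some) c)" .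
  qed
  then show ?thesis using that z'(1) by blast
qed

section \<open>Terms and vector spaces\<close>

lemma evalt_cong: "(\<And>i. i \<in> fvt t \<Longrightarrow> e i = e' i) \<Longrightarrow> evalt M e t = evalt M e' t"
proof (induction t)
  case (Fun f ts)
  have "map (evalt M e) ts = map (evalt M e') ts" by (intro map_cong refl Fun.IH) (use Fun.prems in auto)
  then show ?case by (metis evalt.simps(2))
qed simp

lemma sat_cong: "(\<And>i. i \<in> fv A \<Longrightarrow> e i = e' i) \<Longrightarrow> sat M e A \<longleftrightarrow> sat M e' A"
proof (induction A arbitrary: e e')
  case (Eq s t)
  then show ?case using evalt_cong[of s e e' M] evalt_cong[of t e e' M] by auto
next
  case (Rel R ts)
  then have "map (evalt M e) ts = map (evalt M e') ts" by (auto intro!: evalt_cong)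
  then show ?case by (metis sat.simps(2))
next
  case (Imp A B)
  then show ?case by (metis UnCI fv.simps(4) sat.simps(4))
next
  case (All n A)
  have "sat M (e(n := a)) A \<longleftrightarrow> sat M (e'(n := a)) A" for a by (rule All.IH) (use All.prems in auto)
  then show ?case by simp
qed simp

lemma trm_in_lang_kS [simp]: "trm_in (lang_kS S0 S1) t \<longleftrightarrow> trm_in lang_k t"
  by (induction t) (auto simp: lang_kS_def)

lemma fsym_in_lang_k [simp]:
  "(Plus, Suc (Suc 0)) \<in> fst lang_k" "(Zero, 0) \<in> fst lang_k" "(One, 0) \<in> fst lang_k"
  "(Scale c, Suc 0) \<in> fst lang_k"
  by (auto simp: lang_k_def)

lemma trm_induct_k [consumes 1, case_names Var Plus Zero One Scale]:
  assumes "trm_in lang_k t" "\<And>n. P (V n)"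
    "\<And>s t. trm_in lang_k s \<Longrightarrow> trm_in lang_k t \<Longrightarrow> P s \<Longrightarrow> P t \<Longrightarrow> P (tadd s t)" "P tzero" "P tone"
    "\<And>c t. trm_in lang_k t \<Longrightarrow> P t \<Longrightarrow> P (tscale c t)"
  shows "P t"
  using assms(1)
proof (induction t)
  case (Fun f ts)
  then have f: "(f, length ts) \<in> fst lang_k" "\<And>t. t \<in> set ts \<Longrightarrow> trm_in lang_k t \<and> P t" by auto
  then consider "f = Plus" "length ts = 2" | "f = Zero" "ts = []" | "f = One" "ts = []"
    | c where "f = Scale c" "length ts = 1" by (auto simp: lang_k_def)
  then show ?case
  proof cases
    case 1
    then obtain s t where "ts = [s, t]" by (auto simp: numeral_2_eq_2 length_Suc_conv)
    then show ?thesis using 1 f(2) assms(3) by auto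
  next
    case 4
    then obtain s where "ts = [s]" by (auto simp: length_Suc_conv)
    then show ?thesis using 4 f(2) assms(6) by auto
  qed (use assms in auto)
qed (use assms in auto)

text \<open>The index \<open>None\<close> stands for the constant one.\<close>

fun tcoef :: "'k::field fsym trm \<Rightarrow> nat option \<Rightarrow> 'k" where
  "tcoef (Var n) = (\<lambda>i. if i = Some n then 1 else 0)"
| "tcoef (Fun Plus [s, t]) = (\<lambda>i. tcoef s i + tcoef t i)"
| "tcoef (Fun One []) = (\<lambda>i. if i = None then 1 else 0)"
| "tcoef (Fun (Scale c) [t]) = (\<lambda>i. c * tcoef t i)"
| "tcoef _ = (\<lambda>i. 0)"

locale vspace =
  fixes M :: "('k::field fsym, 'r, 'u) struct"
  assumes vs: "vector_space_struct M"
begin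

lemmas closed [simp, intro] = vector_space_structD(1-3,12)[OF vs]

lemma evalt_closed [simp]: "trm_in lang_k t \<Longrightarrow> range e \<subseteq> univ M \<Longrightarrow> evalt M e t \<in> univ M"
  by (induction t rule: trm_induct_k) auto

lemma add_comm: "x \<in> univ M \<Longrightarrow> y \<in> univ M \<Longrightarrow> madd M x y = madd M y x"
  and add_assoc: "x \<in> univ M \<Longrightarrow> y \<in> univ M \<Longrightarrow> z \<in> univ M \<Longrightarrow> madd M (madd M x y) z = madd M x (madd M y z)"
  and scale_add: "x \<in> univ M \<Longrightarrow> y \<in> univ M \<Longrightarrow> mscale M c (madd M x y) = madd M (mscale M c x) (mscale M c y)"
  and add_scale: "x \<in> univ M \<Longrightarrow> mscale M (c + d) x = madd M (mscale M c x) (mscale M d x)"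
  and scale_scale: "x \<in> univ M \<Longrightarrow> mscale M c (mscale M d x) = mscale M (c * d) x"
  and scale_one [simp]: "x \<in> univ M \<Longrightarrow> mscale M 1 x = x"
  and zero_add [simp]: "x \<in> univ M \<Longrightarrow> madd M (mzero M) x = x"
  and sub_self [simp]: "x \<in> univ M \<Longrightarrow> madd M x (mscale M (- 1) x) = mzero M"
  using vector_space_structD[OF vs] by metis+

lemma add_zero [simp]: "x \<in> univ M \<Longrightarrow> madd M x (mzero M) = x"
  using add_comm[of x "mzero M"] by simp

lemma add_lcomm: "x \<in> univ M \<Longrightarrow> y \<in> univ M \<Longrightarrow> z \<in> univ M \<Longrightarrow> madd M x (madd M y z) = madd M y (madd M x z)"
  by (metis add_assoc add_comm)

lemma scale_zero_left [simp]: "x \<in> univ M \<Longrightarrow> mscale M 0 x = mzero M"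
  using add_scale[of x 1 "- 1"] by simp

lemma scale_zero [simp]: "mscale M c (mzero M) = mzero M"
  using scale_scale[of "mzero M" c 0] by simp

lemma scale_eq_zero: "x \<in> univ M \<Longrightarrow> c \<noteq> 0 \<Longrightarrow> mscale M c x = mzero M \<longleftrightarrow> x = mzero M"
  using scale_scale[of x "inverse c" c] by auto

definition lval :: "(nat \<Rightarrow> 'u) \<Rightarrow> nat option \<Rightarrow> 'u" where
  "lval e i = (case i of None \<Rightarrow> mone M | Some n \<Rightarrow> e n)"

definition lcomb :: "(nat \<Rightarrow> 'u) \<Rightarrow> (nat option \<Rightarrow> 'k) \<Rightarrow> nat option list \<Rightarrow> 'u" where
  "lcomb e c is = foldr (\<lambda>i. madd M (mscale M (c i) (lval e i))) is (mzero M)"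

text \<open>The list fixes an order of summation, so that two combinations can be added slot by
  slot.\<close>

lemma lcomb_evalt:
  assumes e: "range e \<subseteq> univ M" and "trm_in lang_k t" "distinct is" "insert None (Some ` fvt t) \<subseteq> set is"
  shows "evalt M e t = lcomb e (tcoef t) is"
proof -
  have lv: "lval e i \<in> univ M" for i using e unfolding lval_def by (auto split: option.split)
  have cl: "lcomb e c js \<in> univ M" for c js unfolding lcomb_def by (induction js) (auto simp: lv)
  have add: "lcomb e (\<lambda>i. c i + d i) js = madd M (lcomb e c js) (lcomb e d js)" for c d js
  proof (induction js)
    case (Cons j js)
    then show ?case using lv cl[of c js] cl[of d js] unfolding lcomb_def
      by (simp add: add_scale add_assoc add_lcomm)
  qed (simp add: lcomb_def)
  have scale: "lcomb e (\<lambda>i. a * c i) js = mscale M a (lcomb e c js)" for a c js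
  proof (induction js)
    case (Cons j js)
    then show ?case using lv cl[of c js] unfolding lcomb_def by (simp add: scale_add scale_scale)
  qed (simp add: lcomb_def)
  have zero: "lcomb e c js = mzero M" if "\<forall>i\<in>set js. c i = 0" for c js
    using that by (induction js) (auto simp: lcomb_def lv)
  have single: "lcomb e (\<lambda>i. if i = j then 1 else 0) js = lval e j" if "j \<in> set js" "distinct js" for j js
    using that
  proof (induction js)
    case (Cons a js)
    show ?case
    proof (cases "a = j")
      case True
      then have "lcomb e (\<lambda>i. if i = j then 1 else 0) js = mzero M" using Cons.prems by (intro zero) auto
      then show ?thesis using True lv unfolding lcomb_def by simp
    next
      case False
      then show ?thesis using Cons lv unfolding lcomb_def by simp
    qed
  qed simp
  show ?thesis using assms(2,4)
  proof (induction t rule: trm_induct_k)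
    case (Var n)
    then show ?case using single[of "Some n" "is"] assms(3) by (simp add: lval_def)
  next
    case One
    then show ?case using single[of None "is"] assms(3) by (simp add: lval_def)
  qed (auto simp: add scale zero image_Un)
qed

lemma evalt_eqI:
  assumes "range e \<subseteq> univ M" "trm_in lang_k s" "trm_in lang_k t" "\<And>i. tcoef s i = tcoef t i"
  shows "evalt M e s = evalt M e t"
proof -
  have fin: "finite (fvt s)" for s :: "'k fsym trm" by (induction s) auto
  have "finite (insert None (Some ` (fvt s \<union> fvt t)))" using fin by auto
  then obtain js where js: "set js = insert None (Some ` (fvt s \<union> fvt t))" "distinct js"
    using finite_distinct_list by metis
  have "tcoef s = tcoef t" using assms(4) by auto
  moreover have "insert None (Some ` fvt s) \<subseteq> set js" "insert None (Some ` fvt t) \<subseteq> set js" using js(1) by auto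
  ultimately show ?thesis
    using lcomb_evalt[OF assms(1) assms(2) js(2)] lcomb_evalt[OF assms(1) assms(3) js(2)] by simp
qed

definition env3 :: "'u \<Rightarrow> 'u \<Rightarrow> 'u \<Rightarrow> nat \<Rightarrow> 'u" where
  "env3 x y z n = (if n = 0 then x else if n = 1 then y else z)"

lemma env3 [simp]: "env3 x y z 0 = x" "env3 x y z (Suc 0) = y" "env3 x y z 2 = z"
  by (simp_all add: env3_def)

text \<open>Proof by reflection: an identity between vectors follows from an identity between
  coefficients in the field, which simplification decides.\<close>

lemma vec_eqI:
  assumes "x \<in> univ M" "y \<in> univ M" "z \<in> univ M" "trm_in lang_k s" "trm_in lang_k t" "\<And>i. tcoef s i = tcoef t i"
  shows "evalt M (env3 x y z) s = evalt M (env3 x y z) t"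
  by (rule evalt_eqI) (use assms in \<open>auto simp: env3_def\<close>)

lemma sub_sub:
  assumes "x \<in> univ M" "y \<in> univ M" "z \<in> univ M"
  shows "madd M (msub M x y) (msub M y z) = msub M x z"
    "msub M (msub M x z) (msub M x y) = msub M y z"
    "mscale M (- 1) (msub M x y) = msub M y x"
    "msub M (madd M x y) z = madd M y (msub M x z)"
    "madd M x (msub M y x) = y"
    "msub M (madd M x y) y = x"
  using vec_eqI[OF assms, of "tadd (tsub (V 0) (V 1)) (tsub (V 1) (V 2))" "tsub (V 0) (V 2)"]
    vec_eqI[OF assms, of "tsub (tsub (V 0) (V 2)) (tsub (V 0) (V 1))" "tsub (V 1) (V 2)"]
    vec_eqI[OF assms, of "tscale (- 1) (tsub (V 0) (V 1))" "tsub (V 1) (V 0)"]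
    vec_eqI[OF assms, of "tsub (tadd (V 0) (V 1)) (V 2)" "tadd (V 1) (tsub (V 0) (V 2))"]
    vec_eqI[OF assms, of "tadd (V 0) (tsub (V 1) (V 0))" "V 1"]
    vec_eqI[OF assms, of "tsub (tadd (V 0) (V 1)) (V 1)" "V 0"]
  by simp_all

lemma sub_eq_zero: "x \<in> univ M \<Longrightarrow> y \<in> univ M \<Longrightarrow> msub M x y = mzero M \<longleftrightarrow> x = y"
  using sub_sub(5)[of y x] by auto

end

lemma trm_decompose:
  assumes "trm_in lang_k t"
  obtains c t' where "trm_in lang_k t'" "fvt t' \<subseteq> fvt t - {n}"
    "\<And>i. tcoef t i = tcoef (tadd (tscale c (V n)) t') i"
proof -
  have "\<exists>c t'. trm_in lang_k t' \<and> fvt t' \<subseteq> fvt t - {n} \<and> (\<forall>i. tcoef t i = tcoef (tadd (tscale c (V n)) t') i)"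
    using assms
  proof (induction t rule: trm_induct_k)
    case (Var m)
    show ?case
    proof (cases "m = n")
      case True
      then show ?thesis by (intro exI[of _ 1] exI[of _ tzero]) auto
    next
      case False
      then show ?thesis by (intro exI[of _ 0] exI[of _ "V m"]) auto
    qed
  next
    case (Plus s t)
    then obtain c s' d t' where
      "trm_in lang_k s'" "fvt s' \<subseteq> fvt s - {n}" "\<forall>i. tcoef s i = tcoef (tadd (tscale c (V n)) s') i"
      "trm_in lang_k t'" "fvt t' \<subseteq> fvt t - {n}" "\<forall>i. tcoef t i = tcoef (tadd (tscale d (V n)) t') i" by blast
    then show ?case by (intro exI[of _ "c + d"] exI[of _ "tadd s' t'"]) (auto simp: algebra_simps)
  next
    case Zero
    then show ?case by (intro exI[of _ 0] exI[of _ tzero]) auto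
  next
    case One
    then show ?case by (intro exI[of _ 0] exI[of _ tone]) auto
  next
    case (Scale a t)
    then obtain c t' where
      "trm_in lang_k t'" "fvt t' \<subseteq> fvt t - {n}" "\<forall>i. tcoef t i = tcoef (tadd (tscale c (V n)) t') i" by blast
    then show ?case by (intro exI[of _ "a * c"] exI[of _ "tscale a t'"]) (auto simp: algebra_simps)
  qed
  then show ?thesis using that by blast
qed

section \<open>The valuation of the field\<close>

lemma pval_minus_one:
  assumes "finite_place p" "discrete_place p"
  shows "pval p (- 1) = 0"
  using pval_mult[OF assms, of "- 1" "- 1"] pval_one[OF assms] by simp

lemma pval_minus:
  assumes "finite_place p" "discrete_place p"
  shows "pval p (- x) = pval p x"
  using pval_mult[OF assms, of "- 1" x] pval_minus_one[OF assms] by (cases "x = 0") auto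

lemma pval_inverse:
  assumes "finite_place p" "discrete_place p" "x \<noteq> 0"
  shows "pval p (inverse x) = - pval p x"
  using pval_mult[OF assms(1,2), of x "inverse x"] pval_one[OF assms(1,2)] assms(3) by simp

lemma pval_add:
  fixes p :: "'k::field place"
  assumes p: "finite_place p" "discrete_place p" and xy: "x \<noteq> 0" "y \<noteq> 0" "x + y \<noteq> 0"
  shows "min (pval p x) (pval p y) \<le> pval p (x + y)"
proof -
  obtain a c \<pi> where a: "a \<in> p" "absolute_value a" "(0::real) < c" "c < 1"
    "\<And>x. x \<noteq> 0 \<Longrightarrow> a x = c powi pval p x" by (rule pval_base[OF p]) blast
  have "ultrametric_av a" using p(1) a(1) unfolding finite_place_def by blast
  then have "a (x + y) \<le> max (a x) (a y)" unfolding ultrametric_av_def by blast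
  then have m: "c powi pval p (x + y) \<le> max (c powi pval p x) (c powi pval p y)" using a(5) xy by simp
  show ?thesis
  proof (rule ccontr)
    assume "\<not> ?thesis"
    then have "pval p (x + y) < pval p x" "pval p (x + y) < pval p y" by auto
    then have "c powi pval p x < c powi pval p (x + y)" "c powi pval p y < c powi pval p (x + y)"
      using power_int_strict_decreasing a(3,4) by blast+
    then show False using m by auto
  qed
qed

definition punif :: "'k::field place \<Rightarrow> 'k" where
  "punif p = (SOME \<pi>. \<pi> \<noteq> 0 \<and> pval p \<pi> = 1)"

lemma punif:
  fixes p :: "'k::field place"
  assumes "finite_place p" "discrete_place p"
  shows "punif p \<noteq> 0" "pval p (punif p) = 1"
proof -
  obtain \<pi> where "\<pi> \<noteq> 0" "pval p \<pi> = 1" by (rule pval_base[OF assms]) blast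
  then have "\<exists>\<pi>. \<pi> \<noteq> 0 \<and> pval p \<pi> = 1" by blast
  then show "punif p \<noteq> 0" "pval p (punif p) = 1" unfolding punif_def by (metis (mono_tags, lifting) someI_ex)+
qed

abbreviation ppow :: "'k::field place \<Rightarrow> int \<Rightarrow> 'k" where "ppow p n \<equiv> punif p powi n"

lemma pval_ppow:
  assumes "finite_place p" "discrete_place p"
  shows "pval p (ppow p n) = n"
proof (cases "n \<ge> 0")
  case True
  then show ?thesis using pval_power[OF assms punif(1)[OF assms], of "nat n"] punif(2)[OF assms]
    by (simp add: power_int_def)
next
  case False
  then have "ppow p n = inverse (punif p ^ nat (- n))" by (simp add: power_int_def power_inverse)
  then show ?thesis using False pval_power[OF assms punif(1)[OF assms], of "nat (- n)"] punif[OF assms]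
      pval_inverse[OF assms, of "punif p ^ nat (- n)"] by simp
qed

lemma residue_equiv:
  assumes p: "finite_place p" "discrete_place p"
  shows "equiv (vring p) {(x, y). x \<in> vring p \<and> y \<in> vring p \<and> same_residue p x y}"
proof (rule equivI)
  show "refl_on (vring p) {(x, y). x \<in> vring p \<and> y \<in> vring p \<and> same_residue p x y}"
    by (auto simp: refl_on_def same_residue_def)
  show "sym {(x, y). x \<in> vring p \<and> y \<in> vring p \<and> same_residue p x y}"
    using pval_minus[OF p] by (auto simp: sym_def same_residue_def) (metis minus_diff_eq)+
  show "trans {(x, y). x \<in> vring p \<and> y \<in> vring p \<and> same_residue p x y}"
  proof (rule transI, clarsimp)
    fix x y z assume "same_residue p x y" "same_residue p y z"
    then show "same_residue p x z"
      using pval_add[OF p, of "x - y" "y - z"] unfolding same_residue_def by (cases "x = y"; cases "y = z"; cases "x = z") auto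
  qed
qed auto

lemma vunits_iff:
  assumes p: "finite_place p" "discrete_place p" and "x \<in> vring p"
  shows "x \<in> vunits p \<longleftrightarrow> \<not> same_residue p x 0"
  using assms(3) unfolding vring_def vunits_def same_residue_def by auto

lemma vunits_subset: "vunits p \<subseteq> vring p"
  unfolding vring_def vunits_def by auto

text \<open>One element is chosen from each residue class other than that of zero; leaving out one
  class does not affect finiteness. \<open>R\<close> yields a list of representatives in the finite
  case and arbitrarily many distinct residues in the infinite one.\<close>

lemma residue_transversal:
  fixes p :: "'k::field place"
  assumes p: "finite_place p" "discrete_place p"
  obtains R where "R \<subseteq> vunits p" "\<And>u. u \<in> vunits p \<Longrightarrow> \<exists>!w. w \<in> R \<and> same_residue p u w"
    "finite R \<longleftrightarrow> finite (residue_field p)"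
proof -
  define E where "E = {(x, y). x \<in> vring p \<and> y \<in> vring p \<and> same_residue p x y}"
  have eq: "equiv (vring p) E" unfolding E_def by (rule residue_equiv[OF p])
  have ER: "same_residue p a b" if "(a, b) \<in> E" for a b using that unfolding E_def by simp
  have rf: "residue_field p = vring p // E" unfolding residue_field_def E_def ..
  define f where "f C = (SOME u. u \<in> C)" for C :: "'k set"
  have fC: "f C \<in> C" if "C \<in> vring p // E" for C
    unfolding f_def using in_quotient_imp_non_empty[OF eq that] by (metis some_in_eq)
  define Q where "Q = vring p // E - {E `` {0}}"
  define R where "R = f ` Q"
  have z: "0 \<in> vring p" unfolding vring_def by simp
  have cls: "C = E `` {f C}" if "C \<in> vring p // E" for C
    using fC[OF that] that eq by (metis Image_singleton_iff equiv_class_eq_iff quotientE)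
  have inj: "inj_on f (vring p // E)" by (rule inj_onI) (metis cls)
  have sub: "R \<subseteq> vunits p"
  proof
    fix u assume "u \<in> R"
    then obtain C where C: "C \<in> vring p // E" "C \<noteq> E `` {0}" "u = f C" unfolding R_def Q_def by auto
    then have uR: "u \<in> vring p" using fC in_quotient_imp_subset[OF eq] by blast
    moreover have "\<not> same_residue p u 0"
    proof
      assume "same_residue p u 0"
      then have "(u, 0) \<in> E" unfolding E_def using uR z by simp
      then show False using C cls equiv_class_eq[OF eq] by metis
    qed
    ultimately show "u \<in> vunits p" using vunits_iff[OF p] by simp
  qed
  moreover have "\<exists>!w. w \<in> R \<and> same_residue p u w" if u: "u \<in> vunits p" for u
  proof -
    have uR: "u \<in> vring p" using u vunits_subset by blast
    have "(u, 0) \<notin> E" using vunits_iff[OF p uR] u unfolding E_def by simp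
    then have "E `` {u} \<noteq> E `` {0}" using eq_equiv_class[OF _ eq z] by blast
    then have "E `` {u} \<in> Q" unfolding Q_def using quotientI[OF uR, of E] by simp
    then have Ru: "f (E `` {u}) \<in> R" unfolding R_def by simp
    have "(u, f (E `` {u})) \<in> E" using fC[OF quotientI[OF uR]] by (simp only: Image_singleton_iff)
    then have su: "same_residue p u (f (E `` {u}))" using ER by blast
    have "w = f (E `` {u})" if w: "w \<in> R" "same_residue p u w" for w
    proof -
      obtain C where C: "C \<in> Q" "w = f C" using w unfolding R_def by auto
      have "(u, w) \<in> E" unfolding E_def using w uR sub vunits_subset by auto
      then have "E `` {u} = E `` {w}" using equiv_class_eq[OF eq] by metis
      then show ?thesis using C cls unfolding Q_def by (metis Diff_iff)
    qed
    then show ?thesis using Ru su by blast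
  qed
  moreover have "finite R \<longleftrightarrow> finite (residue_field p)"
    unfolding R_def rf using inj finite_image_iff[of f Q] inj_on_subset[of f _ Q] unfolding Q_def by auto
  ultimately show ?thesis using that by blast
qed

lemma residue_reps_exist:
  assumes "finite_place p" "discrete_place p" "finite (residue_field p)"
  shows "\<exists>ws. residue_reps p ws"
proof -
  obtain R where R: "R \<subseteq> vunits p" "\<And>u. u \<in> vunits p \<Longrightarrow> \<exists>!w. w \<in> R \<and> same_residue p u w" "finite R"
    by (rule residue_transversal[OF assms(1,2)]) (use assms(3) in blast)
  obtain ws where "set ws = R" "distinct ws" using finite_distinct_list[OF R(3)] by metis
  then show ?thesis using R(1,2) unfolding residue_reps_def by (intro exI[of _ ws]) simp
qed

lemma distinct_residues_exist:
  assumes "finite_place p" "discrete_place p" "infinite (residue_field p)"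
  shows "\<exists>ws. length ws = n \<and> distinct_residues p ws"
proof -
  obtain R where R: "R \<subseteq> vunits p" "\<And>u. u \<in> vunits p \<Longrightarrow> \<exists>!w. w \<in> R \<and> same_residue p u w" "infinite R"
    by (rule residue_transversal[OF assms(1,2)]) (use assms(3) in blast)
  obtain F where F: "finite F" "card F = n" "F \<subseteq> R" using infinite_arbitrarily_large[OF R(3)] by blast
  obtain ws where ws: "set ws = F" "distinct ws" using finite_distinct_list[OF F(1)] by metis
  have "\<not> same_residue p (ws ! i) (ws ! j)" if "i < length ws" "j < length ws" "i \<noteq> j" for i j
  proof
    assume s: "same_residue p (ws ! i) (ws ! j)"
    have "ws ! i \<in> R" "ws ! j \<in> R" "ws ! i \<noteq> ws ! j"
      using that ws F(3) nth_mem nth_eq_iff_index_eq by blast+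
    moreover have "same_residue p (ws ! i) (ws ! i)" unfolding same_residue_def by simp
    ultimately show False using R(1,2) s by blast
  qed
  moreover have "length ws = n" "set ws \<subseteq> vunits p" using ws F R(1) distinct_card[OF ws(2)] by auto
  ultimately show ?thesis unfolding distinct_residues_def by (intro exI[of _ ws] conjI allI impI) auto
qed

section \<open>Models at a finite place\<close>

lemma finite_extremal:
  assumes "finite I" "I \<noteq> {}"
    and "\<And>i j. i \<in> I \<Longrightarrow> j \<in> I \<Longrightarrow> R i j \<or> R j i"
    and "\<And>i j k. i \<in> I \<Longrightarrow> j \<in> I \<Longrightarrow> k \<in> I \<Longrightarrow> R i j \<Longrightarrow> R j k \<Longrightarrow> R i k"
  shows "\<exists>i\<in>I. \<forall>j\<in>I. R j i"
  using assms
proof (induction I rule: finite_ne_induct)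
  case (singleton x)
  then show ?case by blast
next
  case (insert x F)
  then obtain i where i: "i \<in> F" "\<forall>j\<in>F. R j i" by blast
  have "R x x" using insert.prems(1)[of x x] by blast
  show ?case
  proof (cases "R x i")
    case True
    then show ?thesis using i by blast
  next
    case False
    then have "R i x" using insert.prems(1)[of x i] i by blast
    then have "\<forall>j\<in>F. R j x" using insert.prems(2)[of _ i x] i by blast
    then show ?thesis using \<open>R x x\<close> by blast
  qed
qed

text \<open>The value of \<open>x\<close> is represented by the set of all \<open>y\<close> with \<open>v(y) \<le> v(x)\<close>. Values are then ordered by
inclusion, and the minimum is the intersection.\<close>

definition vv :: "'k place \<Rightarrow> ('f, 'k rsym, 'u) struct \<Rightarrow> 'u \<Rightarrow> 'u set" where
  "vv p M x = {y \<in> univ M. mL p M x y}"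

locale finplace = vspace M for M :: "('k::field fsym, 'k rsym, 'u) struct" +
  fixes p :: "'k place"
  assumes p: "finite_place p" "discrete_place p" and ax: "fin_ax p M"
begin

lemmas pu = punif[OF p]

lemmas axs = ax[unfolded fin_ax_def, THEN conjunct2]

lemma zero_ne_one: "mzero M \<noteq> mone M"
  using axs by (rule conjunct1)

lemma L_total: "x \<in> univ M \<Longrightarrow> y \<in> univ M \<Longrightarrow> mL p M x y \<or> mL p M y x"
  using axs[THEN conjunct2, THEN conjunct1] by simp

lemma L_trans: "x \<in> univ M \<Longrightarrow> y \<in> univ M \<Longrightarrow> z \<in> univ M \<Longrightarrow> mL p M x y \<Longrightarrow> mL p M y z \<Longrightarrow> mL p M x z"
  using axs[THEN conjunct2, THEN conjunct2, THEN conjunct1] by blast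

lemma L_zero: "x \<in> univ M \<Longrightarrow> mL p M (mzero M) x"
  using axs[THEN conjunct2, THEN conjunct2, THEN conjunct2, THEN conjunct1] by simp

lemmas axs' = axs[THEN conjunct2, THEN conjunct2, THEN conjunct2, THEN conjunct2]

lemma L_zeroD: "x \<in> univ M \<Longrightarrow> mL p M x (mzero M) \<Longrightarrow> x = mzero M"
  using axs'[THEN conjunct1] by simp

lemma L_add: "x \<in> univ M \<Longrightarrow> y \<in> univ M \<Longrightarrow> z \<in> univ M \<Longrightarrow> mL p M x z \<Longrightarrow> mL p M y z \<Longrightarrow> mL p M (madd M x y) z"
  using axs'[THEN conjunct2, THEN conjunct1] by simp

lemma L_scale_eq: "c \<noteq> 0 \<Longrightarrow> d \<noteq> 0 \<Longrightarrow> pval p c = pval p d \<Longrightarrow> x \<in> univ M \<Longrightarrow> mL p M (mscale M c x) (mscale M d x)"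
  using axs'[THEN conjunct2, THEN conjunct2, THEN conjunct1] by simp

lemma L_unif:
  assumes "x \<in> univ M" "x \<noteq> mzero M"
  shows "\<not> mL p M x (mscale M (punif p) x)"
    "y \<in> univ M \<Longrightarrow> \<not> mL p M x y \<Longrightarrow> mL p M y (mscale M (punif p) x)"
  using axs'[THEN conjunct2, THEN conjunct2, THEN conjunct2, THEN conjunct1] assms pu by simp_all

lemma L_residue_finite:
  assumes "finite (residue_field p)" "residue_reps p ws" "x \<in> univ M" "y \<in> univ M" "mL p M x y" "mL p M y x" "x \<noteq> mzero M"
  shows "\<exists>w\<in>set ws. \<not> mL p M x (madd M (mscale M w x) y)"
  using axs'[THEN conjunct2, THEN conjunct2, THEN conjunct2, THEN conjunct2, THEN conjunct1] assms by simp

lemma L_residue_infinite: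
  assumes "infinite (residue_field p)" "length ws = Suc n" "distinct_residues p ws" "x \<in> univ M"
    "\<And>j. j \<in> {1..n} \<Longrightarrow> y j \<in> univ M \<and> mL p M (y j) x"
  shows "\<exists>w\<in>set ws. \<forall>j\<in>{1..n}. mL p M (madd M (mscale M w x) (y j)) x \<and> mL p M x (madd M (mscale M w x) (y j))"
  using axs'[THEN conjunct2, THEN conjunct2, THEN conjunct2, THEN conjunct2, THEN conjunct2, rule_format, OF _ assms(4)]
    assms by blast

abbreviation "val \<equiv> vv p M"

lemma L_iff: "x \<in> univ M \<Longrightarrow> y \<in> univ M \<Longrightarrow> mL p M x y \<longleftrightarrow> val y \<subseteq> val x"
  unfolding vv_def using L_trans L_total[of y y] by blast

lemma val_total: "x \<in> univ M \<Longrightarrow> y \<in> univ M \<Longrightarrow> val x \<subseteq> val y \<or> val y \<subseteq> val x"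
  using L_total L_iff by metis

lemma val_zero: "x \<in> univ M \<Longrightarrow> val x \<subseteq> val (mzero M)"
  using L_zero L_iff by force

lemma val_eq_zero: "x \<in> univ M \<Longrightarrow> val x = val (mzero M) \<longleftrightarrow> x = mzero M"
  using L_zeroD L_iff by force

lemma val_add: "x \<in> univ M \<Longrightarrow> y \<in> univ M \<Longrightarrow> val x \<inter> val y \<subseteq> val (madd M x y)"
  unfolding vv_def using L_add by blast

lemma val_scale_eq: "c \<noteq> 0 \<Longrightarrow> d \<noteq> 0 \<Longrightarrow> pval p c = pval p d \<Longrightarrow> x \<in> univ M \<Longrightarrow> val (mscale M c x) = val (mscale M d x)"
  using L_scale_eq[of c d x] L_scale_eq[of d c x] L_iff by (simp add: subset_antisym)

lemma val_unif:
  assumes "x \<in> univ M" "x \<noteq> mzero M"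
  shows "val x \<subset> val (mscale M (punif p) x)"
    "y \<in> univ M \<Longrightarrow> val x \<subset> val y \<Longrightarrow> val (mscale M (punif p) x) \<subseteq> val y"
proof -
  show "val x \<subset> val (mscale M (punif p) x)"
    using L_unif(1)[OF assms] L_iff[of x "mscale M (punif p) x"] val_total[of x "mscale M (punif p) x"] assms(1) by auto
  show "y \<in> univ M \<Longrightarrow> val x \<subset> val y \<Longrightarrow> val (mscale M (punif p) x) \<subseteq> val y"
    using L_unif(2)[OF assms] L_iff[of x y] L_iff[of y "mscale M (punif p) x"] assms(1) by auto
qed

lemma val_unit: "c \<noteq> 0 \<Longrightarrow> pval p c = 0 \<Longrightarrow> x \<in> univ M \<Longrightarrow> val (mscale M c x) = val x"
  using val_scale_eq[of c 1 x] pval_one[OF p] by simp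

lemma val_uminus [simp]: "x \<in> univ M \<Longrightarrow> val (mscale M (- 1) x) = val x"
  using val_unit[of "- 1"] pval_minus_one[OF p] by simp

lemma val_sub_commute: "x \<in> univ M \<Longrightarrow> y \<in> univ M \<Longrightarrow> val (msub M x y) = val (msub M y x)"
  using sub_sub(3)[of y x x] val_uminus[of "msub M y x"] by auto

text \<open>A larger value is at least the next one: if \<open>v(x) < v(y)\<close>, then
  \<open>v(\<pi> x) \<le> v(y) < v(\<pi> y)\<close>, with \<open>y = 0\<close> treated
  apart.\<close>

lemma val_unif_mono:
  assumes "x \<in> univ M" "y \<in> univ M"
  shows "val (mscale M (punif p) x) \<subseteq> val (mscale M (punif p) y) \<longleftrightarrow> val x \<subseteq> val y"
proof -
  have *: "val (mscale M (punif p) x) \<subset> val (mscale M (punif p) y)"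
    if "x \<in> univ M" "y \<in> univ M" "val x \<subset> val y" for x y
  proof (cases "y = mzero M")
    case True
    then have "mscale M (punif p) x \<noteq> mzero M" using that scale_eq_zero[of x "punif p"] pu by auto
    then show ?thesis using True val_zero val_eq_zero that by (auto simp: psubset_eq)
  next
    case False
    have "x \<noteq> mzero M" using that val_zero[of y] by auto
    then have "val (mscale M (punif p) x) \<subseteq> val y" using val_unif(2)[of x y] that by auto
    then show ?thesis using val_unif(1)[of y] that False by auto
  qed
  have eq: "val (mscale M (punif p) x) \<subseteq> val (mscale M (punif p) y)" if xy: "x \<in> univ M" "y \<in> univ M" "val x = val y" for x y
  proof (cases "x = mzero M")
    case True
    then have "y = mzero M" using xy val_eq_zero by blast
    then show ?thesis using True by simp
  next
    case False
    then have y0: "y \<noteq> mzero M" using xy val_eq_zero[of x] by auto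
    show ?thesis using val_unif(2)[OF xy(1) False, of "mscale M (punif p) y"] val_unif(1)[OF xy(2) y0] xy by simp
  qed
  show ?thesis using *[of x y] *[of y x] eq[of x y] val_total[OF assms] assms by blast
qed

lemma val_scale_mono:
  assumes xy: "x \<in> univ M" "y \<in> univ M" and c: "c \<noteq> 0"
  shows "val (mscale M c x) \<subseteq> val (mscale M c y) \<longleftrightarrow> val x \<subseteq> val y"
proof -
  have pw: "val (mscale M (punif p ^ n) x) \<subseteq> val (mscale M (punif p ^ n) y) \<longleftrightarrow> val x \<subseteq> val y"
    if xy: "x \<in> univ M" "y \<in> univ M" for n x y
    by (induction n) (use val_unif_mono xy in \<open>auto simp: scale_scale[symmetric]\<close>)
  have pos: "val (mscale M c x) \<subseteq> val (mscale M c y) \<longleftrightarrow> val x \<subseteq> val y"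
    if xy: "x \<in> univ M" "y \<in> univ M" and c: "c \<noteq> 0" "pval p c \<ge> 0" for x y c
  proof -
    have "pval p c = pval p (punif p ^ nat (pval p c))" using pval_power[OF p pu(1)] pu(2) c by simp
    then have "val (mscale M c z) = val (mscale M (punif p ^ nat (pval p c)) z)" if "z \<in> univ M" for z
      using val_scale_eq[OF c(1) _ _ that] pu by simp
    then show ?thesis using pw xy by simp
  qed
  show ?thesis
  proof (cases "pval p c \<ge> 0")
    case False
    then have "pval p (inverse c) \<ge> 0" using pval_inverse[OF p c] by simp
    then show ?thesis using pos[of "mscale M c x" "mscale M c y" "inverse c"] xy c by (simp add: scale_scale)
  qed (use pos xy c in blast)
qed

lemma val_scale_cong: "x \<in> univ M \<Longrightarrow> y \<in> univ M \<Longrightarrow> val x = val y \<Longrightarrow> val (mscale M c x) = val (mscale M c y)"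
  using val_scale_mono[of x y c] val_scale_mono[of y x c] by (cases "c = 0") auto

lemma val_scale_pval: "c \<noteq> 0 \<Longrightarrow> x \<in> univ M \<Longrightarrow> val (mscale M c x) = val (mscale M (ppow p (pval p c)) x)"
  using val_scale_eq[of c "ppow p (pval p c)" x] pu pval_ppow[OF p] by simp

lemma val_add_strict:
  assumes "x \<in> univ M" "y \<in> univ M" "val x \<subset> val y"
  shows "val (madd M x y) = val x"
proof
  show "val x \<subseteq> val (madd M x y)" using val_add[OF assms(1,2)] assms(3) by blast
  have "msub M (madd M x y) y = x" using sub_sub(6) assms by simp
  then have "val (madd M x y) \<inter> val y \<subseteq> val x"
    using val_add[of "madd M x y" "mscale M (- 1) y"] assms by simp
  then show "val (madd M x y) \<subseteq> val x" using assms val_total[of y "madd M x y"] by blast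
qed

lemma val_add_strict': "x \<in> univ M \<Longrightarrow> y \<in> univ M \<Longrightarrow> val y \<subset> val x \<Longrightarrow> val (madd M x y) = val y"
  using val_add_strict[of y x] by (simp add: add_comm)

lemma val_max:
  assumes "finite I" "I \<noteq> {}" "\<And>i. i \<in> I \<Longrightarrow> w i \<in> univ M"
  shows "\<exists>i\<in>I. \<forall>j\<in>I. val (w j) \<subseteq> val (w i)" "\<exists>i\<in>I. \<forall>j\<in>I. val (w i) \<subseteq> val (w j)"
proof -
  show "\<exists>i\<in>I. \<forall>j\<in>I. val (w j) \<subseteq> val (w i)" by (rule finite_extremal[OF assms(1,2)]) (use val_total assms(3) in auto)
  show "\<exists>i\<in>I. \<forall>j\<in>I. val (w i) \<subseteq> val (w j)" by (rule finite_extremal[OF assms(1,2)]) (use val_total assms(3) in auto)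
qed

lemma val_shift_le:
  assumes "x \<in> univ M" "y \<in> univ M"
  shows "val (mscale M (ppow p n) x) \<subseteq> val (mscale M (ppow p m) y) \<longleftrightarrow> val x \<subseteq> val (mscale M (ppow p (m - n)) y)"
proof -
  have "mscale M (ppow p m) y = mscale M (ppow p n) (mscale M (ppow p (m - n)) y)"
    using assms pu by (simp add: scale_scale power_int_add[symmetric])
  then show ?thesis using val_scale_mono[of x "mscale M (ppow p (m - n)) y" "ppow p n"] assms pu by simp
qed

text \<open>Discreteness turns an upper bound on \<open>v(z)\<close> into the failure of a lower
  one, so that only lower thresholds have to be matched.\<close>

lemma val_discrete:
  assumes "y \<in> univ M" "y \<noteq> mzero M" "z \<in> univ M"
  shows "val z \<subseteq> val y \<longleftrightarrow> \<not> val (mscale M (punif p) y) \<subseteq> val z"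
  using val_unif(1)[OF assms(1,2)] val_unif(2)[OF assms] val_total[OF assms(1,3)] by blast

lemma val_self_shift:
  assumes x: "x \<in> univ M" "x \<noteq> mzero M"
  shows "val x \<subseteq> val (mscale M (ppow p n) x) \<longleftrightarrow> n \<ge> 0"
proof -
  have up: "val x \<subseteq> val (mscale M (punif p ^ k) x)" for k
  proof (induction k)
    case (Suc k)
    have "mscale M (punif p ^ k) x \<noteq> mzero M" using scale_eq_zero x pu by simp
    then show ?case using Suc val_unif(1)[of "mscale M (punif p ^ k) x"] x by (auto simp: scale_scale)
  qed (use x in simp)
  show ?thesis
  proof (cases "n \<ge> 0")
    case True
    then show ?thesis using up[of "nat n"] by (simp add: power_int_def)
  next
    case False
    define m where "m = nat (- n - 1)"
    have n: "ppow p n = inverse (punif p ^ Suc m)" using False unfolding m_def by (simp add: power_int_def power_inverse Suc_nat_eq_nat_zadd1)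
    define y where "y = mscale M (ppow p n) x"
    have y: "y \<in> univ M" "y \<noteq> mzero M" unfolding y_def using scale_eq_zero x pu by auto
    have "punif p * (punif p ^ m * ppow p n) = 1" unfolding n using pu by (simp add: field_simps)
    then have xy: "x = mscale M (punif p) (mscale M (punif p ^ m) y)"
      unfolding y_def using x by (simp add: scale_scale)
    have "mscale M (punif p ^ m) y \<noteq> mzero M" using scale_eq_zero y pu by simp
    then have "val (mscale M (punif p ^ m) y) \<subset> val x" unfolding xy using val_unif(1) y by simp
    moreover have "val y \<subseteq> val (mscale M (punif p ^ m) y)"
    proof (induction m)
      case (Suc m)
      have "mscale M (punif p ^ m) y \<noteq> mzero M" using scale_eq_zero y pu by simp
      then show ?case using Suc val_unif(1)[of "mscale M (punif p ^ m) y"] y by (auto simp: scale_scale)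
    qed (use y in simp)
    ultimately show ?thesis using False unfolding y_def by blast
  qed
qed

text \<open>With finite residue field, the set \<open>D\<close> of centers is enlarged so that every \<open>x\<close> has a center
whose distances to the \<open>a i\<close> all differ from the distance to \<open>x\<close>.\<close>

lemma nearest_center:
  assumes I: "finite I" "I \<noteq> {}" and a: "\<And>i. i \<in> I \<Longrightarrow> a i \<in> univ M" and x: "x \<in> univ M"
    and D: "a ` I \<subseteq> D" "D \<subseteq> univ M" "x \<notin> D"
    and W: "\<And>i j w. finite (residue_field p) \<Longrightarrow> residue_reps p ws \<and> (i \<in> I \<longrightarrow> j \<in> I \<longrightarrow> w \<in> set ws \<longrightarrow>
      madd M (a i) (mscale M w (msub M (a j) (a i))) \<in> D)"
  shows "\<exists>c\<in>D. \<forall>i\<in>I. val (msub M x (a i)) = val (msub M x c) \<inter> val (msub M c (a i)) \<and>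
    (finite (residue_field p) \<longrightarrow> val (msub M x c) \<noteq> val (msub M c (a i)))"
proof -
  \<comment> \<open>\<open>a i\<close> is a closest center. It serves already, unless the residue
    field is finite and \<open>v(x - a i)\<close> equals some \<open>v(a i - a j)\<close>.\<close>
  obtain i where i: "i \<in> I" "\<forall>j\<in>I. val (msub M x (a j)) \<subseteq> val (msub M x (a i))"
    using val_max(1)[OF I, of "\<lambda>i. msub M x (a i)"] a x by auto
  define z where "z = msub M x (a i)"
  have ai: "a i \<in> univ M" and z: "z \<in> univ M" using i a x unfolding z_def by auto
  have near: "val (msub M x (a j)) = val z \<inter> val (msub M (a i) (a j))" if j: "j \<in> I" for j
  proof
    have aj: "a j \<in> univ M" using a j by simp
    have "msub M x (a j) = madd M z (msub M (a i) (a j))" unfolding z_def using sub_sub(1) x ai aj by simp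
    then show "val z \<inter> val (msub M (a i) (a j)) \<subseteq> val (msub M x (a j))" using val_add z ai aj by simp
    have "msub M (a i) (a j) = msub M (msub M x (a j)) z" unfolding z_def using sub_sub(2) x ai aj by simp
    then have "val (msub M x (a j)) \<inter> val z \<subseteq> val (msub M (a i) (a j))"
      using val_add[of "msub M x (a j)" "mscale M (- 1) z"] x aj z by simp
    then show "val (msub M x (a j)) \<subseteq> val z \<inter> val (msub M (a i) (a j))" using i j unfolding z_def by blast
  qed
  show ?thesis
  proof (cases "finite (residue_field p) \<and> (\<exists>j\<in>I. val z = val (msub M (a i) (a j)))")
    case False
    then have "\<forall>j\<in>I. val (msub M x (a j)) = val z \<inter> val (msub M (a i) (a j)) \<and>
        (finite (residue_field p) \<longrightarrow> val z \<noteq> val (msub M (a i) (a j)))" using near by blast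
    moreover have "a i \<in> D" using i D(1) by auto
    ultimately show ?thesis unfolding z_def by blast
  next
    case True
    then obtain j where j: "j \<in> I" "val z = val (msub M (a i) (a j))" by auto
    note fin = True[THEN conjunct1]
    have aj: "a j \<in> univ M" using a j by simp
    define x' where "x' = msub M (a j) (a i)"
    have x': "x' \<in> univ M" "val x' = val z" unfolding x'_def using ai aj j(2) val_sub_commute by auto
    have "x \<noteq> a i" using D(1,3) i by auto
    then have "z \<noteq> mzero M" unfolding z_def using sub_eq_zero x ai by simp
    then have x'0: "x' \<noteq> mzero M" using x' val_eq_zero z by metis
    define y' where "y' = msub M (a i) x"
    have y': "y' \<in> univ M" "val y' = val x'" unfolding y'_def x'(2) z_def using val_sub_commute ai x by auto
    \<comment> \<open>The residue axiom is applied to \<open>a j - a i\<close> and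
      \<open>a i - x\<close>, which have the same value. The new center
      \<open>a i + w (a j - a i)\<close> is strictly closer to \<open>x\<close> than every
      \<open>a l\<close>, so it has the same distances from them as \<open>x\<close>.\<close>
    obtain w where w: "w \<in> set ws" "\<not> mL p M x' (madd M (mscale M w x') y')"
      using L_residue_finite[OF fin W[OF fin, THEN conjunct1] x'(1) y'(1)] L_iff x' y' x'0 by auto
    define c where "c = madd M (a i) (mscale M w x')"
    have c: "c \<in> D" unfolding c_def x'_def using W[OF fin] i j w by blast
    have cM: "c \<in> univ M" using c D by blast
    have "madd M (mscale M w x') y' = msub M c x"
      unfolding c_def y'_def using sub_sub(4)[of "a i" "mscale M w x'" x] ai x x'(1) by simp
    then have "\<not> val (msub M c x) \<subseteq> val x'" using w L_iff x' cM x by auto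
    then have lt: "val z \<subset> val (msub M x c)"
      using val_total[of x' "msub M x c"] val_sub_commute[of c x] x' cM x by auto
    have "val (msub M c (a l)) = val (msub M x (a l))" if l: "l \<in> I" for l
    proof -
      have al: "a l \<in> univ M" using a l by simp
      have "msub M c (a l) = msub M (msub M x (a l)) (msub M x c)"
        using sub_sub(2)[of x c "a l"] x cM al by simp
      moreover have "val (msub M x (a l)) \<subset> val (mscale M (- 1) (msub M x c))"
        using lt i l x cM unfolding z_def by auto
      ultimately show ?thesis using val_add_strict x cM al by simp
    qed
    moreover have "val (msub M x (a l)) \<subset> val (msub M x c)" if "l \<in> I" for l
      using lt i(2) that unfolding z_def by blast
    ultimately have "val (msub M x (a l)) = val (msub M x c) \<inter> val (msub M c (a l)) \<and>
        val (msub M x c) \<noteq> val (msub M c (a l))" if "l \<in> I" for l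
      using that by blast
    then show ?thesis using c by blast
  qed
qed

text \<open>The point is \<open>c\<close> plus a unit multiple of \<open>z\<close>, and cancellation
  between this multiple and \<open>c - a i\<close> must be avoided. For a finite residue field the
  hypothesis \<open>fin\<close> rules it out; otherwise a unit is chosen that avoids it for all
  \<open>i\<close> at once, from one more residue than there are indices.\<close>

lemma generic_point:
  assumes I: "finite I" and a: "\<And>i. i \<in> I \<Longrightarrow> a i \<in> univ M" and c: "c \<in> univ M" and z: "z \<in> univ M" "z \<noteq> mzero M"
    and fin: "finite (residue_field p) \<Longrightarrow> \<forall>i\<in>I. val z \<noteq> val (msub M c (a i))"
  shows "\<exists>y\<in>univ M. \<forall>i\<in>I. val (msub M y (a i)) = val z \<inter> val (msub M c (a i))"
proof (cases "finite (residue_field p)")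
  case True
  have "val (msub M (madd M c z) (a i)) = val z \<inter> val (msub M c (a i))" if i: "i \<in> I" for i
  proof -
    have ai: "a i \<in> univ M" using a i by simp
    have 1: "msub M (madd M c z) (a i) = madd M z (msub M c (a i))" using sub_sub(4) c z ai by simp
    consider "val z \<subset> val (msub M c (a i))" | "val (msub M c (a i)) \<subset> val z"
      using fin[OF True] i val_total[of z "msub M c (a i)"] c z ai by blast
    then show ?thesis
    proof cases
      case 1
      then show ?thesis unfolding \<open>msub M (madd M c z) (a i) = _\<close> using val_add_strict z c ai by auto
    next
      case 2
      then show ?thesis unfolding \<open>msub M (madd M c z) (a i) = _\<close> using val_add_strict' z c ai by auto
    qed
  qed
  then show ?thesis using c z by (intro bexI[of _ "madd M c z"]) auto
next
  case False
  obtain h where h: "bij_betw h {1..card I} I" using ex_bij_betw_nat_finite_1[OF I] by blast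
  obtain ws where ws: "length ws = Suc (card I)" "distinct_residues p ws" using distinct_residues_exist[OF p False] by blast
  \<comment> \<open>Differences of value below \<open>v(z)\<close> cannot cancel with a unit
    multiple of \<open>z\<close>; they are replaced by zero, as the axiom asks for values at least
    \<open>v(z)\<close>.\<close>
  define y where "y j = (if val z \<subseteq> val (msub M c (a (h j))) then msub M c (a (h j)) else mzero M)" for j
  have hI: "h j \<in> I" if "j \<in> {1..card I}" for j using h that by (auto simp: bij_betw_def)
  have "y j \<in> univ M \<and> mL p M (y j) z" if "j \<in> {1..card I}" for j
    unfolding y_def using a[OF hI[OF that]] c z L_iff val_zero by auto
  then obtain w where w: "w \<in> set ws" "\<forall>j\<in>{1..card I}. mL p M (madd M (mscale M w z) (y j)) z \<and>
      mL p M z (madd M (mscale M w z) (y j))" using L_residue_infinite[OF False ws z(1)] by blast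
  have "w \<noteq> 0" "pval p w = 0" using w(1) ws(2) unfolding distinct_residues_def vunits_def by auto
  then have vw: "val (mscale M w z) = val z" using val_unit z by simp
  have "val (msub M (madd M c (mscale M w z)) (a i)) = val z \<inter> val (msub M c (a i))" if i: "i \<in> I" for i
  proof -
    have ai: "a i \<in> univ M" using a i by simp
    have 1: "msub M (madd M c (mscale M w z)) (a i) = madd M (mscale M w z) (msub M c (a i))"
      using sub_sub(4) c z ai by simp
    obtain j where j: "j \<in> {1..card I}" "i = h j" using h i by (metis bij_betw_imp_surj_on imageE)
    show ?thesis
    proof (cases "val z \<subseteq> val (msub M c (a i))")
      case True
      then have "y j = msub M c (a i)" unfolding y_def using j by simp
      then have "val (madd M (mscale M w z) (msub M c (a i))) = val z"
        using w(2) j(1) L_iff z c ai by (metis closed(2,3) subset_antisym)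
      then show ?thesis using 1 True by auto
    next
      case False
      then have "val (msub M c (a i)) \<subset> val (mscale M w z)"
        unfolding vw using val_total[of z "msub M c (a i)"] z c ai by auto
      then show ?thesis unfolding 1 using val_add_strict' z c ai vw by auto
    qed
  qed
  then show ?thesis using c z by (intro bexI[of _ "madd M c (mscale M w z)"]) auto
qed

end

section \<open>The value group\<close>

text \<open>\<open>mM\<close> gives addition of values only as a relation on vectors, so the product
  is read off chosen representatives. It is also defined at the value of zero, which is infinity and
  stays outside the carrier.\<close>

definition vgroup :: "'k place \<Rightarrow> ('k fsym, 'k rsym, 'u) struct \<Rightarrow> 'u set monoid" where
  "vgroup p M = \<lparr>carrier = vv p M ` (univ M - {mzero M}),
     mult = (\<lambda>A B. vv p M (SOME z. z \<in> univ M \<and> (\<exists>x\<in>univ M. \<exists>y\<in>univ M. vv p M x = A \<and> vv p M y = B \<and> mM p M x y z))),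
     one = vv p M (mone M)\<rparr>"

definition veps :: "'k::field place \<Rightarrow> ('k fsym, 'k rsym, 'u) struct \<Rightarrow> 'u set" where
  "veps p M = vv p M (mscale M (punif p) (mone M))"

locale finplus = finplace M p for M :: "('k::field fsym, 'k rsym, 'u) struct" and p +
  assumes pax: "plus_ax p M"
begin

abbreviation "G \<equiv> vgroup p M"

lemma plus_axD:
  "x \<in> univ M \<Longrightarrow> y \<in> univ M \<Longrightarrow> \<exists>z\<in>univ M. mM p M x y z"
  "x \<in> univ M \<Longrightarrow> y \<in> univ M \<Longrightarrow> z \<in> univ M \<Longrightarrow> x' \<in> univ M \<Longrightarrow> y' \<in> univ M \<Longrightarrow> z' \<in> univ M \<Longrightarrow>
    (mL p M x x' \<and> mL p M x' x) \<and> (mL p M y y' \<and> mL p M y' y) \<and> mM p M x y z \<Longrightarrow>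
    (mL p M z z' \<and> mL p M z' z \<longleftrightarrow> mM p M x' y' z')"
  "x \<in> univ M \<Longrightarrow> y \<in> univ M \<Longrightarrow> z \<in> univ M \<Longrightarrow> mM p M x y z \<Longrightarrow> mM p M y x z"
  "x \<in> univ M \<Longrightarrow> y \<in> univ M \<Longrightarrow> z \<in> univ M \<Longrightarrow> x' \<in> univ M \<Longrightarrow> y' \<in> univ M \<Longrightarrow> z' \<in> univ M \<Longrightarrow>
    mM p M x y x' \<and> mM p M x' z z' \<and> mM p M y z y' \<Longrightarrow> mM p M x y' z'"
  "x \<in> univ M \<Longrightarrow> mM p M (mone M) x x"
  "x \<in> univ M \<Longrightarrow> mM p M x (mzero M) (mzero M)"
  "x \<in> univ M \<Longrightarrow> x \<noteq> mzero M \<Longrightarrow> \<exists>y\<in>univ M. mM p M x y (mone M)"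
  "x \<in> univ M \<Longrightarrow> y \<in> univ M \<Longrightarrow> x \<noteq> mzero M \<Longrightarrow> y \<noteq> mzero M \<Longrightarrow> \<not> mM p M x y (mzero M)"
  "x \<in> univ M \<Longrightarrow> y \<in> univ M \<Longrightarrow> z \<in> univ M \<Longrightarrow> x' \<in> univ M \<Longrightarrow> y' \<in> univ M \<Longrightarrow>
    mL p M x y \<and> mM p M x z x' \<and> mM p M y z y' \<Longrightarrow> mL p M x' y'"
  "n \<ge> 1 \<Longrightarrow> \<pi> \<noteq> 0 \<Longrightarrow> pval p \<pi> = 1 \<Longrightarrow> x \<in> univ M \<Longrightarrow> \<exists>f. mchain p M n f \<and>
        (\<exists>i\<in>{1..n}. mM p M (f n) (mscale M (\<pi> ^ i) (mone M)) x)"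
  "n \<ge> 1 \<Longrightarrow> x \<in> univ M \<Longrightarrow> mQ p n M x \<longleftrightarrow> (\<exists>f. mchain p M n f \<and> mL p M (f n) x \<and> mL p M x (f n))"
proof -
  note D = pax[unfolded plus_ax_def]
  note d1 = D[THEN conjunct1]
  note d2 = D[THEN conjunct2, THEN conjunct1]
  note d3 = D[THEN conjunct2, THEN conjunct2, THEN conjunct1]
  note d4 = D[THEN conjunct2, THEN conjunct2, THEN conjunct2, THEN conjunct1]
  note D5 = D[THEN conjunct2, THEN conjunct2, THEN conjunct2, THEN conjunct2]
  note d5 = D5[THEN conjunct1] and d6 = D5[THEN conjunct2, THEN conjunct1]
    and d7 = D5[THEN conjunct2, THEN conjunct2, THEN conjunct1]
    and d8 = D5[THEN conjunct2, THEN conjunct2, THEN conjunct2, THEN conjunct1]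
  note D9 = D5[THEN conjunct2, THEN conjunct2, THEN conjunct2, THEN conjunct2]
  note d9 = D9[THEN conjunct1] and d10 = D9[THEN conjunct2, THEN conjunct1]
    and d11 = D9[THEN conjunct2, THEN conjunct2]
  show "x \<in> univ M \<Longrightarrow> y \<in> univ M \<Longrightarrow> \<exists>z\<in>univ M. mM p M x y z" using d1 by simp
  show "x \<in> univ M \<Longrightarrow> y \<in> univ M \<Longrightarrow> z \<in> univ M \<Longrightarrow> x' \<in> univ M \<Longrightarrow> y' \<in> univ M \<Longrightarrow> z' \<in> univ M \<Longrightarrow>
    (mL p M x x' \<and> mL p M x' x) \<and> (mL p M y y' \<and> mL p M y' y) \<and> mM p M x y z \<Longrightarrow>
    (mL p M z z' \<and> mL p M z' z \<longleftrightarrow> mM p M x' y' z')" by (rule d2[rule_format])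
  show "x \<in> univ M \<Longrightarrow> y \<in> univ M \<Longrightarrow> z \<in> univ M \<Longrightarrow> mM p M x y z \<Longrightarrow> mM p M y x z" using d3 by simp
  show "x \<in> univ M \<Longrightarrow> y \<in> univ M \<Longrightarrow> z \<in> univ M \<Longrightarrow> x' \<in> univ M \<Longrightarrow> y' \<in> univ M \<Longrightarrow> z' \<in> univ M \<Longrightarrow>
    mM p M x y x' \<and> mM p M x' z z' \<and> mM p M y z y' \<Longrightarrow> mM p M x y' z'"
    by (rule d4[rule_format, of x y z x' y' z'])
  show "x \<in> univ M \<Longrightarrow> mM p M (mone M) x x" using d5 by simp
  show "x \<in> univ M \<Longrightarrow> mM p M x (mzero M) (mzero M)" using d6 by simp
  show "x \<in> univ M \<Longrightarrow> x \<noteq> mzero M \<Longrightarrow> \<exists>y\<in>univ M. mM p M x y (mone M)" using d7 by simp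
  show "x \<in> univ M \<Longrightarrow> y \<in> univ M \<Longrightarrow> x \<noteq> mzero M \<Longrightarrow> y \<noteq> mzero M \<Longrightarrow> \<not> mM p M x y (mzero M)" using d8 by simp
  show "x \<in> univ M \<Longrightarrow> y \<in> univ M \<Longrightarrow> z \<in> univ M \<Longrightarrow> x' \<in> univ M \<Longrightarrow> y' \<in> univ M \<Longrightarrow>
    mL p M x y \<and> mM p M x z x' \<and> mM p M y z y' \<Longrightarrow> mL p M x' y'" by (rule d9[rule_format, of x y z x' y'])
  show "n \<ge> 1 \<Longrightarrow> \<pi> \<noteq> 0 \<Longrightarrow> pval p \<pi> = 1 \<Longrightarrow> x \<in> univ M \<Longrightarrow> \<exists>f. mchain p M n f \<and>
        (\<exists>i\<in>{1..n}. mM p M (f n) (mscale M (\<pi> ^ i) (mone M)) x)" using d10 by blast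
  show "n \<ge> 1 \<Longrightarrow> x \<in> univ M \<Longrightarrow> mQ p n M x \<longleftrightarrow> (\<exists>f. mchain p M n f \<and> mL p M (f n) x \<and> mL p M x (f n))"
    using d11 by blast
qed

text \<open>\<open>mM\<close> respects equality of values, so the choice of representatives in
  \<open>vgroup\<close> is harmless.\<close>

lemma mult_iff:
  assumes "x \<in> univ M" "y \<in> univ M" "z \<in> univ M"
  shows "mM p M x y z \<longleftrightarrow> val x \<otimes>\<^bsub>G\<^esub> val y = val z"
proof -
  let ?P = "\<lambda>z. z \<in> univ M \<and> (\<exists>x'\<in>univ M. \<exists>y'\<in>univ M. val x' = val x \<and> val y' = val y \<and> mM p M x' y' z)"
  define z' where "z' = (SOME z. ?P z)"
  have "\<exists>z. ?P z" using plus_axD(1)[OF assms(1,2)] assms by blast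
  then have "?P z'" unfolding z'_def by (rule someI_ex)
  then obtain x' y' where z': "z' \<in> univ M" "x' \<in> univ M" "y' \<in> univ M" "val x' = val x" "val y' = val y" "mM p M x' y' z'"
    by blast
  have "mL p M z' z \<and> mL p M z z' \<longleftrightarrow> mM p M x y z"
    using z' assms L_iff by (intro plus_axD(2)[of x' y']) auto
  moreover have "val x \<otimes>\<^bsub>G\<^esub> val y = val z'" unfolding vgroup_def z'_def by simp
  ultimately show ?thesis using L_iff[of z z'] L_iff[of z' z] z'(1) assms(3) by auto
qed

lemma mult_ex:
  assumes "x \<in> univ M" "y \<in> univ M"
  obtains z where "z \<in> univ M" "val x \<otimes>\<^bsub>G\<^esub> val y = val z" "z = mzero M \<longleftrightarrow> x = mzero M \<or> y = mzero M"
proof -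
  obtain z where z: "z \<in> univ M" "mM p M x y z" using plus_axD(1)[OF assms] by blast
  then have 1: "val x \<otimes>\<^bsub>G\<^esub> val y = val z" using mult_iff assms by simp
  moreover have "z = mzero M" if "x = mzero M \<or> y = mzero M"
  proof -
    have "mM p M x y (mzero M)" using that plus_axD(6)[of x] plus_axD(6)[of y] plus_axD(3)[of y x "mzero M"] assms by auto
    then have "val z = val (mzero M)" using mult_iff assms 1 by simp
    then show ?thesis using val_eq_zero z by simp
  qed
  moreover have "x = mzero M \<or> y = mzero M" if "z = mzero M"
    using plus_axD(8)[OF assms] z(2) that by auto
  ultimately show ?thesis using that z(1) by blast
qed

lemma carrier_G: "carrier G = val ` (univ M - {mzero M})" and one_G: "\<one>\<^bsub>G\<^esub> = val (mone M)"
  unfolding vgroup_def by simp_all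

lemma mult_zero: "x \<in> univ M \<Longrightarrow> val x \<otimes>\<^bsub>G\<^esub> val (mzero M) = val (mzero M)"
  using mult_iff plus_axD(6) by simp

lemma comm_group_G: "comm_group G"
proof (rule comm_groupI)
  show "A \<otimes>\<^bsub>G\<^esub> B \<in> carrier G" if AB: "A \<in> carrier G" "B \<in> carrier G" for A B
  proof -
    obtain x y where xy: "x \<in> univ M" "x \<noteq> mzero M" "A = val x" "y \<in> univ M" "y \<noteq> mzero M" "B = val y"
      using AB unfolding carrier_G by auto
    obtain z where "z \<in> univ M" "val x \<otimes>\<^bsub>G\<^esub> val y = val z" "z = mzero M \<longleftrightarrow> x = mzero M \<or> y = mzero M"
      by (rule mult_ex[OF xy(1,4)])
    then show ?thesis using xy unfolding carrier_G by simp
  qed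
  show "\<one>\<^bsub>G\<^esub> \<in> carrier G" unfolding carrier_G one_G using zero_ne_one by auto
  show "A \<otimes>\<^bsub>G\<^esub> B \<otimes>\<^bsub>G\<^esub> C = A \<otimes>\<^bsub>G\<^esub> (B \<otimes>\<^bsub>G\<^esub> C)"
    if ABC: "A \<in> carrier G" "B \<in> carrier G" "C \<in> carrier G" for A B C
  proof -
    obtain x y z where xyz: "x \<in> univ M" "A = val x" "y \<in> univ M" "B = val y" "z \<in> univ M" "C = val z"
      using ABC unfolding carrier_G by auto
    obtain x' where x': "x' \<in> univ M" "mM p M x y x'" using plus_axD(1) xyz by blast
    obtain y' where y': "y' \<in> univ M" "mM p M y z y'" using plus_axD(1) xyz by blast
    obtain z' where z': "z' \<in> univ M" "mM p M x' z z'" using plus_axD(1) xyz x' by blast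
    have "mM p M x y' z'" using plus_axD(4)[of x y z x' y' z'] xyz x' y' z' by blast
    then show ?thesis using xyz x' y' z' mult_iff by simp
  qed
  show "A \<otimes>\<^bsub>G\<^esub> B = B \<otimes>\<^bsub>G\<^esub> A" if AB: "A \<in> carrier G" "B \<in> carrier G" for A B
  proof -
    obtain x y where xy: "x \<in> univ M" "A = val x" "y \<in> univ M" "B = val y" using AB unfolding carrier_G by auto
    obtain z where z: "z \<in> univ M" "mM p M x y z" using plus_axD(1) xy by blast
    then show ?thesis using plus_axD(3)[of x y z] xy mult_iff by simp
  qed
  show "\<one>\<^bsub>G\<^esub> \<otimes>\<^bsub>G\<^esub> A = A" if "A \<in> carrier G" for A
    using that mult_iff plus_axD(5) unfolding carrier_G one_G by auto
  show "\<exists>B\<in>carrier G. B \<otimes>\<^bsub>G\<^esub> A = \<one>\<^bsub>G\<^esub>" if A: "A \<in> carrier G" for A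
  proof -
    obtain x where x: "x \<in> univ M" "x \<noteq> mzero M" "A = val x" using A unfolding carrier_G by auto
    obtain y where y: "y \<in> univ M" "mM p M x y (mone M)" using plus_axD(7)[OF x(1,2)] by blast
    have "y \<noteq> mzero M"
    proof
      assume "y = mzero M"
      then have "val (mzero M) = val (mone M)" using y mult_iff x mult_zero by simp
      then show False using val_eq_zero[of "mone M"] zero_ne_one by auto
    qed
    moreover have "mM p M y x (mone M)" using plus_axD(3) x y by simp
    ultimately show ?thesis unfolding carrier_G one_G using x y mult_iff by auto
  qed
qed

lemma mono_G:
  assumes ABC: "A \<in> carrier G" "B \<in> carrier G" "C \<in> carrier G" "A \<subseteq> B"
  shows "A \<otimes>\<^bsub>G\<^esub> C \<subseteq> B \<otimes>\<^bsub>G\<^esub> C"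
proof -
  obtain x y z where xyz: "x \<in> univ M" "A = val x" "y \<in> univ M" "B = val y" "z \<in> univ M" "C = val z"
    using ABC unfolding carrier_G by auto
  obtain x' where x': "x' \<in> univ M" "mM p M x z x'" using plus_axD(1) xyz by blast
  obtain y' where y': "y' \<in> univ M" "mM p M y z y'" using plus_axD(1) xyz by blast
  have "mL p M y' x'" using plus_axD(9)[of y x z y' x'] xyz x' y' L_iff ABC by simp
  then show ?thesis using xyz x' y' mult_iff L_iff by simp
qed

lemma smono_G:
  assumes ABC: "A \<in> carrier G" "B \<in> carrier G" "C \<in> carrier G" "A \<subset> B"
  shows "A \<otimes>\<^bsub>G\<^esub> C \<subset> B \<otimes>\<^bsub>G\<^esub> C"
proof -
  interpret G: comm_group G by (rule comm_group_G)
  show ?thesis using mono_G[of A B C] ABC G.right_cancel[of C A B] by (auto simp: psubset_eq)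
qed

text \<open>Both sides are the immediate successor of \<open>v(x)\<close>: translation by an inverse
  carries the values above \<open>v(x)\<close> to those above the neutral element, of which
  \<open>veps p M\<close> is the least.\<close>

lemma veps_mult:
  assumes x: "x \<in> univ M"
  shows "val (mscale M (punif p) x) = val x \<otimes>\<^bsub>G\<^esub> veps p M"
proof (cases "x = mzero M")
  case True
  interpret G: comm_group G by (rule comm_group_G)
  show ?thesis
    using True plus_axD(6)[of "mscale M (punif p) (mone M)"]
      plus_axD(3)[of "mscale M (punif p) (mone M)" "mzero M" "mzero M"] mult_iff unfolding veps_def by simp
next
  case False
  interpret G: comm_group G by (rule comm_group_G)
  define X where "X = val x"
  have X: "X \<in> carrier G" unfolding X_def carrier_G using x False by auto
  have e0: "mscale M (punif p) (mone M) \<noteq> mzero M" using scale_eq_zero pu zero_ne_one by auto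
  have e: "veps p M \<in> carrier G" unfolding veps_def carrier_G using e0 by auto
  have px: "mscale M (punif p) x \<noteq> mzero M" using scale_eq_zero pu x False by auto
  define Y where "Y = val (mscale M (punif p) x)"
  have Y: "Y \<in> carrier G" unfolding Y_def carrier_G using px x by auto
  have one: "\<one>\<^bsub>G\<^esub> \<subset> veps p M" unfolding one_G veps_def using val_unif(1)[of "mone M"] zero_ne_one by auto
  have XY: "X \<subset> Y" unfolding X_def Y_def using val_unif(1)[OF x False] .
  have 1: "X \<subset> X \<otimes>\<^bsub>G\<^esub> veps p M"
    using smono_G[OF _ e X one] X e by (simp add: G.m_comm)
  obtain z where z: "z \<in> univ M" "X \<otimes>\<^bsub>G\<^esub> veps p M = val z"
    using G.m_closed[OF X e] unfolding carrier_G by auto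
  have "Y \<subseteq> X \<otimes>\<^bsub>G\<^esub> veps p M" using val_unif(2)[OF x False z(1)] 1 z unfolding X_def Y_def by simp
  moreover have "X \<otimes>\<^bsub>G\<^esub> veps p M \<subseteq> Y"
  proof -
    have i: "inv\<^bsub>G\<^esub> X \<in> carrier G" using X by simp
    have "\<one>\<^bsub>G\<^esub> \<subset> Y \<otimes>\<^bsub>G\<^esub> inv\<^bsub>G\<^esub> X" using smono_G[OF X Y i XY] X by simp
    moreover obtain y where y: "y \<in> univ M" "Y \<otimes>\<^bsub>G\<^esub> inv\<^bsub>G\<^esub> X = val y"
      using G.m_closed[OF Y i] unfolding carrier_G by auto
    ultimately have "veps p M \<subseteq> Y \<otimes>\<^bsub>G\<^esub> inv\<^bsub>G\<^esub> X"
      using val_unif(2)[of "mone M" y] zero_ne_one unfolding one_G veps_def by auto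
    then have "veps p M \<otimes>\<^bsub>G\<^esub> X \<subseteq> Y \<otimes>\<^bsub>G\<^esub> inv\<^bsub>G\<^esub> X \<otimes>\<^bsub>G\<^esub> X" using mono_G[OF e _ X] Y i by simp
    then show ?thesis using X Y e by (simp add: G.m_assoc) (simp add: G.m_comm)
  qed
  ultimately show ?thesis unfolding X_def Y_def by simp
qed


lemma veps_carrier: "veps p M \<in> carrier G"
  unfolding veps_def carrier_G using scale_eq_zero pu zero_ne_one by auto

lemma val_ppow:
  assumes x: "x \<in> univ M" "x \<noteq> mzero M"
  shows "val (mscale M (ppow p n) x) = val x \<otimes>\<^bsub>G\<^esub> veps p M [^]\<^bsub>G\<^esub> n"
proof -
  interpret G: comm_group G by (rule comm_group_G)
  have nat: "val (mscale M (punif p ^ k) x) = val x \<otimes>\<^bsub>G\<^esub> veps p M [^]\<^bsub>G\<^esub> int k"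
    if x: "x \<in> univ M" "x \<noteq> mzero M" for k x
  proof (induction k)
    case 0
    have "val x \<in> carrier G" unfolding carrier_G using x by auto
    then show ?case using x by simp
  next
    case (Suc k)
    have vx: "val x \<in> carrier G" unfolding carrier_G using x by auto
    have "val (mscale M (punif p ^ Suc k) x) = val (mscale M (punif p ^ k) x) \<otimes>\<^bsub>G\<^esub> veps p M"
      using veps_mult[of "mscale M (punif p ^ k) x"] x by (simp add: scale_scale)
    also have "\<dots> = val x \<otimes>\<^bsub>G\<^esub> (veps p M [^]\<^bsub>G\<^esub> int k \<otimes>\<^bsub>G\<^esub> veps p M [^]\<^bsub>G\<^esub> (1::int))"
      using Suc vx veps_carrier by (simp add: G.m_assoc)
    also have "\<dots> = val x \<otimes>\<^bsub>G\<^esub> veps p M [^]\<^bsub>G\<^esub> int (Suc k)"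
      using G.int_pow_mult[OF veps_carrier, of "int k" 1] by (simp add: add.commute)
    finally show ?case .
  qed
  show ?thesis
  proof (cases "n \<ge> 0")
    case True
    then show ?thesis using nat[OF x, of "nat n"] by (simp add: power_int_def)
  next
    case False
    define y where "y = mscale M (ppow p n) x"
    have y: "y \<in> univ M" "y \<noteq> mzero M" unfolding y_def using x scale_eq_zero pu by auto
    have vy: "val y \<in> carrier G" unfolding carrier_G using y by auto
    have "mscale M (punif p ^ nat (- n)) y = x"
      using False x pu unfolding y_def by (simp add: scale_scale power_int_def power_inverse)
    then have "val x = val y \<otimes>\<^bsub>G\<^esub> veps p M [^]\<^bsub>G\<^esub> (- n)" using nat[OF y, of "nat (- n)"] False by simp
    then have "val x \<otimes>\<^bsub>G\<^esub> veps p M [^]\<^bsub>G\<^esub> n = val y \<otimes>\<^bsub>G\<^esub> (veps p M [^]\<^bsub>G\<^esub> (- n) \<otimes>\<^bsub>G\<^esub> veps p M [^]\<^bsub>G\<^esub> n)"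
      using vy veps_carrier by (simp add: G.m_assoc)
    also have "\<dots> = val y" using vy veps_carrier by (simp add: G.int_pow_mult[symmetric])
    finally show ?thesis unfolding y_def by simp
  qed
qed

lemma val_scale:
  assumes "x \<in> univ M" "x \<noteq> mzero M" "c \<noteq> 0"
  shows "val (mscale M c x) = val x \<otimes>\<^bsub>G\<^esub> veps p M [^]\<^bsub>G\<^esub> pval p c"
  using val_scale_pval[of c x] val_ppow[of x] assms by simp

text \<open>A chain starting with the zero vector stays at infinity; this case is kept apart because
  infinity is not in the group.\<close>

lemma chain_val:
  assumes f: "mchain p M n f" and "1 \<le> i" "i \<le> n"
  shows "f i = mzero M \<longleftrightarrow> f 1 = mzero M"
    "f 1 \<noteq> mzero M \<Longrightarrow> val (f i) = val (f 1) [^]\<^bsub>G\<^esub> int i"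
proof -
  interpret G: comm_group G by (rule comm_group_G)
  have fM: "f i \<in> univ M" if "1 \<le> i" "i \<le> n" for i using f that unfolding mchain_def by simp
  have "(f i = mzero M \<longleftrightarrow> f 1 = mzero M) \<and> (f 1 \<noteq> mzero M \<longrightarrow> val (f i) = val (f 1) [^]\<^bsub>G\<^esub> int i)"
    using assms(2,3)
  proof (induction i rule: nat_induct_at_least)
    case base
    then have "f 1 \<noteq> mzero M \<Longrightarrow> val (f 1) \<in> carrier G" using fM[of 1] unfolding carrier_G by auto
    then show ?case by simp
  next
    case (Suc i)
    then have i: "1 \<le> i" "i \<le> n" and m: "mM p M (f i) (f 1) (f (Suc i))" using f unfolding mchain_def by auto
    have u: "f i \<in> univ M" "f 1 \<in> univ M" "f (Suc i) \<in> univ M" using fM Suc i by auto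
    have v: "val (f i) \<otimes>\<^bsub>G\<^esub> val (f 1) = val (f (Suc i))" using mult_iff u m by simp
    obtain z where z: "z \<in> univ M" "val (f i) \<otimes>\<^bsub>G\<^esub> val (f 1) = val z" "z = mzero M \<longleftrightarrow> f i = mzero M \<or> f 1 = mzero M"
      by (rule mult_ex[OF u(1,2)])
    have 1: "f (Suc i) = mzero M \<longleftrightarrow> f 1 = mzero M"
      using z v val_eq_zero[of z] val_eq_zero[of "f (Suc i)"] u Suc.IH i by auto
    moreover have "val (f (Suc i)) = val (f 1) [^]\<^bsub>G\<^esub> int (Suc i)" if "f 1 \<noteq> mzero M"
    proof -
      have c: "val (f 1) \<in> carrier G" using that u unfolding carrier_G by auto
      then show ?thesis using v Suc.IH i that G.int_pow_mult[OF c, of "int i" 1] by (simp add: add.commute)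
    qed
    ultimately show ?case by blast
  qed
  then show "f i = mzero M \<longleftrightarrow> f 1 = mzero M"
    "f 1 \<noteq> mzero M \<Longrightarrow> val (f i) = val (f 1) [^]\<^bsub>G\<^esub> int i" by blast+
qed

lemma zgroup_G: "zgroup G (veps p M)"
proof -
  interpret G: comm_group G by (rule comm_group_G)
  show ?thesis
  proof (unfold_locales)
    show "veps p M \<in> carrier G" by (rule veps_carrier)
    show "\<one>\<^bsub>G\<^esub> < veps p M" unfolding one_G veps_def using val_unif(1)[of "mone M"] zero_ne_one by auto
    show "x \<le> y \<or> y \<le> x" if "x \<in> carrier G" "y \<in> carrier G" for x y
      using that val_total unfolding carrier_G by auto
    show "x \<otimes>\<^bsub>G\<^esub> z \<le> y \<otimes>\<^bsub>G\<^esub> z" if "x \<in> carrier G" "y \<in> carrier G" "z \<in> carrier G" "x \<le> y" for x y z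
      using mono_G that by simp
    show "veps p M \<le> x" if "x \<in> carrier G" "\<one>\<^bsub>G\<^esub> < x" for x
      using that val_unif(2)[of "mone M"] zero_ne_one unfolding carrier_G one_G veps_def by auto
    show "\<exists>y\<in>carrier G. \<exists>i\<in>{1..n}. A = y [^]\<^bsub>G\<^esub> n \<otimes>\<^bsub>G\<^esub> veps p M [^]\<^bsub>G\<^esub> i" if n: "1 \<le> n" and A: "A \<in> carrier G" for n :: int and A
    proof -
      obtain x where x: "x \<in> univ M" "x \<noteq> mzero M" "A = val x" using A unfolding carrier_G by auto
      have n': "1 \<le> nat n" using n by simp
      obtain f i where f: "mchain p M (nat n) f" "i \<in> {1..nat n}" "mM p M (f (nat n)) (mscale M (punif p ^ i) (mone M)) x"
        using plus_axD(10)[OF n' pu x(1)] by blast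
      have u: "f (nat n) \<in> univ M" "f 1 \<in> univ M" using f(1) n' unfolding mchain_def by auto
      have v: "val (f (nat n)) \<otimes>\<^bsub>G\<^esub> val (mscale M (punif p ^ i) (mone M)) = val x" using mult_iff f(3) u x by simp
      have p1: "val (mscale M (punif p ^ i) (mone M)) = veps p M [^]\<^bsub>G\<^esub> int i"
        using val_ppow[of "mone M" "int i"] zero_ne_one veps_carrier by (simp add: one_G[symmetric])
      have "f 1 \<noteq> mzero M"
      proof
        assume "f 1 = mzero M"
        then have "f (nat n) = mzero M" using chain_val(1)[OF f(1), of "nat n"] n' by simp
        then have "mM p M (mscale M (punif p ^ i) (mone M)) (mzero M) x"
          using f(3) plus_axD(3)[of "mzero M" "mscale M (punif p ^ i) (mone M)" x] u x by simp
        then have "val x = val (mzero M)" using mult_iff mult_zero x by simp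
        then show False using val_eq_zero x by simp
      qed
      then have "val (f 1) \<in> carrier G" "val (f (nat n)) = val (f 1) [^]\<^bsub>G\<^esub> n"
        using chain_val(2)[OF f(1), of "nat n"] n u unfolding carrier_G by auto
      then show ?thesis using v p1 f(2) n x by (intro bexI[of _ "val (f 1)"] bexI[of _ "int i"]) auto
    qed
  qed
qed

text \<open>The constant chain of zeros witnesses that infinity is a multiple of itself.\<close>

lemma Q_zero: "n \<ge> 1 \<Longrightarrow> mQ p n M (mzero M)"
  using plus_axD(11)[of n "mzero M"] plus_axD(6) L_zero
  by (auto intro!: exI[of _ "\<lambda>_. mzero M"] simp: mchain_def)

lemma Q_iff:
  assumes n: "n \<ge> 1" and x: "x \<in> univ M" "x \<noteq> mzero M"
  shows "mQ p n M x \<longleftrightarrow> zdvd G (int n) (val x)"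
proof -
  interpret G: zgroup G "veps p M" by (rule zgroup_G)
  show ?thesis
  proof
    assume "mQ p n M x"
    then obtain f where f: "mchain p M n f" "mL p M (f n) x" "mL p M x (f n)" using plus_axD(11) n x by blast
    have u: "f n \<in> univ M" "f 1 \<in> univ M" using f(1) n unfolding mchain_def by auto
    then have v: "val (f n) = val x" using f L_iff x by auto
    then have "f n \<noteq> mzero M" using x val_eq_zero by metis
    then have "f 1 \<noteq> mzero M" using chain_val(1)[OF f(1), of n] n by simp
    then show "zdvd G (int n) (val x)" unfolding zdvd_def
      using chain_val(2)[OF f(1), of n] n v u unfolding carrier_G by (intro bexI[of _ "val (f 1)"]) auto
  next
    assume "zdvd G (int n) (val x)"
    then obtain B where B: "B \<in> carrier G" "val x = B [^]\<^bsub>G\<^esub> int n" unfolding zdvd_def by auto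
    have "\<exists>z\<in>univ M. val z = B [^]\<^bsub>G\<^esub> int i" for i
      using G.int_pow_closed[OF B(1), of "int i"] unfolding carrier_G by auto
    then obtain f where f: "\<And>i. f i \<in> univ M" "\<And>i. val (f i) = B [^]\<^bsub>G\<^esub> int i" by metis
    have "mM p M (f i) (f 1) (f (Suc i))" for i
      using mult_iff f B(1) G.int_pow_mult[OF B(1), of "int i" 1] by (simp add: add.commute)
    then have "mchain p M n f" unfolding mchain_def using f by simp
    moreover have "mL p M (f n) x \<and> mL p M x (f n)" using L_iff f B x by auto
    ultimately show "mQ p n M x" using plus_axD(11) n x by blast
  qed
qed

end

section \<open>Agreement of tuples at a finite place\<close>

definition zero_agree :: "'i set \<Rightarrow> ('k fsym, 'r, 'u) struct \<Rightarrow> ('i \<Rightarrow> 'u) \<Rightarrow> ('k fsym, 'r, 'v) struct \<Rightarrow> ('i \<Rightarrow> 'v) \<Rightarrow> bool" where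
  "zero_agree X M w N w' \<longleftrightarrow> (\<forall>i\<in>X. w i = mzero M \<longleftrightarrow> w' i = mzero N)"

definition vsim :: "'k::field place \<Rightarrow> int \<Rightarrow> 'i set \<Rightarrow> ('k fsym, 'k rsym, 'u) struct \<Rightarrow> ('i \<Rightarrow> 'u) \<Rightarrow>
    ('k fsym, 'k rsym, 'v) struct \<Rightarrow> ('i \<Rightarrow> 'v) \<Rightarrow> bool" where
  "vsim p H X M w N w' \<longleftrightarrow> zero_agree X M w N w' \<and> (\<forall>i\<in>X. \<forall>j\<in>X. \<forall>n. \<bar>n\<bar> \<le> H \<longrightarrow>
     (vv p M (w i) \<subseteq> vv p M (mscale M (ppow p n) (w j)) \<longleftrightarrow> vv p N (w' i) \<subseteq> vv p N (mscale N (ppow p n) (w' j))))"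

text \<open>The value of zero lies outside the value group, so Presburger atoms are imposed on the
  nonzero entries only.\<close>

definition gsim :: "'k::field place \<Rightarrow> int \<Rightarrow> 'i set \<Rightarrow> ('k fsym, 'k rsym, 'u) struct \<Rightarrow> ('i \<Rightarrow> 'u) \<Rightarrow>
    ('k fsym, 'k rsym, 'v) struct \<Rightarrow> ('i \<Rightarrow> 'v) \<Rightarrow> bool" where
  "gsim p H X M w N w' \<longleftrightarrow> zero_agree X M w N w' \<and>
     zsim H {i\<in>X. w i \<noteq> mzero M} (vgroup p M) (veps p M) (\<lambda>i. vv p M (w i)) (vgroup p N) (veps p N) (\<lambda>i. vv p N (w' i))"

definition fsim :: "'k::field place set \<Rightarrow> 'k place \<Rightarrow> int \<Rightarrow> 'i set \<Rightarrow> ('k fsym, 'k rsym, 'u) struct \<Rightarrow> ('i \<Rightarrow> 'u) \<Rightarrow>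
    ('k fsym, 'k rsym, 'v) struct \<Rightarrow> ('i \<Rightarrow> 'v) \<Rightarrow> bool" where
  "fsim S1 p H X M w N w' \<longleftrightarrow> (if p \<in> S1 then gsim p H X M w N w' else vsim p H X M w N w')"

text \<open>The level that agreement loses when \<open>k\<close> entries are replaced by multiples
  with scalars of valuation at most \<open>D\<close> in absolute value. \<open>2 * D\<close> covers
  the difference of two such valuations in a comparison; the product bounds the coefficients
  collected along fibres and the constant that the scalars produce.\<close>

definition sublevel :: "int \<Rightarrow> int \<Rightarrow> int \<Rightarrow> int" where
  "sublevel H D k = H + 2 * D + H * k * (1 + D) + H"

text \<open>\<open>2 * H + 2\<close> serves the comparison of shifted values in
  \<open>vsim_extend\<close>, and \<open>zlevel H\<close> the Presburger atoms; the sum covers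
  whichever kind occurs at the place.\<close>

definition extlevel :: "int \<Rightarrow> int" where
  "extlevel H = 2 * H + 2 + zlevel H"

lemma zlevel_nonneg: "H \<ge> 0 \<Longrightarrow> zlevel H \<ge> 0"
  unfolding zlevel_def Let_def by simp

locale finpair = A: finplace M p + B: finplace N p
  for M :: "('k::field fsym, 'k rsym, 'u) struct" and N :: "('k fsym, 'k rsym, 'v) struct" and p +
  fixes S1 :: "'k place set"
  assumes plus: "p \<in> S1 \<Longrightarrow> plus_ax p M \<and> plus_ax p N"
begin

lemma fsim_zero: "fsim S1 p H X M w N w' \<Longrightarrow> i \<in> X \<Longrightarrow> w i = mzero M \<longleftrightarrow> w' i = mzero N"
  unfolding fsim_def gsim_def vsim_def zero_agree_def by (auto split: if_splits)

lemma fsim_level: "fsim S1 p H' X M w N w' \<Longrightarrow> H \<le> H' \<Longrightarrow> fsim S1 p H X M w N w'"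
  unfolding fsim_def gsim_def vsim_def by (auto intro: zsim_mono_level)

text \<open>Only the values of the new entries are prescribed, not the entries themselves. This lets
  a difference \<open>x - a\<close> be represented by whichever of \<open>x - c\<close> and
  \<open>c - a\<close> has the smaller value.\<close>

lemma fsim_subst:
  assumes fin: "finite X" "finite Y" and g: "\<And>t. t \<in> X \<Longrightarrow> g t \<in> Y" and H: "H \<ge> 0"
    and c: "\<And>t. t \<in> X \<Longrightarrow> c t \<noteq> 0 \<and> \<bar>pval p (c t)\<bar> \<le> D"
    and w: "\<And>i. i \<in> Y \<Longrightarrow> w i \<in> univ M" "\<And>i. i \<in> Y \<Longrightarrow> w' i \<in> univ N"
    and sim: "fsim S1 p (sublevel H D (int (card X))) Y M w N w'"
    and u: "\<And>t. t \<in> X \<Longrightarrow> u t \<in> univ M \<and> vv p M (u t) = vv p M (mscale M (c t) (w (g t)))"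
    and u': "\<And>t. t \<in> X \<Longrightarrow> u' t \<in> univ N \<and> vv p N (u' t) = vv p N (mscale N (c t) (w' (g t)))"
  shows "fsim S1 p H X M u N u'"
proof (cases "X = {}")
  case True
  show ?thesis
  proof (cases "p \<in> S1")
    case p: True
    interpret A': finplus M p using plus[OF p] by unfold_locales simp
    interpret B': finplus N p using plus[OF p] by unfold_locales simp
    interpret GA: zgroup "vgroup p M" "veps p M" by (rule A'.zgroup_G)
    interpret GB: zgroup "vgroup p N" "veps p N" by (rule B'.zgroup_G)
    \<comment> \<open>Without entries the atoms still compare powers of the least positive element,
      and these are decided in the same way in every Z-group. The case is separate because
      \<open>D \<ge> 0\<close> is read off an element of \<open>X\<close> below.\<close>
    have "zsim H {} (vgroup p M) (veps p M) (\<lambda>i. vv p M (u i)) (vgroup p N) (veps p N) (\<lambda>i. vv p N (u' i))"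
      unfolding zsim_def zlin_def using GA.eps_pow_ge_one GB.eps_pow_ge_one GA.zdvd_eps GB.zdvd_eps GA.eps GB.eps by simp
    then show ?thesis unfolding fsim_def gsim_def zero_agree_def True using p by simp
  qed (simp add: fsim_def vsim_def zero_agree_def True)
next
  case False
  then obtain t0 where "t0 \<in> X" by blast
  then have D: "D \<ge> 0" using c[of t0] by linarith
  have card: "int (card X) \<ge> 1" using False fin by (simp add: Suc_le_eq card_gt_0_iff)
  have nn: "0 \<le> H * int (card X) * (1 + D)" using H D by simp
  have uz: "u t = mzero M \<longleftrightarrow> w (g t) = mzero M" if "t \<in> X" for t
    using u[OF that] A.val_eq_zero[of "u t"] A.val_eq_zero[of "mscale M (c t) (w (g t))"] A.scale_eq_zero[of "w (g t)" "c t"]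
      w(1)[OF g[OF that]] c[OF that] by auto
  have uz': "u' t = mzero N \<longleftrightarrow> w' (g t) = mzero N" if "t \<in> X" for t
    using u'[OF that] B.val_eq_zero[of "u' t"] B.val_eq_zero[of "mscale N (c t) (w' (g t))"] B.scale_eq_zero[of "w' (g t)" "c t"]
      w(2)[OF g[OF that]] c[OF that] by auto
  have za: "zero_agree X M u N u'" unfolding zero_agree_def using uz uz' fsim_zero[OF sim] g by simp
  show ?thesis
  proof (cases "p \<in> S1")
    case False
    have "vv p M (u i) \<subseteq> vv p M (mscale M (ppow p n) (u j)) \<longleftrightarrow> vv p N (u' i) \<subseteq> vv p N (mscale N (ppow p n) (u' j))"
      if ij: "i \<in> X" "j \<in> X" and n: "\<bar>n\<bar> \<le> H" for i j n
    proof -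
      define m where "m = n + pval p (c j) - pval p (c i)"
      have m: "\<bar>m\<bar> \<le> sublevel H D (int (card X))"
        using c[OF ij(1)] c[OF ij(2)] n H nn unfolding m_def sublevel_def by linarith
      have pv: "pval p (ppow p n * c j) = pval p (c i * ppow p m)"
        using pval_mult[OF A.p, of "ppow p n" "c j"] pval_mult[OF A.p, of "c i" "ppow p m"] pval_ppow[OF A.p] A.pu(1)
          c[OF ij(1)] c[OF ij(2)] unfolding m_def by simp
      have nz: "ppow p n * c j \<noteq> 0" "c i * ppow p m \<noteq> 0" using A.pu(1) c ij by auto
      have "vv p M (mscale M (ppow p n) (u j)) = vv p M (mscale M (ppow p n * c j) (w (g j)))"
        using A.val_scale_cong[of "u j" "mscale M (c j) (w (g j))"] u[OF ij(2)] w(1)[OF g[OF ij(2)]] by (simp add: A.scale_scale)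
      also have "\<dots> = vv p M (mscale M (c i) (mscale M (ppow p m) (w (g j))))"
        using A.val_scale_eq[OF nz pv] w(1)[OF g[OF ij(2)]] by (simp add: A.scale_scale)
      finally have 1: "vv p M (u i) \<subseteq> vv p M (mscale M (ppow p n) (u j)) \<longleftrightarrow> vv p M (w (g i)) \<subseteq> vv p M (mscale M (ppow p m) (w (g j)))"
        using A.val_scale_mono[of "w (g i)" "mscale M (ppow p m) (w (g j))" "c i"] u[OF ij(1)] w(1) g ij c by simp
      have "vv p N (mscale N (ppow p n) (u' j)) = vv p N (mscale N (ppow p n * c j) (w' (g j)))"
        using B.val_scale_cong[of "u' j" "mscale N (c j) (w' (g j))"] u'[OF ij(2)] w(2)[OF g[OF ij(2)]] by (simp add: B.scale_scale)
      also have "\<dots> = vv p N (mscale N (c i) (mscale N (ppow p m) (w' (g j))))"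
        using B.val_scale_eq[OF nz pv] w(2)[OF g[OF ij(2)]] by (simp add: B.scale_scale)
      finally have 2: "vv p N (u' i) \<subseteq> vv p N (mscale N (ppow p n) (u' j)) \<longleftrightarrow> vv p N (w' (g i)) \<subseteq> vv p N (mscale N (ppow p m) (w' (g j)))"
        using B.val_scale_mono[of "w' (g i)" "mscale N (ppow p m) (w' (g j))" "c i"] u'[OF ij(1)] w(2) g ij c by simp
      show ?thesis unfolding 1 2 using sim False g ij m unfolding fsim_def vsim_def by simp
    qed
    then show ?thesis using False za unfolding fsim_def vsim_def by simp
  next
    case True
    interpret A': finplus M p using plus[OF True] by unfold_locales simp
    interpret B': finplus N p using plus[OF True] by unfold_locales simp
    interpret GA: zgroup "vgroup p M" "veps p M" by (rule A'.zgroup_G)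
    interpret GB: zgroup "vgroup p N" "veps p N" by (rule B'.zgroup_G)
    define X0 where "X0 = {t\<in>X. u t \<noteq> mzero M}"
    define Y0 where "Y0 = {i\<in>Y. w i \<noteq> mzero M}"
    have f0: "finite X0" "finite Y0" unfolding X0_def Y0_def using fin by auto
    have g0: "g t \<in> Y0" if "t \<in> X0" for t using that g uz unfolding X0_def Y0_def by auto
    have wc: "vv p M (w i) \<in> carrier (vgroup p M)" if "i \<in> Y0" for i
      using that w(1) unfolding Y0_def A'.carrier_G by auto
    have wz': "w' i \<noteq> mzero N" if "i \<in> Y0" for i using that fsim_zero[OF sim] unfolding Y0_def by auto
    have wc': "vv p N (w' i) \<in> carrier (vgroup p N)" if "i \<in> Y0" for i
      using that w(2) wz' unfolding B'.carrier_G Y0_def by auto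
    have zs: "zsim (sublevel H D (int (card X))) Y0 (vgroup p M) (veps p M) (\<lambda>i. vv p M (w i)) (vgroup p N) (veps p N) (\<lambda>i. vv p N (w' i))"
      using sim True unfolding fsim_def gsim_def Y0_def by simp
    have uu: "vv p M (u t) = vv p M (w (g t)) \<otimes>\<^bsub>vgroup p M\<^esub> veps p M [^]\<^bsub>vgroup p M\<^esub> pval p (c t)" if "t \<in> X0" for t
      using A'.val_scale[of "w (g t)" "c t"] u[of t] w(1)[of "g t"] g0[OF that] c[of t] that unfolding X0_def Y0_def by auto
    have uu': "vv p N (u' t) = vv p N (w' (g t)) \<otimes>\<^bsub>vgroup p N\<^esub> veps p N [^]\<^bsub>vgroup p N\<^esub> pval p (c t)" if "t \<in> X0" for t
      using B'.val_scale[of "w' (g t)" "c t"] u'[of t] w(2)[of "g t"] wz'[OF g0[OF that]] g0[OF that] c[of t] that unfolding X0_def Y0_def by auto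
    have "zsim H X0 (vgroup p M) (veps p M) (\<lambda>i. vv p M (u i)) (vgroup p N) (veps p N) (\<lambda>i. vv p N (u' i))"
      unfolding zsim_def
    proof (intro allI impI)
      fix n k assume n: "\<forall>i\<in>X0. \<bar>n i\<bar> \<le> H" and k: "\<bar>k::int\<bar> \<le> H"
      define n' where "n' y = (\<Sum>t\<in>{t\<in>X0. g t = y}. n t)" for y
      define k' where "k' = k + (\<Sum>t\<in>X0. n t * pval p (c t))"
      have lA: "zlin (vgroup p M) (veps p M) X0 (\<lambda>i. vv p M (u i)) n k = zlin (vgroup p M) (veps p M) Y0 (\<lambda>i. vv p M (w i)) n' k'"
        unfolding n'_def k'_def by (rule GA.lin_subst) (use f0 g0 wc uu in auto)
      have lB: "zlin (vgroup p N) (veps p N) X0 (\<lambda>i. vv p N (u' i)) n k = zlin (vgroup p N) (veps p N) Y0 (\<lambda>i. vv p N (w' i)) n' k'"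
        unfolding n'_def k'_def by (rule GB.lin_subst) (use f0 g0 wc' uu' in auto)
      have cX: "int (card X0) \<le> int (card X)" unfolding X0_def using fin by (simp add: card_mono)
      have n'b: "\<bar>n' y\<bar> \<le> sublevel H D (int (card X))" for y
      proof -
        have "\<bar>n' y\<bar> \<le> (\<Sum>t\<in>{t\<in>X0. g t = y}. \<bar>n t\<bar>)" unfolding n'_def by (rule sum_abs)
        also have "\<dots> \<le> (\<Sum>t\<in>X0. \<bar>n t\<bar>)" using f0 by (intro sum_mono2) auto
        also have "\<dots> \<le> (\<Sum>t\<in>X0. H)" using n by (intro sum_mono) auto
        also have "\<dots> \<le> int (card X) * H" using cX H by (simp add: mult_right_mono)
        also have "\<dots> \<le> H * int (card X) * (1 + D)" using H D by (simp add: algebra_simps)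
        finally show ?thesis using H D unfolding sublevel_def by linarith
      qed
      have k'b: "\<bar>k'\<bar> \<le> sublevel H D (int (card X))"
      proof -
        have "\<bar>\<Sum>t\<in>X0. n t * pval p (c t)\<bar> \<le> (\<Sum>t\<in>X0. \<bar>n t * pval p (c t)\<bar>)" by (rule sum_abs)
        also have "\<dots> \<le> (\<Sum>t\<in>X0. H * D)"
          using n c H D unfolding abs_mult X0_def by (intro sum_mono mult_mono) auto
        also have "\<dots> \<le> int (card X) * (H * D)" using cX H D by (simp add: mult_right_mono)
        also have "\<dots> \<le> H * int (card X) * (1 + D)" using H D by (simp add: algebra_simps)
        finally show ?thesis using H D k unfolding sublevel_def k'_def by linarith
      qed
      have Hs: "H \<le> sublevel H D (int (card X))" using H D nn unfolding sublevel_def by linarith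
      show "(\<one>\<^bsub>vgroup p M\<^esub> \<subseteq> zlin (vgroup p M) (veps p M) X0 (\<lambda>i. vv p M (u i)) n k \<longleftrightarrow>
          \<one>\<^bsub>vgroup p N\<^esub> \<subseteq> zlin (vgroup p N) (veps p N) X0 (\<lambda>i. vv p N (u' i)) n k) \<and>
        (\<forall>m\<in>{1..H}. zdvd (vgroup p M) m (zlin (vgroup p M) (veps p M) X0 (\<lambda>i. vv p M (u i)) n k) \<longleftrightarrow>
          zdvd (vgroup p N) m (zlin (vgroup p N) (veps p N) X0 (\<lambda>i. vv p N (u' i)) n k))"
        unfolding lA lB using zsim_pos[OF zs n'b k'b] zsim_dvd[OF zs n'b k'b] Hs by auto
    qed
    then show ?thesis using True za unfolding fsim_def gsim_def X0_def by simp
  qed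
qed

lemma fsim_le:
  assumes sim: "fsim S1 p H X M w N w'" and H: "H \<ge> 1" and X: "finite X" "i \<in> X" "j \<in> X"
    and w: "\<And>i. i \<in> X \<Longrightarrow> w i \<in> univ M" "\<And>i. i \<in> X \<Longrightarrow> w' i \<in> univ N"
  shows "vv p M (w i) \<subseteq> vv p M (w j) \<longleftrightarrow> vv p N (w' i) \<subseteq> vv p N (w' j)"
proof (cases "p \<in> S1")
  case False
  then have "vv p M (w i) \<subseteq> vv p M (mscale M (ppow p 0) (w j)) \<longleftrightarrow> vv p N (w' i) \<subseteq> vv p N (mscale N (ppow p 0) (w' j))"
    using sim X H unfolding fsim_def vsim_def by (simp del: power_int_0_right)
  then show ?thesis using w X by simp
next
  case True
  interpret A': finplus M p using plus[OF True] by unfold_locales simp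
  interpret B': finplus N p using plus[OF True] by unfold_locales simp
  interpret GA: zgroup "vgroup p M" "veps p M" by (rule A'.zgroup_G)
  interpret GB: zgroup "vgroup p N" "veps p N" by (rule B'.zgroup_G)
  note z = fsim_zero[OF sim X(2)] fsim_zero[OF sim X(3)]
  have iw: "w i \<in> univ M" "w j \<in> univ M" "w' i \<in> univ N" "w' j \<in> univ N" using w X by auto
  consider "w j = mzero M" | "w j \<noteq> mzero M" "w i = mzero M" | "w j \<noteq> mzero M" "w i \<noteq> mzero M" by blast
  then show ?thesis
  proof cases
    case 1
    then show ?thesis using z A.val_zero[OF iw(1)] B.val_zero[OF iw(3)] by simp
  next
    case 2
    then have "\<not> vv p M (w i) \<subseteq> vv p M (w j)" "\<not> vv p N (w' i) \<subseteq> vv p N (w' j)"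
      using z A.val_zero[OF iw(2)] B.val_zero[OF iw(4)] A.val_eq_zero[OF iw(2)] B.val_eq_zero[OF iw(4)] by auto
    then show ?thesis by simp
  next
    case 3
    define X0 where "X0 = {t\<in>X. w t \<noteq> mzero M}"
    have X0: "i \<in> X0" "j \<in> X0" "finite X0" unfolding X0_def using X 3 by auto
    have c: "vv p M (w t) \<in> carrier (vgroup p M)" "vv p N (w' t) \<in> carrier (vgroup p N)" if "t \<in> X0" for t
      using that w fsim_zero[OF sim, of t] unfolding X0_def A'.carrier_G B'.carrier_G by auto
    have zs: "zsim H X0 (vgroup p M) (veps p M) (\<lambda>i. vv p M (w i)) (vgroup p N) (veps p N) (\<lambda>i. vv p N (w' i))"
      using sim True unfolding fsim_def gsim_def X0_def by simp
    \<comment> \<open>If \<open>i = j\<close>, the two indicators cancel and the atom is trivially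
      true.\<close>
    define n where "n t = (if t = j then 1 else 0) - (if t = i then 1 else 0 :: int)" for t
    have "\<one>\<^bsub>vgroup p M\<^esub> \<subseteq> zlin (vgroup p M) (veps p M) X0 (\<lambda>i. vv p M (w i)) n 0 \<longleftrightarrow>
       \<one>\<^bsub>vgroup p N\<^esub> \<subseteq> zlin (vgroup p N) (veps p N) X0 (\<lambda>i. vv p N (w' i)) n 0"
      using H by (intro zsim_pos[OF zs]) (auto simp: n_def)
    moreover have "vv p M (w i) \<subseteq> vv p M (w j) \<longleftrightarrow> \<one>\<^bsub>vgroup p M\<^esub> \<subseteq> zlin (vgroup p M) (veps p M) X0 (\<lambda>i. vv p M (w i)) n 0"
      using GA.lin_le_iff[of X0 "\<lambda>i. vv p M (w i)" "\<lambda>t. if t = i then 1 else 0" 0 "\<lambda>t. if t = j then 1 else 0" 0]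
        GA.lin_single[of X0 "\<lambda>i. vv p M (w i)"] X0 c unfolding n_def by simp
    moreover have "vv p N (w' i) \<subseteq> vv p N (w' j) \<longleftrightarrow> \<one>\<^bsub>vgroup p N\<^esub> \<subseteq> zlin (vgroup p N) (veps p N) X0 (\<lambda>i. vv p N (w' i)) n 0"
      using GB.lin_le_iff[of X0 "\<lambda>i. vv p N (w' i)" "\<lambda>t. if t = i then 1 else 0" 0 "\<lambda>t. if t = j then 1 else 0" 0]
        GB.lin_single[of X0 "\<lambda>i. vv p N (w' i)"] X0 c unfolding n_def by simp
    ultimately show ?thesis by simp
  qed
qed


text \<open>\<open>z\<close> is located among the shifts of the nonzero entries by at most
  \<open>H + 1\<close>; the additional step expresses an upper bound \<open>v(z) \<le> v(y)\<close>
  as the failure of \<open>v(\<pi> y) \<le> v(z)\<close>. Two such thresholds differ by a shift of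
  at most \<open>2 * H + 2\<close>. If some threshold lies below \<open>z\<close>, the image of the
  largest one is taken for \<open>z'\<close>; otherwise an element one step below the least one, or
  \<open>mone N\<close> if there are no thresholds.\<close>

lemma vsim_extend:
  assumes X: "finite X" and H: "H \<ge> 1" and sim: "vsim p (2 * H + 2) X M w N w'"
    and w: "\<And>i. i \<in> X \<Longrightarrow> w i \<in> univ M" "\<And>i. i \<in> X \<Longrightarrow> w' i \<in> univ N"
    and z: "z \<in> univ M" "z \<noteq> mzero M"
  shows "\<exists>z'\<in>univ N. z' \<noteq> mzero N \<and> vsim p H (insert None (Some ` X)) M (case_option z w) N (case_option z' w')"
proof -
  define T where "T = {i\<in>X. w i \<noteq> mzero M} \<times> {- (H + 1)..H + 1}"
  define th where "th t = mscale M (ppow p (snd t)) (w (fst t))" for t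
  define th' where "th' t = mscale N (ppow p (snd t)) (w' (fst t))" for t
  have T: "finite T" unfolding T_def using X by simp
  have z0: "w i = mzero M \<longleftrightarrow> w' i = mzero N" if "i \<in> X" for i
    using sim that unfolding vsim_def zero_agree_def by simp
  have thM: "th t \<in> univ M" "th' t \<in> univ N" "th' t \<noteq> mzero N" if "t \<in> T" for t
    using that w z0 B.scale_eq_zero B.pu unfolding T_def th_def th'_def by auto
  have cmp: "vv p M (th s) \<subseteq> vv p M (th t) \<longleftrightarrow> vv p N (th' s) \<subseteq> vv p N (th' t)" if "s \<in> T" "t \<in> T" for s t
  proof -
    have "\<bar>snd t - snd s\<bar> \<le> 2 * H + 2" "fst s \<in> X" "fst t \<in> X" using that unfolding T_def by auto
    then show ?thesis
      unfolding th_def th'_def using A.val_shift_le[of "w (fst s)"] B.val_shift_le[of "w' (fst s)"] w sim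
      unfolding vsim_def by simp
  qed
  have "\<exists>z'\<in>univ N. z' \<noteq> mzero N \<and> (\<forall>t\<in>T. vv p M (th t) \<subseteq> vv p M z \<longleftrightarrow> vv p N (th' t) \<subseteq> vv p N z')"
  proof (cases "\<exists>t\<in>T. vv p M (th t) \<subseteq> vv p M z")
    case True
    define S where "S = {t\<in>T. vv p M (th t) \<subseteq> vv p M z}"
    have "S \<noteq> {}" "finite S" using True T unfolding S_def by auto
    moreover have "th t \<in> univ M" if "t \<in> S" for t using that thM(1) unfolding S_def by blast
    ultimately have "\<exists>t\<in>S. \<forall>s\<in>S. vv p M (th s) \<subseteq> vv p M (th t)" by (intro A.val_max(1)) auto
    then obtain t where t: "t \<in> T" "vv p M (th t) \<subseteq> vv p M z" "\<forall>s\<in>T. vv p M (th s) \<subseteq> vv p M z \<longrightarrow> vv p M (th s) \<subseteq> vv p M (th t)"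
      unfolding S_def by blast
    then have "\<forall>s\<in>T. vv p M (th s) \<subseteq> vv p M z \<longleftrightarrow> vv p N (th' s) \<subseteq> vv p N (th' t)" using cmp by blast
    then show ?thesis using thM[OF t(1)] by blast
  next
    case False
    show ?thesis
    proof (cases "T = {}")
      case True
      then show ?thesis using B.zero_ne_one by (intro bexI[of _ "mone N"]) auto
    next
      case ne: False
      then obtain t where t: "t \<in> T" "\<forall>s\<in>T. vv p N (th' t) \<subseteq> vv p N (th' s)"
        using B.val_max(2)[of T th'] T thM by auto
      define z' where "z' = mscale N (inverse (punif p)) (th' t)"
      have z': "z' \<in> univ N" "z' \<noteq> mzero N" "th' t = mscale N (punif p) z'"
        unfolding z'_def using thM[OF t(1)] B.scale_eq_zero B.pu by (auto simp: B.scale_scale)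
      then have "\<not> vv p N (th' s) \<subseteq> vv p N z'" if "s \<in> T" for s using B.val_unif(1)[of z'] t(2) that by auto
      then show ?thesis using False z' by auto
    qed
  qed
  then obtain z' where z': "z' \<in> univ N" "z' \<noteq> mzero N"
    and tr: "\<And>t. t \<in> T \<Longrightarrow> vv p M (th t) \<subseteq> vv p M z \<longleftrightarrow> vv p N (th' t) \<subseteq> vv p N z'" by blast
  have 1: "vv p M (w i) \<subseteq> vv p M (mscale M (ppow p n) z) \<longleftrightarrow> vv p N (w' i) \<subseteq> vv p N (mscale N (ppow p n) z')"
    if i: "i \<in> X" and n: "\<bar>n\<bar> \<le> H" for i n
  proof (cases "w i = mzero M")
    case True
    have "mscale M (ppow p n) z \<noteq> mzero M" "mscale N (ppow p n) z' \<noteq> mzero N"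
      using z z' A.scale_eq_zero B.scale_eq_zero A.pu by auto
    then show ?thesis using True z0[OF i] A.val_zero[of "mscale M (ppow p n) z"] B.val_zero[of "mscale N (ppow p n) z'"]
      A.val_eq_zero[of "mscale M (ppow p n) z"] B.val_eq_zero[of "mscale N (ppow p n) z'"] z z' by auto
  next
    case False
    then have "(i, - n) \<in> T" using i n unfolding T_def by auto
    then show ?thesis using tr[of "(i, - n)"] A.val_shift_le[of "w i" z "- n" 0] B.val_shift_le[of "w' i" z' "- n" 0] w i z z'
      unfolding th_def th'_def by simp
  qed
  have 2: "vv p M z \<subseteq> vv p M (mscale M (ppow p n) (w i)) \<longleftrightarrow> vv p N z' \<subseteq> vv p N (mscale N (ppow p n) (w' i))"
    if i: "i \<in> X" and n: "\<bar>n\<bar> \<le> H" for i n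
  proof (cases "w i = mzero M")
    case True
    then show ?thesis using z0[OF i] A.val_zero B.val_zero z z' by simp
  next
    case False
    then have T': "(i, n + 1) \<in> T" using i n unfolding T_def by auto
    have "mscale M (punif p) (mscale M (ppow p n) (w i)) = th (i, n + 1)"
        "mscale N (punif p) (mscale N (ppow p n) (w' i)) = th' (i, n + 1)"
      unfolding th_def th'_def using w i A.pu by (simp_all add: A.scale_scale B.scale_scale power_int_add mult.commute)
    moreover have "mscale M (ppow p n) (w i) \<noteq> mzero M" "mscale N (ppow p n) (w' i) \<noteq> mzero N"
      using False z0[OF i] w i A.scale_eq_zero B.scale_eq_zero A.pu by auto
    ultimately show ?thesis
      using tr[OF T'] A.val_discrete[of "mscale M (ppow p n) (w i)" z] B.val_discrete[of "mscale N (ppow p n) (w' i)" z'] w i z z' by simp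
  qed
  have "vsim p H (insert None (Some ` X)) M (case_option z w) N (case_option z' w')"
    unfolding vsim_def zero_agree_def
  proof (intro conjI ballI allI impI)
    fix i assume "i \<in> insert None (Some ` X)"
    then show "(case_option z w i = mzero M) = (case_option z' w' i = mzero N)" using z z' z0 by auto
    fix j n assume j: "j \<in> insert None (Some ` X)" and n: "\<bar>n\<bar> \<le> H"
    have "n \<le> 2 * H + 2" "- n \<le> 2 * H + 2" using n H by auto
    then show "vv p M (case_option z w i) \<subseteq> vv p M (mscale M (ppow p n) (case_option z w j)) \<longleftrightarrow>
        vv p N (case_option z' w' i) \<subseteq> vv p N (mscale N (ppow p n) (case_option z' w' j))"
      using \<open>i \<in> insert None (Some ` X)\<close> j 1[OF _ n] 2[OF _ n] A.val_self_shift[OF z] B.val_self_shift[OF z'] sim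
      unfolding vsim_def by (cases i; cases j) (simp_all add: image_iff)
  qed
  then show ?thesis using z' by blast
qed

lemma fsim_extend:
  assumes X: "finite X" and H: "H \<ge> 1" and sim: "fsim S1 p (extlevel H) X M w N w'"
    and w: "\<And>i. i \<in> X \<Longrightarrow> w i \<in> univ M" "\<And>i. i \<in> X \<Longrightarrow> w' i \<in> univ N"
    and z: "z \<in> univ M" "z \<noteq> mzero M"
  shows "\<exists>z'\<in>univ N. z' \<noteq> mzero N \<and> fsim S1 p H (insert None (Some ` X)) M (case_option z w) N (case_option z' w')"
proof -
  have lev: "2 * H + 2 \<le> extlevel H" "zlevel H \<le> extlevel H" unfolding extlevel_def using H zlevel_nonneg[of H] by auto
  show ?thesis
  proof (cases "p \<in> S1")
    case False
    have "vsim p (2 * H + 2) X M w N w'" using fsim_level[OF sim lev(1)] False unfolding fsim_def by simp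
    then show ?thesis using vsim_extend[OF X H _ w z] False unfolding fsim_def by simp
  next
    case True
    interpret A': finplus M p using plus[OF True] by unfold_locales simp
    interpret B': finplus N p using plus[OF True] by unfold_locales simp
    define X0 where "X0 = {t\<in>X. w t \<noteq> mzero M}"
    have X0: "finite X0" unfolding X0_def using X by auto
    have c: "vv p M (w t) \<in> carrier (vgroup p M)" "vv p N (w' t) \<in> carrier (vgroup p N)" if "t \<in> X0" for t
      using that w fsim_zero[OF sim, of t] unfolding X0_def A'.carrier_G B'.carrier_G by auto
    have zs: "zsim (zlevel H) X0 (vgroup p M) (veps p M) (\<lambda>i. vv p M (w i)) (vgroup p N) (veps p N) (\<lambda>i. vv p N (w' i))"
      using fsim_level[OF sim lev(2)] True unfolding fsim_def gsim_def X0_def by simp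
    have zc: "vv p M z \<in> carrier (vgroup p M)" unfolding A'.carrier_G using z by auto
    obtain Z where Z: "Z \<in> carrier (vgroup p N)"
      "zsim H (insert None (Some ` X0)) (vgroup p M) (veps p M) (case_option (vv p M z) (\<lambda>i. vv p M (w i)))
        (vgroup p N) (veps p N) (case_option Z (\<lambda>i. vv p N (w' i)))"
      by (rule zsim_extend[OF A'.zgroup_G B'.zgroup_G X0 H c zs zc])
    obtain z' where z': "z' \<in> univ N" "z' \<noteq> mzero N" "Z = vv p N z'" using Z(1) unfolding B'.carrier_G by auto
    have e: "case_option (vv p M z) (\<lambda>i. vv p M (w i)) = (\<lambda>i. vv p M (case_option z w i))"
      "case_option (vv p N z') (\<lambda>i. vv p N (w' i)) = (\<lambda>i. vv p N (case_option z' w' i))" by (auto simp: fun_eq_iff split: option.split)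
    have "{i \<in> insert None (Some ` X). case_option z w i \<noteq> mzero M} = insert None (Some ` X0)"
      unfolding X0_def using z by auto
    then have "gsim p H (insert None (Some ` X)) M (case_option z w) N (case_option z' w')"
      unfolding gsim_def zero_agree_def using Z(2) z z' fsim_zero[OF sim] e by (auto split: option.split)
    then show ?thesis using z' True unfolding fsim_def by auto
  qed
qed


text \<open>Coefficients outside the smaller set are filled with zeros, so the level stays
  \<open>H\<close>, whereas \<open>fsim_subst\<close> asks for a higher one.\<close>

lemma fsim_subset:
  assumes sim: "fsim S1 p H Y M w N w'" and XY: "X \<subseteq> Y" "finite Y" and H: "H \<ge> 0"
    and w: "\<And>i. i \<in> Y \<Longrightarrow> w i \<in> univ M" "\<And>i. i \<in> Y \<Longrightarrow> w' i \<in> univ N"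
  shows "fsim S1 p H X M w N w'"
proof (cases "p \<in> S1")
  case False
  then show ?thesis using sim XY(1) unfolding fsim_def vsim_def zero_agree_def by (auto simp: subset_eq)
next
  case True
  interpret A': finplus M p using plus[OF True] by unfold_locales simp
  interpret B': finplus N p using plus[OF True] by unfold_locales simp
  interpret GA: zgroup "vgroup p M" "veps p M" by (rule A'.zgroup_G)
  interpret GB: zgroup "vgroup p N" "veps p N" by (rule B'.zgroup_G)
  define X0 where "X0 = {t\<in>X. w t \<noteq> mzero M}"
  define Y0 where "Y0 = {t\<in>Y. w t \<noteq> mzero M}"
  have f0: "finite X0" "finite Y0" "X0 \<subseteq> Y0" unfolding X0_def Y0_def using XY finite_subset[OF XY] by auto
  have c: "vv p M (w t) \<in> carrier (vgroup p M)" "vv p N (w' t) \<in> carrier (vgroup p N)" if "t \<in> Y0" for t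
    using that w fsim_zero[OF sim, of t] unfolding Y0_def A'.carrier_G B'.carrier_G by auto
  have zs: "zsim H Y0 (vgroup p M) (veps p M) (\<lambda>i. vv p M (w i)) (vgroup p N) (veps p N) (\<lambda>i. vv p N (w' i))"
    using sim True unfolding fsim_def gsim_def Y0_def by simp
  have "zsim H X0 (vgroup p M) (veps p M) (\<lambda>i. vv p M (w i)) (vgroup p N) (veps p N) (\<lambda>i. vv p N (w' i))"
    unfolding zsim_def
  proof (intro allI impI)
    fix n k assume n: "\<forall>i\<in>X0. \<bar>n i\<bar> \<le> H" and k: "\<bar>k::int\<bar> \<le> H"
    define n' where "n' y = (\<Sum>t\<in>{t\<in>X0. id t = y}. n t)" for y
    have n'b: "\<bar>n' y\<bar> \<le> H" for y
    proof (cases "y \<in> X0")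
      case True
      then have "{t\<in>X0. id t = y} = {y}" by auto
      then show ?thesis unfolding n'_def using n True by simp
    next
      case False
      then have "{t\<in>X0. id t = y} = {}" by auto
      then have "n' y = 0" unfolding n'_def by (metis sum.empty)
      then show ?thesis using H by simp
    qed
    have lA: "zlin (vgroup p M) (veps p M) X0 (\<lambda>i. vv p M (w i)) n k = zlin (vgroup p M) (veps p M) Y0 (\<lambda>i. vv p M (w i)) n' k"
      using GA.lin_subst[of X0 id Y0 "\<lambda>i. vv p M (w i)" "\<lambda>i. vv p M (w i)" "\<lambda>_. 0" n k] f0 c unfolding n'_def by auto
    have lB: "zlin (vgroup p N) (veps p N) X0 (\<lambda>i. vv p N (w' i)) n k = zlin (vgroup p N) (veps p N) Y0 (\<lambda>i. vv p N (w' i)) n' k"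
      using GB.lin_subst[of X0 id Y0 "\<lambda>i. vv p N (w' i)" "\<lambda>i. vv p N (w' i)" "\<lambda>_. 0" n k] f0 c unfolding n'_def by auto
    show "(\<one>\<^bsub>vgroup p M\<^esub> \<subseteq> zlin (vgroup p M) (veps p M) X0 (\<lambda>i. vv p M (w i)) n k \<longleftrightarrow>
          \<one>\<^bsub>vgroup p N\<^esub> \<subseteq> zlin (vgroup p N) (veps p N) X0 (\<lambda>i. vv p N (w' i)) n k) \<and>
        (\<forall>m\<in>{1..H}. zdvd (vgroup p M) m (zlin (vgroup p M) (veps p M) X0 (\<lambda>i. vv p M (w i)) n k) \<longleftrightarrow>
          zdvd (vgroup p N) m (zlin (vgroup p N) (veps p N) X0 (\<lambda>i. vv p N (w' i)) n k))"
      unfolding lA lB using zsim_pos[OF zs n'b k] zsim_dvd[OF zs n'b k] by auto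
  qed
  moreover have "zero_agree X M w N w'" unfolding zero_agree_def using fsim_zero[OF sim] XY(1) by auto
  ultimately show ?thesis using True unfolding fsim_def gsim_def X0_def by simp
qed

lemma fsim_sym:
  assumes "fsim S1 p H X M w N w'"
  shows "fsim S1 p H X N w' M w"
proof -
  have "{i\<in>X. w i \<noteq> mzero M} = {i\<in>X. w' i \<noteq> mzero N}" using fsim_zero[OF assms] by auto
  then show ?thesis using assms zsim_sym unfolding fsim_def gsim_def vsim_def zero_agree_def by (auto split: if_splits)
qed

end

section \<open>Models at a real place\<close>

lemma real_place_embedding:
  fixes p :: "'k::field place"
  assumes "real_place p"
  obtains \<sigma> :: "'k \<Rightarrow> real" where "completion_map p \<sigma>" "\<sigma> 0 = 0" "\<sigma> 1 = 1"
    "\<And>x y. \<sigma> (x + y) = \<sigma> x + \<sigma> y" "\<And>x y. \<sigma> (x * y) = \<sigma> x * \<sigma> y" "\<And>x. \<sigma> (- x) = - \<sigma> x"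
proof -
  obtain \<sigma> :: "'k \<Rightarrow> real" where \<sigma>: "completion_map p \<sigma>" using assms unfolding real_place_def by auto
  then have h: "\<sigma> 1 = 1" "\<And>x y. \<sigma> (x + y) = \<sigma> x + \<sigma> y" "\<And>x y. \<sigma> (x * y) = \<sigma> x * \<sigma> y"
    unfolding completion_map_def by auto
  have z: "\<sigma> 0 = 0" using h(2)[of 0 0] by simp
  have "\<sigma> (- x) = - \<sigma> x" for x using h(2)[of x "- x"] z by simp
  then show ?thesis using that \<sigma> h z by blast
qed

lemma place_nonneg_cases: "real_place p \<Longrightarrow> place_nonneg p c \<or> place_nonneg p (- c)"
  unfolding place_nonneg_def by (metis real_place_embedding linear neg_0_le_iff_le)

text \<open>Prepares \<open>cut_point\<close>, where an interval is divided into four parts: this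
  takes a scalar that exists in the field and respects the order.\<close>

lemma place_quarter:
  fixes p :: "'k::field place"
  assumes "real_place p"
  shows "(4::'k) \<noteq> 0" "place_nonneg p (inverse 4)"
proof -
  obtain \<sigma> :: "'k \<Rightarrow> real" where \<sigma>: "completion_map p \<sigma>" "\<sigma> 0 = 0" "\<sigma> 1 = 1"
    "\<And>x y. \<sigma> (x + y) = \<sigma> x + \<sigma> y" "\<And>x y. \<sigma> (x * y) = \<sigma> x * \<sigma> y" by (rule real_place_embedding[OF assms]) blast
  have "\<sigma> 4 = \<sigma> (1 + 1 + 1 + 1)" by simp
  also have "\<dots> = 4" unfolding \<sigma>(4) \<sigma>(3) by simp
  finally have 4: "\<sigma> 4 = 4" .
  then show n: "(4::'k) \<noteq> 0" using \<sigma>(2) by auto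
  have "\<sigma> 4 * \<sigma> (inverse 4) = 1" using \<sigma>(5)[of 4 "inverse 4"] \<sigma>(3) n by simp
  then have "\<sigma> (inverse 4) \<ge> 0" using 4 by simp
  then show "place_nonneg p (inverse 4)" using \<sigma>(1) unfolding place_nonneg_def by blast
qed

locale realplace = vspace M for M :: "('k::field fsym, 'k rsym, 'u) struct" +
  fixes p :: "'k place"
  assumes rp: "real_place p" and ax: "model_T_kreal p M"
begin

abbreviation "rle \<equiv> mle p M"

lemmas axs = ax[unfolded model_T_kreal_def, THEN conjunct2]

lemma zero_le_one: "rle (mzero M) (mone M)"
  by (rule axs[THEN conjunct1])

lemma zero_ne_one: "mzero M \<noteq> mone M"
  by (rule axs[THEN conjunct2, THEN conjunct1])

lemmas axs' = axs[THEN conjunct2, THEN conjunct2]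

lemma le_refl: "x \<in> univ M \<Longrightarrow> rle x x"
  using axs'[THEN conjunct1] by blast

lemma le_antisym: "x \<in> univ M \<Longrightarrow> y \<in> univ M \<Longrightarrow> rle x y \<Longrightarrow> rle y x \<Longrightarrow> x = y"
  using axs'[THEN conjunct2, THEN conjunct1] by blast

lemma le_trans: "x \<in> univ M \<Longrightarrow> y \<in> univ M \<Longrightarrow> z \<in> univ M \<Longrightarrow> rle x y \<Longrightarrow> rle y z \<Longrightarrow> rle x z"
  using axs'[THEN conjunct2, THEN conjunct2, THEN conjunct1] by blast

lemma le_total: "x \<in> univ M \<Longrightarrow> y \<in> univ M \<Longrightarrow> rle x y \<or> rle y x"
  using axs'[THEN conjunct2, THEN conjunct2, THEN conjunct2, THEN conjunct1] by blast

lemma le_add: "x \<in> univ M \<Longrightarrow> y \<in> univ M \<Longrightarrow> z \<in> univ M \<Longrightarrow> rle x y \<Longrightarrow> rle (madd M x z) (madd M y z)"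
  using axs'[THEN conjunct2, THEN conjunct2, THEN conjunct2, THEN conjunct2, THEN conjunct1] by blast

lemmas axs'' = axs'[THEN conjunct2, THEN conjunct2, THEN conjunct2, THEN conjunct2, THEN conjunct2]

lemma L_iff: "x \<in> univ M \<Longrightarrow> y \<in> univ M \<Longrightarrow> mL p M x y \<longleftrightarrow>
   rle (mzero M) x \<and> rle x y \<or> rle (mzero M) (mscale M (- 1) x) \<and> rle (mscale M (- 1) x) y \<or>
   rle (mzero M) x \<and> rle x (mscale M (- 1) y) \<or> rle (mzero M) (mscale M (- 1) x) \<and> rle (mscale M (- 1) x) (mscale M (- 1) y)"
  using axs''[THEN conjunct1, rule_format] by blast

lemma le_scale: "place_nonneg p c \<Longrightarrow> x \<in> univ M \<Longrightarrow> y \<in> univ M \<Longrightarrow> rle x y \<Longrightarrow> rle (mscale M c x) (mscale M c y)"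
  using axs''[THEN conjunct2] by blast

lemma le_sub:
  assumes "x \<in> univ M" "y \<in> univ M"
  shows "rle x y \<longleftrightarrow> rle (mzero M) (msub M y x)"
proof
  assume "rle x y"
  then show "rle (mzero M) (msub M y x)" using le_add[of x y "mscale M (- 1) x"] assms by simp
next
  assume "rle (mzero M) (msub M y x)"
  then have "rle (madd M (mzero M) x) (madd M (msub M y x) x)" using le_add[of "mzero M" "msub M y x" x] assms by simp
  moreover have "madd M (msub M y x) x = y"
    using add_comm[of "msub M y x" x] sub_sub(5)[of x y x] assms by simp
  ultimately show "rle x y" using assms by simp
qed

lemma le_zero_neg:
  assumes "x \<in> univ M"
  shows "rle (mzero M) (mscale M (- 1) x) \<longleftrightarrow> rle x (mzero M)"
  using le_sub[of x "mzero M"] assms by simp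

lemma neg_cases: "x \<in> univ M \<Longrightarrow> rle (mzero M) (mscale M (- 1) x) \<longleftrightarrow> \<not> rle (mzero M) x \<or> x = mzero M"
  using le_zero_neg le_total[of x "mzero M"] le_antisym[of x "mzero M"] le_refl[of x] by auto

lemma le_zero_scale:
  assumes x: "x \<in> univ M" and c: "c \<noteq> 0"
  shows "rle (mzero M) (mscale M c x) \<longleftrightarrow> (if place_nonneg p c then rle (mzero M) x else rle (mzero M) (mscale M (- 1) x))"
proof -
  have *: "rle (mzero M) (mscale M c x) \<longleftrightarrow> rle (mzero M) x" if x: "x \<in> univ M" and c: "c \<noteq> 0" "place_nonneg p c" for c x
  proof
    assume l: "rle (mzero M) (mscale M c x)"
    show "rle (mzero M) x"
    proof (rule ccontr)
      assume n: "\<not> rle (mzero M) x"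
      then have "rle x (mzero M)" using le_total x by blast
      then have "rle (mscale M c x) (mzero M)" using le_scale[OF c(2) x, of "mzero M"] by simp
      then have "mscale M c x = mzero M" using l le_antisym x by simp
      then show False using n scale_eq_zero[OF x c(1)] le_refl by simp
    qed
  next
    assume "rle (mzero M) x"
    then show "rle (mzero M) (mscale M c x)" using le_scale[OF c(2) _ x, of "mzero M"] by simp
  qed
  show ?thesis
  proof (cases "place_nonneg p c")
    case False
    then have "place_nonneg p (- c)" using place_nonneg_cases[OF rp] by blast
    then show ?thesis using *[of "mscale M (- 1) x" "- c"] x c False by (simp add: scale_scale)
  qed (use *[OF x c] in simp)
qed

text \<open>With \<open>l\<close> the largest lower and \<open>u\<close> the smallest upper bound,
  put \<open>4 d = u - l\<close>. The ball of radius \<open>d\<close> about \<open>l + 2 d\<close>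
  stays between \<open>l + d\<close> and \<open>l + 3 d\<close>, hence away from both
  bounds.\<close>

lemma cut_point:
  assumes fin: "finite Lo" "finite Up" "Lo \<subseteq> univ M" "Up \<subseteq> univ M"
    and lt: "\<And>l u. l \<in> Lo \<Longrightarrow> u \<in> Up \<Longrightarrow> \<not> rle u l"
  shows "\<exists>y\<in>univ M. \<exists>d\<in>univ M. d \<noteq> mzero M \<and> (\<forall>y'\<in>univ M. mL p M (msub M y' y) d \<longrightarrow>
     (\<forall>l\<in>Lo. \<not> rle y' l) \<and> (\<forall>u\<in>Up. \<not> rle u y'))"
proof -
  have max: "\<exists>l\<in>univ M. \<forall>l'\<in>Lo. rle l' l" if "Lo \<noteq> {} \<longrightarrow> l \<in> Lo \<and> (\<forall>l'\<in>Lo. rle l' l)" "Lo = {} \<longrightarrow> l \<in> univ M" for l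
    using that fin(3) by blast
  \<comment> \<open>\<open>l\<close> and \<open>l + 4 d\<close> are the ends of an interval between
    the two sets. If one of the sets is empty, \<open>d\<close> can be
    \<open>mone M\<close>.\<close>
  define ok where "ok l d \<longleftrightarrow> l \<in> univ M \<and> d \<in> univ M \<and> rle (mzero M) d \<and> d \<noteq> mzero M \<and> (\<forall>l'\<in>Lo. rle l' l) \<and>
    (\<forall>u\<in>Up. rle (madd M l (mscale M 4 d)) u)" for l d
  have "\<exists>l d. ok l d"
  proof -
    have mx: "\<exists>l\<in>Lo. \<forall>l'\<in>Lo. rle l' l" if "Lo \<noteq> {}"
      by (rule finite_extremal[OF fin(1) that]) (use fin(3) le_total le_trans in blast)+
    have mn: "\<exists>u\<in>Up. \<forall>u'\<in>Up. rle u u'" if "Up \<noteq> {}"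
      by (rule finite_extremal[OF fin(2) that, where R = "\<lambda>x y. rle y x"]) (use fin(4) le_total le_trans in blast)+
    show ?thesis
    proof (cases "Up = {}")
      case True
      show ?thesis
      proof (cases "Lo = {}")
        case True
        then show ?thesis using \<open>Up = {}\<close> zero_le_one zero_ne_one unfolding ok_def
          by (intro exI[of _ "mzero M"] exI[of _ "mone M"]) auto
      next
        case False
        then obtain l where "l \<in> Lo" "\<forall>l'\<in>Lo. rle l' l" using mx by blast
        then show ?thesis using \<open>Up = {}\<close> zero_le_one zero_ne_one fin(3) unfolding ok_def
          by (intro exI[of _ l] exI[of _ "mone M"]) auto
      qed
    next
      case False
      then obtain u where u: "u \<in> Up" "\<forall>u'\<in>Up. rle u u'" using mn by blast
      have uM: "u \<in> univ M" using u fin by auto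
      show ?thesis
      proof (cases "Lo = {}")
        case True
        have "madd M (msub M u (mscale M 4 (mone M))) (mscale M 4 (mone M)) = u"
          using uM sub_sub(5)[of "mscale M 4 (mone M)" u u] by (simp add: add_comm)
        then show ?thesis using True zero_le_one zero_ne_one u uM unfolding ok_def
          by (intro exI[of _ "msub M u (mscale M 4 (mone M))"] exI[of _ "mone M"]) auto
      next
        case False
        then obtain l where l: "l \<in> Lo" "\<forall>l'\<in>Lo. rle l' l" using mx by blast
        have lM: "l \<in> univ M" using l fin by auto
        define d where "d = mscale M (inverse 4) (msub M u l)"
        have d: "d \<in> univ M" unfolding d_def using uM lM by simp
        have lu: "rle l u" "l \<noteq> u" using lt[OF l(1) u(1)] le_total le_refl uM lM by auto
        have "mscale M 4 d = msub M u l" unfolding d_def using uM lM place_quarter(1)[OF rp] by (simp add: scale_scale)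
        then have "madd M l (mscale M 4 d) = u" using sub_sub(5) uM lM by simp
        moreover have "rle (mzero M) d" "d \<noteq> mzero M"
          unfolding d_def using le_scale[OF place_quarter(2)[OF rp], of "mzero M" "msub M u l"] le_sub[of l u] lu uM lM
            scale_eq_zero[of "msub M u l" "inverse 4"] place_quarter(1)[OF rp] sub_eq_zero[of u l] by auto
        ultimately show ?thesis unfolding ok_def using lM d l u by (intro exI[of _ l] exI[of _ d]) auto
      qed
    qed
  qed
  then obtain l d where ok: "ok l d" by blast
  then have l: "l \<in> univ M" "\<forall>l'\<in>Lo. rle l' l" and d: "d \<in> univ M" "rle (mzero M) d" "d \<noteq> mzero M"
    and u: "\<forall>u\<in>Up. rle (madd M l (mscale M 4 d)) u" unfolding ok_def by auto
  define y where "y = madd M l (mscale M 2 d)"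
  have y: "y \<in> univ M" unfolding y_def using l d by simp
  have nd: "\<not> rle d (mzero M)" using d le_antisym by auto
  have "(\<forall>l\<in>Lo. \<not> rle y' l) \<and> (\<forall>u\<in>Up. \<not> rle u y')" if y': "y' \<in> univ M" and L: "mL p M (msub M y' y) d" for y'
  proof -
    define s where "s = msub M y' y"
    have s: "s \<in> univ M" unfolding s_def using y y' by simp
    have nd1: "rle (mscale M (- 1) d) (mzero M)" using le_zero_neg[of "mscale M (- 1) d"] d by (simp add: scale_scale)
    \<comment> \<open>\<open>L\<close> compares absolute values; as \<open>d\<close> is positive,
      the two disjuncts that bound by \<open>-d\<close> cannot hold.\<close>
    have no: "\<not> (rle (mzero M) x \<and> rle x (mscale M (- 1) d))" if "x \<in> univ M" for x
    proof
      assume "rle (mzero M) x \<and> rle x (mscale M (- 1) d)"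
      then have "rle (mzero M) (mscale M (- 1) d)" using le_trans[of "mzero M" x] that d by simp
      then show False using le_zero_neg d nd by simp
    qed
    have "rle (mzero M) s \<and> rle s d \<or> rle (mzero M) (mscale M (- 1) s) \<and> rle (mscale M (- 1) s) d"
      using L L_iff[of s d] no[of s] no[of "mscale M (- 1) s"] s d unfolding s_def by auto
    then have sd: "rle s d" "rle (mscale M (- 1) s) d"
    proof -
      assume a: "rle (mzero M) s \<and> rle s d \<or> rle (mzero M) (mscale M (- 1) s) \<and> rle (mscale M (- 1) s) d"
      have z: "rle (mzero M) s \<Longrightarrow> rle (mscale M (- 1) s) (mzero M)"
        using le_zero_neg[of "mscale M (- 1) s"] s by (simp add: scale_scale)
      have z': "rle (mzero M) (mscale M (- 1) s) \<Longrightarrow> rle s (mzero M)" using le_zero_neg s by simp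
      show "rle s d" "rle (mscale M (- 1) s) d"
        using a z z' le_trans[of s "mzero M" d] le_trans[of "mscale M (- 1) s" "mzero M" d] s d by auto
    qed
    have e1: "msub M d s = msub M (madd M l (mscale M 3 d)) y'"
      using vec_eqI[of y' l d "tsub (V 2) (tsub (V 0) (tadd (V 1) (tscale 2 (V 2))))" "tsub (tadd (V 1) (tscale 3 (V 2))) (V 0)"]
        y' l d unfolding s_def y_def by simp
    have e2: "msub M d (mscale M (- 1) s) = msub M y' (madd M l d)"
      using vec_eqI[of y' l d "tsub (V 2) (tscale (- 1) (tsub (V 0) (tadd (V 1) (tscale 2 (V 2)))))" "tsub (V 0) (tadd (V 1) (V 2))"]
        y' l d unfolding s_def y_def by simp
    have b1: "rle y' (madd M l (mscale M 3 d))" using sd(1) le_sub[of s d] le_sub[of y' "madd M l (mscale M 3 d)"] e1 s d y' l by simp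
    have b2: "rle (madd M l d) y'" using sd(2) le_sub[of "mscale M (- 1) s" d] le_sub[of "madd M l d" y'] e2 s d y' l by simp
    have e3: "msub M l (madd M l d) = mscale M (- 1) d"
      using vec_eqI[of l d d "tsub (V 0) (tadd (V 0) (V 1))" "tneg (V 1)"] l d by simp
    have e4: "msub M (madd M l (mscale M 3 d)) (madd M l (mscale M 4 d)) = mscale M (- 1) d"
      using vec_eqI[of l d d "tsub (tadd (V 0) (tscale 3 (V 1))) (tadd (V 0) (tscale 4 (V 1)))" "tneg (V 1)"] l d by simp
    have n1: "\<not> rle (madd M l d) l" using le_sub[of "madd M l d" l] e3 le_zero_neg[of d] nd l d by simp
    have n2: "\<not> rle (madd M l (mscale M 4 d)) (madd M l (mscale M 3 d))"
      using le_sub[of "madd M l (mscale M 4 d)" "madd M l (mscale M 3 d)"] e4 le_zero_neg[of d] nd l d by simp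
    show ?thesis
    proof (intro conjI ballI notI)
      fix l' assume l': "l' \<in> Lo" "rle y' l'"
      then have "rle (madd M l d) l" using b2 l(2) le_trans[of "madd M l d" y' l'] le_trans[of "madd M l d" l' l] l d y' fin(3) by auto
      then show False using n1 by simp
    next
      fix u' assume u': "u' \<in> Up" "rle u' y'"
      have "u' \<in> univ M" using u' fin by auto
      then have "rle (madd M l (mscale M 4 d)) y'"
        using le_trans[of "madd M l (mscale M 4 d)" u' y'] u' u l d y' by simp
      then show False using n2 le_trans[of "madd M l (mscale M 4 d)" y' "madd M l (mscale M 3 d)"] b1 l d y' by simp
    qed
  qed
  then show ?thesis using y d by blast
qed

end

definition rsim :: "'k::field place \<Rightarrow> 'i set \<Rightarrow> ('k fsym, 'k rsym, 'u) struct \<Rightarrow> ('i \<Rightarrow> 'u) \<Rightarrow>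
    ('k fsym, 'k rsym, 'v) struct \<Rightarrow> ('i \<Rightarrow> 'v) \<Rightarrow> bool" where
  "rsim p X M w N w' \<longleftrightarrow> zero_agree X M w N w' \<and> (\<forall>i\<in>X. mle p M (mzero M) (w i) \<longleftrightarrow> mle p N (mzero N) (w' i))"

locale realpair = A: realplace M p + B: realplace N p
  for M :: "('k::field fsym, 'k rsym, 'u) struct" and N :: "('k fsym, 'k rsym, 'v) struct" and p
begin

lemma rsim_subst:
  assumes g: "\<And>t. t \<in> X \<Longrightarrow> g t \<in> Y" and c: "\<And>t. t \<in> X \<Longrightarrow> c t \<noteq> 0"
    and w: "\<And>i. i \<in> Y \<Longrightarrow> w i \<in> univ M" "\<And>i. i \<in> Y \<Longrightarrow> w' i \<in> univ N"
    and sim: "rsim p Y M w N w'"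
    and u: "\<And>t. t \<in> X \<Longrightarrow> u t = mscale M (c t) (w (g t))" "\<And>t. t \<in> X \<Longrightarrow> u' t = mscale N (c t) (w' (g t))"
  shows "rsim p X M u N u'"
  unfolding rsim_def zero_agree_def
proof (intro conjI ballI)
  fix t assume t: "t \<in> X"
  have wt: "w (g t) \<in> univ M" "w' (g t) \<in> univ N" using w g t by auto
  have z: "w (g t) = mzero M \<longleftrightarrow> w' (g t) = mzero N"
    and l: "mle p M (mzero M) (w (g t)) \<longleftrightarrow> mle p N (mzero N) (w' (g t))"
    using sim g t unfolding rsim_def zero_agree_def by auto
  show "u t = mzero M \<longleftrightarrow> u' t = mzero N"
    using u t c A.scale_eq_zero[OF wt(1)] B.scale_eq_zero[OF wt(2)] z by simp
  show "mle p M (mzero M) (u t) \<longleftrightarrow> mle p N (mzero N) (u' t)"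
    unfolding u(1)[OF t] u(2)[OF t] A.le_zero_scale[OF wt(1) c[OF t]] B.le_zero_scale[OF wt(2) c[OF t]]
      A.neg_cases[OF wt(1)] B.neg_cases[OF wt(2)] using z l by simp
qed

end

section \<open>The local extension step\<close>

text \<open>For \<open>c \<noteq> 0\<close>, the solution \<open>x\<close> of
  \<open>c x + t = 0\<close>.\<close>

definition ctr :: "'k::field \<Rightarrow> 'k fsym trm \<Rightarrow> 'k fsym trm" where
  "ctr c t = tscale (- inverse c) t"

lemma ctr_in [simp]: "trm_in lang_k (ctr c t) \<longleftrightarrow> trm_in lang_k t" "fvt (ctr c t) = fvt t"
  unfolding ctr_def by auto

lemma (in vspace) eval_split:
  assumes t: "trm_in lang_k t" "trm_in lang_k t'" "n \<notin> fvt t'" "\<And>i. tcoef t i = tcoef (tadd (tscale c (V n)) t') i"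
    and e: "range e \<subseteq> univ M" "x \<in> univ M"
  shows "c = 0 \<Longrightarrow> evalt M (e(n := x)) t = evalt M e t'"
    and "c \<noteq> 0 \<Longrightarrow> evalt M (e(n := x)) t = mscale M c (msub M x (evalt M e (ctr c t')))"
proof -
  have ex: "range (e(n := x)) \<subseteq> univ M" using e by auto
  have e': "evalt M (e(n := x)) t' = evalt M e t'" using t(3) by (intro evalt_cong) auto
  show "c = 0 \<Longrightarrow> evalt M (e(n := x)) t = evalt M e t'"
    using evalt_eqI[OF ex t(1,2)] t(4) e' by simp
  assume c: "c \<noteq> 0"
  have "evalt M (e(n := x)) t = evalt M (e(n := x)) (tscale c (tsub (V n) (ctr c t')))"
    using t c by (intro evalt_eqI[OF ex t(1)]) (auto simp: ctr_def algebra_simps)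
  also have "\<dots> = mscale M c (msub M x (evalt M e (ctr c t')))" using e' by (simp add: ctr_def)
  finally show "evalt M (e(n := x)) t = mscale M c (msub M x (evalt M e (ctr c t')))" .
qed

text \<open>The decomposition of the terms in \<open>X\<close> as \<open>c x + t'\<close>, where \<open>x\<close> is the variable \<open>n\<close>; the sets \<open>A\<close> and
\<open>C\<close> contain the centers, and \<open>X'\<close> the terms without \<open>x\<close> on which agreement is required.\<close>

definition decomposed :: "nat \<Rightarrow> 'k::field fsym trm set \<Rightarrow> ('k fsym trm \<Rightarrow> 'k) \<Rightarrow> ('k fsym trm \<Rightarrow> 'k fsym trm) \<Rightarrow>
    'k fsym trm set \<Rightarrow> 'k fsym trm set \<Rightarrow> 'k fsym trm set \<Rightarrow> bool" where
  "decomposed n X cf rf A C X' \<longleftrightarrow> finite X \<and> finite A \<and> A \<noteq> {} \<and> finite C \<and> finite X' \<and> A \<subseteq> C \<and>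
     (\<forall>t\<in>X \<union> A \<union> C \<union> X'. trm_in lang_k t) \<and>
     (\<forall>t\<in>X. trm_in lang_k (rf t) \<and> n \<notin> fvt (rf t) \<and> (\<forall>i. tcoef t i = tcoef (tadd (tscale (cf t) (V n)) (rf t)) i) \<and>
        (cf t = 0 \<longrightarrow> rf t \<in> X') \<and> (cf t \<noteq> 0 \<longrightarrow> ctr (cf t) (rf t) \<in> A)) \<and>
     (\<forall>c\<in>C. \<forall>a\<in>A. tsub c a \<in> X')"

lemma decomposedD:
  assumes "decomposed n X cf rf A C X'"
  shows "finite X" "finite A" "A \<noteq> {}" "finite C" "finite X'" "A \<subseteq> C"
    "\<And>t. t \<in> X \<Longrightarrow> trm_in lang_k t" "\<And>t. t \<in> A \<Longrightarrow> trm_in lang_k t" "\<And>t. t \<in> C \<Longrightarrow> trm_in lang_k t"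
    "\<And>t. t \<in> X' \<Longrightarrow> trm_in lang_k t" "\<And>t. t \<in> X \<Longrightarrow> trm_in lang_k (rf t)" "\<And>t. t \<in> X \<Longrightarrow> n \<notin> fvt (rf t)"
    "\<And>t i. t \<in> X \<Longrightarrow> tcoef t i = tcoef (tadd (tscale (cf t) (V n)) (rf t)) i"
    "\<And>t. t \<in> X \<Longrightarrow> cf t = 0 \<Longrightarrow> rf t \<in> X'" "\<And>t. t \<in> X \<Longrightarrow> cf t \<noteq> 0 \<Longrightarrow> ctr (cf t) (rf t) \<in> A"
    "\<And>c a. c \<in> C \<Longrightarrow> a \<in> A \<Longrightarrow> tsub c a \<in> X'"
  using assms unfolding decomposed_def by blast+

lemma (in vspace) eval_decomposed:
  assumes d: "decomposed n X cf rf A C X'" and t: "t \<in> X" and e: "range e \<subseteq> univ M" "x \<in> univ M"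
  shows "evalt M (e(n := x)) t = (if cf t = 0 then evalt M e (rf t) else mscale M (cf t) (msub M x (evalt M e (ctr (cf t) (rf t)))))"
  using eval_split[OF decomposedD(7)[OF d t] decomposedD(11)[OF d t] decomposedD(12)[OF d t] decomposedD(13)[OF d t] e]
  by simp

context finpair
begin

text \<open>When \<open>x\<close> is the value of a center \<open>c\<close>, a term containing the
  variable becomes a multiple of some \<open>c - a\<close>, which belongs to \<open>X'\<close>. No
  new value arises, and the same center works in \<open>N\<close>.\<close>

lemma center_step:
  assumes d: "decomposed n X cf rf A C X'" and H: "H \<ge> 1"
    and D: "\<And>t. t \<in> X \<Longrightarrow> cf t \<noteq> 0 \<Longrightarrow> \<bar>pval p (cf t)\<bar> \<le> D" "D \<ge> 0"
    and e: "range e \<subseteq> univ M" "range f \<subseteq> univ N"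
    and sim: "fsim S1 p (sublevel H D (int (card X))) X' M (evalt M e) N (evalt N f)" and c: "c \<in> C"
  shows "fsim S1 p H X M (evalt M (e(n := evalt M e c))) N (evalt N (f(n := evalt N f c)))"
proof -
  note dd = decomposedD[OF d]
  have u: "evalt M e c \<in> univ M" "evalt N f c \<in> univ N" using dd(9)[OF c] e by auto
  define g where "g t = (if cf t = 0 then rf t else tsub c (ctr (cf t) (rf t)))" for t
  define s where "s t = (if cf t = 0 then 1 else cf t)" for t
  show ?thesis
  proof (rule fsim_subst[OF dd(1) dd(5), where g = g and c = s and D = D and w = "evalt M e" and w' = "evalt N f"])
    show "g t \<in> X'" if "t \<in> X" for t unfolding g_def using dd(14-16) that c by auto
    show "s t \<noteq> 0 \<and> \<bar>pval p (s t)\<bar> \<le> D" if "t \<in> X" for t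
      unfolding s_def using D that pval_one[OF A.p] by auto
    show "evalt M e i \<in> univ M" "evalt N f i \<in> univ N" if "i \<in> X'" for i using dd(10)[OF that] e by auto
    show "evalt M (e(n := evalt M e c)) t \<in> univ M \<and> vv p M (evalt M (e(n := evalt M e c)) t) = vv p M (mscale M (s t) (evalt M e (g t)))"
      if "t \<in> X" for t
      using A.eval_decomposed[OF d that e(1) u(1)] e dd(11)[OF that] u unfolding s_def g_def by auto
    show "evalt N (f(n := evalt N f c)) t \<in> univ N \<and> vv p N (evalt N (f(n := evalt N f c)) t) = vv p N (mscale N (s t) (evalt N f (g t)))"
      if "t \<in> X" for t
      using B.eval_decomposed[OF d that e(2) u(2)] e dd(11)[OF that] u unfolding s_def g_def by auto
  qed (use H sim in auto)
qed

text \<open>\<open>nearest_center\<close> reduces all distances from \<open>x\<close> to the value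
  of \<open>z = x - c\<close>, \<open>fsim_extend\<close> matches this value by \<open>z'\<close>,
  and \<open>generic_point\<close> realizes the resulting minima by a vector \<open>y\<close>. The
  distances stay the same in a small ball around \<open>y\<close>, which leaves room for conditions
  at other places.\<close>

lemma generic_step:
  assumes d: "decomposed n X cf rf A C X'" and H: "H \<ge> 1"
    and W: "finite (residue_field p) \<Longrightarrow> residue_reps p ws \<and>
      (\<forall>a\<in>A. \<forall>a'\<in>A. \<forall>w\<in>set ws. tadd a (tscale w (tsub a' a)) \<in> C)"
    and D: "\<And>t. t \<in> X \<Longrightarrow> cf t \<noteq> 0 \<Longrightarrow> \<bar>pval p (cf t)\<bar> \<le> D" "D \<ge> 0"
    and e: "range e \<subseteq> univ M" "range f \<subseteq> univ N"
    and sim: "fsim S1 p (extlevel (sublevel H D (int (card X)))) X' M (evalt M e) N (evalt N f)"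
    and x: "x \<in> univ M" "x \<notin> evalt M e ` C"
  shows "\<exists>y\<in>univ N. \<exists>d\<in>univ N. d \<noteq> mzero N \<and> (\<forall>y'\<in>univ N. mL p N (msub N y' y) d \<longrightarrow>
    fsim S1 p H X M (evalt M (e(n := x))) N (evalt N (f(n := y'))))"
proof -
  note dd = decomposedD[OF d]
  have aM: "evalt M e t \<in> univ M" "evalt N f t \<in> univ N" if "t \<in> A \<union> C \<union> X'" for t using dd(8-10) that e by auto
  have H': "sublevel H D (int (card X)) \<ge> 1"
  proof -
    have "0 \<le> H * int (card X) * (1 + D)" using H D by simp
    then show ?thesis using H D unfolding sublevel_def by linarith
  qed
  obtain c where c: "c \<in> C" and near: "\<And>a. a \<in> A \<Longrightarrow>
     vv p M (msub M x (evalt M e a)) = vv p M (msub M x (evalt M e c)) \<inter> vv p M (msub M (evalt M e c) (evalt M e a)) \<and>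
     (finite (residue_field p) \<longrightarrow> vv p M (msub M x (evalt M e c)) \<noteq> vv p M (msub M (evalt M e c) (evalt M e a)))"
  proof -
    have "\<exists>c\<in>evalt M e ` C. \<forall>i\<in>A. vv p M (msub M x (evalt M e i)) = vv p M (msub M x c) \<inter> vv p M (msub M c (evalt M e i)) \<and>
      (finite (residue_field p) \<longrightarrow> vv p M (msub M x c) \<noteq> vv p M (msub M c (evalt M e i)))"
    proof (rule A.nearest_center[OF dd(2,3) _ x(1), where ws = ws])
      show "finite (residue_field p) \<Longrightarrow> residue_reps p ws \<and> (i \<in> A \<longrightarrow> j \<in> A \<longrightarrow> w \<in> set ws \<longrightarrow>
        madd M (evalt M e i) (mscale M w (msub M (evalt M e j) (evalt M e i))) \<in> evalt M e ` C)" for i j w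
        using W imageI[of "tadd i (tscale w (tsub j i))" C "evalt M e"] by auto
    qed (use aM dd(6) x in auto)
    then show ?thesis using that by blast
  qed
  define z where "z = msub M x (evalt M e c)"
  have cM: "evalt M e c \<in> univ M" "evalt N f c \<in> univ N" using aM c by auto
  have z: "z \<in> univ M" "z \<noteq> mzero M" unfolding z_def using A.sub_eq_zero x c cM by auto
  obtain z' where z': "z' \<in> univ N" "z' \<noteq> mzero N" and
    sim': "fsim S1 p (sublevel H D (int (card X))) (insert None (Some ` X')) M (case_option z (evalt M e)) N (case_option z' (evalt N f))"
    using fsim_extend[OF dd(5) H' sim aM(1) aM(2) z] by auto
  have le: "vv p M (case_option z (evalt M e) i) \<subseteq> vv p M (case_option z (evalt M e) j) \<longleftrightarrow>
     vv p N (case_option z' (evalt N f) i) \<subseteq> vv p N (case_option z' (evalt N f) j)"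
    if "i \<in> insert None (Some ` X')" "j \<in> insert None (Some ` X')" for i j
    by (rule fsim_le[OF sim' H' _ that]) (use dd(5) aM z z' in auto)
  have le1: "vv p M z \<subseteq> vv p M (msub M (evalt M e c) (evalt M e a)) \<longleftrightarrow> vv p N z' \<subseteq> vv p N (msub N (evalt N f c) (evalt N f a))"
    and le2: "vv p M (msub M (evalt M e c) (evalt M e a)) \<subseteq> vv p M z \<longleftrightarrow> vv p N (msub N (evalt N f c) (evalt N f a)) \<subseteq> vv p N z'"
    if "a \<in> A" for a
    using le[of None "Some (tsub c a)"] le[of "Some (tsub c a)" None] dd(16)[OF c that] by auto
  have "\<exists>y\<in>univ N. \<forall>a\<in>A. vv p N (msub N y (evalt N f a)) = vv p N z' \<inter> vv p N (msub N (evalt N f c) (evalt N f a))"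
  proof (rule B.generic_point[OF dd(2) _ cM(2) z'])
    assume fin: "finite (residue_field p)"
    show "\<forall>a\<in>A. vv p N z' \<noteq> vv p N (msub N (evalt N f c) (evalt N f a))"
    proof
      fix a assume a: "a \<in> A"
      have "vv p M z \<noteq> vv p M (msub M (evalt M e c) (evalt M e a))" using near[OF a] fin unfolding z_def by blast
      then show "vv p N z' \<noteq> vv p N (msub N (evalt N f c) (evalt N f a))" using le1[OF a] le2[OF a] by blast
    qed
  qed (use aM in auto)
  then obtain y where y: "y \<in> univ N" "\<And>a. a \<in> A \<Longrightarrow> vv p N (msub N y (evalt N f a)) = vv p N z' \<inter> vv p N (msub N (evalt N f c) (evalt N f a))"
    by blast
  have ne0: "msub N y (evalt N f a) \<noteq> mzero N" if "a \<in> A" for a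
  proof
    assume "msub N y (evalt N f a) = mzero N"
    then have "vv p N (mzero N) \<subseteq> vv p N z'" using y(2)[OF that] by auto
    then show False using B.val_zero[OF z'(1)] B.val_eq_zero[OF z'(1)] z'(2) by auto
  qed
  obtain a0 where a0: "a0 \<in> A" "\<forall>a\<in>A. vv p N (msub N y (evalt N f a)) \<subseteq> vv p N (msub N y (evalt N f a0))"
    using B.val_max(1)[OF dd(2,3), of "\<lambda>a. msub N y (evalt N f a)"] aM y(1) by auto
  \<comment> \<open>One step beyond the largest value \<open>v(y - a)\<close>: adding a vector of
    value at least \<open>v(\<delta>)\<close> changes none of these values.\<close>
  define \<delta> where "\<delta> = mscale N (punif p) (msub N y (evalt N f a0))"
  have a0N: "msub N y (evalt N f a0) \<in> univ N" using a0 aM y(1) by auto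
  have \<delta>: "\<delta> \<in> univ N" "\<delta> \<noteq> mzero N" "vv p N (msub N y (evalt N f a0)) \<subset> vv p N \<delta>"
    unfolding \<delta>_def using B.scale_eq_zero[OF a0N] ne0[OF a0(1)] B.pu B.val_unif(1)[OF a0N] a0N by auto
  \<comment> \<open>The smaller of \<open>v(x - c)\<close> and \<open>v(c - a)\<close> carries the
    value of the term, and \<open>None\<close> stands for the former. The choice is made in
    \<open>M\<close>; by \<open>le1\<close> it is also correct in \<open>N\<close>.\<close>
  define g where "g t = (if cf t = 0 then Some (rf t) else let a = ctr (cf t) (rf t) in
     if vv p M z \<subseteq> vv p M (msub M (evalt M e c) (evalt M e a)) then None else Some (tsub c a))" for t
  define s where "s t = (if cf t = 0 then 1 else cf t)" for t
  have "fsim S1 p H X M (evalt M (e(n := x))) N (evalt N (f(n := y')))"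
    if y': "y' \<in> univ N" and L: "mL p N (msub N y' y) \<delta>" for y'
  proof -
    have "vv p N \<delta> \<subseteq> vv p N (msub N y' y)" using L B.L_iff y' y(1) \<delta>(1) by auto
    then have close: "vv p N (msub N y' (evalt N f a)) = vv p N (msub N y (evalt N f a))" if a: "a \<in> A" for a
    proof -
      have aN: "evalt N f a \<in> univ N" using aM a by auto
      have "msub N y' (evalt N f a) = madd N (msub N y' y) (msub N y (evalt N f a))"
        using B.sub_sub(1) y' y(1) aN by simp
      moreover have "vv p N (msub N y (evalt N f a)) \<subset> vv p N (msub N y' y)"
        using a0(2) a \<delta>(3) \<open>vv p N \<delta> \<subseteq> vv p N (msub N y' y)\<close> by blast
      ultimately show ?thesis using B.val_add_strict'[of "msub N y' y" "msub N y (evalt N f a)"] y' y(1) aN by simp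
    qed
    show ?thesis
    proof (rule fsim_subst[OF dd(1), where Y = "insert None (Some ` X')" and g = g and c = s and D = D
          and w = "case_option z (evalt M e)" and w' = "case_option z' (evalt N f)"])
      show "finite (insert None (Some ` X'))" using dd(5) by simp
      show "g t \<in> insert None (Some ` X')" if "t \<in> X" for t unfolding g_def Let_def using dd(14-16) that c by auto
      show "s t \<noteq> 0 \<and> \<bar>pval p (s t)\<bar> \<le> D" if "t \<in> X" for t
        unfolding s_def using D that pval_one[OF A.p] by auto
      show "case_option z (evalt M e) i \<in> univ M" "case_option z' (evalt N f) i \<in> univ N" if "i \<in> insert None (Some ` X')" for i
        using that aM z z' by auto
      show "evalt M (e(n := x)) t \<in> univ M \<and> vv p M (evalt M (e(n := x)) t) = vv p M (mscale M (s t) (case_option z (evalt M e) (g t)))"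
        if t: "t \<in> X" for t
      proof (cases "cf t = 0")
        case True
        then show ?thesis using A.eval_decomposed[OF d t e(1) x(1)] e dd(11)[OF t] unfolding s_def g_def by auto
      next
        case False
        define a where "a = ctr (cf t) (rf t)"
        have a: "a \<in> A" unfolding a_def using dd(15)[OF t False] .
        have aM': "evalt M e a \<in> univ M" using aM a by auto
        have "vv p M (msub M x (evalt M e a)) = vv p M (case_option z (evalt M e) (g t))"
          using near[OF a] A.val_total[of z "msub M (evalt M e c) (evalt M e a)"] z cM aM' False
          unfolding g_def Let_def a_def[symmetric] z_def[symmetric] by auto
        moreover have "case_option z (evalt M e) (g t) \<in> univ M"
          using z cM aM' False unfolding g_def Let_def a_def[symmetric] by auto
        ultimately have "vv p M (mscale M (cf t) (msub M x (evalt M e a))) = vv p M (mscale M (cf t) (case_option z (evalt M e) (g t)))"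
          using x(1) aM' by (intro A.val_scale_cong) auto
        then show ?thesis
          using A.eval_decomposed[OF d t e(1) x(1)] False x(1) aM' unfolding s_def a_def by simp
      qed
      show "evalt N (f(n := y')) t \<in> univ N \<and> vv p N (evalt N (f(n := y')) t) = vv p N (mscale N (s t) (case_option z' (evalt N f) (g t)))"
        if t: "t \<in> X" for t
      proof (cases "cf t = 0")
        case True
        then show ?thesis using B.eval_decomposed[OF d t e(2) y'] e dd(11)[OF t] unfolding s_def g_def by auto
      next
        case False
        define a where "a = ctr (cf t) (rf t)"
        have a: "a \<in> A" unfolding a_def using dd(15)[OF t False] .
        have aN': "evalt N f a \<in> univ N" using aM a by auto
        have "vv p N (msub N y' (evalt N f a)) = vv p N (case_option z' (evalt N f) (g t))"
          using close[OF a] y(2)[OF a] B.val_total[of z' "msub N (evalt N f c) (evalt N f a)"] z' cM aN' False le1[OF a]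
          unfolding g_def Let_def a_def[symmetric] by auto
        moreover have "case_option z' (evalt N f) (g t) \<in> univ N"
          using z' cM aN' False unfolding g_def Let_def a_def[symmetric] by auto
        ultimately have "vv p N (mscale N (cf t) (msub N y' (evalt N f a))) = vv p N (mscale N (cf t) (case_option z' (evalt N f) (g t)))"
          using y' aN' by (intro B.val_scale_cong) auto
        then show ?thesis
          using B.eval_decomposed[OF d t e(2) y'] False y' aN' unfolding s_def a_def by simp
      qed
    qed (use H sim' in auto)
  qed
  then show ?thesis using y(1) \<delta> by blast
qed

end

context realpair
begin

lemma center_step:
  assumes d: "decomposed n X cf rf A C X'" and e: "range e \<subseteq> univ M" "range f \<subseteq> univ N"
    and sim: "rsim p X' M (evalt M e) N (evalt N f)" and c: "c \<in> C"
  shows "rsim p X M (evalt M (e(n := evalt M e c))) N (evalt N (f(n := evalt N f c)))"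
proof -
  note dd = decomposedD[OF d]
  have u: "evalt M e c \<in> univ M" "evalt N f c \<in> univ N" using dd(9)[OF c] e by auto
  define g where "g t = (if cf t = 0 then rf t else tsub c (ctr (cf t) (rf t)))" for t
  define s where "s t = (if cf t = 0 then 1 else cf t)" for t
  show ?thesis
  proof (rule rsim_subst[where g = g and c = s and w = "evalt M e" and w' = "evalt N f", OF _ _ _ _ sim])
    show "g t \<in> X'" if "t \<in> X" for t unfolding g_def using dd(14-16) that c by auto
    show "s t \<noteq> 0" for t unfolding s_def by auto
    show "evalt M e i \<in> univ M" "evalt N f i \<in> univ N" if "i \<in> X'" for i using dd(10)[OF that] e by auto
    show "evalt M (e(n := evalt M e c)) t = mscale M (s t) (evalt M e (g t))" if "t \<in> X" for t
      using A.eval_decomposed[OF d that e(1) u(1)] e dd(11)[OF that] u unfolding s_def g_def by auto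
    show "evalt N (f(n := evalt N f c)) t = mscale N (s t) (evalt N f (g t))" if "t \<in> X" for t
      using B.eval_decomposed[OF d that e(2) u(2)] e dd(11)[OF that] u unfolding s_def g_def by auto
  qed
qed

text \<open>As \<open>x\<close> is not a center, it cuts the centers strictly into two parts.
  Agreement on the signs of their differences carries the cut to \<open>N\<close>, where
  \<open>cut_point\<close> supplies a ball inside the gap.\<close>

lemma generic_step:
  assumes d: "decomposed n X cf rf A C X'" and e: "range e \<subseteq> univ M" "range f \<subseteq> univ N"
    and sim: "rsim p X' M (evalt M e) N (evalt N f)" and x: "x \<in> univ M" "x \<notin> evalt M e ` C"
  shows "\<exists>y\<in>univ N. \<exists>d\<in>univ N. d \<noteq> mzero N \<and> (\<forall>y'\<in>univ N. mL p N (msub N y' y) d \<longrightarrow>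
    rsim p X M (evalt M (e(n := x))) N (evalt N (f(n := y'))))"
proof -
  note dd = decomposedD[OF d]
  have aM: "evalt M e t \<in> univ M" "evalt N f t \<in> univ N" if "t \<in> A \<union> C \<union> X'" for t using dd(8-10) that e by auto
  define Lo where "Lo = {a\<in>A. mle p M (evalt M e a) x}"
  \<comment> \<open>The reverse inequality would pull back to \<open>M\<close> and contradict the
    position of \<open>x\<close> between the two centers.\<close>
  have cut: "\<not> mle p N u l" if lu: "l \<in> evalt N f ` Lo" "u \<in> evalt N f ` (A - Lo)" for l u
  proof -
    obtain a b where ab: "a \<in> A" "mle p M (evalt M e a) x" "l = evalt N f a" "b \<in> A" "\<not> mle p M (evalt M e b) x" "u = evalt N f b"
      using lu unfolding Lo_def by auto
    have "tsub a b \<in> X'" using dd(16)[of a b] dd(6) ab by auto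
    then have "mle p M (mzero M) (msub M (evalt M e a) (evalt M e b)) \<longleftrightarrow> mle p N (mzero N) (msub N l u)"
      using sim unfolding rsim_def ab by auto
    then have "mle p M (evalt M e b) (evalt M e a) \<longleftrightarrow> mle p N u l"
      using A.le_sub[of "evalt M e b" "evalt M e a"] B.le_sub[of u l] aM ab by auto
    then show ?thesis using A.le_trans[of "evalt M e b" "evalt M e a" x] aM ab x(1) by auto
  qed
  define P where "P y d \<longleftrightarrow> (\<forall>y'\<in>univ N. mL p N (msub N y' y) d \<longrightarrow>
     (\<forall>l\<in>evalt N f ` Lo. \<not> mle p N y' l) \<and> (\<forall>u\<in>evalt N f ` (A - Lo). \<not> mle p N u y'))" for y d
  have "\<exists>y\<in>univ N. \<exists>d\<in>univ N. d \<noteq> mzero N \<and> P y d"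
    unfolding P_def by (rule B.cut_point[OF _ _ _ _ cut]) (use dd(2) aM in \<open>auto simp: Lo_def\<close>)
  then obtain y \<delta> where y: "y \<in> univ N" "\<delta> \<in> univ N" "\<delta> \<noteq> mzero N" and P: "P y \<delta>" by blast
  have y4: "(\<forall>l\<in>evalt N f ` Lo. \<not> mle p N y' l) \<and> (\<forall>u\<in>evalt N f ` (A - Lo). \<not> mle p N u y')"
    if "y' \<in> univ N" "mL p N (msub N y' y) \<delta>" for y' using P that unfolding P_def by simp
  have "rsim p X M (evalt M (e(n := x))) N (evalt N (f(n := y')))"
    if y': "y' \<in> univ N" and L: "mL p N (msub N y' y) \<delta>" for y'
  proof -
    define h where "h t = (if cf t = 0 then evalt M e (rf t) else msub M x (evalt M e (ctr (cf t) (rf t))))" for t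
    define h' where "h' t = (if cf t = 0 then evalt N f (rf t) else msub N y' (evalt N f (ctr (cf t) (rf t))))" for t
    define s where "s t = (if cf t = 0 then 1 else cf t)" for t
    have hM: "h t \<in> univ M" "h' t \<in> univ N" if "t \<in> X" for t
      unfolding h_def h'_def using dd(11)[OF that] e x(1) y' by auto
    have "rsim p X M h N h'"
      unfolding rsim_def zero_agree_def
    proof (intro conjI ballI)
      fix t assume t: "t \<in> X"
      have "(h t = mzero M \<longleftrightarrow> h' t = mzero N) \<and> (mle p M (mzero M) (h t) \<longleftrightarrow> mle p N (mzero N) (h' t))"
      proof (cases "cf t = 0")
        case True
        then show ?thesis using sim dd(14)[OF t] unfolding h_def h'_def rsim_def zero_agree_def by auto
      next
        case False
        define a where "a = ctr (cf t) (rf t)"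
        have a: "a \<in> A" unfolding a_def using dd(15)[OF t False] .
        have aa: "evalt M e a \<in> univ M" "evalt N f a \<in> univ N" using aM a by auto
        have "x \<noteq> evalt M e a" using x(2) a dd(6) by auto
        moreover have "y' \<noteq> evalt N f a" "mle p N (evalt N f a) y' \<longleftrightarrow> a \<in> Lo"
        proof -
          have yl: "a \<in> Lo \<Longrightarrow> \<not> mle p N y' (evalt N f a)" and yu: "a \<notin> Lo \<Longrightarrow> \<not> mle p N (evalt N f a) y'"
            using y4[OF y' L] a by auto
          then show "y' \<noteq> evalt N f a" using B.le_refl[OF y'] by auto
          show "mle p N (evalt N f a) y' \<longleftrightarrow> a \<in> Lo" using yl yu B.le_total[OF y' aa(2)] by blast
        qed
        moreover have "mle p M (evalt M e a) x \<longleftrightarrow> a \<in> Lo" unfolding Lo_def using a by simp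
        ultimately show ?thesis using False A.le_sub[OF aa(1) x(1)] B.le_sub[OF aa(2) y'] A.sub_eq_zero[OF x(1) aa(1)]
          B.sub_eq_zero[OF y' aa(2)] unfolding h_def h'_def a_def by simp
      qed
      then show "h t = mzero M \<longleftrightarrow> h' t = mzero N" "mle p M (mzero M) (h t) \<longleftrightarrow> mle p N (mzero N) (h' t)" by auto
    qed
    then show ?thesis
    proof (rule rsim_subst[where g = id and c = s, rotated 4])
      show "s t \<noteq> 0" for t unfolding s_def by auto
      show "evalt M (e(n := x)) t = mscale M (s t) (h (id t))" if "t \<in> X" for t
        using A.eval_decomposed[OF d that e(1) x(1)] dd(11)[OF that] e unfolding s_def h_def by auto
      show "evalt N (f(n := y')) t = mscale N (s t) (h' (id t))" if "t \<in> X" for t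
        using B.eval_decomposed[OF d that e(2) y'] dd(11)[OF that] e unfolding s_def h'_def by auto
    qed (use hM in auto)
  qed
  then show ?thesis using y(1-3) by blast
qed

end

section \<open>Back and forth between models\<close>

definition tmodel :: "'k::field place set \<Rightarrow> 'k place set \<Rightarrow> ('k fsym, 'k rsym, 'u) struct \<Rightarrow> bool" where
  "tmodel S0 S1 M \<longleftrightarrow> struct_in (lang_kS S0 S1) M \<and> models M (T_kS S0 S1)"

definition agree :: "'k::field place set \<Rightarrow> 'k place \<Rightarrow> int \<Rightarrow> 'i set \<Rightarrow> ('k fsym, 'k rsym, 'u) struct \<Rightarrow> ('i \<Rightarrow> 'u) \<Rightarrow>
    ('k fsym, 'k rsym, 'v) struct \<Rightarrow> ('i \<Rightarrow> 'v) \<Rightarrow> bool" where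
  "agree S1 p H X M w N w' \<longleftrightarrow> (if real_place p then rsim p X M w N w' else fsim S1 p H X M w N w')"

definition agrees :: "'k::field place set \<Rightarrow> 'k place set \<Rightarrow> int \<Rightarrow> 'k fsym trm set \<Rightarrow> ('k fsym, 'k rsym, 'u) struct \<Rightarrow>
    (nat \<Rightarrow> 'u) \<Rightarrow> ('k fsym, 'k rsym, 'v) struct \<Rightarrow> (nat \<Rightarrow> 'v) \<Rightarrow> bool" where
  "agrees S1 P H X M e N f \<longleftrightarrow> (\<forall>p\<in>P. agree S1 p H X M (evalt M e) N (evalt N f))"

lemma models_mono: "models M T \<Longrightarrow> T' \<subseteq> T \<Longrightarrow> models M T'"
  unfolding models_def by blast

text \<open>What the model theory has to know about the places: each one in \<open>S0\<close> is
  real or finite and discrete. For subsets of \<open>places'\<close> without complex places this is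
  supplied by \<open>infinite_place_cases\<close>.\<close>

locale admissible =
  fixes S0 S1 :: "'k::field place set"
  assumes sub: "S1 \<subseteq> S0"
    and nonreal: "\<And>p. p \<in> S0 \<Longrightarrow> \<not> real_place p \<Longrightarrow> finite_place p \<and> discrete_place p"
    and S1_nonreal: "\<And>p. p \<in> S1 \<Longrightarrow> \<not> real_place p"
begin

abbreviation "L \<equiv> lang_kS S0 S1"

lemma tmodel_vspace:
  assumes "tmodel S0 S1 M"
  shows "vspace M"
proof
  have "models M T_vs" using assms models_mono[of M "T_kS S0 S1" T_vs] unfolding tmodel_def T_kS_def by auto
  then show "vector_space_struct M" using models_T_vs[of M] assms unfolding tmodel_def struct_in_lang_k by simp
qed

lemma tmodel_place:
  assumes "tmodel S0 S1 M" "p \<in> S0"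
  shows "models M (T_place p)"
proof -
  have "T_place p \<subseteq> T_kS S0 S1" using assms(2) unfolding T_kS_def by blast
  then show ?thesis using models_mono[of M "T_kS S0 S1"] assms(1) unfolding tmodel_def by simp
qed

lemma tmodel_real:
  assumes "tmodel S0 S1 M" "p \<in> S0" "real_place p"
  shows "realplace M p"
proof -
  interpret vspace M by (rule tmodel_vspace[OF assms(1)])
  have s: "struct_in (lang_kS {p} {}) M" using assms(1) unfolding tmodel_def struct_in_lang_k by simp
  have "models M (T_real p)" using tmodel_place[OF assms(1,2)] assms(3) unfolding T_place_def by simp
  then show ?thesis using models_T_real[OF s] assms(3) by unfold_locales auto
qed

lemma tmodel_fin:
  assumes "tmodel S0 S1 M" "p \<in> S0" "\<not> real_place p"
  shows "finplace M p"
proof -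
  interpret vspace M by (rule tmodel_vspace[OF assms(1)])
  have s: "struct_in lang_k M" using assms(1) unfolding tmodel_def struct_in_lang_k by simp
  have "models M (T_fin p)" using tmodel_place[OF assms(1,2)] assms(3) unfolding T_place_def by simp
  then show ?thesis using models_fin_ax[OF s] nonreal[OF assms(2,3)] by unfold_locales auto
qed

lemma tmodel_plus:
  assumes "tmodel S0 S1 M" "p \<in> S1"
  shows "plus_ax p M"
proof -
  have "T_fin_plus p \<subseteq> T_kS S0 S1" using assms(2) unfolding T_kS_def by blast
  have s: "struct_in lang_k M" using assms(1) unfolding tmodel_def struct_in_lang_k by simp
  have "models M (T_fin_plus p)"
    using models_mono[of M "T_kS S0 S1" "T_fin_plus p"] \<open>T_fin_plus p \<subseteq> T_kS S0 S1\<close> assms(1) unfolding tmodel_def by simp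
  then show ?thesis using models_plus_ax[OF s] by simp
qed

lemma tmodel_finpair:
  assumes "tmodel S0 S1 M" "tmodel S0 S1 N" "p \<in> S0" "\<not> real_place p"
  shows "finpair M N p S1"
proof -
  interpret A: finplace M p by (rule tmodel_fin[OF assms(1,3,4)])
  interpret B: finplace N p by (rule tmodel_fin[OF assms(2,3,4)])
  show ?thesis using tmodel_plus[OF assms(1)] tmodel_plus[OF assms(2)] by unfold_locales auto
qed

lemma tmodel_realpair:
  assumes "tmodel S0 S1 M" "tmodel S0 S1 N" "p \<in> S0" "real_place p"
  shows "realpair M N p"
  unfolding realpair_def using tmodel_real[OF assms(1,3,4)] tmodel_real[OF assms(2,3,4)] by simp

text \<open>The instance of the scheme with one unknown and no equations: an extension step brings a
  single vector close to its target at each place.\<close>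

lemma tmodel_weak_approx:
  assumes M: "tmodel S0 S1 M" and P: "finite P" "P \<noteq> {}" "P \<subseteq> S0"
    and c: "\<And>p. p \<in> P \<Longrightarrow> c p \<in> univ M \<and> c p \<noteq> mzero M \<and> x p \<in> univ M"
  shows "\<exists>y\<in>univ M. \<forall>p\<in>P. mL p M (msub M y (x p)) (c p)"
proof -
  obtain ps where ps: "set ps = P" "distinct ps" using finite_distinct_list[OF P(1)] by metis
  have "ps \<noteq> [] \<and> distinct ps \<and> set ps \<subseteq> S0" using ps P by auto
  then have "weak_approx ps 0 1 (\<lambda>_ _. 0) \<in> T_kS S0 S1" unfolding T_kS_def by blast
  then have "models M {weak_approx ps 0 1 (\<lambda>_ _. 0)}"
    using M models_mono[of M "T_kS S0 S1" "{weak_approx ps 0 1 (\<lambda>_ _. 0)}"] unfolding tmodel_def by auto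
  note * = this[unfolded models_weak_approx[OF M[unfolded tmodel_def, THEN conjunct1]], rule_format]
  have cp: "c (ps ! i) \<in> univ M - {mzero M} \<and> x (ps ! i) \<in> univ M" if "i < length ps" for i
    using c[of "ps ! i"] ps that nth_mem by blast
  obtain y :: "nat \<Rightarrow> _" where "y 0 \<in> univ M" "\<forall>i<length ps. mL (ps ! i) M (msub M (y 0) (x (ps ! i))) (c (ps ! i))"
    using *[of "\<lambda>_. mzero M" "\<lambda>i. c (ps ! i)" "\<lambda>i j. x (ps ! i)"] cp by auto
  then show ?thesis using ps(1) by (intro bexI[of _ "y 0"]) (auto simp: in_set_conv_nth)
qed

lemma agrees_sym:
  assumes "tmodel S0 S1 M" "tmodel S0 S1 N" "P \<subseteq> S0" "agrees S1 P H X M e N f"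
  shows "agrees S1 P H X N f M e"
  unfolding agrees_def
proof
  fix p assume p: "p \<in> P"
  show "agree S1 p H X N (evalt N f) M (evalt M e)"
  proof (cases "real_place p")
    case True
    then show ?thesis using assms(4) p unfolding agrees_def agree_def rsim_def zero_agree_def by auto
  next
    case False
    then interpret finpair M N p S1 using tmodel_finpair assms(1-3) p by blast
    have "fsim S1 p H X M (evalt M e) N (evalt N f)" using assms(4) p False unfolding agrees_def agree_def by auto
    then show ?thesis using False fsim_sym[of H X "evalt M e" "evalt N f"] unfolding agree_def by simp
  qed
qed

lemma agrees_mono:
  assumes M: "tmodel S0 S1 M" "tmodel S0 S1 N" and P: "P' \<subseteq> P" "P \<subseteq> S0" and e: "range e \<subseteq> univ M" "range f \<subseteq> univ N"
    and X: "X' \<subseteq> X" "finite X" "\<And>t. t \<in> X \<Longrightarrow> trm_in lang_k t" and H: "0 \<le> H'" "H' \<le> H" and a: "agrees S1 P H X M e N f"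
  shows "agrees S1 P' H' X' M e N f"
  unfolding agrees_def
proof
  fix p assume p: "p \<in> P'"
  then have a': "agree S1 p H X M (evalt M e) N (evalt N f)" using a P(1) unfolding agrees_def by auto
  show "agree S1 p H' X' M (evalt M e) N (evalt N f)"
  proof (cases "real_place p")
    case True
    then show ?thesis using a' X(1) unfolding agree_def rsim_def zero_agree_def by auto
  next
    case False
    then interpret finpair M N p S1 using tmodel_finpair M P p by blast
    have "fsim S1 p H' X M (evalt M e) N (evalt N f)" using fsim_level a' H False unfolding agree_def by auto
    then have "fsim S1 p H' X' M (evalt M e) N (evalt N f)"
      by (rule fsim_subset) (use X H e in auto)
    then show ?thesis using False unfolding agree_def by simp
  qed
qed

section \<open>The extension step for finitely many places\<close>

lemma decomposition_ex:
  fixes X :: "'k fsym trm set"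
  assumes X: "finite X" "\<And>t. t \<in> X \<Longrightarrow> trm_in lang_k t" and P: "finite P" and Vs: "Vs = (\<Union>t\<in>X. fvt t) - {n}"
  obtains cf rf A C X' where "decomposed n X cf rf A C X'" "\<And>t. t \<in> X' \<Longrightarrow> fvt t \<subseteq> Vs"
    "\<And>p a a' w. p \<in> P \<Longrightarrow> a \<in> A \<Longrightarrow> a' \<in> A \<Longrightarrow> w \<in> set (SOME ws. residue_reps p ws) \<Longrightarrow> tadd a (tscale w (tsub a' a)) \<in> C"
proof -
  have "\<forall>t\<in>X. \<exists>c t'. trm_in lang_k t' \<and> fvt t' \<subseteq> fvt t - {n} \<and> (\<forall>i. tcoef t i = tcoef (tadd (tscale c (V n)) t') i)"
    using X(2) trm_decompose[of _ n] by metis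
  then obtain cf rf where dec: "\<And>t. t \<in> X \<Longrightarrow> trm_in lang_k (rf t) \<and> fvt (rf t) \<subseteq> fvt t - {n} \<and>
      (\<forall>i. tcoef t i = tcoef (tadd (tscale (cf t) (V n)) (rf t)) i)" by metis
  \<comment> \<open>\<open>tzero\<close> keeps \<open>A\<close> nonempty even if no term contains
    the variable, so that closest centers and largest distances exist.\<close>
  define A where "A = insert tzero ((\<lambda>t. ctr (cf t) (rf t)) ` X)"
  \<comment> \<open>At real places and for infinite residue fields \<open>SOME\<close> yields a list
    without meaning, which merely enlarges the finite set \<open>C\<close>.\<close>
  define W where "W p = set (SOME ws. residue_reps p ws)" for p :: "'k place"
  define C where "C = A \<union> (\<Union>p\<in>P. \<Union>a\<in>A. \<Union>a'\<in>A. (\<lambda>w. tadd a (tscale w (tsub a' a))) ` W p)"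
  define X' where "X' = rf ` X \<union> (\<Union>c\<in>C. (\<lambda>a. tsub c a) ` A)"
  have fA: "finite A" unfolding A_def using X by simp
  have fC: "finite C" unfolding C_def W_def using fA P by auto
  have fX: "finite X'" unfolding X'_def using fA fC X by auto
  have A: "trm_in lang_k t \<and> fvt t \<subseteq> Vs" if "t \<in> A" for t using that dec unfolding A_def Vs by fastforce
  have C: "trm_in lang_k t \<and> fvt t \<subseteq> Vs" if "t \<in> C" for t using that A unfolding C_def by fastforce
  have X': "trm_in lang_k t \<and> fvt t \<subseteq> Vs" if "t \<in> X'" for t
    using that A C dec unfolding X'_def Vs by fastforce
  have "decomposed n X cf rf A C X'"
    unfolding decomposed_def
  proof (intro conjI ballI allI impI)
    show "A \<noteq> {}" "A \<subseteq> C" unfolding A_def C_def by auto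
    show "trm_in lang_k t" if "t \<in> X \<union> A \<union> C \<union> X'" for t using that X(2) A C X' by auto
    fix t assume t: "t \<in> X"
    show "trm_in lang_k (rf t)" "n \<notin> fvt (rf t)" "\<And>i. tcoef t i = tcoef (tadd (tscale (cf t) (Var n)) (rf t)) i" using dec[OF t] by auto
    show "rf t \<in> X'" "ctr (cf t) (rf t) \<in> A" using t unfolding X'_def A_def by auto
  next
    show "tsub c a \<in> X'" if "c \<in> C" "a \<in> A" for c a using that unfolding X'_def by auto
  qed (use fA fC fX X in auto)
  then show ?thesis using that[of cf rf A C X'] X' unfolding C_def W_def by blast
qed

text \<open>\<open>H'\<close> and \<open>X'\<close> are fixed before the models, so they depend on
  the terms alone. There are two carrier types because the field is later compared with models on an
  arbitrary type.\<close>

definition extends :: "'u itself \<Rightarrow> 'v itself \<Rightarrow> nat \<Rightarrow> 'k place set \<Rightarrow> int \<Rightarrow> 'k fsym trm set \<Rightarrow> int \<Rightarrow> 'k fsym trm set \<Rightarrow> bool" where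
  "extends _ _ n P H X H' X' \<longleftrightarrow>
    (\<forall>(M :: ('k fsym, 'k rsym, 'u) struct) (N :: ('k fsym, 'k rsym, 'v) struct) e f x. tmodel S0 S1 M \<longrightarrow> tmodel S0 S1 N \<longrightarrow>
       range e \<subseteq> univ M \<longrightarrow> range f \<subseteq> univ N \<longrightarrow> agrees S1 P H' X' M e N f \<longrightarrow> x \<in> univ M \<longrightarrow>
       (\<exists>y\<in>univ N. agrees S1 P H X M (e(n := x)) N (f(n := y))))"

lemma extension_step:
  assumes X: "finite X" "\<And>t. t \<in> X \<Longrightarrow> trm_in lang_k t" and P: "finite P" "P \<noteq> {}" "P \<subseteq> S0" and H: "H \<ge> 1"
  shows "\<exists>X' H'. finite X' \<and> (\<forall>t\<in>X'. trm_in lang_k t \<and> fvt t \<subseteq> (\<Union>t\<in>X. fvt t) - {n}) \<and> H' \<ge> 1 \<and>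
    extends TYPE('u) TYPE('v) n P H X H' X'"
proof -
  obtain cf rf A C X' where d: "decomposed n X cf rf A C X'" and fv: "\<And>t. t \<in> X' \<Longrightarrow> fvt t \<subseteq> (\<Union>t\<in>X. fvt t) - {n}"
    and W: "\<And>p a a' w. p \<in> P \<Longrightarrow> a \<in> A \<Longrightarrow> a' \<in> A \<Longrightarrow> w \<in> set (SOME ws. residue_reps p ws) \<Longrightarrow> tadd a (tscale w (tsub a' a)) \<in> C"
    using decomposition_ex[OF X P(1), of "(\<Union>t\<in>X. fvt t) - {n}" n] by blast
  note dd = decomposedD[OF d]
  \<comment> \<open>One bound for the valuations of the leading coefficients at all places of
    \<open>P\<close>; at a real place \<open>pval\<close> is just some integer, which can only
    increase the bound.\<close>
  define D where "D = (\<Sum>p\<in>P. \<Sum>t\<in>X. \<bar>pval p (cf t)\<bar>)"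
  have D0: "D \<ge> 0" unfolding D_def by (intro sum_nonneg) auto
  have D: "\<bar>pval p (cf t)\<bar> \<le> D" if "p \<in> P" "t \<in> X" for p t
  proof -
    have "\<bar>pval p (cf t)\<bar> \<le> (\<Sum>t\<in>X. \<bar>pval p (cf t)\<bar>)" using that X by (intro member_le_sum) auto
    also have "\<dots> \<le> D" unfolding D_def using that P by (intro member_le_sum[where f = "\<lambda>p. \<Sum>t\<in>X. \<bar>pval p (cf t)\<bar>"] sum_nonneg) (auto intro: sum_nonneg)
    finally show ?thesis .
  qed
  define H1 where "H1 = sublevel H D (int (card X))"
  have H1: "H1 \<ge> 1"
  proof -
    have "0 \<le> H * int (card X) * (1 + D)" using H D0 by simp
    then show ?thesis using H D0 unfolding sublevel_def H1_def by linarith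
  qed
  define H' where "H' = extlevel H1"
  have H': "H1 \<le> H'" unfolding H'_def extlevel_def using H1 zlevel_nonneg[of H1] by simp
  have "\<exists>y\<in>univ N. agrees S1 P H X M (e(n := x)) N (f(n := y))"
    if M: "tmodel S0 S1 M" "tmodel S0 S1 N" and e: "range e \<subseteq> univ M" "range f \<subseteq> univ N"
      and ag: "agrees S1 P H' X' M e N f" and x: "x \<in> univ M"
    for M :: "('k fsym, 'k rsym, 'u) struct" and N :: "('k fsym, 'k rsym, 'v) struct" and e f x
  proof (cases "x \<in> evalt M e ` C")
    case True
    \<comment> \<open>A center is imitated by evaluating the same term in \<open>N\<close>. This
      serves all places at once, so no approximation is involved.\<close>
    then obtain c where c: "c \<in> C" "x = evalt M e c" by auto
    interpret N: vspace N by (rule tmodel_vspace[OF M(2)])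
    have "agree S1 p H X M (evalt M (e(n := evalt M e c))) N (evalt N (f(n := evalt N f c)))" if p: "p \<in> P" for p
    proof (cases "real_place p")
      case True
      then interpret realpair M N p using tmodel_realpair M P p by blast
      show ?thesis using center_step[OF d e _ c(1)] ag p True unfolding agrees_def agree_def by auto
    next
      case False
      then interpret finpair M N p S1 using tmodel_finpair M P p by blast
      have "fsim S1 p H' X' M (evalt M e) N (evalt N f)" using ag p False unfolding agrees_def agree_def by auto
      then have "fsim S1 p H1 X' M (evalt M e) N (evalt N f)" using H' by (rule fsim_level)
      then show ?thesis using center_step[OF d H D[OF p] D0 e _ c(1)] False unfolding agree_def H1_def by auto
    qed
    then show ?thesis unfolding agrees_def c(2) using dd(9)[OF c(1)] e(2) by (intro bexI[of _ "evalt N f c"]) auto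
  next
    case False
    have "\<exists>y\<in>univ N. \<exists>d\<in>univ N. d \<noteq> mzero N \<and> (\<forall>y'\<in>univ N. mL p N (msub N y' y) d \<longrightarrow>
        agree S1 p H X M (evalt M (e(n := x))) N (evalt N (f(n := y'))))" if p: "p \<in> P" for p
    proof (cases "real_place p")
      case True
      then interpret realpair M N p using tmodel_realpair M P p by blast
      have "rsim p X' M (evalt M e) N (evalt N f)" using ag p True unfolding agrees_def agree_def by auto
      then show ?thesis using generic_step[OF d e _ x False] True unfolding agree_def by simp
    next
      case fin: False
      then interpret finpair M N p S1 using tmodel_finpair M P p by blast
      have s: "fsim S1 p (extlevel (sublevel H D (int (card X)))) X' M (evalt M e) N (evalt N f)"
        using ag p fin unfolding agrees_def agree_def H'_def H1_def by auto
      have "residue_reps p (SOME ws. residue_reps p ws) \<and>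
          (\<forall>a\<in>A. \<forall>a'\<in>A. \<forall>w\<in>set (SOME ws. residue_reps p ws). tadd a (tscale w (tsub a' a)) \<in> C)" if "finite (residue_field p)"
        using residue_reps_exist[OF A.p that] W[OF p] by (metis (no_types, lifting) someI_ex)
      then show ?thesis
        using generic_step[OF d H _ D[OF p] D0 e s x False, where ws = "SOME ws. residue_reps p ws"] fin
        unfolding agree_def by simp
    qed
    then obtain y \<delta> where y: "\<And>p. p \<in> P \<Longrightarrow> \<delta> p \<in> univ N \<and> \<delta> p \<noteq> mzero N \<and> y p \<in> univ N"
      and ag': "\<And>p y'. p \<in> P \<Longrightarrow> y' \<in> univ N \<Longrightarrow> mL p N (msub N y' (y p)) (\<delta> p) \<Longrightarrow>
        agree S1 p H X M (evalt M (e(n := x))) N (evalt N (f(n := y')))" by metis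
    obtain y' where "y' \<in> univ N" "\<forall>p\<in>P. mL p N (msub N y' (y p)) (\<delta> p)"
      using tmodel_weak_approx[OF M(2) P, of \<delta> y] y by blast
    then show ?thesis unfolding agrees_def using ag' by blast
  qed
  then have "extends TYPE('u) TYPE('v) n P H X H' X'" unfolding extends_def by (intro allI impI)
  moreover have "H' \<ge> 1" using H1 H' by simp
  ultimately show ?thesis using dd(5,10) fv by (intro exI[of _ X'] exI[of _ H'] conjI ballI)
qed

text \<open>The inclusion \<open>fvt t \<subseteq> fv A\<close> ensures that no new variables enter
  the quantifier-free equivalent, and \<open>P\<close> is kept nonempty so that weak approximation
  applies.\<close>

definition determined :: "'u itself \<Rightarrow> 'v itself \<Rightarrow> 'k form \<Rightarrow> 'k place set \<Rightarrow> int \<Rightarrow> 'k fsym trm set \<Rightarrow> bool" where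
  "determined _ _ A P H X \<longleftrightarrow> finite X \<and> (\<forall>t\<in>X. trm_in lang_k t \<and> fvt t \<subseteq> fv A) \<and> finite P \<and> P \<noteq> {} \<and> P \<subseteq> S0 \<and> H \<ge> 1 \<and>
    (\<forall>(M :: ('k fsym, 'k rsym, 'u) struct) (N :: ('k fsym, 'k rsym, 'v) struct) e f. tmodel S0 S1 M \<longrightarrow> tmodel S0 S1 N \<longrightarrow>
       range e \<subseteq> univ M \<longrightarrow> range f \<subseteq> univ N \<longrightarrow> agrees S1 P H X M e N f \<longrightarrow> (sat M e A \<longleftrightarrow> sat N f A))"

lemma agree_zero: "agree S1 p H X M w N w' \<Longrightarrow> t \<in> X \<Longrightarrow> w t = mzero M \<longleftrightarrow> w' t = mzero N"
  unfolding agree_def rsim_def fsim_def gsim_def vsim_def zero_agree_def by (auto split: if_splits)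

text \<open>Every kind of agreement includes agreement on which entries vanish, so a single place
  suffices; it exists because \<open>S0\<close> is nonempty.\<close>

lemma determined_Eq:
  assumes "S0 \<noteq> {}" "fm_in L (Eq s t)"
  shows "\<exists>P H X. determined TYPE('u) TYPE('v) (Eq s t) P H X"
proof -
  obtain p where p: "p \<in> S0" using assms by auto
  have st: "trm_in lang_k s" "trm_in lang_k t" using assms by auto
  have "sat M e (Eq s t) \<longleftrightarrow> sat N f (Eq s t)" if M: "tmodel S0 S1 M" "tmodel S0 S1 N" and e: "range e \<subseteq> univ M" "range f \<subseteq> univ N"
      and ag: "agrees S1 {p} 1 {tsub s t} M e N f"
    for M :: "('k fsym, 'k rsym, 'u) struct" and N :: "('k fsym, 'k rsym, 'v) struct" and e f
  proof -
    interpret M: vspace M by (rule tmodel_vspace[OF M(1)])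
    interpret N: vspace N by (rule tmodel_vspace[OF M(2)])
    have "agree S1 p 1 {tsub s t} M (evalt M e) N (evalt N f)" using ag unfolding agrees_def by simp
    then have "evalt M e (tsub s t) = mzero M \<longleftrightarrow> evalt N f (tsub s t) = mzero N"
      using agree_zero[of p 1 "{tsub s t}" M "evalt M e" N "evalt N f" "tsub s t"] by simp
    then show ?thesis using M.sub_eq_zero N.sub_eq_zero st e by simp
  qed
  then have "determined TYPE('u) TYPE('v) (Eq s t) {p} 1 {tsub s t}"
    unfolding determined_def using p st by auto
  then show ?thesis by blast
qed

lemma determined_RL:
  assumes p: "p \<in> S0" and st: "trm_in lang_k s" "trm_in lang_k t"
  shows "\<exists>P H X. determined TYPE('u) TYPE('v) (fL p s t) P H X"
proof -
  \<comment> \<open>At a real place \<open>L\<close> compares absolute values, and the signs of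
    these terms decide its four disjuncts; at a finite place the entries \<open>s\<close> and
    \<open>t\<close> decide.\<close>
  define X where "X = {s, t, tneg s, tsub t s, tsub t (tneg s), tsub (tneg t) s, tsub (tneg t) (tneg s)}"
  have X: "finite X" "\<And>u. u \<in> X \<Longrightarrow> trm_in lang_k u \<and> fvt u \<subseteq> fvt s \<union> fvt t" unfolding X_def using st by auto
  have "sat M e (fL p s t) \<longleftrightarrow> sat N f (fL p s t)" if M: "tmodel S0 S1 M" "tmodel S0 S1 N" and e: "range e \<subseteq> univ M" "range f \<subseteq> univ N"
      and ag: "agrees S1 {p} 1 X M e N f"
    for M :: "('k fsym, 'k rsym, 'u) struct" and N :: "('k fsym, 'k rsym, 'v) struct" and e f
  proof (cases "real_place p")
    case True
    then interpret realpair M N p using tmodel_realpair M p by blast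
    have sg: "mle p M (mzero M) (evalt M e u) \<longleftrightarrow> mle p N (mzero N) (evalt N f u)" if "u \<in> X" for u
      using ag that True unfolding agrees_def agree_def rsim_def by auto
    have l: "mle p M (evalt M e u) (evalt M e v) \<longleftrightarrow> mle p N (evalt N f u) (evalt N f v)"
      if "tsub v u \<in> X" "trm_in lang_k u" "trm_in lang_k v" for u v
      using sg[OF that(1)] A.le_sub[of "evalt M e u" "evalt M e v"] B.le_sub[of "evalt N f u" "evalt N f v"] e that by simp
    have "evalt M e s \<in> univ M" "evalt M e t \<in> univ M" "evalt N f s \<in> univ N" "evalt N f t \<in> univ N" using st e by auto
    then show ?thesis
      using A.L_iff[of "evalt M e s" "evalt M e t"] B.L_iff[of "evalt N f s" "evalt N f t"]
        sg[of s] sg[of "tneg s"] l[of t s] l[of t "tneg s"] l[of "tneg t" s] l[of "tneg t" "tneg s"] st unfolding X_def by simp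
  next
    case False
    then interpret finpair M N p S1 using tmodel_finpair M p by blast
    have "fsim S1 p 1 X M (evalt M e) N (evalt N f)" using ag False unfolding agrees_def agree_def by auto
    then have "vv p M (evalt M e t) \<subseteq> vv p M (evalt M e s) \<longleftrightarrow> vv p N (evalt N f t) \<subseteq> vv p N (evalt N f s)"
      by (rule fsim_le) (use X e in \<open>auto simp: X_def\<close>)
    then show ?thesis using A.L_iff B.L_iff st e by simp
  qed
  then have "determined TYPE('u) TYPE('v) (fL p s t) {p} 1 X"
    unfolding determined_def using p X by simp
  then show ?thesis by blast
qed

lemma determined_RM:
  assumes p: "p \<in> S1" and st: "trm_in lang_k s" "trm_in lang_k t" "trm_in lang_k u"
  shows "\<exists>P H X. determined TYPE('u) TYPE('v) (fM p s t u) P H X"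
proof -
  have p0: "p \<in> S0" "\<not> real_place p" using p sub S1_nonreal by auto
  define X where "X = {s, t, u}"
  have X: "finite X" "\<And>v. v \<in> X \<Longrightarrow> trm_in lang_k v \<and> fvt v \<subseteq> fvt s \<union> fvt t \<union> fvt u" unfolding X_def using st by auto
  have "sat M e (fM p s t u) \<longleftrightarrow> sat N f (fM p s t u)" if M: "tmodel S0 S1 M" "tmodel S0 S1 N" and e: "range e \<subseteq> univ M" "range f \<subseteq> univ N"
      and ag: "agrees S1 {p} 2 X M e N f"
    for M :: "('k fsym, 'k rsym, 'u) struct" and N :: "('k fsym, 'k rsym, 'v) struct" and e f
  proof -
    interpret finpair M N p S1 using tmodel_finpair M p0 by blast
    interpret A': finplus M p using plus[OF p] by unfold_locales simp
    interpret B': finplus N p using plus[OF p] by unfold_locales simp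
    interpret GA: zgroup "vgroup p M" "veps p M" by (rule A'.zgroup_G)
    interpret GB: zgroup "vgroup p N" "veps p N" by (rule B'.zgroup_G)
    have sim: "fsim S1 p 2 X M (evalt M e) N (evalt N f)" using ag p0 unfolding agrees_def agree_def by auto
    note z = fsim_zero[OF sim]
    have iM: "evalt M e v \<in> univ M" "evalt N f v \<in> univ N" if "v \<in> X" for v using X that e by auto
    have XX: "s \<in> X" "t \<in> X" "u \<in> X" unfolding X_def by auto
    show ?thesis
    proof (cases "evalt M e s = mzero M \<or> evalt M e t = mzero M \<or> evalt M e u = mzero M")
      case True
      have "mM p M x y w \<longleftrightarrow> w = mzero M \<and> (x = mzero M \<or> y = mzero M)"
        if xy: "x \<in> univ M" "y \<in> univ M" "w \<in> univ M" "x = mzero M \<or> y = mzero M \<or> w = mzero M" for x y w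
      proof -
        obtain w' where "w' \<in> univ M" "vv p M x \<otimes>\<^bsub>vgroup p M\<^esub> vv p M y = vv p M w'" "w' = mzero M \<longleftrightarrow> x = mzero M \<or> y = mzero M"
          by (rule A'.mult_ex[OF xy(1,2)])
        then show ?thesis using A'.mult_iff[OF xy(1-3)] xy A.val_eq_zero[of w'] A.val_eq_zero[of w] by auto
      qed
      moreover have "mM p N x y w \<longleftrightarrow> w = mzero N \<and> (x = mzero N \<or> y = mzero N)"
        if xy: "x \<in> univ N" "y \<in> univ N" "w \<in> univ N" "x = mzero N \<or> y = mzero N \<or> w = mzero N" for x y w
      proof -
        obtain w' where "w' \<in> univ N" "vv p N x \<otimes>\<^bsub>vgroup p N\<^esub> vv p N y = vv p N w'" "w' = mzero N \<longleftrightarrow> x = mzero N \<or> y = mzero N"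
          by (rule B'.mult_ex[OF xy(1,2)])
        then show ?thesis using B'.mult_iff[OF xy(1-3)] xy B.val_eq_zero[of w'] B.val_eq_zero[of w] by auto
      qed
      ultimately show ?thesis using True iM[OF XX(1)] iM[OF XX(2)] iM[OF XX(3)] z[OF XX(1)] z[OF XX(2)] z[OF XX(3)] by simp
    next
      case False
      then have X0: "{i\<in>X. evalt M e i \<noteq> mzero M} = X" unfolding X_def by auto
      have zs: "zsim 2 X (vgroup p M) (veps p M) (\<lambda>i. vv p M (evalt M e i)) (vgroup p N) (veps p N) (\<lambda>i. vv p N (evalt N f i))"
        using sim p unfolding fsim_def gsim_def X0 by simp
      have cM: "vv p M (evalt M e v) \<in> carrier (vgroup p M)" if "v \<in> X" for v
        unfolding A'.carrier_G using iM[OF that] that X0 by auto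
      have cN: "vv p N (evalt N f v) \<in> carrier (vgroup p N)" if "v \<in> X" for v
        unfolding B'.carrier_G using iM[OF that] that X0 z by auto
      \<comment> \<open>If \<open>s\<close> and \<open>t\<close> are the same term, its coefficient
        is two; hence the level 2.\<close>
      define n1 where "n1 v = (if v = s then 1 else 0) + (if v = t then 1 else 0 :: int)" for v
      define n2 where "n2 v = (if v = u then 1 else 0 :: int)" for v
      have 1: "vv p M (evalt M e s) \<otimes>\<^bsub>vgroup p M\<^esub> vv p M (evalt M e t) = zlin (vgroup p M) (veps p M) X (\<lambda>i. vv p M (evalt M e i)) n1 0"
         "vv p M (evalt M e u) = zlin (vgroup p M) (veps p M) X (\<lambda>i. vv p M (evalt M e i)) n2 0"
        using GA.lin_add[of X "\<lambda>i. vv p M (evalt M e i)" "\<lambda>v. if v = s then 1 else 0" 0 "\<lambda>v. if v = t then 1 else 0" 0]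
          GA.lin_single[OF X(1), of "\<lambda>i. vv p M (evalt M e i)"] cM XX unfolding n1_def n2_def by auto
      have 2: "vv p N (evalt N f s) \<otimes>\<^bsub>vgroup p N\<^esub> vv p N (evalt N f t) = zlin (vgroup p N) (veps p N) X (\<lambda>i. vv p N (evalt N f i)) n1 0"
         "vv p N (evalt N f u) = zlin (vgroup p N) (veps p N) X (\<lambda>i. vv p N (evalt N f i)) n2 0"
        using GB.lin_add[of X "\<lambda>i. vv p N (evalt N f i)" "\<lambda>v. if v = s then 1 else 0" 0 "\<lambda>v. if v = t then 1 else 0" 0]
          GB.lin_single[OF X(1), of "\<lambda>i. vv p N (evalt N f i)"] cN XX unfolding n1_def n2_def by auto
      have "zlin (vgroup p M) (veps p M) X (\<lambda>i. vv p M (evalt M e i)) a 0 \<subseteq> zlin (vgroup p M) (veps p M) X (\<lambda>i. vv p M (evalt M e i)) b 0 \<longleftrightarrow>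
         zlin (vgroup p N) (veps p N) X (\<lambda>i. vv p N (evalt N f i)) a 0 \<subseteq> zlin (vgroup p N) (veps p N) X (\<lambda>i. vv p N (evalt N f i)) b 0"
        if ab: "a = n1 \<and> b = n2 \<or> a = n2 \<and> b = n1" for a b
      proof -
        have "\<bar>b i - a i\<bar> \<le> 2" for i using ab unfolding n1_def n2_def by auto
        then show ?thesis
        using GA.lin_le_iff[of X "\<lambda>i. vv p M (evalt M e i)" a 0 b 0] GB.lin_le_iff[of X "\<lambda>i. vv p N (evalt N f i)" a 0 b 0] cM cN
          zsim_pos[OF zs, of "\<lambda>i. b i - a i" 0] by simp
      qed
      then have "vv p M (evalt M e s) \<otimes>\<^bsub>vgroup p M\<^esub> vv p M (evalt M e t) = vv p M (evalt M e u) \<longleftrightarrow>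
         vv p N (evalt N f s) \<otimes>\<^bsub>vgroup p N\<^esub> vv p N (evalt N f t) = vv p N (evalt N f u)"
        unfolding 1 2 by (metis subset_antisym order_refl)
      then show ?thesis using A'.mult_iff B'.mult_iff iM XX by simp
    qed
  qed
  then have "determined TYPE('u) TYPE('v) (fM p s t u) {p} 2 X"
    unfolding determined_def using p0 X by (auto simp: Un_assoc)
  then show ?thesis by blast
qed

lemma determined_RQ:
  assumes p: "p \<in> S1" and s: "trm_in lang_k s" and n: "n \<ge> 1"
  shows "\<exists>P H X. determined TYPE('u) TYPE('v) (fQ p n s) P H X"
proof -
  have p0: "p \<in> S0" "\<not> real_place p" using p sub S1_nonreal by auto
  have "sat M e (fQ p n s) \<longleftrightarrow> sat N f (fQ p n s)" if M: "tmodel S0 S1 M" "tmodel S0 S1 N" and e: "range e \<subseteq> univ M" "range f \<subseteq> univ N"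
      and ag: "agrees S1 {p} (int n) {s} M e N f"
    for M :: "('k fsym, 'k rsym, 'u) struct" and N :: "('k fsym, 'k rsym, 'v) struct" and e f
  proof -
    interpret finpair M N p S1 using tmodel_finpair M p0 by blast
    interpret A': finplus M p using plus[OF p] by unfold_locales simp
    interpret B': finplus N p using plus[OF p] by unfold_locales simp
    interpret GA: zgroup "vgroup p M" "veps p M" by (rule A'.zgroup_G)
    interpret GB: zgroup "vgroup p N" "veps p N" by (rule B'.zgroup_G)
    have sim: "fsim S1 p (int n) {s} M (evalt M e) N (evalt N f)" using ag p0 unfolding agrees_def agree_def by auto
    note z = fsim_zero[OF sim]
    have iM: "evalt M e s \<in> univ M" "evalt N f s \<in> univ N" using s e by auto
    show ?thesis
    proof (cases "evalt M e s = mzero M")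
      case True
      then show ?thesis using z A'.Q_zero[OF n] B'.Q_zero[OF n] by simp
    next
      case False
      then have X0: "{i\<in>{s}. evalt M e i \<noteq> mzero M} = {s}" by auto
      have zs: "zsim (int n) {s} (vgroup p M) (veps p M) (\<lambda>i. vv p M (evalt M e i)) (vgroup p N) (veps p N) (\<lambda>i. vv p N (evalt N f i))"
        using sim p unfolding fsim_def gsim_def X0 by simp
      have c: "vv p M (evalt M e s) \<in> carrier (vgroup p M)" "vv p N (evalt N f s) \<in> carrier (vgroup p N)"
        unfolding A'.carrier_G B'.carrier_G using iM False z by auto
      have "zdvd (vgroup p M) (int n) (zlin (vgroup p M) (veps p M) {s} (\<lambda>i. vv p M (evalt M e i)) (\<lambda>v. if v = s then 1 else 0) 0) \<longleftrightarrow>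
         zdvd (vgroup p N) (int n) (zlin (vgroup p N) (veps p N) {s} (\<lambda>i. vv p N (evalt N f i)) (\<lambda>v. if v = s then 1 else 0) 0)"
        using n by (intro zsim_dvd[OF zs]) auto
      then have "zdvd (vgroup p M) (int n) (vv p M (evalt M e s)) \<longleftrightarrow> zdvd (vgroup p N) (int n) (vv p N (evalt N f s))"
        using GA.lin_single[of "{s}" "\<lambda>i. vv p M (evalt M e i)" s] GB.lin_single[of "{s}" "\<lambda>i. vv p N (evalt N f i)" s] c by simp
      then show ?thesis using A'.Q_iff[OF n] B'.Q_iff[OF n] iM False z by simp
    qed
  qed
  then have "determined TYPE('u) TYPE('v) (fQ p n s) {p} (int n) {s}"
    unfolding determined_def using p0 s n by auto
  then show ?thesis by blast
qed

theorem formula_determined: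
  assumes "S0 \<noteq> {}" "fm_in L A"
  shows "\<exists>P H X. determined TYPE('u) TYPE('v) A P H X"
  using assms(2)
proof (induction A)
  case (Eq s t)
  then show ?case by (rule determined_Eq[OF assms(1)])
next
  case (Rel R ts)
  then have ts: "(R, length ts) \<in> snd L" "\<And>t. t \<in> set ts \<Longrightarrow> trm_in lang_k t" by auto
  then consider p where "p \<in> S0" "R = RL p" "length ts = 2" | p where "p \<in> S1" "R = RM p" "length ts = 3"
    | p n where "p \<in> S1" "R = RQ p n" "n \<ge> 1" "length ts = 1" unfolding lang_kS_def by auto
  then show ?case
  proof cases
    case 1
    then obtain s t where "ts = [s, t]" by (auto simp: numeral_2_eq_2 length_Suc_conv)
    then show ?thesis unfolding 1(2) using 1 ts by (simp only:) (rule determined_RL; simp)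
  next
    case 2
    then obtain s t u where "ts = [s, t, u]" by (auto simp: numeral_3_eq_3 length_Suc_conv)
    then show ?thesis unfolding 2(2) using 2 ts by (simp only:) (rule determined_RM; simp)
  next
    case 3
    then obtain s where "ts = [s]" by (auto simp: length_Suc_conv)
    then show ?thesis unfolding 3(2) using 3 ts by (simp only:) (rule determined_RQ; simp)
  qed
next
  case Bot
  obtain p where "p \<in> S0" using assms by auto
  then have "determined TYPE('u) TYPE('v) Bot {p} 1 {}" unfolding determined_def by simp
  then show ?case by blast
next
  case (Imp A B)
  then obtain P H X P' H' X' where A: "determined TYPE('u) TYPE('v) A P H X" and B: "determined TYPE('u) TYPE('v) B P' H' X'" by auto
  have "determined TYPE('u) TYPE('v) (Imp A B) (P \<union> P') (max H H') (X \<union> X')"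
    unfolding determined_def
  proof (intro conjI allI impI)
    fix M :: "('k fsym, 'k rsym, 'u) struct" and N :: "('k fsym, 'k rsym, 'v) struct" and e f
    assume h: "tmodel S0 S1 M" "tmodel S0 S1 N" "range e \<subseteq> univ M" "range f \<subseteq> univ N"
      and ag: "agrees S1 (P \<union> P') (max H H') (X \<union> X') M e N f"
    have "agrees S1 P H X M e N f" "agrees S1 P' H' X' M e N f"
      using A B unfolding determined_def by (intro agrees_mono[OF h(1,2) _ _ h(3,4) _ _ _ _ _ ag]; auto)+
    then have "sat M e A \<longleftrightarrow> sat N f A" "sat M e B \<longleftrightarrow> sat N f B" using A B h unfolding determined_def by blast+
    then show "sat M e (Imp A B) \<longleftrightarrow> sat N f (Imp A B)" by simp
  qed (use A B in \<open>auto simp: determined_def\<close>)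
  then show ?case by blast
next
  case (All n A)
  then obtain P H X where A: "determined TYPE('u) TYPE('v) A P H X" by auto
  then have X: "finite X" "\<And>t. t \<in> X \<Longrightarrow> trm_in lang_k t" "\<And>t. t \<in> X \<Longrightarrow> fvt t \<subseteq> fv A"
    and P: "finite P" "P \<noteq> {}" "P \<subseteq> S0" and H: "H \<ge> 1" unfolding determined_def by auto
  have fv: "(\<Union>t\<in>X. fvt t) - {n} \<subseteq> fv (All n A)" using X(3) by auto
  have ext1: "\<exists>X' H'. finite X' \<and> (\<forall>t\<in>X'. trm_in lang_k t \<and> fvt t \<subseteq> (\<Union>t\<in>X. fvt t) - {n}) \<and> H' \<ge> 1 \<and>
      extends TYPE('u) TYPE('v) n P H X H' X'"
    by (rule extension_step[OF X(1) _ P H]) (rule X(2))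
  obtain X1 H1 where X1': "finite X1" "\<forall>t\<in>X1. trm_in lang_k t \<and> fvt t \<subseteq> (\<Union>t\<in>X. fvt t) - {n}" "H1 \<ge> 1"
    and 1: "extends TYPE('u) TYPE('v) n P H X H1 X1"
    using ext1 by (elim exE conjE)
  have X1: "finite X1" "\<And>t. t \<in> X1 \<Longrightarrow> trm_in lang_k t \<and> fvt t \<subseteq> fv (All n A)" "H1 \<ge> 1"
    using X1' fv by auto
  \<comment> \<open>A quantifier has to be matched from both sides; the second side exchanges the
    carrier types of the two models.\<close>
  have ext2: "\<exists>X' H'. finite X' \<and> (\<forall>t\<in>X'. trm_in lang_k t \<and> fvt t \<subseteq> (\<Union>t\<in>X. fvt t) - {n}) \<and> H' \<ge> 1 \<and>
      extends TYPE('v) TYPE('u) n P H X H' X'"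
    by (rule extension_step[OF X(1) _ P H]) (rule X(2))
  obtain X2 H2 where X2': "finite X2" "\<forall>t\<in>X2. trm_in lang_k t \<and> fvt t \<subseteq> (\<Union>t\<in>X. fvt t) - {n}" "H2 \<ge> 1"
    and 2: "extends TYPE('v) TYPE('u) n P H X H2 X2"
    using ext2 by (elim exE conjE)
  have X2: "finite X2" "\<And>t. t \<in> X2 \<Longrightarrow> trm_in lang_k t \<and> fvt t \<subseteq> fv (All n A)" "H2 \<ge> 1"
    using X2' fv by auto
  have "determined TYPE('u) TYPE('v) (All n A) P (max H1 H2) (X1 \<union> X2)"
    unfolding determined_def
  proof (intro conjI allI impI)
    fix M :: "('k fsym, 'k rsym, 'u) struct" and N :: "('k fsym, 'k rsym, 'v) struct" and e f
    assume h: "tmodel S0 S1 M" "tmodel S0 S1 N" "range e \<subseteq> univ M" "range f \<subseteq> univ N"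
      and ag: "agrees S1 P (max H1 H2) (X1 \<union> X2) M e N f"
    have a1: "agrees S1 P H1 X1 M e N f" and a2: "agrees S1 P H2 X2 M e N f"
      by (rule agrees_mono[OF h(1,2) subset_refl P(3) h(3,4) _ _ _ _ _ ag]; use X1 X2 in auto)+
    have a2': "agrees S1 P H2 X2 N f M e" by (rule agrees_sym[OF h(1,2) P(3) a2])
    have A': "sat M (e(n := x)) A \<longleftrightarrow> sat N (f(n := y)) A"
      if "x \<in> univ M" "y \<in> univ N" "agrees S1 P H X M (e(n := x)) N (f(n := y))" for x y
    proof -
      have "range (e(n := x)) \<subseteq> univ M" "range (f(n := y)) \<subseteq> univ N" using that h by auto
      then show ?thesis using A h that unfolding determined_def by blast
    qed
    show "sat M e (All n A) \<longleftrightarrow> sat N f (All n A)"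
    proof
      assume s: "sat M e (All n A)"
      show "sat N f (All n A)" unfolding sat.simps
      proof
        fix y assume y: "y \<in> univ N"
        obtain x where x: "x \<in> univ M" "agrees S1 P H X N (f(n := y)) M (e(n := x))"
          using 2[unfolded extends_def, rule_format, OF h(2,1,4,3) a2' y] by blast
        have "agrees S1 P H X M (e(n := x)) N (f(n := y))" by (rule agrees_sym[OF h(2,1) P(3) x(2)])
        then show "sat N (f(n := y)) A" using A' x(1) y s by simp
      qed
    next
      assume s: "sat N f (All n A)"
      show "sat M e (All n A)" unfolding sat.simps
      proof
        fix x assume x: "x \<in> univ M"
        obtain y where "y \<in> univ N" "agrees S1 P H X M (e(n := x)) N (f(n := y))"
          using 1[unfolded extends_def, rule_format, OF h a1 x] by blast
        then show "sat M (e(n := x)) A" using A' x s by simp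
      qed
    qed
  qed (use X1 X2 P in auto)
  then show ?case by blast
qed

end

section \<open>Embeddings, completeness and quantifier elimination\<close>

definition embeds :: "'k::field place set \<Rightarrow> 'k place set \<Rightarrow> ('u \<Rightarrow> 'v) \<Rightarrow> ('k fsym, 'k rsym, 'u) struct \<Rightarrow> ('k fsym, 'k rsym, 'v) struct \<Rightarrow> bool" where
  "embeds S0 S1 h M N \<longleftrightarrow> inj_on h (univ M) \<and> h ` univ M \<subseteq> univ N \<and> h (mzero M) = mzero N \<and> h (mone M) = mone N \<and>
     (\<forall>x\<in>univ M. \<forall>y\<in>univ M. h (madd M x y) = madd N (h x) (h y)) \<and>
     (\<forall>c. \<forall>x\<in>univ M. h (mscale M c x) = mscale N c (h x)) \<and>
     (\<forall>p\<in>S0. \<forall>x\<in>univ M. \<forall>y\<in>univ M. mL p M x y \<longleftrightarrow> mL p N (h x) (h y)) \<and>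
     (\<forall>p\<in>S1. \<forall>x\<in>univ M. \<forall>y\<in>univ M. \<forall>z\<in>univ M. mM p M x y z \<longleftrightarrow> mM p N (h x) (h y) (h z)) \<and>
     (\<forall>p\<in>S1. \<forall>n\<ge>1. \<forall>x\<in>univ M. mQ p n M x \<longleftrightarrow> mQ p n N (h x))"

context admissible
begin

text \<open>Presburger atoms concern the value groups, whereas \<open>h\<close> acts on vectors.
  Preservation of \<open>mM\<close> makes the induced map on values a homomorphism; divisibility,
  which could become easier in a larger group, is reflected thanks to the predicates
  \<open>mQ\<close>.\<close>

lemma embeds_agrees:
  assumes h: "embeds S0 S1 h M N" and M: "tmodel S0 S1 M" "tmodel S0 S1 N" and e: "range e \<subseteq> univ M"
    and P: "P \<subseteq> S0" and X: "finite X" "\<And>t. t \<in> X \<Longrightarrow> trm_in lang_k t"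
  shows "agrees S1 P H X M e N (h \<circ> e)"
proof -
  interpret M: vspace M by (rule tmodel_vspace[OF M(1)])
  interpret N: vspace N by (rule tmodel_vspace[OF M(2)])
  have hM: "h x \<in> univ N" if "x \<in> univ M" for x using h that unfolding embeds_def by blast
  have hop: "h (mzero M) = mzero N" "h (mone M) = mone N"
    "\<And>x y. x \<in> univ M \<Longrightarrow> y \<in> univ M \<Longrightarrow> h (madd M x y) = madd N (h x) (h y)"
    "\<And>c x. x \<in> univ M \<Longrightarrow> h (mscale M c x) = mscale N c (h x)"
    and hL: "\<And>p x y. p \<in> S0 \<Longrightarrow> x \<in> univ M \<Longrightarrow> y \<in> univ M \<Longrightarrow> mL p M x y \<longleftrightarrow> mL p N (h x) (h y)"
    and hMM: "\<And>p x y z. p \<in> S1 \<Longrightarrow> x \<in> univ M \<Longrightarrow> y \<in> univ M \<Longrightarrow> z \<in> univ M \<Longrightarrow> mM p M x y z \<longleftrightarrow> mM p N (h x) (h y) (h z)"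
    and hQ: "\<And>p n x. p \<in> S1 \<Longrightarrow> n \<ge> 1 \<Longrightarrow> x \<in> univ M \<Longrightarrow> mQ p n M x \<longleftrightarrow> mQ p n N (h x)"
    using h unfolding embeds_def by blast+
  have hz: "h x = mzero N \<longleftrightarrow> x = mzero M" if "x \<in> univ M" for x
    using h that hop(1) unfolding embeds_def by (metis M.closed(1) inj_on_def)
  have ev: "evalt N (h \<circ> e) t = h (evalt M e t)" if "trm_in lang_k t" for t
    using that by (induction t rule: trm_induct_k) (use hop e in auto)
  define w where "w = evalt M e"
  define w' where "w' = evalt N (h \<circ> e)"
  have w: "w t \<in> univ M" if "t \<in> X" for t unfolding w_def using X that e by auto
  have w': "w' t = h (w t)" if "t \<in> X" for t unfolding w_def w'_def using X ev that by auto
  have za: "zero_agree X M w N w'" unfolding zero_agree_def using w w' hz by auto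
  have "agree S1 p H X M w N w'" if "p \<in> P" for p
  proof -
    have p: "p \<in> S0" using that P by auto
    show ?thesis
    proof (cases "real_place p")
      case True
      have "mle p M (mzero M) x \<longleftrightarrow> mle p N (mzero N) (h x)" if "x \<in> univ M" for x
        unfolding mle_def using that hL[OF p] hop by (simp add: hop[symmetric] del: M.scale_zero N.scale_zero)
      then show ?thesis using True za w w' unfolding agree_def rsim_def by auto
    next
      case False
      interpret finpair M N p S1 by (rule tmodel_finpair[OF M p False])
      have val: "vv p M x \<subseteq> vv p M y \<longleftrightarrow> vv p N (h x) \<subseteq> vv p N (h y)" if "x \<in> univ M" "y \<in> univ M" for x y
        using A.L_iff[of y x] B.L_iff[of "h y" "h x"] that hM hL[OF p] by simp
      show ?thesis
      proof (cases "p \<in> S1")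
        case False
        have "vsim p H X M w N w'" unfolding vsim_def using za w w' val by (simp add: hop(4)[symmetric])
        then show ?thesis using False \<open>\<not> real_place p\<close> unfolding agree_def fsim_def by simp
      next
        case p1: True
        interpret A': finplus M p using plus[OF p1] by unfold_locales simp
        interpret B': finplus N p using plus[OF p1] by unfold_locales simp
        interpret GA: zgroup "vgroup p M" "veps p M" by (rule A'.zgroup_G)
        interpret GB: zgroup "vgroup p N" "veps p N" by (rule B'.zgroup_G)
        \<comment> \<open>The graph of the map of value groups induced by \<open>h\<close>; as a
          relation it takes no choice of representatives.\<close>
        define R where "R U V \<longleftrightarrow> (\<exists>z\<in>univ M. z \<noteq> mzero M \<and> U = vv p M z \<and> V = vv p N (h z))" for U V
        have Rc: "U \<in> carrier (vgroup p M)" "V \<in> carrier (vgroup p N)" if "R U V" for U V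
          using that hM hz unfolding R_def A'.carrier_G B'.carrier_G by auto
        have Rm: "R (U \<otimes>\<^bsub>vgroup p M\<^esub> U') (V \<otimes>\<^bsub>vgroup p N\<^esub> V')" if RR: "R U V" "R U' V'" for U V U' V'
        proof -
          obtain x y where xy: "x \<in> univ M" "x \<noteq> mzero M" "U = vv p M x" "V = vv p N (h x)"
            "y \<in> univ M" "y \<noteq> mzero M" "U' = vv p M y" "V' = vv p N (h y)" using RR unfolding R_def by auto
          obtain z where z: "z \<in> univ M" "vv p M x \<otimes>\<^bsub>vgroup p M\<^esub> vv p M y = vv p M z" "z = mzero M \<longleftrightarrow> x = mzero M \<or> y = mzero M"
            by (rule A'.mult_ex[OF xy(1,5)])
          have "mM p N (h x) (h y) (h z)" using A'.mult_iff[OF xy(1,5) z(1)] z hMM[OF p1] xy by simp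
          then show ?thesis using B'.mult_iff hM xy z unfolding R_def by auto
        qed
        have R1: "R \<one>\<^bsub>vgroup p M\<^esub> \<one>\<^bsub>vgroup p N\<^esub>"
          unfolding R_def A'.one_G B'.one_G using A.zero_ne_one hop(2) by (intro bexI[of _ "mone M"]) auto
        have Re: "R (veps p M) (veps p N)"
          unfolding R_def veps_def using A.zero_ne_one A.pu M.scale_eq_zero hop(2,4)
          by (intro bexI[of _ "mscale M (punif p) (mone M)"]) auto
        have Ri: "R (inv\<^bsub>vgroup p M\<^esub> U) (inv\<^bsub>vgroup p N\<^esub> V)" if R: "R U V" for U V
        proof -
          obtain x where x: "x \<in> univ M" "x \<noteq> mzero M" "inv\<^bsub>vgroup p M\<^esub> U = vv p M x"
            using GA.inv_closed[OF Rc(1)[OF R]] unfolding A'.carrier_G by auto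
          have Rx: "R (vv p M x) (vv p N (h x))" unfolding R_def using x by auto
          then have "R (U \<otimes>\<^bsub>vgroup p M\<^esub> vv p M x) (V \<otimes>\<^bsub>vgroup p N\<^esub> vv p N (h x))" using Rm R by blast
          then have "R \<one>\<^bsub>vgroup p M\<^esub> (V \<otimes>\<^bsub>vgroup p N\<^esub> vv p N (h x))" using x(3) Rc(1)[OF R] by (metis GA.r_inv)
          then obtain z where z: "z \<in> univ M" "vv p M (mone M) = vv p M z" "V \<otimes>\<^bsub>vgroup p N\<^esub> vv p N (h x) = vv p N (h z)"
            unfolding R_def A'.one_G by auto
          have "vv p N (h z) = vv p N (h (mone M))" using val[of z "mone M"] val[of "mone M" z] z by auto
          then have "V \<otimes>\<^bsub>vgroup p N\<^esub> vv p N (h x) = \<one>\<^bsub>vgroup p N\<^esub>" unfolding B'.one_G using z hop(2) by simp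
          then have "vv p N (h x) = inv\<^bsub>vgroup p N\<^esub> V" using Rc(2)[OF R] Rc(2)[OF Rx] by (metis GB.inv_equality GB.m_comm)
          then show ?thesis using Rx x(3) by simp
        qed
        have Rnat: "R (U [^]\<^bsub>vgroup p M\<^esub> (k::nat)) (V [^]\<^bsub>vgroup p N\<^esub> k)" if "R U V" for U V k
          by (induction k) (use that R1 Rm in auto)
        have Rpow: "R (U [^]\<^bsub>vgroup p M\<^esub> k) (V [^]\<^bsub>vgroup p N\<^esub> k)" if "R U V" for U V and k :: int
        proof (cases k rule: int_cases2)
          case (nonneg n)
          then show ?thesis using Rnat[OF that, of n] by (simp only: int_pow_int)
        next
          case (nonpos n)
          then show ?thesis using Ri[OF Rnat[OF that, of n]] Rc[OF that] by (simp only: GA.int_pow_neg_int GB.int_pow_neg_int)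
        qed
        define X0 where "X0 = {t\<in>X. w t \<noteq> mzero M}"
        have RX: "R (vv p M (w t)) (vv p N (w' t))" if "t \<in> X0" for t
          using that w w' unfolding R_def X0_def by auto
        have "finite X0" unfolding X0_def using X by simp
        then have Rprod: "R (\<Otimes>\<^bsub>vgroup p M\<^esub>t\<in>X0. vv p M (w t) [^]\<^bsub>vgroup p M\<^esub> n t) (\<Otimes>\<^bsub>vgroup p N\<^esub>t\<in>X0. vv p N (w' t) [^]\<^bsub>vgroup p N\<^esub> n t)" for n :: "_ \<Rightarrow> int"
          using RX
        proof (induction X0 rule: finite_induct)
          case (insert t F)
          have "R (vv p M (w t) [^]\<^bsub>vgroup p M\<^esub> n t) (vv p N (w' t) [^]\<^bsub>vgroup p N\<^esub> n t)" using insert Rpow by simp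
          moreover have cc: "(\<lambda>t. vv p M (w t) [^]\<^bsub>vgroup p M\<^esub> n t) \<in> insert t F \<rightarrow> carrier (vgroup p M)"
            "(\<lambda>t. vv p N (w' t) [^]\<^bsub>vgroup p N\<^esub> n t) \<in> insert t F \<rightarrow> carrier (vgroup p N)"
            using Rc Rpow insert.prems by blast+
          moreover have "R (\<Otimes>\<^bsub>vgroup p M\<^esub>t\<in>F. vv p M (w t) [^]\<^bsub>vgroup p M\<^esub> n t) (\<Otimes>\<^bsub>vgroup p N\<^esub>t\<in>F. vv p N (w' t) [^]\<^bsub>vgroup p N\<^esub> n t)"
            using insert by simp
          ultimately have "R (vv p M (w t) [^]\<^bsub>vgroup p M\<^esub> n t \<otimes>\<^bsub>vgroup p M\<^esub> (\<Otimes>\<^bsub>vgroup p M\<^esub>t\<in>F. vv p M (w t) [^]\<^bsub>vgroup p M\<^esub> n t))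
              (vv p N (w' t) [^]\<^bsub>vgroup p N\<^esub> n t \<otimes>\<^bsub>vgroup p N\<^esub> (\<Otimes>\<^bsub>vgroup p N\<^esub>t\<in>F. vv p N (w' t) [^]\<^bsub>vgroup p N\<^esub> n t))"
            using Rm by blast
          then show ?case using insert(1,2) cc
            by (simp add: GA.finprod_insert GB.finprod_insert Pi_def)
        qed (use R1 in simp)
        have Rlin: "R (zlin (vgroup p M) (veps p M) X0 (\<lambda>i. vv p M (w i)) n c) (zlin (vgroup p N) (veps p N) X0 (\<lambda>i. vv p N (w' i)) n c)" for n c
          unfolding zlin_def using Rprod Rpow[OF Re] Rm by blast
        have Rpos: "\<one>\<^bsub>vgroup p M\<^esub> \<subseteq> U \<longleftrightarrow> \<one>\<^bsub>vgroup p N\<^esub> \<subseteq> V" if R: "R U V" for U V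
          using R val[of "mone M"] hop(2) unfolding R_def A'.one_G B'.one_G by auto
        have Rdvd: "zdvd (vgroup p M) m U \<longleftrightarrow> zdvd (vgroup p N) m V" if R: "R U V" and m: "m \<ge> 1" for U V m
        proof -
          obtain z where z: "z \<in> univ M" "z \<noteq> mzero M" "U = vv p M z" "V = vv p N (h z)" using R unfolding R_def by auto
          have m': "nat m \<ge> 1" "int (nat m) = m" using m by auto
          show ?thesis using A'.Q_iff[OF m'(1) z(1,2)] B'.Q_iff[OF m'(1), of "h z"] hQ[OF p1 m'(1) z(1)] hM hz z m'(2) by simp
        qed
        have "gsim p H X M w N w'" unfolding gsim_def zsim_def X0_def[symmetric] using za Rpos[OF Rlin] Rdvd[OF Rlin] by auto
        then show ?thesis using p1 \<open>\<not> real_place p\<close> unfolding agree_def fsim_def by simp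
      qed
    qed
  qed
  then show ?thesis unfolding agrees_def w_def w'_def by blast
qed

lemma embeds_sat:
  fixes M :: "('k fsym, 'k rsym, 'u) struct" and N :: "('k fsym, 'k rsym, 'v) struct"
  assumes ne: "S0 \<noteq> {}" and h: "embeds S0 S1 h M N" and M: "tmodel S0 S1 M" "tmodel S0 S1 N" and e: "range e \<subseteq> univ M"
    and A: "fm_in L A"
  shows "sat M e A \<longleftrightarrow> sat N (h \<circ> e) A"
proof -
  obtain P H X where d: "determined TYPE('u) TYPE('v) A P H X" using formula_determined[OF ne A] by blast
  have he: "range (h \<circ> e) \<subseteq> univ N" using h e unfolding embeds_def by auto
  have "agrees S1 P H X M e N (h \<circ> e)"
    by (rule embeds_agrees[OF h M e]) (use d in \<open>auto simp: determined_def\<close>)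
  then show ?thesis using d M e he unfolding determined_def by blast
qed

theorem model_completeness:
  assumes ne: "S0 \<noteq> {}"
  shows "model_complete TYPE('u) L (T_kS S0 S1)"
  unfolding model_complete_def
proof (intro allI impI)
  fix M N :: "('k fsym, 'k rsym, 'u) struct"
  assume M: "struct_in L M" "struct_in L N" "models M (T_kS S0 S1)" "models N (T_kS S0 S1)" and s: "substruct L M N"
  have tm: "tmodel S0 S1 M" "tmodel S0 S1 N" using M unfolding tmodel_def by auto
  interpret vspace M by (rule tmodel_vspace[OF tm(1)])
  have f: "fint M f xs = fint N f xs" if "(f, length xs) \<in> fst L" "set xs \<subseteq> univ M" for f xs
    using s that unfolding substruct_def by blast
  have r: "rint M R xs = rint N R xs" if "(R, length xs) \<in> snd L" "set xs \<subseteq> univ M" for R xs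
    using s that unfolding substruct_def by blast
  have "univ M \<subseteq> univ N" using s unfolding substruct_def by blast
  then have "embeds S0 S1 id M N" unfolding embeds_def using f r sub by (auto simp: subset_eq)
  then have "sat M e A \<longleftrightarrow> sat N e A" if "fm_in L A" "range e \<subseteq> univ M" for A e
    using embeds_sat[OF ne _ tm that(2,1)] by fastforce
  then show "elem_substruct L M N" unfolding elem_substruct_def using s by blast
qed

text \<open>Their truth values amount to agreement at \<open>p\<close> when \<open>p\<close> is not
  in \<open>S1\<close>: vanishing together with signs at a real place, and with shifted comparisons
  at a finite one.\<close>

definition atoms :: "'k place \<Rightarrow> int \<Rightarrow> 'k fsym trm set \<Rightarrow> 'k form set" where
  "atoms p H X = (\<lambda>t. Eq t tzero) ` X \<union> (if real_place p then (\<lambda>t. fle p tzero t) ` X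
     else (\<lambda>(s, t, n). fL p (tscale (ppow p n) t) s) ` (X \<times> X \<times> {- H..H}))"

lemma atoms:
  assumes "finite X" "\<And>t. t \<in> X \<Longrightarrow> trm_in lang_k t \<and> fvt t \<subseteq> Vs" "p \<in> S0"
  shows "finite (atoms p H X)" "\<And>\<phi>. \<phi> \<in> atoms p H X \<Longrightarrow> qfree \<phi> \<and> fm_in L \<phi> \<and> fv \<phi> \<subseteq> Vs"
proof -
  have h: "x \<in> Vs" if "t \<in> X" "x \<in> fvt t" for t x using assms(2) that by blast
  show "finite (atoms p H X)" "\<And>\<phi>. \<phi> \<in> atoms p H X \<Longrightarrow> qfree \<phi> \<and> fm_in L \<phi> \<and> fv \<phi> \<subseteq> Vs"
    using assms h unfolding atoms_def fle_def by (auto split: if_splits)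
qed

lemma atoms_agree:
  assumes S1: "S1 = {}" and p: "p \<in> S0" and M: "tmodel S0 S1 M" "tmodel S0 S1 N" and e: "range e \<subseteq> univ M" "range f \<subseteq> univ N"
    and X: "\<And>t. t \<in> X \<Longrightarrow> trm_in lang_k t" and a: "\<And>\<phi>. \<phi> \<in> atoms p H X \<Longrightarrow> sat M e \<phi> \<longleftrightarrow> sat N f \<phi>"
  shows "agree S1 p H X M (evalt M e) N (evalt N f)"
proof -
  have "sat M e (Eq t tzero) \<longleftrightarrow> sat N f (Eq t tzero)" if "t \<in> X" for t using a that unfolding atoms_def by blast
  then have za: "zero_agree X M (evalt M e) N (evalt N f)" unfolding zero_agree_def by simp
  show ?thesis
  proof (cases "real_place p")
    case True
    have "sat M e (fle p tzero t) \<longleftrightarrow> sat N f (fle p tzero t)" if "t \<in> X" for t using a that True unfolding atoms_def by simp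
    then show ?thesis using za True unfolding agree_def rsim_def sat_fle by simp
  next
    case False
    interpret finpair M N p S1 by (rule tmodel_finpair[OF M p False])
    have "sat M e (fL p (tscale (ppow p n) t) s) \<longleftrightarrow> sat N f (fL p (tscale (ppow p n) t) s)"
      if "s \<in> X" "t \<in> X" "\<bar>n\<bar> \<le> H" for s t n
      using that False by (intro a) (force simp: atoms_def image_iff)
    then have "vsim p H X M (evalt M e) N (evalt N f)"
      unfolding vsim_def using za A.L_iff B.L_iff X e by simp
    then show ?thesis using False S1 unfolding agree_def fsim_def by simp
  qed
qed

text \<open>\<open>A\<close> is equivalent to the disjunction of those complete truth assignments to
  the finitely many atoms that occur together with \<open>A\<close> in some model. Equal assignments
  give agreement, and agreement decides \<open>A\<close>.\<close>

theorem quantifier_elim: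
  assumes ne: "S0 \<noteq> {}" and S1: "S1 = {}"
  shows "quantifier_elimination TYPE('u) L (T_kS S0 S1)"
  unfolding quantifier_elimination_def
proof (intro allI impI)
  fix A :: "'k form" assume A: "fm_in L A"
  obtain P H X where d: "determined TYPE('u) TYPE('u) A P H X" using formula_determined[OF ne A] by blast
  then have X: "finite X" "\<And>t. t \<in> X \<Longrightarrow> trm_in lang_k t \<and> fvt t \<subseteq> fv A" and P: "finite P" "P \<subseteq> S0"
    unfolding determined_def by auto
  define \<Phi> where "\<Phi> = (\<Union>p\<in>P. atoms p H X)"
  have \<Phi>: "finite \<Phi>" "\<And>\<phi>. \<phi> \<in> \<Phi> \<Longrightarrow> qfree \<phi> \<and> fm_in L \<phi> \<and> fv \<phi> \<subseteq> fv A"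
  proof -
    show "finite \<Phi>" unfolding \<Phi>_def using atoms(1)[OF X] P by auto
    fix \<phi> assume "\<phi> \<in> \<Phi>"
    then obtain p where "p \<in> P" "\<phi> \<in> atoms p H X" unfolding \<Phi>_def by auto
    then show "qfree \<phi> \<and> fm_in L \<phi> \<and> fv \<phi> \<subseteq> fv A" using atoms(2)[OF X, of p \<phi> H] P by blast
  qed
  obtain \<phi>s where \<phi>s: "set \<phi>s = \<Phi>" using finite_list[OF \<Phi>(1)] by blast
  define \<theta> where "\<theta> \<sigma> = Conj (map (\<lambda>\<phi>. if \<phi> \<in> \<sigma> then \<phi> else Neg \<phi>) \<phi>s)" for \<sigma>
  \<comment> \<open>There are only finitely many truth assignments, so those compatible with
    \<open>A\<close> can be collected although all models on the type are searched.\<close>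
  define \<Sigma> where "\<Sigma> = {\<sigma>\<in>Pow \<Phi>. \<exists>(M :: ('k fsym, 'k rsym, 'u) struct) e. tmodel S0 S1 M \<and> range e \<subseteq> univ M \<and> sat M e A \<and> sat M e (\<theta> \<sigma>)}"
  have "finite \<Sigma>" unfolding \<Sigma>_def using \<Phi>(1) by simp
  then obtain \<sigma>s where \<sigma>s: "set \<sigma>s = \<Sigma>" using finite_list by blast
  define B where "B = Disj (map \<theta> \<sigma>s)"
  have qC: "qfree (Conj Bs)" if "\<forall>B\<in>set Bs. qfree B" for Bs :: "'k form list"
    using that by (induction Bs) (auto simp: Conj_def)
  have qD: "qfree (Disj Bs)" if "\<forall>B\<in>set Bs. qfree B" for Bs :: "'k form list"
    using that by (induction Bs) (auto simp: Disj_def)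
  have "qfree (\<theta> \<sigma>) \<and> fm_in L (\<theta> \<sigma>) \<and> fv (\<theta> \<sigma>) \<subseteq> fv A" for \<sigma>
    unfolding \<theta>_def using \<Phi>(2) \<phi>s by (auto intro!: qC split: if_splits)
  then have "fm_in L B" "qfree B" "fv B \<subseteq> fv A" unfolding B_def by (auto intro!: qD)
  moreover have "entails TYPE('u) L (T_kS S0 S1) (Iff A B)"
    unfolding entails_def
  proof (intro allI impI)
    fix M :: "('k fsym, 'k rsym, 'u) struct" and e :: "nat \<Rightarrow> 'u"
    assume "struct_in L M" "models M (T_kS S0 S1)" and e: "range e \<subseteq> univ M"
    then have M: "tmodel S0 S1 M" unfolding tmodel_def by simp
    have th: "sat M e (\<theta> \<sigma>) \<longleftrightarrow> (\<forall>\<phi>\<in>\<Phi>. sat M e \<phi> \<longleftrightarrow> \<phi> \<in> \<sigma>)" for \<sigma> and M :: "('k fsym, 'k rsym, 'u) struct" and e :: "nat \<Rightarrow> 'u"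
    proof -
      have "sat M e (if \<phi> \<in> \<sigma> then \<phi> else Neg \<phi>) \<longleftrightarrow> (sat M e \<phi> \<longleftrightarrow> \<phi> \<in> \<sigma>)" for \<phi> by simp
      then show ?thesis unfolding \<theta>_def by (simp only: sat_Conj set_map \<phi>s ball_simps)
    qed
    have "sat M e A \<longleftrightarrow> sat M e B"
    proof
      assume s: "sat M e A"
      have "sat M e (\<theta> {\<phi>\<in>\<Phi>. sat M e \<phi>})" unfolding th by auto
      then have "{\<phi>\<in>\<Phi>. sat M e \<phi>} \<in> \<Sigma>" unfolding \<Sigma>_def using M e s by blast
      then show "sat M e B" unfolding B_def using \<sigma>s \<open>sat M e (\<theta> _)\<close> by auto
    next
      assume "sat M e B"
      then obtain \<sigma> where \<sigma>: "\<sigma> \<in> \<Sigma>" "sat M e (\<theta> \<sigma>)" unfolding B_def using \<sigma>s by auto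
      then obtain N :: "('k fsym, 'k rsym, 'u) struct" and f where N: "tmodel S0 S1 N" "range f \<subseteq> univ N" "sat N f A" "sat N f (\<theta> \<sigma>)"
        unfolding \<Sigma>_def by blast
      have "agrees S1 P H X M e N f"
        unfolding agrees_def
      proof
        fix p assume p: "p \<in> P"
        show "agree S1 p H X M (evalt M e) N (evalt N f)"
        proof (rule atoms_agree[OF S1 _ M N(1) e N(2)])
          show "p \<in> S0" using p P by auto
          show "trm_in lang_k t" if "t \<in> X" for t using X that by simp
          show "sat M e \<phi> \<longleftrightarrow> sat N f \<phi>" if "\<phi> \<in> atoms p H X" for \<phi>
            using \<sigma>(2) N(4) that p unfolding th \<Phi>_def by blast
        qed
      qed
      then show "sat M e A" using d M N e unfolding determined_def by blast
    qed
    then show "sat M e (Iff A B)" by auto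
  qed
  ultimately show "\<exists>B. fm_in L B \<and> qfree B \<and> fv B \<subseteq> fv A \<and> entails TYPE('u) L (T_kS S0 S1) (Iff A B)" by blast
qed

end

text \<open>Satisfiability asks for a model carried by formulas, so the model on the field is moved
  along an injection.\<close>

definition push :: "('a \<Rightarrow> 'b) \<Rightarrow> ('f, 'r, 'a) struct \<Rightarrow> ('f, 'r, 'b) struct" where
  "push g M = \<lparr>univ = g ` univ M, fint = (\<lambda>f xs. g (fint M f (map (inv_into UNIV g) xs))), rint = (\<lambda>R xs. rint M R (map (inv_into UNIV g) xs))\<rparr>"

lemma push_simps:
  "univ (push g M) = g ` univ M" "fint (push g M) f xs = g (fint M f (map (inv_into UNIV g) xs))"
  "rint (push g M) R xs = rint M R (map (inv_into UNIV g) xs)"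
  unfolding push_def by simp_all

lemma evalt_push: "inj g \<Longrightarrow> evalt (push g M) (\<lambda>i. g (e i)) t = g (evalt M e t)"
proof (induction t)
  case (Fun f ts)
  then have "map (inv_into UNIV g) (map (evalt (push g M) (\<lambda>i. g (e i))) ts) = map (evalt M e) ts" by simp
  then show ?case by (simp only: evalt.simps push_simps)
qed simp

lemma sat_push:
  assumes g: "inj g"
  shows "sat (push g M) (\<lambda>i. g (e i)) A \<longleftrightarrow> sat M e A"
proof (induction A arbitrary: e)
  case (Eq s t)
  then show ?case by (simp add: evalt_push[OF g] inj_eq[OF g])
next
  case (Rel R ts)
  have "map (inv_into UNIV g) (map (evalt (push g M) (\<lambda>i. g (e i))) ts) = map (evalt M e) ts" by (simp add: evalt_push[OF g] g)
  then show ?case by (simp only: sat.simps push_simps)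
next
  case (All n A)
  have "(\<lambda>i. g (e i))(n := g a) = (\<lambda>i. g ((e(n := a)) i))" for a by auto
  then have "sat (push g M) ((\<lambda>i. g (e i))(n := g a)) A \<longleftrightarrow> sat M (e(n := a)) A" for a
    using All[of "e(n := a)"] by metis
  then show ?case by (simp add: push_simps)
qed simp_all

lemma models_push:
  fixes g :: "'a \<Rightarrow> 'b"
  assumes g: "inj g" and M: "models M T"
  shows "models (push g M) T"
  unfolding models_def
proof (intro ballI allI impI)
  fix A and e :: "nat \<Rightarrow> 'b" assume A: "A \<in> T" and e: "range e \<subseteq> univ (push g M)"
  have "\<forall>i. \<exists>a\<in>univ M. e i = g a" using e unfolding push_def by auto
  then obtain e' where e': "\<And>i. e' i \<in> univ M" "\<And>i. e i = g (e' i)" by metis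
  have "e = (\<lambda>i. g (e' i))" using e'(2) by auto
  moreover have "sat M e' A" using M A e'(1) unfolding models_def by auto
  ultimately show "sat (push g M) e A" using sat_push[OF g] by metis
qed

lemma struct_in_push:
  assumes g: "inj g" and M: "struct_in L M"
  shows "struct_in L (push g M)"
  unfolding struct_in_def
proof (intro conjI ballI)
  show "univ (push g M) \<noteq> {}" using M unfolding struct_in_def push_def by simp
  fix fn assume fn: "fn \<in> fst L"
  obtain f n where f: "fn = (f, n)" by (cases fn)
  have "g (fint M f (map (inv_into UNIV g) xs)) \<in> g ` univ M" if "length xs = n" "set xs \<subseteq> g ` univ M" for xs
  proof -
    have "set (map (inv_into UNIV g) xs) \<subseteq> univ M" using that(2) g by auto
    then have "fint M f (map (inv_into UNIV g) xs) \<in> univ M" using M fn that(1) unfolding struct_in_def f by fastforce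
    then show ?thesis by simp
  qed
  then show "case fn of (f, n) \<Rightarrow> \<forall>xs. length xs = n \<longrightarrow> set xs \<subseteq> univ (push g M) \<longrightarrow> fint (push g M) f xs \<in> univ (push g M)"
    unfolding f push_def by simp
qed

context admissible
begin

theorem completeness:
  fixes K :: "('k fsym, 'k rsym, 'k) struct"
  assumes ne: "S0 \<noteq> {}" and K: "tmodel S0 S1 K"
    and emb: "\<And>M :: ('k fsym, 'k rsym, 'u) struct. tmodel S0 S1 M \<Longrightarrow> \<exists>h. embeds S0 S1 h K M"
  shows "complete_theory TYPE('u) L (T_kS S0 S1)"
  unfolding complete_theory_def
proof (intro conjI allI impI)
  define g :: "'k \<Rightarrow> ('k fsym, 'k rsym) fm" where "g c = Eq (Fun (Scale c) []) (Fun Zero [])" for c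
  \<comment> \<open>Formulas serve as mere names for the field elements, told apart by the symbol
    \<open>Scale c\<close>.\<close>
  have "inj g" unfolding g_def by (auto intro: injI)
  then show "satisfiable L (T_kS S0 S1)"
    unfolding satisfiable_def using models_push struct_in_push K unfolding tmodel_def by blast
  fix A :: "'k form" assume "sentence_in L A"
  then have A: "fm_in L A" "fv A = {}" unfolding sentence_in_def by auto
  obtain e :: "nat \<Rightarrow> 'k" where e: "range e \<subseteq> univ K"
    using ex_assignment K unfolding tmodel_def struct_in_def by metis
  have "sat M f A \<longleftrightarrow> sat K e A" if M: "tmodel S0 S1 M" for M :: "('k fsym, 'k rsym, 'u) struct" and f
  proof -
    obtain h where "embeds S0 S1 h K M" using emb[OF M] by blast
    then have "sat K e A \<longleftrightarrow> sat M (h \<circ> e) A" by (rule embeds_sat[OF ne _ K M e A(1)])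
    moreover have "sat M (h \<circ> e) A \<longleftrightarrow> sat M f A" by (rule sat_cong) (use A in auto)
    ultimately show ?thesis by simp
  qed
  then show "entails TYPE('u) L (T_kS S0 S1) A \<or> entails TYPE('u) L (T_kS S0 S1) (Neg A)"
    unfolding entails_def tmodel_def by (metis sat.simps(3,4))
qed

end

section \<open>Weak approximation in the field\<close>

locale absval =
  fixes a :: "'k::field \<Rightarrow> real"
  assumes av: "absolute_value a"
begin

lemma nonneg [simp]: "0 \<le> a x" and eq_zero [simp]: "a x = 0 \<longleftrightarrow> x = 0"
  and mult: "a (x * y) = a x * a y" and triangle: "a (x + y) \<le> a x + a y"
  using av unfolding absolute_value_def by auto

lemma zero [simp]: "a 0 = 0"
  by simp

lemma pos [simp]: "0 < a x \<longleftrightarrow> x \<noteq> 0"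
  using nonneg[of x] eq_zero[of x] by linarith

lemma one [simp]: "a 1 = 1"
  using mult[of 1 1] eq_zero[of 1] by simp

lemma inverse: "a (inverse x) = inverse (a x)"
proof (cases "x = 0")
  case False
  then have "a x * a (inverse x) = 1" using mult[of x "inverse x"] by simp
  then show ?thesis by (metis inverse_unique)
qed (simp add: eq_zero[THEN iffD2])

lemma divide: "a (x / y) = a x / a y"
  by (simp add: divide_inverse mult inverse)

lemma power: "a (x ^ n) = a x ^ n"
  by (induction n) (simp_all add: mult)

lemma minus [simp]: "a (- x) = a x"
proof -
  have "a (- 1) * a (- 1) = 1" using mult[of "- 1" "- 1"] by simp
  then have "(a (- 1) - 1) * (a (- 1) + 1) = 0" by (simp add: algebra_simps)
  moreover have "a (- 1) + 1 > 0" using nonneg[of "- 1"] by linarith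
  ultimately have "a (- 1) = 1" by simp
  then show ?thesis using mult[of "- 1" x] by simp
qed

lemma triangle_diff: "a (x - y) \<le> a x + a y"
  using triangle[of x "- y"] by simp

lemma reverse_triangle: "\<bar>a x - a y\<bar> \<le> a (x - y)"
  using triangle[of "x - y" y] triangle[of "y - x" x] minus[of "x - y"] by auto

lemma sum_le: "a (\<Sum>i\<in>I. f i) \<le> (\<Sum>i\<in>I. a (f i))"
proof (induction I rule: infinite_finite_induct)
  case (insert x F)
  then show ?case using triangle[of "f x" "sum f F"] by simp
qed auto

lemma ex_gt_one:
  assumes "nontrivial_av a"
  obtains y where "a y > 1"
proof -
  obtain x where x: "x \<noteq> 0" "a x \<noteq> 1" using assms unfolding nontrivial_av_def by auto
  show ?thesis
  proof (cases "a x > 1")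
    case False
    then have "a (inverse x) > 1" using x by (simp add: inverse one_less_inverse_iff)
    then show ?thesis using that by blast
  qed (use that in blast)
qed

end

text \<open>Logarithms to the base \<open>y\<close> are compared. If the one for \<open>b\<close>
  exceeded the one for \<open>a\<close> at \<open>x\<close>, a rational \<open>m / n\<close>
  strictly between them would make the quotient of \<open>x^n\<close> by \<open>y^m\<close> small
  for \<open>a\<close> but large for \<open>b\<close>. The inverse of \<open>x\<close> gives the
  other inequality.\<close>

lemma equiv_av_criterion:
  fixes a b :: "'k::field \<Rightarrow> real"
  assumes a: "absolute_value a" "nontrivial_av a" and b: "absolute_value b"
    and sub: "\<And>x. a x < 1 \<Longrightarrow> b x < 1"
  shows "equiv_av a b"
proof -
  interpret A: absval a by unfold_locales (rule a)
  interpret B: absval b by unfold_locales (rule b)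
  obtain y where y: "a y > 1" by (rule A.ex_gt_one[OF a(2)])
  then have y0: "y \<noteq> 0" by auto
  have by1: "b y > 1"
  proof -
    have "a (inverse y) < 1" using y by (simp add: A.inverse inverse_less_1_iff)
    then have "b (inverse y) < 1" by (rule sub)
    then have "b y \<le> 0 \<or> 1 < b y" by (simp add: B.inverse inverse_less_1_iff)
    moreover have "0 < b y" using y0 by simp
    ultimately show ?thesis by linarith
  qed
  define la where "la = ln (a y)"
  define lb where "lb = ln (b y)"
  have l: "la > 0" "lb > 0" unfolding la_def lb_def by (rule ln_gt_zero[OF y], rule ln_gt_zero[OF by1])
  have lt: "ln (b (x ^ n * inverse y ^ m)) < 0" if "ln (a x) * n < la * m" "x \<noteq> 0" for x and n m :: nat
  proof -
    have "ln (a (x ^ n * inverse y ^ m)) = n * ln (a x) - m * la"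
      using that(2) y0 by (simp add: A.mult A.power A.inverse la_def ln_mult ln_realpow ln_inverse)
    then have neg: "ln (a (x ^ n * inverse y ^ m)) < 0" using that(1) by (simp add: mult.commute)
    have nz: "x ^ n * inverse y ^ m \<noteq> 0" using that(2) y0 by simp
    have "a (x ^ n * inverse y ^ m) < 1"
      by (rule ccontr) (use neg ln_ge_zero[of "a (x ^ n * inverse y ^ m)"] in linarith)
    from sub[OF this] show ?thesis using nz by (intro ln_less_zero) (simp_all only: B.pos not_False_eq_True)
  qed
  have key: "ln (b x) / lb \<le> ln (a x) / la" if x: "x \<noteq> 0" for x
  proof (rule ccontr)
    assume "\<not> ?thesis"
    then obtain q where q: "q \<in> \<rat>" "ln (a x) / la < q" "q < ln (b x) / lb" using Rats_dense_in_real by (metis not_le)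
    \<comment> \<open>Multiplying \<open>x\<close> by \<open>y^k\<close> shifts both normalized
      logarithms by \<open>k\<close> and makes the separating rational nonnegative, so that its
      numerator is a natural exponent.\<close>
    obtain k :: nat where k: "q + real k \<ge> 0" using real_arch_simple[of "- q"] that by (metis add.commute add_le_cancel_left add.right_inverse)
    define x' where "x' = x * y ^ k"
    have x'0: "x' \<noteq> 0" unfolding x'_def using x y0 by simp
    have la': "ln (a x') / la = ln (a x) / la + k" "ln (b x') / lb = ln (b x) / lb + k"
      unfolding x'_def using x y0 l by (simp_all add: A.mult A.power B.mult B.power ln_mult ln_realpow la_def lb_def add_divide_distrib)
    have "q + real k \<in> \<rat>" using q by auto
    then obtain m n :: nat where mn: "n \<noteq> 0" "\<bar>q + real k\<bar> = real m / real n" by (rule Rats_abs_nat_div_natE)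
    then have qk: "q + real k = m / n" using k by simp
    have "ln (a x') / la < m / n" "m / n < ln (b x') / lb" using la' q qk by linarith+
    then have 1: "ln (a x') * n < la * m" "lb * m < ln (b x') * n" using l mn by (auto simp: field_simps)
    have "ln (b (x' ^ n * inverse y ^ m)) = n * ln (b x') - m * lb"
      using x'0 y0 by (simp add: B.mult B.power B.inverse lb_def ln_mult ln_realpow ln_inverse)
    then show False using lt[OF 1(1) x'0] 1(2) by (simp add: mult.commute)
  qed
  have eq: "ln (b x) / lb = ln (a x) / la" if x: "x \<noteq> 0" for x
  proof (rule antisym[OF key[OF x]])
    have "ln (b (inverse x)) / lb \<le> ln (a (inverse x)) / la" using key[of "inverse x"] x by simp
    then show "ln (a x) / la \<le> ln (b x) / lb" using x by (simp add: A.inverse B.inverse ln_inverse)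
  qed
  have "b x = a x powr (lb / la)" for x
  proof (cases "x = 0")
    case True
    then show ?thesis using A.eq_zero[of x] B.eq_zero[of x] by simp
  next
    case False
    then have "ln (b x) = lb / la * ln (a x)" using eq[OF False] l by (simp add: field_simps)
    then have "exp (ln (b x)) = a x powr (lb / la)" using False by (simp add: powr_def)
    then show ?thesis using False by simp
  qed
  then show ?thesis unfolding equiv_av_def using l by (intro exI[of _ "lb / la"]) auto
qed

lemma equiv_av_sym:
  assumes "absolute_value a" "equiv_av a b"
  shows "equiv_av b a"
proof -
  interpret A: absval a by unfold_locales (rule assms)
  obtain s where s: "s > 0" "\<And>x. b x = a x powr s" using assms unfolding equiv_av_def by auto
  have "a x = b x powr (1 / s)" for x using s by (simp add: powr_powr)
  then show ?thesis unfolding equiv_av_def using s by (intro exI[of _ "1 / s"]) auto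
qed

lemma equiv_av_trans: "equiv_av a b \<Longrightarrow> equiv_av b c \<Longrightarrow> equiv_av a c"
proof -
  assume "equiv_av a b" "equiv_av b c"
  then obtain s t where "s > 0" "\<And>x. b x = a x powr s" "t > 0" "\<And>x. c x = b x powr t"
    unfolding equiv_av_def by auto
  then show ?thesis unfolding equiv_av_def by (intro exI[of _ "s * t"]) (simp add: powr_powr)
qed

lemma place_props:
  assumes p: "p \<in> places" and a: "a \<in> p"
  shows "absolute_value a" "nontrivial_av a" "p = {b. absolute_value b \<and> equiv_av a b}"
proof -
  obtain a0 where a0: "p = {b. absolute_value b \<and> equiv_av a0 b}" "absolute_value a0" "nontrivial_av a0"
    using p unfolding places_def by auto
  show av: "absolute_value a" using a a0 by simp
  have e: "equiv_av a0 a" using a a0 by simp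
  interpret A0: absval a0 by unfold_locales (rule a0)
  interpret A: absval a by unfold_locales (rule av)
  obtain s where s: "s > 0" "\<And>x. a x = a0 x powr s" using e unfolding equiv_av_def by auto
  obtain y where y: "a0 y > 1" by (rule A0.ex_gt_one[OF a0(3)])
  then have "a y > 1" unfolding s(2) using s(1) by simp
  then show "nontrivial_av a" unfolding nontrivial_av_def by (intro exI[of _ y]) auto
  show "p = {b. absolute_value b \<and> equiv_av a b}"
    unfolding a0(1) using equiv_av_trans[OF e] equiv_av_trans[OF equiv_av_sym[OF a0(2) e]] by blast
qed

lemma places_equiv: "p \<in> places \<Longrightarrow> q \<in> places \<Longrightarrow> a \<in> p \<Longrightarrow> b \<in> q \<Longrightarrow> equiv_av a b \<Longrightarrow> p = q"
  using place_props[of p a] place_props[of q b] equiv_av_sym[of a b] equiv_av_trans[of a b] equiv_av_trans[of b a] by blast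

lemma place_le:
  assumes "p \<in> places" "a \<in> p" "b \<in> p"
  shows "a x \<le> a y \<longleftrightarrow> b x \<le> b y"
proof -
  interpret A: absval a by unfold_locales (rule place_props(1)[OF assms(1,2)])
  obtain s where s: "s > 0" "\<And>x. b x = a x powr s"
    using place_props(3)[OF assms(1,2)] assms(3) unfolding equiv_av_def by auto
  show ?thesis unfolding s(2) using s(1) powr_mono2[of s "a x" "a y"] powr_less_mono2[of s "a y" "a x"] by force
qed

definition rep :: "'k::field place \<Rightarrow> 'k \<Rightarrow> real" where
  "rep p = (SOME a. a \<in> p)"

lemma rep:
  assumes "p \<in> places"
  shows "rep p \<in> p" "absval (rep p)" "nontrivial_av (rep p)"
proof -
  obtain a where "a \<in> p" by (rule place_base[OF assms]) blast
  then show "rep p \<in> p" unfolding rep_def by (rule someI[of "\<lambda>a. a \<in> p"])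
  then show "absval (rep p)" "nontrivial_av (rep p)" using place_props[OF assms] unfolding absval_def by auto
qed

lemma approx_zero:
  assumes "absval a" "a z < 1"
  shows "(\<lambda>m. a (z ^ m / (1 + z ^ m))) \<longlonglongrightarrow> 0"
proof -
  interpret absval a by (rule assms)
  have pw: "(\<lambda>m. a z ^ m) \<longlonglongrightarrow> 0" using assms(2) by (intro LIMSEQ_realpow_zero) auto
  have "eventually (\<lambda>m. a (z ^ m / (1 + z ^ m)) \<le> a z ^ m / (1 - a z ^ m)) sequentially"
    using eventually_gt_at_top[of 0]
  proof eventually_elim
    case (elim m)
    have g: "a z ^ m < 1" using assms(2) elim power_less_one_iff[of "a z" m] by simp
    have "1 - a z ^ m \<le> a (1 + z ^ m)" using reverse_triangle[of 1 "- (z ^ m)"] by (simp add: power)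
    then have "a z ^ m / a (1 + z ^ m) \<le> a z ^ m / (1 - a z ^ m)" using g by (intro divide_left_mono mult_pos_pos) auto
    then show ?case by (simp add: divide power)
  qed
  then have "eventually (\<lambda>m. norm (a (z ^ m / (1 + z ^ m))) \<le> a z ^ m / (1 - a z ^ m)) sequentially" by simp
  moreover have "(\<lambda>m. a z ^ m / (1 - a z ^ m)) \<longlonglongrightarrow> 0"
    using tendsto_divide[OF pw tendsto_diff[OF tendsto_const pw, of 1]] by simp
  ultimately show ?thesis by (rule Lim_null_comparison)
qed

text \<open>Replacing \<open>z\<close> by its inverse turns the quotient into one minus itself,
  which reduces the claim to \<open>approx_zero\<close>.\<close>

lemma approx_one:
  assumes "absval a" "a z > 1"
  shows "(\<lambda>m. a (z ^ m / (1 + z ^ m) - 1)) \<longlonglongrightarrow> 0"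
proof -
  interpret absval a by (rule assms)
  have z0: "z \<noteq> 0" using assms(2) by auto
  have "a (inverse z) < 1" using assms(2) by (simp add: inverse inverse_less_1_iff)
  then have lim: "(\<lambda>m. a (inverse z ^ m / (1 + inverse z ^ m))) \<longlonglongrightarrow> 0" by (rule approx_zero[OF assms(1)])
  have "eventually (\<lambda>m. a (inverse z ^ m / (1 + inverse z ^ m)) = a (z ^ m / (1 + z ^ m) - 1)) sequentially"
    using eventually_gt_at_top[of 0]
  proof eventually_elim
    case (elim m)
    have "a (z ^ m) \<noteq> 1" using one_less_power[OF assms(2) elim] by (simp add: power)
    then have nz: "1 + z ^ m \<noteq> 0" using minus[of 1] by (metis add_eq_0_iff one)
    have "inverse z ^ m / (1 + inverse z ^ m) = - (z ^ m / (1 + z ^ m) - 1)"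
      using nz z0 by (simp add: power_inverse field_simps)
    then show ?case using minus by metis
  qed
  then show ?thesis using lim tendsto_cong by fast
qed

text \<open>Inequivalence in both directions gives \<open>w = y / x\<close>, large at
  \<open>i\<close> and small at the new index \<open>j\<close>. If the element \<open>z\<close>
  found for \<open>J\<close> is not large at \<open>j\<close>, a high power of it times
  \<open>w\<close> works. Otherwise the power is replaced by \<open>z^m / (1 + z^m)\<close>, which
  tends to one at \<open>i\<close> and \<open>j\<close> and to zero on \<open>J\<close>.\<close>

lemma separating_element:
  assumes "finite J" "i \<notin> J" and a: "\<And>j. j \<in> insert i J \<Longrightarrow> absval (a j) \<and> nontrivial_av (a j)"
    and ne: "\<And>j l. j \<in> insert i J \<Longrightarrow> l \<in> insert i J \<Longrightarrow> j \<noteq> l \<Longrightarrow> \<not> equiv_av (a j) (a l)"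
  shows "\<exists>z. a i z > 1 \<and> (\<forall>j\<in>J. a j z < (1::real))"
  using assms
proof (induction J rule: finite_induct)
  case empty
  then show ?case using absval.ex_gt_one by (metis empty_iff insertI1)
next
  case (insert j J)
  then obtain z where z: "a i z > 1" "\<forall>l\<in>J. a l z < 1" by auto
  interpret I: absval "a i" using insert.prems by auto
  interpret J: absval "a j" using insert.prems by auto
  have ij: "i \<noteq> j" using insert.prems by auto
  obtain x where x: "a i x < 1" "a j x \<ge> 1"
    using equiv_av_criterion[of "a i" "a j"] insert.prems(2)[of i] insert.prems(2)[of j] insert.prems(3)[of i j] ij
    unfolding absval_def by force
  obtain y where y: "a j y < 1" "a i y \<ge> 1"
    using equiv_av_criterion[of "a j" "a i"] insert.prems(2)[of i] insert.prems(2)[of j] insert.prems(3)[of j i] ij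
    unfolding absval_def by force
  define w where "w = y / x"
  have x0: "x \<noteq> 0" using x(2) by auto
  have "0 < a i x" using x0 by simp
  then have w: "a i w > 1" "a j w < 1" unfolding w_def I.divide J.divide
    using x y by (auto simp: less_divide_eq divide_less_eq)
  show ?case
  proof (cases "a j z \<le> 1")
    case True
    have "eventually (\<lambda>m. \<forall>l\<in>J. a l (z ^ m * w) < 1) sequentially"
    proof (intro eventually_ball_finite[OF insert(1)] ballI)
      fix l assume l: "l \<in> J"
      interpret L: absval "a l" using insert.prems l by auto
      have "(\<lambda>m. a l z ^ m * a l w) \<longlonglongrightarrow> 0 * a l w" using z l by (intro tendsto_intros LIMSEQ_realpow_zero) auto
      then show "eventually (\<lambda>m. a l (z ^ m * w) < 1) sequentially"
        using order_tendstoD(2)[of "\<lambda>m. a l z ^ m * a l w" 0 sequentially 1] by (simp add: L.mult L.power)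
    qed
    from eventually_happens'[OF sequentially_bot this] obtain m where m: "\<forall>l\<in>J. a l (z ^ m * w) < 1" by blast
    have "a i (z ^ m * w) > 1"
      using z w(1) one_le_power[of "a i z" m] less_le_trans[of 1 "a i w" "a i z ^ m * a i w"] mult_right_mono[of 1 "a i z ^ m" "a i w"]
      by (simp add: I.mult I.power)
    moreover have "a j (z ^ m * w) < 1"
      using True w(2) power_le_one[of "a j z" m] mult_right_mono[of "a j z ^ m" 1 "a j w"] by (simp add: J.mult J.power)
    ultimately show ?thesis using m by (intro exI[of _ "z ^ m * w"]) auto
  next
    case False
    define u where "u m = z ^ m / (1 + z ^ m)" for m :: nat
    have lim1: "(\<lambda>m. b (u m)) \<longlonglongrightarrow> 1" if b: "absval b" "b z > 1" for b :: "_ \<Rightarrow> real"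
    proof -
      interpret B: absval b by (rule b)
      have "(\<lambda>m. \<bar>b (u m) - b 1\<bar>) \<longlonglongrightarrow> 0"
        unfolding u_def
        by (intro Lim_null_comparison[OF always_eventually approx_one[OF b]] allI)
          (simp only: real_norm_def abs_idempotent B.reverse_triangle)
      then show ?thesis by (simp add: tendsto_rabs_zero_iff LIM_zero_iff)
    qed
    have "eventually (\<lambda>m. \<forall>l\<in>J. a l (u m * w) < 1) sequentially"
    proof (intro eventually_ball_finite[OF insert(1)] ballI)
      fix l assume l: "l \<in> J"
      interpret L: absval "a l" using insert.prems l by auto
      have "(\<lambda>m. a l (u m) * a l w) \<longlonglongrightarrow> 0 * a l w"
        unfolding u_def using z l by (intro tendsto_intros approx_zero) (auto intro: L.absval_axioms)
      then show "eventually (\<lambda>m. a l (u m * w) < 1) sequentially"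
        using order_tendstoD(2)[of "\<lambda>m. a l (u m) * a l w" 0 sequentially 1] by (simp add: L.mult)
    qed
    moreover have "eventually (\<lambda>m. a i (u m * w) > 1) sequentially"
    proof -
      have "(\<lambda>m. a i (u m) * a i w) \<longlonglongrightarrow> 1 * a i w" using z by (intro tendsto_intros lim1 I.absval_axioms)
      then show ?thesis using order_tendstoD(1)[of "\<lambda>m. a i (u m) * a i w" "a i w" sequentially 1] w(1) by (simp add: I.mult)
    qed
    moreover have "eventually (\<lambda>m. a j (u m * w) < 1) sequentially"
    proof -
      have "(\<lambda>m. a j (u m) * a j w) \<longlonglongrightarrow> 1 * a j w" using False by (intro tendsto_intros lim1 J.absval_axioms) auto
      then show ?thesis using order_tendstoD(2)[of "\<lambda>m. a j (u m) * a j w" "a j w" sequentially 1] w(2) by (simp add: J.mult)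
    qed
    ultimately have "eventually (\<lambda>m. a i (u m * w) > 1 \<and> (\<forall>l\<in>insert j J. a l (u m * w) < 1)) sequentially"
      by eventually_elim auto
    from eventually_happens'[OF sequentially_bot this] show ?thesis by blast
  qed
qed

text \<open>The multipliers \<open>u i m\<close> tend to one at \<open>i\<close> and to zero at the
  other indices, so the combination of the targets tends to \<open>x j\<close> at every
  \<open>j\<close>.\<close>

theorem weak_approximation:
  fixes x :: "'i \<Rightarrow> 'k::field" and a :: "'i \<Rightarrow> 'k \<Rightarrow> real"
  assumes I: "finite I" and a: "\<And>i. i \<in> I \<Longrightarrow> absval (a i) \<and> nontrivial_av (a i)"
    and ne: "\<And>i j. i \<in> I \<Longrightarrow> j \<in> I \<Longrightarrow> i \<noteq> j \<Longrightarrow> \<not> equiv_av (a i) (a j)"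
    and \<epsilon>: "\<And>i. i \<in> I \<Longrightarrow> 0 < \<epsilon> i"
  shows "\<exists>y. \<forall>i\<in>I. a i (y - x i) < \<epsilon> i"
proof -
  have "\<exists>z. a i z > 1 \<and> (\<forall>j\<in>I - {i}. a j z < 1)" if "i \<in> I" for i
    by (rule separating_element) (use I a ne that in auto)
  then obtain z where z: "\<And>i. i \<in> I \<Longrightarrow> a i (z i) > 1" "\<And>i j. i \<in> I \<Longrightarrow> j \<in> I \<Longrightarrow> j \<noteq> i \<Longrightarrow> a j (z i) < 1"
    by (metis Diff_iff singletonD)
  define u where "u i m = z i ^ m / (1 + z i ^ m)" for i and m :: nat
  have "eventually (\<lambda>m. a j ((\<Sum>i\<in>I. u i m * x i) - x j) < \<epsilon> j) sequentially" if j: "j \<in> I" for j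
  proof -
    interpret J: absval "a j" using a j by auto
    define v where "v i m = (if i = j then u i m - 1 else u i m)" for i m
    have "(\<lambda>m. a j (v i m)) \<longlonglongrightarrow> 0" if "i \<in> I" for i
    proof (cases "i = j")
      case True
      then show ?thesis unfolding v_def u_def using approx_one[OF J.absval_axioms z(1)[OF j]] by simp
    next
      case False
      then show ?thesis unfolding v_def u_def using approx_zero[OF J.absval_axioms z(2)[OF that j]] by simp
    qed
    then have "(\<lambda>m. \<Sum>i\<in>I. a j (v i m) * a j (x i)) \<longlonglongrightarrow> (\<Sum>i\<in>I. 0 * a j (x i))" by (intro tendsto_intros)
    then have "eventually (\<lambda>m. (\<Sum>i\<in>I. a j (v i m) * a j (x i)) < \<epsilon> j) sequentially"
      using order_tendstoD(2)[of "\<lambda>m. \<Sum>i\<in>I. a j (v i m) * a j (x i)" 0 sequentially "\<epsilon> j"] \<epsilon>[OF j] by simp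
    then show ?thesis
    proof eventually_elim
      case (elim m)
      have "(\<Sum>i\<in>I. u i m * x i) - x j = (\<Sum>i\<in>I. u i m * x i) - (\<Sum>i\<in>I. if i = j then x i else 0)" using I j by simp
      also have "\<dots> = (\<Sum>i\<in>I. v i m * x i)"
        unfolding sum_subtractf[symmetric] v_def by (intro sum.cong) (auto simp: algebra_simps)
      finally have "a j ((\<Sum>i\<in>I. u i m * x i) - x j) \<le> (\<Sum>i\<in>I. a j (v i m) * a j (x i))"
        using J.sum_le[of "\<lambda>i. v i m * x i" I] by (simp add: J.mult)
      then show ?case using elim by linarith
    qed
  qed
  then have "eventually (\<lambda>m. \<forall>j\<in>I. a j ((\<Sum>i\<in>I. u i m * x i) - x j) < \<epsilon> j) sequentially"
    by (simp add: eventually_ball_finite_distrib[OF I])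
  from eventually_happens'[OF sequentially_bot this] show ?thesis by blast
qed

section \<open>The field as a prime model\<close>

text \<open>Zero has value infinity: the first case of \<open>RM\<close> says that infinity absorbs
  every summand, and \<open>RQ\<close> counts infinity as divisible. \<open>RL\<close> uses one
  representative of the place; by \<open>place_le\<close> all of them compare alike.\<close>

definition kmod :: "('k::field fsym, 'k rsym, 'k) struct" where
  "kmod = \<lparr>univ = UNIV,
     fint = (\<lambda>f xs. case f of Plus \<Rightarrow> xs ! 0 + xs ! 1 | Zero \<Rightarrow> 0 | One \<Rightarrow> 1 | Scale c \<Rightarrow> c * xs ! 0),
     rint = (\<lambda>R xs. case R of
        RL p \<Rightarrow> rep p (xs ! 0) \<le> rep p (xs ! 1)
      | RM p \<Rightarrow> if xs ! 0 = 0 \<or> xs ! 1 = 0 then xs ! 2 = 0 else xs ! 2 \<noteq> 0 \<and> pval p (xs ! 2) = pval p (xs ! 0) + pval p (xs ! 1)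
      | RQ p n \<Rightarrow> xs ! 0 = 0 \<or> int n dvd pval p (xs ! 0))\<rparr>"

lemma kmod_simps [simp]:
  "univ kmod = UNIV" "madd kmod x y = x + y" "mzero kmod = 0" "mone kmod = 1" "mscale kmod c x = c * x"
  "mL p kmod x y \<longleftrightarrow> rep p x \<le> rep p y"
  "mM p kmod x y z \<longleftrightarrow> (if x = 0 \<or> y = 0 then z = 0 else z \<noteq> 0 \<and> pval p z = pval p x + pval p y)"
  "mQ p n kmod x \<longleftrightarrow> x = 0 \<or> int n dvd pval p x"
  by (simp_all add: kmod_def numeral_2_eq_2)

lemma kmod_struct: "struct_in (lang_kS S0 S1) kmod"
  unfolding struct_in_def by auto

lemma kmod_vs: "vector_space_struct kmod"
  unfolding vector_space_struct_def by (simp add: algebra_simps)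

lemma msum_kmod: "msum kmod c f n = (\<Sum>j<n. c j * f j)"
  by (induction n) simp_all

lemma rep_finite_place:
  assumes p: "finite_place p" "discrete_place p"
  shows "rep p x \<le> rep p y \<longleftrightarrow> x = 0 \<or> y \<noteq> 0 \<and> pval p y \<le> pval p x"
proof -
  have pl: "p \<in> places" using p unfolding finite_place_def by simp
  obtain a c \<pi> where a: "a \<in> p" "absolute_value a" "(0::real) < c" "c < 1"
    "\<And>x. x \<noteq> 0 \<Longrightarrow> a x = c powi pval p x" by (rule pval_base[OF p]) blast
  interpret absval a by unfold_locales (rule a)
  have "a x \<le> a y \<longleftrightarrow> x = 0 \<or> y \<noteq> 0 \<and> pval p y \<le> pval p x"
  proof (cases "x = 0 \<or> y = 0")
    case True
    then show ?thesis using pos[of x] by (cases "x = 0") (auto simp del: pos)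
  next
    case False
    have "c powi pval p x \<le> c powi pval p y \<longleftrightarrow> pval p y \<le> pval p x"
      using power_int_strict_decreasing[of "pval p x" "pval p y" c] power_int_decreasing[of "pval p y" "pval p x" c] a(3,4)
      by (metis linorder_not_less less_imp_le less_irrefl)
    then show ?thesis using False a(5) by simp
  qed
  then show ?thesis using place_le[OF pl rep(1)[OF pl] a(1)] by simp
qed

lemma kmod_fin_ax:
  fixes p :: "'k::field place"
  assumes p: "finite_place p" "discrete_place p"
  shows "fin_ax p (kmod :: ('k fsym, 'k rsym, 'k) struct)"
proof -
  note pm = pval_mult[OF p] and neg = pval_minus[OF p]
  have quot: "pval p (x / y) = pval p x - pval p y" if "x \<noteq> 0" "y \<noteq> 0" for x y
    using pm[of x "inverse y"] pval_inverse[OF p, of y] that by (simp add: divide_inverse)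
  have ultra: "x + y = 0 \<or> z \<noteq> 0 \<and> pval p z \<le> pval p (x + y)"
    if "x = 0 \<or> z \<noteq> 0 \<and> pval p z \<le> pval p x" "y = 0 \<or> z \<noteq> 0 \<and> pval p z \<le> pval p y" for x y z
    using pval_add[OF p, of x y] that by (cases "x = 0"; cases "y = 0"; cases "x + y = 0") auto
  have fin: "\<exists>w\<in>set ws. \<not> (x = 0 \<or> w * x + y \<noteq> 0 \<and> pval p (w * x + y) \<le> pval p x)"
    if ws: "residue_reps p ws" and xy: "x \<noteq> 0" "y \<noteq> 0" "pval p x = pval p y" for ws x y
  proof -
    \<comment> \<open>A representative \<open>w\<close> congruent to \<open>- (y / x)\<close> makes
      the leading parts of \<open>w * x\<close> and \<open>y\<close> cancel.\<close>
    have u: "- (y / x) \<in> vunits p" unfolding vunits_def using xy quot[of y x] by (simp add: neg)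
    then obtain w where w: "w \<in> set ws" "same_residue p (- (y / x)) w" using ws unfolding residue_reps_def by blast
    have e: "w * x + y = - (x * (- (y / x) - w))" using xy(1) by (simp add: field_simps)
    have "w * x + y = 0 \<or> pval p (w * x + y) > pval p x"
      using w(2) xy(1) unfolding same_residue_def e neg by (cases "- (y / x) = w") (auto simp: pm)
    then show ?thesis using w(1) xy(1) by (intro bexI[of _ w]) auto
  qed
  have inf: "\<exists>w\<in>set ws. \<forall>j\<in>{1..n}. (w * x + y j = 0 \<or> x \<noteq> 0 \<and> pval p x \<le> pval p (w * x + y j)) \<and>
               (x = 0 \<or> w * x + y j \<noteq> 0 \<and> pval p (w * x + y j) \<le> pval p x)"
    if ws: "length ws = Suc n" "distinct_residues p ws" and y: "\<And>j. j \<in> {1..n} \<Longrightarrow> y j = 0 \<or> x \<noteq> 0 \<and> pval p x \<le> pval p (y j)"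
    for ws n x and y :: "nat \<Rightarrow> 'k"
  proof (cases "x = 0")
    case True
    then show ?thesis using y ws(1) by (intro bexI[of _ "ws ! 0"]) auto
  next
    case False
    have unit: "ws ! i \<noteq> 0 \<and> pval p (ws ! i) = 0" if "i < Suc n" for i
      using ws that nth_mem[of i ws] subsetD[of "set ws" "vunits p" "ws ! i"] unfolding distinct_residues_def
      by (simp add: vunits_def)
    \<comment> \<open>Pigeonhole: there are \<open>n + 1\<close> units but only \<open>n\<close>
      indices, and two units bad for the same index would differ by zero or an element of positive
      valuation, against the distinctness of their residues.\<close>
    define bad where "bad i j \<longleftrightarrow> ws ! i * x + y j = 0 \<or> pval p x < pval p (ws ! i * x + y j)" for i j
    have "\<exists>i<Suc n. \<forall>j\<in>{1..n}. \<not> bad i j"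
    proof (rule ccontr)
      assume "\<not> ?thesis"
      then obtain f where f: "\<And>i. i < Suc n \<Longrightarrow> f i \<in> {1..n} \<and> bad i (f i)" by metis
      have "\<not> inj_on f {..<Suc n}"
        using f card_inj_on_le[of f "{..<Suc n}" "{1..n}"] by (metis card_atLeastAtMost card_lessThan
          diff_Suc_1 finite_atLeastAtMost image_subsetI lessThan_iff not_less_eq_eq order_refl)
      then obtain i i' where i: "i < Suc n" "i' < Suc n" "i \<noteq> i'" "f i = f i'" unfolding inj_on_def by auto
      define s where "s = ws ! i * x + y (f i)"
      define t where "t = ws ! i' * x + y (f i)"
      have st: "s = 0 \<or> pval p x < pval p s" "t = 0 \<or> pval p x < pval p t"
        using f[OF i(1)] f[OF i(2)] i(4) unfolding bad_def s_def t_def by auto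
      have d: "(ws ! i - ws ! i') * x = s + - t" unfolding s_def t_def by (simp add: algebra_simps)
      have nd: "ws ! i \<noteq> ws ! i'" "pval p (ws ! i - ws ! i') \<le> 0"
        using ws i unfolding distinct_residues_def same_residue_def by (metis linorder_not_less)+
      then have "s + - t \<noteq> 0" "pval p (s + - t) \<le> pval p x"
        using False pm[of "ws ! i - ws ! i'" x] unfolding d[symmetric] by auto
      then show False
        using st neg[of t] pval_add[OF p, of s "- t"] by (cases "s = 0"; cases "t = 0") auto
    qed
    then obtain i where i: "i < Suc n" "\<forall>j\<in>{1..n}. \<not> bad i j" by blast
    have "ws ! i * x + y j \<noteq> 0 \<and> pval p (ws ! i * x + y j) = pval p x" if j: "j \<in> {1..n}" for j
    proof -
      have nb: "ws ! i * x + y j \<noteq> 0" "pval p (ws ! i * x + y j) \<le> pval p x"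
        using bspec[OF i(2) j] unfolding bad_def by auto
      moreover have "pval p x \<le> pval p (ws ! i * x + y j)"
        using ultra[of "ws ! i * x" x "y j"] y[OF j] unit[OF i(1)] False pm[of "ws ! i" x] nb(1) by auto
      ultimately show ?thesis by simp
    qed
    then show ?thesis using i(1) ws(1) False by (intro bexI[of _ "ws ! i"]) auto
  qed
  show ?thesis
    unfolding fin_ax_def kmod_simps rep_finite_place[OF p]
  proof (intro conjI allI ballI impI, goal_cases)
    case (12 ws x y)
    then show ?case using fin[of ws x y] by auto
  next
    case (13 n ws x y)
    then show ?case using inf[of ws n y x] by blast
  qed (use ultra in \<open>auto simp: kmod_vs pm\<close>)
qed

lemma kmod_plus_ax:
  fixes p :: "'k::field place"
  assumes p: "finite_place p" "discrete_place p"
  shows "plus_ax p (kmod :: ('k fsym, 'k rsym, 'k) struct)"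
proof -
  note pm = pval_mult[OF p] and pp = pval_ppow[OF p] and pu = punif[OF p]
  let ?K = "kmod :: ('k fsym, 'k rsym, 'k) struct"
  have p1: "pval p 1 = 0" by (rule pval_one[OF p])
  have chain: "mchain p ?K n (\<lambda>i. ppow p (d * int i))" for n d
    unfolding mchain_def using pu by (simp add: pp algebra_simps)
  have chain0: "mchain p ?K n (\<lambda>i. 0)" for n unfolding mchain_def by simp
  have chain_val: "if f 1 = 0 then f i = 0 else f i \<noteq> 0 \<and> pval p (f i) = i * pval p (f 1)"
    if "mchain p ?K n f" "1 \<le> i" "i \<le> n" for n i and f :: "nat \<Rightarrow> 'k"
    using that(2,3)
  proof (induction i rule: dec_induct)
    case base
    then show ?case by simp
  next
    case (step i)
    then have "mM p ?K (f i) (f 1) (f (Suc i))" using that(1) unfolding mchain_def by auto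
    then show ?case using step by (auto simp: algebra_simps split: if_splits)
  qed
  show ?thesis
    unfolding plus_ax_def
  proof (intro conjI allI ballI impI, goal_cases)
    case (1 x y)
    then show ?case by (intro bexI[of _ "x * y"]) (auto simp: pm)
  next
    case (7 x)
    then show ?case by (intro bexI[of _ "inverse x"]) (auto simp: pval_inverse[OF p] p1)
  next
    case (10 n \<pi> x)
    show ?case
    proof (cases "x = 0")
      case True
      then show ?thesis using 10 chain0[of n] by (intro exI[of _ "\<lambda>_. 0"]) auto
    next
      case False
      \<comment> \<open>\<open>pval p x - 1\<close> is divided instead of \<open>pval p x\<close>,
        since the axiom takes remainders in \<open>1..n\<close>.\<close>
      define d where "d = (pval p x - 1) div int n"
      define i where "i = nat ((pval p x - 1) mod int n + 1)"
      have r: "0 \<le> (pval p x - 1) mod int n" "(pval p x - 1) mod int n < int n" using 10 by auto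
      then have i: "i \<in> {1..n}" unfolding i_def by auto
      have "pval p x = d * int n + int i"
        unfolding d_def i_def using r div_mult_mod_eq[of "pval p x - 1" "int n"] by linarith
      then have "mM p ?K (ppow p (d * int n)) (mscale ?K (\<pi> ^ i) (mone ?K)) x"
        using 10 False pu by (simp add: pp pval_power[OF p])
      then show ?thesis using chain[of n d] i by blast
    qed
  next
    case (11 n x)
    show ?case
    proof
      assume "mQ p n ?K x"
      then consider "x = 0" | d where "x \<noteq> 0" "pval p x = d * int n" unfolding kmod_simps by (metis dvdE mult.commute)
      then show "\<exists>f. mchain p ?K n f \<and> mL p ?K (f n) x \<and> mL p ?K x (f n)"
      proof cases
        case 1
        then show ?thesis using chain0[of n] by (intro exI[of _ "\<lambda>_. 0"]) auto
      next
        case 2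
        then show ?thesis using chain[of n d] pu
          by (intro exI[of _ "\<lambda>i. ppow p (d * int i)"]) (auto simp: rep_finite_place[OF p] pp)
      qed
    next
      assume "\<exists>f. mchain p ?K n f \<and> mL p ?K (f n) x \<and> mL p ?K x (f n)"
      then obtain f where f: "mchain p ?K n f" "mL p ?K (f n) x" "mL p ?K x (f n)" by blast
      then show "mQ p n ?K x" using chain_val[OF f(1), of n] 11
        by (auto simp: rep_finite_place[OF p] split: if_splits)
    qed
  qed (auto simp: rep_finite_place[OF p] p1 split: if_splits)
qed

text \<open>\<open>place_nonneg\<close> speaks of some embedding, so signs must not depend on the
  choice. They do not: \<open>0 \<le> \<sigma> c\<close> means that \<open>c - 1\<close> is at most
  \<open>c + 1\<close> in absolute value, which the place alone decides.\<close>

lemma rep_real_place: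
  assumes "real_place p"
  obtains \<sigma> :: "'k::field \<Rightarrow> real" where "\<And>x y. rep p x \<le> rep p y \<longleftrightarrow> \<bar>\<sigma> x\<bar> \<le> \<bar>\<sigma> y\<bar>" "\<And>c. place_nonneg p c \<longleftrightarrow> 0 \<le> \<sigma> c"
    "\<sigma> 0 = 0" "\<sigma> 1 = 1" "\<And>x y. \<sigma> (x + y) = \<sigma> x + \<sigma> y" "\<And>x y. \<sigma> (x * y) = \<sigma> x * \<sigma> y" "\<And>x. \<sigma> (- x) = - \<sigma> x"
    "inj \<sigma>"
proof -
  obtain \<sigma> :: "'k \<Rightarrow> real" where \<sigma>: "completion_map p \<sigma>" "\<sigma> 0 = 0" "\<sigma> 1 = 1"
    "\<And>x y. \<sigma> (x + y) = \<sigma> x + \<sigma> y" "\<And>x y. \<sigma> (x * y) = \<sigma> x * \<sigma> y" "\<And>x. \<sigma> (- x) = - \<sigma> x"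
    by (rule real_place_embedding[OF assms]) blast
  have pl: "p \<in> places" using assms unfolding real_place_def infinite_place_def by simp
  have le: "rep p x \<le> rep p y \<longleftrightarrow> \<bar>\<tau> x\<bar> \<le> \<bar>\<tau> y\<bar>" if "completion_map p \<tau>" for \<tau> :: "'k \<Rightarrow> real" and x y
  proof -
    have "(\<lambda>x. \<bar>\<tau> x\<bar>) \<in> p" using that unfolding completion_map_def by simp
    then show ?thesis by (rule place_le[OF pl rep(1)[OF pl]])
  qed
  have sgn: "0 \<le> \<tau> c \<longleftrightarrow> rep p (c + - 1) \<le> rep p (c + 1)" if \<tau>: "completion_map p \<tau>" for \<tau> :: "'k \<Rightarrow> real" and c
  proof -
    have a: "\<tau> 1 = 1" "\<And>x y. \<tau> (x + y) = \<tau> x + \<tau> y" using \<tau> unfolding completion_map_def by auto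
    have "\<tau> 0 = 0" using a(2)[of 0 0] by simp
    then have "\<tau> (- 1) = - 1" using a(2)[of 1 "- 1"] a(1) by simp
    then show ?thesis unfolding le[OF \<tau>] a by (auto simp: abs_if split: if_splits)
  qed
  have nn: "place_nonneg p c \<longleftrightarrow> 0 \<le> \<sigma> c" for c unfolding place_nonneg_def using sgn \<sigma>(1) by metis
  have "inj \<sigma>"
  proof (rule injI)
    fix x y assume "\<sigma> x = \<sigma> y"
    then have z: "\<sigma> (x + - y) = 0" unfolding \<sigma>(4,6) by simp
    show "x = y"
    proof (rule ccontr)
      assume "x \<noteq> y"
      then have "(x + - y) * inverse (x + - y) = 1" by simp
      then show False using \<sigma>(5)[of "x + - y" "inverse (x + - y)"] z \<sigma>(3) by simp
    qed
  qed
  then show ?thesis using that[of \<sigma>] le[OF \<sigma>(1)] nn \<sigma> by blast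
qed

lemma kmod_real:
  fixes p :: "'k::field place"
  assumes p: "real_place p"
  shows "model_T_kreal p (kmod :: ('k fsym, 'k rsym, 'k) struct)"
proof -
  obtain \<sigma> :: "'k \<Rightarrow> real" where \<sigma>: "\<And>x y. rep p x \<le> rep p y \<longleftrightarrow> \<bar>\<sigma> x\<bar> \<le> \<bar>\<sigma> y\<bar>" "\<And>c. place_nonneg p c \<longleftrightarrow> 0 \<le> \<sigma> c"
    "\<sigma> 0 = 0" "\<sigma> 1 = 1" "\<And>x y. \<sigma> (x + y) = \<sigma> x + \<sigma> y" "\<And>x y. \<sigma> (x * y) = \<sigma> x * \<sigma> y" "\<And>x. \<sigma> (- x) = - \<sigma> x"
    "inj \<sigma>" by (rule rep_real_place[OF p]) blast
  have le: "mle p kmod x y \<longleftrightarrow> \<sigma> x \<le> \<sigma> y" for x y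
  proof -
    have "mle p kmod x y \<longleftrightarrow> \<bar>\<sigma> (y + - x + - 1)\<bar> \<le> \<bar>\<sigma> (y + - x + 1)\<bar>"
      unfolding mle_def kmod_simps \<sigma>(1) by simp
    then show ?thesis unfolding \<sigma>(3-7) by (auto simp: abs_if split: if_splits)
  qed
  show ?thesis
    unfolding model_T_kreal_def le
  proof (intro conjI allI ballI impI, goal_cases)
    case (5 x y)
    then show ?case using injD[OF \<sigma>(8)] by simp
  next
    case (10 c x y)
    then show ?case by (simp add: \<sigma> mult_left_mono)
  qed (auto simp: kmod_vs \<sigma>)
qed

text \<open>An affine combination of the solutions \<open>x i\<close> solves the system again. Its
  coefficients come from weak approximation of scalars: \<open>u i\<close> is close to one at place
  \<open>i\<close> and to zero at the others.\<close>

lemma kmod_weak_approx: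
  fixes S0 :: "'k::field place set"
  assumes S0: "S0 \<subseteq> places" and ps: "ps \<noteq> []" "distinct ps" "set ps \<subseteq> S0"
  shows "models kmod {weak_approx ps m n A}"
  unfolding models_weak_approx[OF kmod_struct[of S0 "{}"]]
proof (intro allI impI, goal_cases)
  case (1 b c x)
  define r where "r = length ps"
  \<comment> \<open>Bounds how much the errors of the coefficients \<open>u i\<close> are amplified
    at place \<open>l\<close>; their tolerance is divided by \<open>1 + B l\<close>, where the
    summand one prevents division by zero.\<close>
  define B where "B l = (\<Sum>i\<in>{1..<r}. \<Sum>j<n. rep (ps ! l) (x i j - x 0 j))" for l
  have pl: "ps ! l \<in> places" if "l < r" for l using that ps S0 nth_mem unfolding r_def by blast
  have av: "absval (rep (ps ! l))" if "l < r" for l by (rule rep(2)[OF pl[OF that]])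
  have B0: "0 \<le> B l" if "l < r" for l unfolding B_def by (intro sum_nonneg absval.nonneg[OF av[OF that]])
  have r0: "0 < r" using ps unfolding r_def by simp
  have c0: "0 < rep (ps ! l) (c l)" if "l < r" for l
    using 1(2) that absval.pos[OF av[OF that]] unfolding r_def by auto
  have "\<exists>u. \<forall>l\<in>{..<r}. rep (ps ! l) (u - (if i = l then 1 else 0)) < rep (ps ! l) (c l) / (1 + B l)" for i
  proof (rule weak_approximation)
    fix l l' assume l: "l \<in> {..<r}" "l' \<in> {..<r}" "l \<noteq> l'"
    then have "ps ! l \<noteq> ps ! l'" using ps(2) unfolding r_def by (simp add: nth_eq_iff_index_eq)
    then show "\<not> equiv_av (rep (ps ! l)) (rep (ps ! l'))"
      using places_equiv[of "ps ! l" "ps ! l'"] rep(1) pl l by (metis lessThan_iff)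
  qed (use rep pl c0 B0 in \<open>auto intro!: divide_pos_pos add_pos_nonneg\<close>)
  then obtain u where u: "\<And>i l. l < r \<Longrightarrow> rep (ps ! l) (u i - (if i = l then 1 else 0)) < rep (ps ! l) (c l) / (1 + B l)"
    by (metis lessThan_iff)
  define y where "y j = x 0 j + (\<Sum>i\<in>{1..<r}. u i * (x i j - x 0 j))" for j
  have sol: "(\<Sum>j<n. A h j * x i j) = b h" if "i < r" "h < m" for i h
    using 1(4) that unfolding r_def msum_kmod by simp
  have "msum kmod (A h) y n = b h" if h: "h < m" for h
  proof -
    have "msum kmod (A h) y n = (\<Sum>j<n. A h j * x 0 j) + (\<Sum>j<n. \<Sum>i\<in>{1..<r}. u i * (A h j * x i j - A h j * x 0 j))"
      unfolding msum_kmod y_def by (simp add: sum.distrib[symmetric] sum_distrib_left algebra_simps)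
    also have "(\<Sum>j<n. \<Sum>i\<in>{1..<r}. u i * (A h j * x i j - A h j * x 0 j)) =
        (\<Sum>i\<in>{1..<r}. u i * ((\<Sum>j<n. A h j * x i j) - (\<Sum>j<n. A h j * x 0 j)))"
      by (subst sum.swap) (simp add: sum_distrib_left sum_subtractf right_diff_distrib)
    also have "\<dots> = 0" using sol[OF _ h] r0 by (intro sum.neutral) auto
    finally show ?thesis using sol[OF r0 h] by simp
  qed
  moreover have "rep (ps ! l) (y j - x l j) \<le> rep (ps ! l) (c l)" if l: "l < r" and j: "j < n" for l j
  proof -
    interpret absval "rep (ps ! l)" by (rule av[OF l])
    let ?a = "rep (ps ! l)"
    have "x l j - x 0 j = (\<Sum>i\<in>{1..<r}. (if i = l then 1 else 0) * (x i j - x 0 j))"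
    proof (cases "l = 0")
      case False
      have "(\<Sum>i\<in>{1..<r}. (if i = l then 1 else 0) * (x i j - x 0 j)) = (\<Sum>i\<in>{1..<r}. if i = l then x i j - x 0 j else 0)"
        by (intro sum.cong) auto
      then show ?thesis using False l by simp
    qed simp
    then have "y j - x l j = (\<Sum>i\<in>{1..<r}. u i * (x i j - x 0 j)) - (\<Sum>i\<in>{1..<r}. (if i = l then 1 else 0) * (x i j - x 0 j))"
      unfolding y_def by (simp add: algebra_simps)
    then have "y j - x l j = (\<Sum>i\<in>{1..<r}. (u i - (if i = l then 1 else 0)) * (x i j - x 0 j))"
      unfolding sum_subtractf[symmetric] by (simp only: left_diff_distrib)
    then have "?a (y j - x l j) \<le> (\<Sum>i\<in>{1..<r}. ?a ((u i - (if i = l then 1 else 0)) * (x i j - x 0 j)))"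
      using sum_le by simp
    also have "\<dots> \<le> (\<Sum>i\<in>{1..<r}. ?a (c l) / (1 + B l) * (\<Sum>j<n. ?a (x i j - x 0 j)))"
    proof (intro sum_mono)
      fix i
      have "?a (x i j - x 0 j) \<le> (\<Sum>j<n. ?a (x i j - x 0 j))" using j by (intro member_le_sum) auto
      then show "?a ((u i - (if i = l then 1 else 0)) * (x i j - x 0 j)) \<le> ?a (c l) / (1 + B l) * (\<Sum>j<n. ?a (x i j - x 0 j))"
        unfolding mult using less_imp_le[OF u[OF l, of i]] B0[OF l] by (intro mult_mono) auto
    qed
    also have "\<dots> = ?a (c l) * (B l / (1 + B l))" unfolding B_def sum_distrib_left[symmetric] by simp
    also have "\<dots> \<le> ?a (c l) * 1" using B0[OF l] by (intro mult_left_mono) auto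
    finally show ?thesis by simp
  qed
  ultimately show ?case unfolding r_def by (intro exI[of _ y]) simp
qed

section \<open>The multiples of one in an arbitrary model\<close>

context realplace
begin

lemma le_constants: "rle (mscale M c (mone M)) (mscale M d (mone M)) \<longleftrightarrow> place_nonneg p (d - c)"
proof -
  have "msub M (mscale M d (mone M)) (mscale M c (mone M)) = mscale M (d - c) (mone M)"
    using add_scale[of "mone M" d "- c"] by (simp add: scale_scale)
  then have e: "rle (mscale M c (mone M)) (mscale M d (mone M)) \<longleftrightarrow> rle (mzero M) (mscale M (d - c) (mone M))"
    by (subst le_sub) simp_all
  have "place_nonneg p 0"
    unfolding place_nonneg_def using real_place_embedding[OF rp] by (metis order_refl)
  then show ?thesis
    unfolding e using le_zero_scale[of "mone M" "d - c"] neg_cases[of "mone M"] zero_le_one zero_ne_one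
    by (cases "d - c = 0") (auto simp: le_refl)
qed

text \<open>\<open>L\<close> is determined by the order, and the order on the multiples of one is
  forced by the place, in \<open>M\<close> as in \<open>K\<close>. The function \<open>f\<close>
  lets the field itself take the part of \<open>K\<close>.\<close>

lemma L_constants:
  assumes K: "realplace K p" and one: "\<And>c. mscale K c (mone K) = f c"
  shows "mL p M (mscale M x (mone M)) (mscale M y (mone M)) \<longleftrightarrow> mL p K (f x) (f y)"
proof -
  interpret K: realplace K p by (rule K)
  have zM: "mzero M = mscale M 0 (mone M)" and zK: "mzero K = mscale K 0 (mone K)" by simp_all
  have nM: "mscale M (- 1) (mscale M c (mone M)) = mscale M (- c) (mone M)"
    and nK: "mscale K (- 1) (mscale K c (mone K)) = mscale K (- c) (mone K)" for c
    by (simp_all add: scale_scale K.scale_scale)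
  have "mL p M (mscale M x (mone M)) (mscale M y (mone M)) \<longleftrightarrow> mL p K (mscale K x (mone K)) (mscale K y (mone K))"
    by (subst L_iff, simp, simp, subst K.L_iff, simp, simp) (unfold zM zK nM nK le_constants K.le_constants, rule refl)
  then show ?thesis unfolding one .
qed

end

text \<open>For nonzero \<open>x\<close> and \<open>y\<close>, one multiple of one is
  \<open>x / y\<close> times the other, so a nonzero vector is compared with its own shift, which
  \<open>val_self_shift\<close> decides.\<close>

lemma (in finplace) L_constants:
  "mL p M (mscale M x (mone M)) (mscale M y (mone M)) \<longleftrightarrow> x = 0 \<or> y \<noteq> 0 \<and> pval p y \<le> pval p x"
proof (cases "x = 0 \<or> y = 0")
  case True
  have "mscale M x (mone M) = mzero M" if "mL p M (mscale M x (mone M)) (mzero M)" using L_zeroD that by simp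
  then show ?thesis using True L_zero zero_ne_one scale_eq_zero[of "mone M" x] by auto
next
  case False
  define u where "u = mscale M y (mone M)"
  have u: "u \<in> univ M" "u \<noteq> mzero M" unfolding u_def using False zero_ne_one scale_eq_zero[of "mone M" y] by auto
  have "mscale M x (mone M) = mscale M (x / y) u" unfolding u_def using False by (simp add: scale_scale)
  moreover have "pval p (x / y) = pval p x - pval p y"
    using False pval_mult[OF p, of x "inverse y"] pval_inverse[OF p, of y] by (simp add: divide_inverse)
  ultimately have "val (mscale M x (mone M)) = val (mscale M (ppow p (pval p x - pval p y)) u)"
    using val_scale_pval[of "x / y" u] False u by simp
  then show ?thesis using L_iff[of "mscale M x (mone M)" u] val_self_shift[OF u, of "pval p x - pval p y"] u False
    unfolding u_def[symmetric] by simp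
qed

context finplus
begin

lemma eps_pow_eq: "veps p M [^]\<^bsub>G\<^esub> (m::int) = veps p M [^]\<^bsub>G\<^esub> n \<longleftrightarrow> m = n"
proof -
  interpret G: zgroup G "veps p M" by (rule zgroup_G)
  have "m \<le> n" if e: "veps p M [^]\<^bsub>G\<^esub> m = veps p M [^]\<^bsub>G\<^esub> n" for m n :: int
  proof -
    have "veps p M [^]\<^bsub>G\<^esub> (n - m) = veps p M [^]\<^bsub>G\<^esub> n \<otimes>\<^bsub>G\<^esub> veps p M [^]\<^bsub>G\<^esub> (- m)"
      using G.int_pow_mult[OF veps_carrier, of n "- m"] by simp
    also have "\<dots> = \<one>\<^bsub>G\<^esub>" unfolding e[symmetric] using G.int_pow_mult[OF veps_carrier, of m "- m"] by simp
    finally show ?thesis using G.eps_pow_ge_one[of "n - m"] by simp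
  qed
  from this[of m n] this[of n m] show ?thesis by auto
qed

lemma val_constant: "c \<noteq> 0 \<Longrightarrow> val (mscale M c (mone M)) = veps p M [^]\<^bsub>G\<^esub> pval p c"
proof -
  interpret G: zgroup G "veps p M" by (rule zgroup_G)
  show "c \<noteq> 0 \<Longrightarrow> val (mscale M c (mone M)) = veps p M [^]\<^bsub>G\<^esub> pval p c"
    using val_scale[of "mone M" c] zero_ne_one one_G[symmetric] veps_carrier by simp
qed

lemma mult_constants:
  "mM p M (mscale M x (mone M)) (mscale M y (mone M)) (mscale M z (mone M)) \<longleftrightarrow>
     (if x = 0 \<or> y = 0 then z = 0 else z \<noteq> 0 \<and> pval p z = pval p x + pval p y)"
proof -
  interpret G: zgroup G "veps p M" by (rule zgroup_G)
  have z0: "mscale M z (mone M) = mzero M \<longleftrightarrow> z = 0" for z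
    using scale_eq_zero[of "mone M" z] zero_ne_one by (cases "z = 0") auto
  obtain w where w: "w \<in> univ M" "val (mscale M x (mone M)) \<otimes>\<^bsub>G\<^esub> val (mscale M y (mone M)) = val w"
    "w = mzero M \<longleftrightarrow> x = 0 \<or> y = 0" using mult_ex[of "mscale M x (mone M)" "mscale M y (mone M)"] z0 by auto
  have m: "mM p M (mscale M x (mone M)) (mscale M y (mone M)) (mscale M z (mone M)) \<longleftrightarrow> val w = val (mscale M z (mone M))"
    using mult_iff w(2) by simp
  show ?thesis
  proof (cases "x = 0 \<or> y = 0")
    case True
    then show ?thesis unfolding m using w val_eq_zero[of "mscale M z (mone M)"] z0[of z] by auto
  next
    case False
    then have vw: "val w = veps p M [^]\<^bsub>G\<^esub> (pval p x + pval p y)"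
      using w(2) by (simp add: val_constant G.int_pow_mult veps_carrier)
    show ?thesis
    proof (cases "z = 0")
      case True
      then show ?thesis unfolding m using False w(3) val_eq_zero[OF w(1)] by simp
    next
      case nz: False
      have "veps p M [^]\<^bsub>G\<^esub> (pval p x + pval p y) = veps p M [^]\<^bsub>G\<^esub> pval p z \<longleftrightarrow> pval p x + pval p y = pval p z"
        by (rule eps_pow_eq)
      then show ?thesis unfolding m vw val_constant[OF nz] using False nz by auto
    qed
  qed
qed

lemma Q_constants: "n \<ge> 1 \<Longrightarrow> mQ p n M (mscale M x (mone M)) \<longleftrightarrow> x = 0 \<or> int n dvd pval p x"
proof -
  assume n: "n \<ge> 1"
  interpret G: zgroup G "veps p M" by (rule zgroup_G)
  show ?thesis
    using Q_zero[OF n] Q_iff[OF n, of "mscale M x (mone M)"] val_constant[of x] G.zdvd_eps[of "int n" "pval p x"] n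
      scale_eq_zero[of "mone M" x] zero_ne_one by (cases "x = 0") auto
qed

end

context admissible
begin

lemma kmod_model:
  assumes S0: "S0 \<subseteq> places"
  shows "tmodel S0 S1 (kmod :: ('k fsym, 'k rsym, 'k) struct)"
proof -
  have s: "struct_in lang_k (kmod :: ('k fsym, 'k rsym, 'k) struct)" using kmod_struct[of S0 S1] unfolding struct_in_lang_k .
  have vs: "models (kmod :: ('k fsym, 'k rsym, 'k) struct) T_vs" using models_T_vs[OF s] kmod_vs by simp
  have pl: "models (kmod :: ('k fsym, 'k rsym, 'k) struct) (T_place p)" if "p \<in> S0" for p
    unfolding T_place_def using models_T_real[OF kmod_struct, of p] kmod_real[of p] models_fin_ax[OF s] kmod_fin_ax[of p] nonreal[OF that]
    by auto
  have plus: "models (kmod :: ('k fsym, 'k rsym, 'k) struct) (T_fin_plus p)" if "p \<in> S1" for p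
    using models_plus_ax[OF s] models_fin_ax[OF s] kmod_fin_ax[of p] kmod_plus_ax[of p] nonreal[of p] S1_nonreal[OF that] sub that by auto
  have wa: "models (kmod :: ('k fsym, 'k rsym, 'k) struct) {weak_approx ps m n A | ps m n A. ps \<noteq> [] \<and> distinct ps \<and> set ps \<subseteq> S0}"
    using kmod_weak_approx[OF S0] unfolding models_def by blast
  have Un: "models M (\<Union>p\<in>X. f p) \<longleftrightarrow> (\<forall>p\<in>X. models M (f p))" for M :: "('k fsym, 'k rsym, 'k) struct" and X and f :: "'k place \<Rightarrow> 'k form set"
    unfolding models_def by auto
  have "models (kmod :: ('k fsym, 'k rsym, 'k) struct) (T_kS S0 S1)"
    unfolding T_kS_def models_simps(2) Un using vs pl plus wa by simp
  then show ?thesis unfolding tmodel_def using kmod_struct by simp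
qed

text \<open>The multiples of one form a copy of the field, on which the axioms leave no freedom for
  the symbols. Injectivity rests on \<open>0 \<noteq> 1\<close>, provided by any place of
  \<open>S0\<close>.\<close>

lemma kmod_embeds:
  assumes S0: "S0 \<subseteq> places" "S0 \<noteq> {}" and M: "tmodel S0 S1 M"
  shows "embeds S0 S1 (\<lambda>c. mscale M c (mone M)) kmod M"
proof -
  interpret vspace M by (rule tmodel_vspace[OF M])
  have ne: "mzero M \<noteq> mone M"
  proof -
    obtain p where "p \<in> S0" using S0 by blast
    then show ?thesis using realplace.zero_ne_one[OF tmodel_real[OF M]] finplace.zero_ne_one[OF tmodel_fin[OF M]] by metis
  qed
  have "inj (\<lambda>c. mscale M c (mone M))"
  proof (rule injI)
    fix c d assume "mscale M c (mone M) = mscale M d (mone M)"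
    then have "mscale M (c - d) (mone M) = mzero M"
      using add_scale[of "mone M" c "- d"] scale_scale[of "mone M" "- 1" d] sub_self[of "mscale M d (mone M)"] by simp
    then show "c = d" using scale_eq_zero[of "mone M" "c - d"] ne by auto
  qed
  moreover have "rep p x \<le> rep p y \<longleftrightarrow> mL p M (mscale M x (mone M)) (mscale M y (mone M))" if p: "p \<in> S0" for p x y
  proof (cases "real_place p")
    case True
    have "realplace (kmod :: ('k fsym, 'k rsym, 'k) struct) p"
      using True kmod_real[of p] kmod_vs by unfold_locales auto
    then show ?thesis using realplace.L_constants[OF tmodel_real[OF M p True], of kmod "\<lambda>c. c" x y] by simp
  next
    case False
    show ?thesis
      unfolding finplace.L_constants[OF tmodel_fin[OF M p False]] using rep_finite_place nonreal[OF p False] by blast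
  qed
  moreover have "finplus M p" if "p \<in> S1" for p
    unfolding finplus_def finplus_axioms_def using tmodel_fin[OF M] tmodel_plus[OF M that] S1_nonreal[OF that] sub that by blast
  ultimately show ?thesis
    unfolding embeds_def using finplus.mult_constants[of M] finplus.Q_constants[of M]
    by (auto simp add: add_scale scale_scale)
qed

end

section \<open>Ostrowski's theorem on archimedean absolute values\<close>

text \<open>The monic real polynomial with roots \<open>z\<close> and its conjugate.\<close>

definition quad :: "complex \<Rightarrow> real poly" where
  "quad z = [:(cmod z)\<^sup>2, - 2 * Re z, 1:]"

lemma cmod_diff_real: "(cmod (of_real t - z))\<^sup>2 = t\<^sup>2 - 2 * Re z * t + (cmod z)\<^sup>2"
  unfolding cmod_power2 by (simp add: power2_eq_square algebra_simps)

lemma poly_quad: "poly (quad z) t = (cmod (of_real t - z))\<^sup>2"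
  unfolding quad_def cmod_diff_real by (simp add: algebra_simps power2_eq_square)

lemma poly_linear_mult: "poly ([:- z, 1:] * Q) x = (x - z) * poly Q x" for x z :: "'a::comm_ring_1"
  by (simp add: algebra_simps)

text \<open>Such seminorms arise by evaluating real polynomials at an element of a completion in
  which a real number \<open>r\<close> has absolute value \<open>\<bar>r\<bar> powr s\<close>. Norm
  zero of some \<open>quad z\<close> is then a quadratic equation over the reals: this is the
  content of the Gelfand-Mazur theorem.\<close>

locale polynorm =
  fixes \<nu> :: "real poly \<Rightarrow> real" and s :: real
  assumes s: "0 < s" and nonneg: "0 \<le> \<nu> P" and mult: "\<nu> (P * Q) = \<nu> P * \<nu> Q"
    and triangle: "\<nu> (P + Q) \<le> \<nu> P + \<nu> Q" and const: "\<nu> [:r:] = \<bar>r\<bar> powr s"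
begin

lemma power: "\<nu> (P ^ n) = \<nu> P ^ n"
proof (induction n)
  case 0
  then show ?case using const[of 1] by (simp add: one_pCons)
qed (simp add: mult)

lemma triangle_diff: "\<nu> P \<le> \<nu> Q + \<nu> (P - Q)"
  using triangle[of Q "P - Q"] by simp

lemma linear: "\<nu> [:a, b:] \<le> \<bar>a\<bar> powr s + \<bar>b\<bar> powr s * \<nu> [:0, 1:]"
proof -
  have "[:a, b:] = [:a:] + [:b:] * [:0, 1:]" by simp
  then show ?thesis using triangle[of "[:a:]" "[:b:] * [:0, 1:]"] by (simp only: mult const)
qed

text \<open>Two polynomials \<open>quad\<close> differ by one of degree at most one whose
  coefficients are small when the roots are close, so \<open>linear\<close> bounds the difference of
  the norms.\<close>

lemma continuous_quad: "continuous_on A (\<lambda>z. \<nu> (quad z))"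
proof -
  have "((\<lambda>w. \<nu> (quad w)) \<longlongrightarrow> \<nu> (quad z)) (at z within A)" for z
  proof -
    define g where "g w = \<bar>(cmod w)\<^sup>2 - (cmod z)\<^sup>2\<bar> powr s + \<bar>- 2 * (Re w - Re z)\<bar> powr s * \<nu> [:0, 1:]" for w
    have "(g \<longlongrightarrow> \<bar>(cmod z)\<^sup>2 - (cmod z)\<^sup>2\<bar> powr s + \<bar>- 2 * (Re z - Re z)\<bar> powr s * \<nu> [:0, 1:]) (at z within A)"
      unfolding g_def by (intro tendsto_intros tendsto_powr') (use s in auto)
    then have lim: "(g \<longlongrightarrow> 0) (at z within A)" by simp
    have "\<bar>\<nu> (quad w) - \<nu> (quad z)\<bar> \<le> g w" for w
    proof -
      have "quad w - quad z = [:(cmod w)\<^sup>2 - (cmod z)\<^sup>2, - 2 * (Re w - Re z):]" unfolding quad_def by simp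
      moreover have "quad z - quad w = [:- ((cmod w)\<^sup>2 - (cmod z)\<^sup>2), - (- 2 * (Re w - Re z)):]" unfolding quad_def by simp
      ultimately have "\<nu> (quad w - quad z) \<le> g w" "\<nu> (quad z - quad w) \<le> g w"
        using linear[of "(cmod w)\<^sup>2 - (cmod z)\<^sup>2" "- 2 * (Re w - Re z)"]
          linear[of "- ((cmod w)\<^sup>2 - (cmod z)\<^sup>2)" "- (- 2 * (Re w - Re z))"] unfolding g_def abs_minus_cancel by simp_all
      then show ?thesis using triangle_diff[of "quad w" "quad z"] triangle_diff[of "quad z" "quad w"] by linarith
    qed
    then have "((\<lambda>w. \<nu> (quad w) - \<nu> (quad z)) \<longlongrightarrow> 0) (at z within A)"
      by (intro Lim_null_comparison[OF _ lim]) simp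
    then show ?thesis by (rule LIM_zero_cancel)
  qed
  then show ?thesis unfolding continuous_on_def by blast
qed

text \<open>Solving \<open>quad z\<close> for its constant coefficient bounds the norm
  \<open>t * t\<close> of the latter, where \<open>t = cmod z powr s\<close>, by
  \<open>\<nu> (quad z)\<close> plus a term linear in \<open>t\<close> and a constant. Hence
  \<open>\<nu> (quad z)\<close> grows with \<open>t\<close>, and \<open>T\<close> is where it has
  passed \<open>\<nu> (quad 0)\<close>.\<close>

lemma coercive:
  obtains \<rho> where "0 \<le> \<rho>" "\<And>z. \<rho> \<le> cmod z \<Longrightarrow> \<nu> (quad 0) < \<nu> (quad z)"
proof -
  define c where "c = \<nu> [:0, 1:]"
  define T where "T = 2 powr s * c + c\<^sup>2 + \<nu> (quad 0) + 1"
  have c0: "0 \<le> c" unfolding c_def by (rule nonneg)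
  have T1: "1 \<le> T" unfolding T_def using c0 nonneg by simp
  have "\<nu> (quad 0) < \<nu> (quad z)" if z: "T powr (1 / s) \<le> cmod z" for z
  proof -
    define t where "t = cmod z powr s"
    have "T = (T powr (1 / s)) powr s" using T1 s by (simp add: powr_powr)
    also have "\<dots> \<le> t" unfolding t_def using z s by (intro powr_mono2) auto
    finally have t: "T \<le> t" .
    have e: "[:(cmod z)\<^sup>2:] = quad z + ([:2 * Re z:] * [:0, 1:] + [:- 1:] * ([:0, 1:] * [:0, 1:]))"
      unfolding quad_def by simp
    have "\<nu> [:(cmod z)\<^sup>2:] \<le> \<nu> (quad z) + \<nu> ([:2 * Re z:] * [:0, 1:] + [:- 1:] * ([:0, 1:] * [:0, 1:]))"
      by (subst e) (rule triangle)
    also have "\<nu> ([:2 * Re z:] * [:0, 1:] + [:- 1:] * ([:0, 1:] * [:0, 1:])) \<le> \<nu> ([:2 * Re z:] * [:0, 1:]) + \<nu> ([:- 1:] * ([:0, 1:] * [:0, 1:]))"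
      by (rule triangle)
    also have "\<dots> = \<bar>2 * Re z\<bar> powr s * c + c\<^sup>2"
      unfolding mult const c_def by (simp add: power2_eq_square)
    also have "\<bar>2 * Re z\<bar> powr s * c \<le> (2 * cmod z) powr s * c"
      using c0 s abs_Re_le_cmod[of z] by (intro mult_right_mono powr_mono2) auto
    also have "(2 * cmod z) powr s * c = t * (2 powr s * c)" unfolding t_def by (simp add: powr_mult)
    finally have "\<nu> [:(cmod z)\<^sup>2:] \<le> \<nu> (quad z) + (t * (2 powr s * c) + c\<^sup>2)" by simp
    moreover have "\<nu> [:(cmod z)\<^sup>2:] = t * t"
      unfolding const t_def by (simp add: power2_eq_square powr_mult)
    ultimately have 1: "t * (t - 2 powr s * c) \<le> \<nu> (quad z) + c\<^sup>2" by (simp add: algebra_simps)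
    have 2: "c\<^sup>2 + \<nu> (quad 0) + 1 \<le> t - 2 powr s * c" using t unfolding T_def by simp
    moreover have "0 \<le> t - 2 powr s * c" using 2 nonneg[of "quad 0"] by (smt (verit) zero_le_power2)
    ultimately have "1 * (t - 2 powr s * c) \<le> t * (t - 2 powr s * c)"
      using t T1 by (intro mult_right_mono) auto
    then have "t - 2 powr s * c \<le> \<nu> (quad z) + c\<^sup>2" using 1 by simp
    then show ?thesis using 2 by linarith
  qed
  then show ?thesis using that[of "T powr (1 / s)"] by simp
qed

text \<open>\<open>H\<close> is the product of \<open>Q\<close> and its conjugate, described by its
  values on the real line instead of by conjugating coefficients. Each linear factor of
  \<open>Q\<close> contributes some \<open>quad z\<close>, whose norm is at least
  \<open>m\<close>.\<close>

lemma factor_bound: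
  assumes m: "0 \<le> m" "\<And>z. m \<le> \<nu> (quad z)"
  shows "lead_coeff Q = 1 \<Longrightarrow> \<exists>H. (\<forall>t. poly H t = (cmod (poly Q (of_real t)))\<^sup>2) \<and> m ^ degree Q \<le> \<nu> H"
proof (induction "degree Q" arbitrary: Q)
  case 0
  then obtain c where c: "Q = [:c:]" by (metis degree_eq_zeroE)
  then have "c = 1" using 0 by simp
  then show ?case using c power[of 1 0] by (intro exI[of _ 1]) simp
next
  case (Suc d)
  then have "\<not> constant (poly Q)" by (simp add: constant_degree)
  then obtain z where "poly Q z = 0" using fundamental_theorem_of_algebra by blast
  then obtain Q' where Q': "Q = [:- z, 1:] * Q'" unfolding poly_eq_0_iff_dvd by (rule dvdE)
  have Q'0: "Q' \<noteq> 0" using Q' Suc(2) by auto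
  have lc: "lead_coeff Q' = 1" using Suc(3) unfolding Q' lead_coeff_mult by simp
  have dg: "degree Q = Suc (degree Q')" unfolding Q' using Q'0 by (subst degree_mult_eq) auto
  then obtain H where H: "\<And>t. poly H t = (cmod (poly Q' (of_real t)))\<^sup>2" "m ^ degree Q' \<le> \<nu> H"
    using Suc(1)[of Q'] Suc(2) lc by auto
  have "poly (quad z * H) t = (cmod (poly Q (of_real t)))\<^sup>2" for t
    unfolding Q' poly_linear_mult by (simp add: H(1) poly_quad norm_mult power_mult_distrib)
  moreover have "m ^ degree Q \<le> \<nu> (quad z * H)"
    unfolding dg mult power_Suc using H(2) m nonneg by (intro mult_mono) auto
  ultimately show ?case by blast
qed

text \<open>A minimum exists by coercivity and continuity, and the minimum points form a compact
  set. One of largest modulus makes the minimum strict for all larger moduli, and this strictness is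
  what \<open>ex_quad_zero\<close> contradicts.\<close>

lemma extremal_point:
  obtains z0 where "\<And>z. \<nu> (quad z0) \<le> \<nu> (quad z)" "\<And>z. cmod z0 < cmod z \<Longrightarrow> \<nu> (quad z0) < \<nu> (quad z)"
proof -
  obtain \<rho> where \<rho>: "0 \<le> \<rho>" "\<And>z. \<rho> \<le> cmod z \<Longrightarrow> \<nu> (quad 0) < \<nu> (quad z)" by (rule coercive) blast
  obtain w where w: "w \<in> cball 0 \<rho>" "\<And>z. z \<in> cball 0 \<rho> \<Longrightarrow> \<nu> (quad w) \<le> \<nu> (quad z)"
    using continuous_attains_inf[OF compact_cball _ continuous_quad[of "cball 0 \<rho>"]] \<rho>(1) by auto
  have min: "\<nu> (quad w) \<le> \<nu> (quad z)" for z
    using w(2)[of z] w(2)[of 0] \<rho>(1) \<rho>(2)[of z] by (cases "cmod z \<le> \<rho>") auto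
  have ball: "cmod z \<le> \<rho>" if "\<nu> (quad z) = \<nu> (quad w)" for z
    using \<rho>(2)[of z] min[of 0] that by (cases "cmod z \<le> \<rho>") auto
  define S where "S = {z \<in> cball 0 \<rho>. \<nu> (quad z) = \<nu> (quad w)}"
  have "closed S" unfolding S_def
    by (rule continuous_closed_preimage_constant[OF continuous_quad closed_cball])
  then have "compact S" using compact_Int_closed[OF compact_cball[of 0 \<rho>], of S] unfolding S_def
    by (metis (no_types, lifting) Int_absorb1 mem_Collect_eq subsetI)
  moreover have "S \<noteq> {}" unfolding S_def using w by auto
  ultimately obtain z0 where z0: "z0 \<in> S" "\<And>z. z \<in> S \<Longrightarrow> cmod z \<le> cmod z0"
    using continuous_attains_sup[of S cmod] continuous_on_norm[OF continuous_on_id] by blast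
  show ?thesis
  proof (rule that)
    show "\<nu> (quad z0) \<le> \<nu> (quad z)" for z using min[of z] z0(1) unfolding S_def by simp
    show "\<nu> (quad z0) < \<nu> (quad z)" if "cmod z0 < cmod z" for z
    proof (rule ccontr)
      assume "\<not> ?thesis"
      then have "\<nu> (quad z) = \<nu> (quad w)" using min[of z] z0(1) unfolding S_def by simp
      then have "z \<in> S" using ball[of z] unfolding S_def by simp
      then show False using z0(2)[of z] that by simp
    qed
  qed
qed

text \<open>If the minimum \<open>m\<close> of \<open>\<nu> (quad z)\<close> were positive, take a minimum point \<open>z0\<close> of largest modulus and
\<open>z1\<close> with \<open>quad z0 (z1) = - \<epsilon>\<close>. As \<open>z1\<close> is a root of \<open>(quad z0)^n - (- \<epsilon>)^n\<close>, splitting off the factor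
\<open>quad z1\<close> of the square of this polynomial bounds \<open>\<nu> (quad z1)\<close> by \<open>m\<close> in the limit.\<close>

theorem ex_quad_zero: "\<exists>z. \<nu> (quad z) = 0"
proof (rule ccontr)
  assume no: "\<not> ?thesis"
  obtain z0 where z0: "\<And>z. \<nu> (quad z0) \<le> \<nu> (quad z)" "\<And>z. cmod z0 < cmod z \<Longrightarrow> \<nu> (quad z0) < \<nu> (quad z)"
    by (rule extremal_point) blast
  define m where "m = \<nu> (quad z0)"
  have m: "0 < m" using no nonneg[of "quad z0"] unfolding m_def by (metis order_le_less)
  \<comment> \<open>Chosen so that the constant \<open>\<epsilon>\<close> has norm
    \<open>m / 2\<close>, strictly below the minimum: its powers become negligible against those of
    \<open>m\<close>.\<close>
  define \<epsilon> where "\<epsilon> = (m / 2) powr (1 / s)"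
  have \<epsilon>: "0 < \<epsilon>" "\<epsilon> powr s = m / 2" unfolding \<epsilon>_def using m s by (simp_all add: powr_powr)
  define z1 where "z1 = Complex (Re z0) (sqrt ((Im z0)\<^sup>2 + \<epsilon>))"
  have "(cmod z1)\<^sup>2 = (cmod z0)\<^sup>2 + \<epsilon>" unfolding z1_def cmod_power2 using \<epsilon> by simp
  then have "(cmod z0)\<^sup>2 < (cmod z1)\<^sup>2" using \<epsilon> by simp
  then have "cmod z0 < cmod z1" by (rule power_less_imp_less_base) simp
  then have lt: "m < \<nu> (quad z1)" unfolding m_def by (rule z0(2))
  define q where "q = [:of_real ((cmod z0)\<^sup>2), of_real (- 2 * Re z0), 1 :: complex:]"
  have q_real: "poly q (of_real t) = of_real (poly (quad z0) t)" for t unfolding q_def quad_def by simp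
  have qz1: "poly q z1 = of_real (- \<epsilon>)"
    unfolding q_def z1_def complex_eq_iff cmod_power2 using \<epsilon> by (simp add: power2_eq_square algebra_simps)
  \<comment> \<open>\<open>GC\<close> has \<open>2 * n\<close> complex roots. Removing
    \<open>z1\<close> leaves \<open>2 * n - 1\<close> of them, and each contributes a factor of at
    least \<open>m\<close> to the norm of \<open>H\<close>.\<close>
  have bound: "\<nu> (quad z1) * m ^ (2 * n - 1) \<le> (m ^ n + (m / 2) ^ n)\<^sup>2" if n: "1 \<le> n" for n
  proof -
    define c where "c = - ((- \<epsilon>) ^ n)"
    define G where "G = quad z0 ^ n + [:c:]"
    define GC where "GC = q ^ n + [:complex_of_real c:]"
    have dq: "degree q = 2" "lead_coeff q = 1" unfolding q_def by simp_all
    have dqn: "degree (q ^ n) = 2 * n" using dq n by (subst degree_power_eq) auto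
    have dG: "degree GC = 2 * n" unfolding GC_def using dqn n by (subst degree_add_eq_left) auto
    have "Polynomial.coeff (q ^ n) (2 * n) = 1" using lead_coeff_power[of q n] dqn dq by simp
    then have lG: "lead_coeff GC = 1" unfolding dG using n unfolding GC_def by (cases n) auto
    have "poly GC z1 = 0" unfolding GC_def c_def by (simp add: qz1)
    then obtain Q where Q: "GC = [:- z1, 1:] * Q" unfolding poly_eq_0_iff_dvd by (rule dvdE)
    have "lead_coeff Q = 1" using lG unfolding Q lead_coeff_mult by simp
    moreover have "Q \<noteq> 0" using calculation by auto
    moreover have "degree Q = 2 * n - 1" using dG \<open>Q \<noteq> 0\<close> unfolding Q by (subst (asm) degree_mult_eq) auto
    ultimately obtain H where H: "\<And>t. poly H t = (cmod (poly Q (of_real t)))\<^sup>2" "m ^ (2 * n - 1) \<le> \<nu> H"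
      using factor_bound[of m Q] m z0(1) unfolding m_def[symmetric] by auto
    have "poly (quad z1 * H) t = poly (G * G) t" for t
    proof -
      have "poly (quad z1 * H) t = (cmod (poly GC (of_real t)))\<^sup>2"
        unfolding Q poly_linear_mult by (simp add: H(1) poly_quad norm_mult power_mult_distrib)
      also have "poly GC (of_real t) = of_real (poly G t)" unfolding GC_def G_def by (simp add: q_real)
      finally show ?thesis by (simp add: power2_eq_square)
    qed
    then have "quad z1 * H = G * G" by (metis poly_eq_poly_eq_iff ext)
    then have "\<nu> (quad z1) * \<nu> H = (\<nu> G)\<^sup>2" by (metis mult power2_eq_square)
    moreover have "\<nu> (quad z1) * m ^ (2 * n - 1) \<le> \<nu> (quad z1) * \<nu> H" using H(2) nonneg by (intro mult_left_mono) auto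
    moreover have "\<nu> G \<le> m ^ n + (m / 2) ^ n"
    proof -
      have "\<bar>c\<bar> powr s = (m / 2) ^ n"
        using \<epsilon> unfolding c_def abs_minus_cancel power_abs \<epsilon>(2)[symmetric]
        by (simp add: powr_realpow[symmetric] powr_powr mult.commute)
      then show ?thesis using triangle[of "quad z0 ^ n" "[:c:]"] unfolding G_def power const m_def by simp
    qed
    ultimately show ?thesis using power_mono[OF _ nonneg, of G _ 2] by fastforce
  qed
  have "\<nu> (quad z1) / m \<le> (1 + (1 / 2) ^ n)\<^sup>2" if n: "1 \<le> n" for n
  proof -
    have "(m / 2) ^ n = m ^ n * (1 / 2) ^ n" unfolding power_mult_distrib[symmetric] by simp
    then have "m ^ n + (m / 2) ^ n = m ^ n * (1 + (1 / 2) ^ n)" by (simp only: distrib_left mult_1_right)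
    then have "(m ^ n + (m / 2) ^ n)\<^sup>2 = m ^ (2 * n) * (1 + (1 / 2) ^ n)\<^sup>2"
      by (simp only: power_mult_distrib power_mult[symmetric] mult.commute)
    moreover have "m ^ (2 * n) = m * m ^ (2 * n - 1)" using n by (cases n) auto
    ultimately have "m ^ (2 * n - 1) * \<nu> (quad z1) \<le> m ^ (2 * n - 1) * (m * (1 + (1 / 2) ^ n)\<^sup>2)"
      using bound[OF n] by (simp add: mult_ac)
    then have "\<nu> (quad z1) \<le> m * (1 + (1 / 2) ^ n)\<^sup>2" using m by simp
    then show ?thesis using m by (simp add: field_simps)
  qed
  moreover have "(\<lambda>n. (1 + (1 / 2 :: real) ^ n)\<^sup>2) \<longlonglongrightarrow> (1 + 0)\<^sup>2"
    by (intro tendsto_intros LIMSEQ_realpow_zero) auto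
  ultimately have "\<nu> (quad z1) / m \<le> (1 + 0)\<^sup>2"
    by (intro LIMSEQ_le_const) auto
  then show False using lt m by (simp add: field_simps)
qed

end

text \<open>Exponential growth beats linear growth. Applied to all powers of an element, this
  removes the constants that estimates of sums bring in.\<close>

lemma le_one_of_power_le_linear:
  fixes x :: real
  assumes "\<And>n::nat. x ^ n \<le> real n * c + d"
  shows "x \<le> 1"
proof (rule ccontr)
  assume "\<not> ?thesis"
  then have x: "1 < x" by simp
  then have y: "norm (1 / x) < 1" by (simp add: field_simps)
  have "(\<lambda>n. real n * (1 / x) ^ n * c + (1 / x) ^ n * d) \<longlonglongrightarrow> 0 * c + 0 * d"
    by (intro tendsto_intros powser_times_n_limit_0[OF y, unfolded of_real_eq_id id_apply] LIMSEQ_power_zero[OF y])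
  moreover have "1 \<le> real n * (1 / x) ^ n * c + (1 / x) ^ n * d" for n
  proof -
    have "(1 / x) ^ n * x ^ n \<le> (1 / x) ^ n * (real n * c + d)" using x assms[of n] by (intro mult_left_mono) auto
    then show ?thesis using x by (simp add: power_mult_distrib[symmetric] algebra_simps)
  qed
  ultimately have "1 \<le> 0 * c + 0 * d" by (intro LIMSEQ_le_const) auto
  then show False by simp
qed

section \<open>Absolute values of natural numbers, bounded or a power of the usual one\<close>

context absval
begin

lemma of_nat_le: "a (of_nat n) \<le> real n"
proof (induction n)
  case (Suc n)
  then show ?case using triangle[of 1 "of_nat n"] by simp
qed simp

text \<open>Expansion of \<open>m\<close> in base \<open>n\<close>: at most \<open>k\<close> digits,
  each of absolute value at most \<open>n\<close>, while \<open>max 1 (a (of_nat n))\<close>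
  controls the powers of \<open>n\<close>.\<close>

lemma digits_bound:
  assumes "2 \<le> n" "m < n ^ k"
  shows "a (of_nat m) \<le> real k * real n * max 1 (a (of_nat n)) ^ k"
  using assms(2)
proof (induction k arbitrary: m)
  case (Suc k)
  define A where "A = max 1 (a (of_nat n))"
  have A: "1 \<le> A" "a (of_nat n) \<le> A" unfolding A_def by auto
  have "m div n < n ^ k" using Suc(2) assms(1) by (simp add: less_mult_imp_div_less mult.commute)
  from Suc(1)[OF this] have q: "a (of_nat (m div n)) \<le> real k * real n * A ^ k" unfolding A_def .
  have "m mod n \<le> n" using assms(1) by (intro less_imp_le mod_less_divisor) simp
  then have d: "a (of_nat (m mod n)) \<le> real n" using of_nat_le[of "m mod n"] by simp
  have "(of_nat m :: 'k) = of_nat n * of_nat (m div n) + of_nat (m mod n)"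
    unfolding of_nat_mult[symmetric] of_nat_add[symmetric] by simp
  then have "a (of_nat m) \<le> a (of_nat n) * a (of_nat (m div n)) + a (of_nat (m mod n))"
    using triangle[of "of_nat n * of_nat (m div n)" "of_nat (m mod n)"] by (simp only: mult)
  also have "\<dots> \<le> A * (real k * real n * A ^ k) + real n * A ^ Suc k"
  proof (intro add_mono mult_mono)
    show "a (of_nat (m mod n)) \<le> real n * A ^ Suc k"
      using d mult_left_mono[OF one_le_power[OF A(1), of "Suc k"], of "real n"] by simp
  qed (use A q in auto)
  also have "\<dots> = real (Suc k) * real n * A ^ Suc k" by (simp add: algebra_simps)
  finally show ?case unfolding A_def .
qed simp

text \<open>\<open>digits_bound\<close> is applied to \<open>m ^ N\<close>, which has about
  \<open>N * ln m / ln n\<close> digits in base \<open>n\<close>; the factor linear in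
  \<open>N\<close> disappears by \<open>le_one_of_power_le_linear\<close>.\<close>

lemma of_nat_compare:
  assumes n: "2 \<le> n" and m: "1 \<le> m"
  shows "a (of_nat m) \<le> max 1 (a (of_nat n)) powr (ln m / ln n)"
proof -
  define A where "A = max 1 (a (of_nat n))"
  define c where "c = ln (real m) / ln (real n)"
  have A: "1 \<le> A" unfolding A_def by simp
  have ln: "0 < ln (real n)" "0 \<le> ln (real m)" using n m by (auto intro: ln_ge_zero)
  then have c: "0 \<le> c" "c * ln n = ln m" unfolding c_def by auto
  have "(a (of_nat m) / A powr c) ^ N \<le> real N * (c * n * A) + n * A" for N
  proof -
    define k where "k = nat \<lfloor>N * c\<rfloor> + 1"
    have k: "N * c < k" "k \<le> N * c + 1" unfolding k_def using c by (auto simp: of_nat_nat, linarith+)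
    have "ln (real m ^ N) < ln (real n ^ k)"
      using mult_strict_right_mono[OF k(1) ln(1)] c(2) n m by (simp add: ln_realpow mult.assoc)
    then have "real m ^ N < real n ^ k" using n m by (simp add: ln_less_cancel_iff)
    then have "m ^ N < n ^ k" by (metis of_nat_less_iff of_nat_power)
    then have "a (of_nat (m ^ N)) \<le> real k * real n * A ^ k" unfolding A_def by (rule digits_bound[OF n])
    also have "A ^ k = A powr k" using A by (simp add: powr_realpow)
    also have "real k * real n * A powr k \<le> (N * c + 1) * n * A powr (N * c + 1)"
      using A k(2) by (intro mult_mono powr_mono) (use c in auto)
    also have "A powr (N * c + 1) = (A powr c) ^ N * A"
      using A by (simp add: powr_add powr_power mult.commute)
    finally have "a (of_nat m) ^ N \<le> (N * c + 1) * n * ((A powr c) ^ N * A)" by (simp add: power)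
    then show ?thesis using A by (simp add: power_divide field_simps)
  qed
  then have "a (of_nat m) / A powr c \<le> 1" by (rule le_one_of_power_le_linear)
  then show ?thesis unfolding A_def[symmetric] c_def[symmetric] using A by (simp add: field_simps)
qed

text \<open>The binomial expansion of \<open>(x + y) ^ N\<close> has \<open>N + 1\<close> terms,
  each at most the power \<open>N\<close> of the maximum, and the factor \<open>N + 1\<close> is
  only linear.\<close>

lemma ultrametric_if_bounded:
  assumes "\<And>n. a (of_nat n) \<le> 1"
  shows "ultrametric_av a"
  unfolding ultrametric_av_def
proof (intro allI)
  fix x y
  define m where "m = max (a x) (a y)"
  have m0: "0 \<le> m" unfolding m_def by (simp add: le_max_iff_disj)
  show "a (x + y) \<le> max (a x) (a y)"
  proof (cases "m = 0")
    case True
    then have "a x = 0" "a y = 0" unfolding m_def using nonneg[of x] nonneg[of y] by linarith+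
    then show ?thesis by simp
  next
    case False
    then have m: "0 < m" using m0 by simp
    have "(a (x + y) / m) ^ N \<le> real N * 1 + 1" for N
    proof -
      have "a ((x + y) ^ N) \<le> (\<Sum>k\<le>N. a (of_nat (N choose k) * x ^ k * y ^ (N - k)))"
        unfolding binomial_ring by (rule sum_le)
      also have "\<dots> \<le> (\<Sum>k\<le>N. m ^ N)"
      proof (rule sum_mono)
        fix k assume k: "k \<in> {..N}"
        have "a (of_nat (N choose k) * x ^ k * y ^ (N - k)) \<le> 1 * m ^ k * m ^ (N - k)"
          unfolding mult power using assms m0 unfolding m_def by (intro mult_mono power_mono) auto
        also have "\<dots> = m ^ N" using k by (simp add: power_add[symmetric])
        finally show "a (of_nat (N choose k) * x ^ k * y ^ (N - k)) \<le> m ^ N" .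
      qed
      finally have "a (x + y) ^ N \<le> (real N * 1 + 1) * m ^ N" by (simp add: power algebra_simps)
      then show ?thesis using m by (simp add: power_divide pos_divide_le_eq)
    qed
    then have "a (x + y) / m \<le> 1" by (rule le_one_of_power_le_linear)
    then show ?thesis using m unfolding m_def by (simp add: pos_divide_le_eq)
  qed
qed

text \<open>If one natural number has absolute value above one, \<open>of_nat_compare\<close> forces
  this for all \<open>n \<ge> 2\<close>. Used in both directions, it then shows that
  \<open>ln (a (of_nat n)) / ln n\<close> does not depend on \<open>n\<close>; \<open>s\<close> is
  its value at two.\<close>

lemma archimedean_of_nat:
  assumes "\<not> ultrametric_av a"
  obtains s where "0 < s" "\<And>n. a (of_nat n) = real n powr s"
proof -
  obtain m where m: "1 < a (of_nat m)" using assms ultrametric_if_bounded by (meson not_le)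
  then have m1: "1 \<le> m" by (cases m) auto
  have gt: "1 < a (of_nat n)" if n: "2 \<le> n" for n
  proof (rule ccontr)
    assume "\<not> ?thesis"
    then have "max 1 (a (of_nat n)) = 1" by simp
    then show False using of_nat_compare[OF n m1] m by simp
  qed
  have le: "ln (a (of_nat m)) / ln m \<le> ln (a (of_nat n)) / ln n" if mn: "2 \<le> m" "2 \<le> n" for m n
  proof -
    have ln: "0 < ln (real m)" "0 < ln (real n)" using mn by auto
    have "a (of_nat m) \<le> a (of_nat n) powr (ln m / ln n)"
      using of_nat_compare[of n m] mn gt[OF mn(2)] by (simp add: max_def split: if_splits)
    then have "ln (a (of_nat m)) \<le> ln (a (of_nat n) powr (ln m / ln n))"
      using gt[OF mn(1)] gt[OF mn(2)] by (subst ln_le_cancel_iff) auto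
    then show ?thesis using ln gt[OF mn(2)] by (simp add: ln_powr field_simps)
  qed
  define s where "s = ln (a (of_nat 2)) / ln 2"
  have s: "0 < s" unfolding s_def using gt[of 2] by (intro divide_pos_pos ln_gt_zero) auto
  have "a (of_nat n) = real n powr s" for n
  proof (cases "2 \<le> n")
    case True
    have "ln (a (of_nat n)) / ln n = s" unfolding s_def using le[OF True, of 2] le[of 2 n] True by auto
    then have "ln (a (of_nat n)) = s * ln n" using True by (auto simp: field_simps)
    then have "exp (ln (a (of_nat n))) = real n powr s" using True by (simp add: powr_def)
    moreover have "0 < a (of_nat n)" using gt[OF True] by linarith
    ultimately show ?thesis by (simp only: exp_ln)
  next
    case False
    then have "n = 0 \<or> n = 1" by auto
    then show ?thesis by auto
  qed
  then show ?thesis using that s by blast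
qed

section \<open>Cauchy sequences in place of the completion\<close>

definition cau :: "(nat \<Rightarrow> 'k) \<Rightarrow> bool" where
  "cau X \<longleftrightarrow> (\<forall>e>0. \<exists>N. \<forall>m\<ge>N. \<forall>n\<ge>N. a (X m - X n) < e)"

definition nul :: "(nat \<Rightarrow> 'k) \<Rightarrow> bool" where
  "nul X \<longleftrightarrow> (\<lambda>n. a (X n)) \<longlonglongrightarrow> 0"

text \<open>The completion is not formed as a type: its elements are Cauchy sequences up to
  \<open>eqv\<close>, its absolute value is \<open>lav\<close>, and its identities are proved up to
  \<open>eqv\<close>.\<close>

definition eqv :: "(nat \<Rightarrow> 'k) \<Rightarrow> (nat \<Rightarrow> 'k) \<Rightarrow> bool" where
  "eqv X Y \<longleftrightarrow> nul (X - Y)"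

definition lav :: "(nat \<Rightarrow> 'k) \<Rightarrow> real" where
  "lav X = lim (\<lambda>n. a (X n))"

lemma lav:
  assumes "cau X"
  shows "(\<lambda>n. a (X n)) \<longlonglongrightarrow> lav X"
proof -
  have "Cauchy (\<lambda>n. a (X n))"
  proof (rule metric_CauchyI)
    fix e :: real assume "0 < e"
    then obtain N where "\<forall>m\<ge>N. \<forall>n\<ge>N. a (X m - X n) < e" using assms unfolding cau_def by blast
    then show "\<exists>M. \<forall>m\<ge>M. \<forall>n\<ge>M. dist (a (X m)) (a (X n)) < e"
      unfolding dist_real_def using reverse_triangle le_less_trans by blast
  qed
  then show ?thesis unfolding lav_def convergent_LIMSEQ_iff[symmetric] by (rule real_Cauchy_convergent)
qed

lemma lavI: "(\<lambda>n. a (X n)) \<longlonglongrightarrow> l \<Longrightarrow> lav X = l"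
  unfolding lav_def by (rule limI)

lemma lav_nonneg: "cau X \<Longrightarrow> 0 \<le> lav X"
  using LIMSEQ_le_const[OF lav, of X 0] by auto

lemma lav_zero_iff: "cau X \<Longrightarrow> lav X = 0 \<longleftrightarrow> nul X"
  unfolding nul_def using lav lavI by metis

lemma cau_bounded:
  assumes "cau X"
  obtains B where "0 < B" "\<And>n. a (X n) \<le> B"
proof -
  have "Bseq (\<lambda>n. a (X n))" using lav[OF assms] convergentI by (intro convergent_imp_Bseq) blast
  then obtain B where "0 < B" "\<forall>n. norm (a (X n)) \<le> B" by (rule BseqE) blast
  then show ?thesis using that by simp
qed

lemma cau_const: "cau (\<lambda>_. x)"
  unfolding cau_def by simp

lemma cau_one: "cau 1"
  unfolding one_fun_def by (rule cau_const)

lemma cau_zero: "cau 0"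
  unfolding zero_fun_def by (rule cau_const)

lemma cau_add:
  assumes X: "cau X" and Y: "cau Y"
  shows "cau (X + Y)"
  unfolding cau_def
proof (intro allI impI)
  fix e :: real assume "0 < e"
  then have e: "0 < e / 2" by simp
  obtain N1 where N1: "\<forall>m\<ge>N1. \<forall>n\<ge>N1. a (X m - X n) < e / 2" using X e unfolding cau_def by blast
  obtain N2 where N2: "\<forall>m\<ge>N2. \<forall>n\<ge>N2. a (Y m - Y n) < e / 2" using Y e unfolding cau_def by blast
  have "a ((X + Y) m - (X + Y) n) < e" if "max N1 N2 \<le> m" "max N1 N2 \<le> n" for m n
  proof -
    have "(X + Y) m - (X + Y) n = (X m - X n) + (Y m - Y n)" by simp
    then have "a ((X + Y) m - (X + Y) n) \<le> a (X m - X n) + a (Y m - Y n)" using triangle by metis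
    moreover have "a (X m - X n) < e / 2" "a (Y m - Y n) < e / 2" using N1 N2 that by auto
    ultimately show ?thesis by linarith
  qed
  then show "\<exists>N. \<forall>m\<ge>N. \<forall>n\<ge>N. a ((X + Y) m - (X + Y) n) < e" by blast
qed

lemma cau_mult:
  assumes X: "cau X" and Y: "cau Y"
  shows "cau (X * Y)"
  unfolding cau_def
proof (intro allI impI)
  fix e :: real assume e: "0 < e"
  obtain B where B: "0 < B" "\<And>n. a (X n) \<le> B" by (rule cau_bounded[OF X]) blast
  obtain D where D: "0 < D" "\<And>n. a (Y n) \<le> D" by (rule cau_bounded[OF Y]) blast
  have e1: "0 < e / 2 / D" "0 < e / 2 / B" using e B D by auto
  obtain N1 where N1: "\<forall>m\<ge>N1. \<forall>n\<ge>N1. a (X m - X n) < e / 2 / D" using X e1 unfolding cau_def by blast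
  obtain N2 where N2: "\<forall>m\<ge>N2. \<forall>n\<ge>N2. a (Y m - Y n) < e / 2 / B" using Y e1 unfolding cau_def by blast
  have "a ((X * Y) m - (X * Y) n) < e" if mn: "max N1 N2 \<le> m" "max N1 N2 \<le> n" for m n
  proof -
    have "(X * Y) m - (X * Y) n = X m * (Y m - Y n) + (X m - X n) * Y n" by (simp add: algebra_simps)
    then have "a ((X * Y) m - (X * Y) n) \<le> a (X m) * a (Y m - Y n) + a (X m - X n) * a (Y n)" using triangle mult by metis
    also have "\<dots> \<le> B * a (Y m - Y n) + a (X m - X n) * D" using B D by (intro add_mono mult_mono) (auto intro: less_imp_le)
    also have "\<dots> < B * (e / 2 / B) + (e / 2 / D) * D"
      using N1 N2 mn B(1) D(1) by (intro add_strict_mono mult_strict_left_mono mult_strict_right_mono) auto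
    also have "\<dots> = e" using B D by simp
    finally show ?thesis .
  qed
  then show "\<exists>N. \<forall>m\<ge>N. \<forall>n\<ge>N. a ((X * Y) m - (X * Y) n) < e" by blast
qed

lemma nul_cau:
  assumes "nul X"
  shows "cau X"
  unfolding cau_def
proof (intro allI impI)
  fix e :: real assume "0 < e"
  then have "eventually (\<lambda>n. a (X n) < e / 2) sequentially"
    using assms unfolding nul_def by (intro order_tendstoD(2)) auto
  then obtain N where N: "\<And>n. N \<le> n \<Longrightarrow> a (X n) < e / 2" unfolding eventually_sequentially by blast
  have "a (X m - X n) < e" if "N \<le> m" "N \<le> n" for m n
    using triangle_diff[of "X m" "X n"] N[OF that(1)] N[OF that(2)] by linarith
  then show "\<exists>N. \<forall>m\<ge>N. \<forall>n\<ge>N. a (X m - X n) < e" by blast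
qed

lemma cau_uminus: "cau X \<Longrightarrow> cau (- X)"
  using cau_mult[OF cau_const[of "- 1"], of X] by (simp add: fun_eq_iff times_fun_def fun_Compl_def)

lemma cau_diff: "cau X \<Longrightarrow> cau Y \<Longrightarrow> cau (X - Y)"
  using cau_add[of X "- Y"] cau_uminus[of Y] by simp

lemmas cau_intros = cau_const cau_zero cau_one cau_add cau_mult cau_uminus cau_diff

lemma nul_add:
  assumes "nul X" "nul Y"
  shows "nul (X + Y)"
  unfolding nul_def
proof (rule Lim_null_comparison)
  show "eventually (\<lambda>n. norm (a ((X + Y) n)) \<le> a (X n) + a (Y n)) sequentially"
    using triangle by (intro always_eventually) simp
  show "(\<lambda>n. a (X n) + a (Y n)) \<longlonglongrightarrow> 0" using tendsto_add[of _ 0 _ _ 0] assms unfolding nul_def by fastforce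
qed

lemma nul_uminus: "nul X \<Longrightarrow> nul (- X)"
  unfolding nul_def by simp

lemma lav_mult: "cau X \<Longrightarrow> cau Y \<Longrightarrow> lav (X * Y) = lav X * lav Y"
  by (rule lavI) (simp add: mult tendsto_mult lav)

lemma lav_add: "cau X \<Longrightarrow> cau Y \<Longrightarrow> lav (X + Y) \<le> lav X + lav Y"
  by (rule LIMSEQ_le[OF lav[OF cau_add] tendsto_add[OF lav lav]]) (auto simp: triangle)

lemma lav_const [simp]: "lav (\<lambda>_. x) = a x"
  by (rule lavI) simp

lemma lav_one [simp]: "lav 1 = 1"
  unfolding one_fun_def by simp

lemma lav_uminus: "lav (- X) = lav X"
  unfolding lav_def by simp

text \<open>Null sequences are the Cauchy sequences with \<open>lav\<close> zero, and
  \<open>lav\<close> is multiplicative.\<close>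

lemma nul_mult:
  assumes "nul X" "cau Y"
  shows "nul (X * Y)"
  using lav_zero_iff[OF cau_mult[OF nul_cau[OF assms(1)] assms(2)]] lav_zero_iff[OF nul_cau[OF assms(1)]]
    lav_mult[OF nul_cau[OF assms(1)] assms(2)] assms(1) by simp

lemma eqv_refl: "eqv X X"
  unfolding eqv_def nul_def by simp

lemma eqv_sym: "eqv X Y \<Longrightarrow> eqv Y X"
  unfolding eqv_def using nul_uminus[of "X - Y"] by simp

lemma eqv_trans [trans]: "eqv X Y \<Longrightarrow> eqv Y Z \<Longrightarrow> eqv X Z"
  unfolding eqv_def using nul_add[of "X - Y" "Y - Z"] by simp

lemma eqv_add: "eqv X X' \<Longrightarrow> eqv Y Y' \<Longrightarrow> eqv (X + Y) (X' + Y')"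
  unfolding eqv_def using nul_add[of "X - X'" "Y - Y'"] by (simp add: algebra_simps)

lemma eqv_uminus: "eqv X X' \<Longrightarrow> eqv (- X) (- X')"
  unfolding eqv_def using nul_uminus[of "X - X'"] by (simp add: algebra_simps)

lemma eqv_diff: "eqv X X' \<Longrightarrow> eqv Y Y' \<Longrightarrow> eqv (X - Y) (X' - Y')"
  using eqv_add[of X X' "- Y" "- Y'"] eqv_uminus[of Y Y'] by simp

lemma eqv_mult:
  assumes "eqv X X'" "eqv Y Y'" "cau X" "cau Y'"
  shows "eqv (X * Y) (X' * Y')"
proof -
  have "X * Y - X' * Y' = (Y - Y') * X + (X - X') * Y'" by (simp add: algebra_simps)
  then show ?thesis using nul_add[OF nul_mult nul_mult] assms unfolding eqv_def by metis
qed

lemma eqv_lav: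
  assumes "eqv X Y" "cau X" "cau Y"
  shows "lav X = lav Y"
proof -
  have "lav X \<le> lav Y" if e: "eqv X Y" "cau X" "cau Y" for X Y
  proof -
    have "lav X \<le> lav (X - Y) + lav Y" using lav_add[of "X - Y" Y] e cau_diff by simp
    then show ?thesis using lav_zero_iff[OF cau_diff[OF e(2,3)]] e(1) unfolding eqv_def by simp
  qed
  from this[OF assms] this[OF eqv_sym[OF assms(1)] assms(3,2)] show ?thesis by simp
qed

lemma eqv_zero: "eqv X 0 \<longleftrightarrow> nul X"
  unfolding eqv_def by simp

text \<open>A map with these properties is a ring homomorphism from \<^typ>\<open>'c\<close> to the completion of \<^typ>\<open>'k\<close>.\<close>

definition approx_hom :: "real \<Rightarrow> ('c::real_normed_field \<Rightarrow> nat \<Rightarrow> 'k) \<Rightarrow> bool" where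
  "approx_hom s C \<longleftrightarrow> 0 < s \<and> (\<forall>x. cau (C x)) \<and> (\<forall>x y. eqv (C (x + y)) (C x + C y)) \<and>
     (\<forall>x y. eqv (C (x * y)) (C x * C y)) \<and> eqv (C 1) 1 \<and> (\<forall>x. lav (C x) = norm x powr s)"

text \<open>\<open>C\<close> embeds \<open>'c\<close> in the completion, and by \<open>onto\<close>
  its image contains the field, so reading field elements in \<open>'c\<close> defines
  \<open>\<sigma>\<close>. The image of \<open>\<sigma>\<close> is dense because each Cauchy
  sequence \<open>C w\<close> is approximated by its own entries.\<close>

lemma approx_hom_onto:
  fixes C :: "'c::real_normed_field \<Rightarrow> nat \<Rightarrow> 'k"
  assumes C: "approx_hom s C" and onto: "\<And>x. \<exists>w. eqv (\<lambda>_. x) (C w)"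
  obtains \<sigma> :: "'k \<Rightarrow> 'c" where "\<sigma> 1 = 1" "\<And>x y. \<sigma> (x + y) = \<sigma> x + \<sigma> y" "\<And>x y. \<sigma> (x * y) = \<sigma> x * \<sigma> y"
    "\<And>x. norm (\<sigma> x) = a x powr (1 / s)" "closure (range \<sigma>) = UNIV"
proof -
  have s: "0 < s" and cC: "\<And>x. cau (C x)" and add: "\<And>x y. eqv (C (x + y)) (C x + C y)"
    and mul: "\<And>x y. eqv (C (x * y)) (C x * C y)" and one: "eqv (C 1) 1" and nrm: "\<And>x. lav (C x) = norm x powr s"
    using C unfolding approx_hom_def by blast+
  obtain \<sigma> where \<sigma>: "\<And>x. eqv (\<lambda>_. x) (C (\<sigma> x))" using onto by metis
  have diff: "lav (C w - C w') = norm (w - w') powr s" for w w'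
  proof -
    have "eqv (C w - C w') (C (w - w') + C w' - C w')"
      using eqv_diff[OF add[of "w - w'" w'] eqv_refl[of "C w'"]] by simp
    then show ?thesis using eqv_lav[of "C w - C w'" "C (w - w')"] cC nrm by (simp add: cau_diff)
  qed
  have uniq: "w = w'" if "eqv (C w) (C w')" for w w'
    using that lav_zero_iff[OF cau_diff[OF cC cC], of w w'] diff[of w w'] unfolding eqv_def by simp
  have \<sigma>I: "\<sigma> x = w" if "eqv (\<lambda>_. x) (C w)" for x w
    using uniq eqv_trans[OF eqv_sym[OF \<sigma>] that] by blast
  show ?thesis
  proof (rule that[of \<sigma>])
    show "\<sigma> 1 = 1" using eqv_sym[OF one] unfolding one_fun_def by (rule \<sigma>I)
    show "\<sigma> (x + y) = \<sigma> x + \<sigma> y" for x y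
    proof (rule \<sigma>I)
      have e: "(\<lambda>_. x + y) = (\<lambda>_. x) + (\<lambda>_. y :: 'k)" by (simp add: fun_eq_iff)
      show "eqv (\<lambda>_. x + y) (C (\<sigma> x + \<sigma> y))"
        unfolding e by (rule eqv_trans[OF eqv_add[OF \<sigma> \<sigma>] eqv_sym[OF add]])
    qed
    show "\<sigma> (x * y) = \<sigma> x * \<sigma> y" for x y
    proof (rule \<sigma>I)
      have e: "(\<lambda>_. x * y) = (\<lambda>_. x) * (\<lambda>_. y :: 'k)" by (simp add: fun_eq_iff)
      show "eqv (\<lambda>_. x * y) (C (\<sigma> x * \<sigma> y))"
        unfolding e by (rule eqv_trans[OF eqv_mult[OF \<sigma> \<sigma> cau_const cC] eqv_sym[OF mul]])
    qed
    show "norm (\<sigma> x) = a x powr (1 / s)" for x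
      using eqv_lav[OF \<sigma> cau_const cC, of x] nrm s by (simp add: powr_powr)
    have "w \<in> closure (range \<sigma>)" for w
      unfolding closure_approachable
    proof (intro allI impI)
      fix e :: real assume e: "0 < e"
      \<comment> \<open>The absolute value corresponds to the power \<open>s\<close> of the norm on
        \<open>'c\<close>, so the tolerance is converted; the half leaves room for a strict
        inequality.\<close>
      define \<delta> where "\<delta> = (e / 2) powr s"
      have "0 < \<delta>" unfolding \<delta>_def using e by simp
      then obtain N where N: "\<forall>m\<ge>N. \<forall>n\<ge>N. a (C w m - C w n) < \<delta>" using cC[of w] unfolding cau_def by blast
      define x where "x = C w N"
      have "lav ((\<lambda>_. x) - C w) \<le> \<delta>"
      proof (rule LIMSEQ_le_const2[OF lav[OF cau_diff[OF cau_const cC]]])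
        show "\<exists>M. \<forall>n\<ge>M. a (((\<lambda>_. x) - C w) n) \<le> \<delta>" using N unfolding x_def by (auto intro!: exI[of _ N] less_imp_le)
      qed
      moreover have "lav ((\<lambda>_. x) - C w) = lav (C (\<sigma> x) - C w)"
        by (intro eqv_lav eqv_diff \<sigma> eqv_refl cau_diff cau_const cC)
      ultimately have "norm (\<sigma> x - w) powr s \<le> (e / 2) powr s" unfolding diff \<delta>_def by simp
      then have "norm (\<sigma> x - w) \<le> e / 2" using s powr_less_mono2[of s "e / 2" "norm (\<sigma> x - w)"] e by fastforce
      then show "\<exists>y\<in>range \<sigma>. dist y w < e" using e by (auto simp: dist_norm intro!: exI[of _ x])
    qed
    then show "closure (range \<sigma>) = UNIV" by blast
  qed
qed

end

section \<open>The real numbers inside an archimedean completion\<close>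

locale archimedean = absval a for a :: "'k::field \<Rightarrow> real" +
  fixes s :: real
  assumes s: "0 < s" and a_nat: "a (of_nat n) = real n powr s"
begin

lemma two: "a 2 = 2 powr s" "(2::'k) \<noteq> 0"
proof -
  show "a 2 = 2 powr s" using a_nat[of 2] by simp
  then show "(2::'k) \<noteq> 0" by auto
qed

lemma a_int: "a (of_int i) = \<bar>real_of_int i\<bar> powr s"
proof (cases "0 \<le> i")
  case True
  then show ?thesis using a_nat[of "nat i"] by simp
next
  case False
  then have "(of_int i :: 'k) = - of_nat (nat (- i))" by simp
  then have "a (of_int i) = real (nat (- i)) powr s" by (simp only: minus a_nat)
  then show ?thesis using False by simp
qed

lemma a_dyadic: "a (of_int i / 2 ^ k) = \<bar>of_int i / 2 ^ k\<bar> powr s"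
proof -
  have "(2 powr s) ^ k = (2 ^ k) powr s" by (simp add: powr_realpow[symmetric] powr_powr mult.commute)
  then show ?thesis by (simp add: divide power two a_int powr_divide)
qed

text \<open>Lets rounding errors be estimated in the reals: on dyadic fractions \<open>a\<close> is
  the power \<open>s\<close> of the usual absolute value.\<close>

lemma nul_dyadic:
  assumes "(\<lambda>n. real_of_int (i n) / 2 ^ k n) \<longlonglongrightarrow> 0"
  shows "nul (\<lambda>n. of_int (i n) / 2 ^ k n)"
proof -
  have "(\<lambda>n. \<bar>real_of_int (i n) / 2 ^ k n\<bar> powr s) \<longlonglongrightarrow> \<bar>0\<bar> powr s"
    using s assms by (intro tendsto_powr' tendsto_rabs tendsto_const) auto
  then show ?thesis unfolding nul_def a_dyadic by simp
qed

text \<open>A real number enters the completion through its binary truncations. They make sense in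
  the field because two is invertible, and \<open>a_dyadic\<close> carries their convergence
  over.\<close>

definition dy :: "real \<Rightarrow> nat \<Rightarrow> 'k" where
  "dy r n = of_int \<lfloor>r * 2 ^ n\<rfloor> / 2 ^ n"

lemma floor_lim: "(\<lambda>n. real_of_int \<lfloor>r * 2 ^ n\<rfloor> / 2 ^ n) \<longlonglongrightarrow> r"
proof -
  have "(\<lambda>n. real_of_int \<lfloor>r * 2 ^ n\<rfloor> / 2 ^ n - r) \<longlonglongrightarrow> 0"
  proof (rule Lim_null_comparison)
    show "eventually (\<lambda>n. norm (real_of_int \<lfloor>r * 2 ^ n\<rfloor> / 2 ^ n - r) \<le> (1 / 2) ^ n) sequentially"
    proof (intro always_eventually allI)
      fix n
      have "\<bar>real_of_int \<lfloor>r * 2 ^ n\<rfloor> - r * 2 ^ n\<bar> \<le> 1" by linarith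
      then have "\<bar>real_of_int \<lfloor>r * 2 ^ n\<rfloor> - r * 2 ^ n\<bar> / \<bar>2 ^ n\<bar> \<le> 1 / 2 ^ n" by (simp add: divide_right_mono)
      then have "\<bar>(real_of_int \<lfloor>r * 2 ^ n\<rfloor> - r * 2 ^ n) / 2 ^ n\<bar> \<le> 1 / 2 ^ n" unfolding abs_divide .
      moreover have "(real_of_int \<lfloor>r * 2 ^ n\<rfloor> - r * 2 ^ n) / 2 ^ n = real_of_int \<lfloor>r * 2 ^ n\<rfloor> / 2 ^ n - r"
        by (simp add: diff_divide_distrib)
      ultimately show "norm (real_of_int \<lfloor>r * 2 ^ n\<rfloor> / 2 ^ n - r) \<le> (1 / 2) ^ n" by (simp add: power_divide)
    qed
  qed (intro LIMSEQ_power_zero, simp)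
  then show ?thesis by (simp add: LIM_zero_iff)
qed

lemma dy_zero: "dy 0 = 0" and dy_one: "dy 1 = 1"
proof -
  have "\<lfloor>(2::real) ^ n\<rfloor> = 2 ^ n" for n by (metis floor_of_int of_int_numeral of_int_power)
  then show "dy 1 = 1" "dy 0 = 0" unfolding dy_def using two(2) by (auto simp: fun_eq_iff)
qed

lemma dy_add: "eqv (dy (r + t)) (dy r + dy t)"
proof -
  have "(\<lambda>n. real_of_int (\<lfloor>(r + t) * 2 ^ n\<rfloor> - (\<lfloor>r * 2 ^ n\<rfloor> + \<lfloor>t * 2 ^ n\<rfloor>)) / 2 ^ n) \<longlonglongrightarrow> 0"
    using tendsto_diff[OF floor_lim[of "r + t"] tendsto_add[OF floor_lim[of r] floor_lim[of t]]]
    by (simp add: diff_divide_distrib add_divide_distrib)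
  then have "nul (\<lambda>n. of_int (\<lfloor>(r + t) * 2 ^ n\<rfloor> - (\<lfloor>r * 2 ^ n\<rfloor> + \<lfloor>t * 2 ^ n\<rfloor>)) / 2 ^ n)" by (rule nul_dyadic)
  moreover have "dy (r + t) - (dy r + dy t) = (\<lambda>n. of_int (\<lfloor>(r + t) * 2 ^ n\<rfloor> - (\<lfloor>r * 2 ^ n\<rfloor> + \<lfloor>t * 2 ^ n\<rfloor>)) / 2 ^ n)"
    unfolding dy_def by (auto simp: fun_eq_iff diff_divide_distrib add_divide_distrib)
  ultimately show ?thesis unfolding eqv_def by simp
qed

lemma dy_mult: "eqv (dy (r * t)) (dy r * dy t)"
proof -
  have e: "real_of_int (\<lfloor>r * t * 2 ^ n\<rfloor> * 2 ^ n - \<lfloor>r * 2 ^ n\<rfloor> * \<lfloor>t * 2 ^ n\<rfloor>) / 2 ^ (n + n) =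
     of_int \<lfloor>r * t * 2 ^ n\<rfloor> / 2 ^ n - of_int \<lfloor>r * 2 ^ n\<rfloor> / 2 ^ n * (of_int \<lfloor>t * 2 ^ n\<rfloor> / 2 ^ n)" for n
    by (simp add: power_add diff_divide_distrib)
  have "(\<lambda>n. real_of_int (\<lfloor>r * t * 2 ^ n\<rfloor> * 2 ^ n - \<lfloor>r * 2 ^ n\<rfloor> * \<lfloor>t * 2 ^ n\<rfloor>) / 2 ^ (n + n)) \<longlonglongrightarrow> 0"
    unfolding e using tendsto_diff[OF floor_lim[of "r * t"] tendsto_mult[OF floor_lim[of r] floor_lim[of t]]] by simp
  then have "nul (\<lambda>n. of_int (\<lfloor>r * t * 2 ^ n\<rfloor> * 2 ^ n - \<lfloor>r * 2 ^ n\<rfloor> * \<lfloor>t * 2 ^ n\<rfloor>) / 2 ^ (n + n))" by (rule nul_dyadic)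
  moreover have "dy (r * t) - dy r * dy t = (\<lambda>n. of_int (\<lfloor>r * t * 2 ^ n\<rfloor> * 2 ^ n - \<lfloor>r * 2 ^ n\<rfloor> * \<lfloor>t * 2 ^ n\<rfloor>) / 2 ^ (n + n))"
    unfolding dy_def using two(2) by (auto simp: fun_eq_iff power_add diff_divide_distrib)
  ultimately show ?thesis unfolding eqv_def by simp
qed

lemma cau_dy: "cau (dy r)"
  unfolding cau_def
proof (intro allI impI)
  fix e :: real assume e: "0 < e"
  let ?f = "\<lambda>n. real_of_int \<lfloor>r * 2 ^ n\<rfloor> / 2 ^ n"
  have "0 < e powr (1 / s)" using e by simp
  then obtain N where N: "\<And>m n. N \<le> m \<Longrightarrow> N \<le> n \<Longrightarrow> dist (?f m) (?f n) < e powr (1 / s)"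
    using metric_CauchyD[OF LIMSEQ_imp_Cauchy[OF floor_lim]] by blast
  have "a (dy r m - dy r n) < e" if "N \<le> m" "N \<le> n" for m n
  proof -
    have "dy r m - dy r n = of_int (\<lfloor>r * 2 ^ m\<rfloor> * 2 ^ n - \<lfloor>r * 2 ^ n\<rfloor> * 2 ^ m) / 2 ^ (m + n)"
      unfolding dy_def using two(2) by (simp add: power_add diff_divide_distrib)
    moreover have "?f m - ?f n = of_int (\<lfloor>r * 2 ^ m\<rfloor> * 2 ^ n - \<lfloor>r * 2 ^ n\<rfloor> * 2 ^ m) / 2 ^ (m + n)"
      by (simp add: power_add diff_divide_distrib)
    ultimately have "a (dy r m - dy r n) = \<bar>?f m - ?f n\<bar> powr s" by (simp only: a_dyadic)
    also have "\<dots> < (e powr (1 / s)) powr s"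
      using N[OF that] s unfolding dist_real_def by (intro powr_less_mono2) auto
    also have "\<dots> = e" using e s by (simp add: powr_powr)
    finally show ?thesis .
  qed
  then show "\<exists>N. \<forall>m\<ge>N. \<forall>n\<ge>N. a (dy r m - dy r n) < e" by blast
qed

lemma lav_dy: "lav (dy r) = \<bar>r\<bar> powr s"
proof (rule lavI)
  have "(\<lambda>n. \<bar>real_of_int \<lfloor>r * 2 ^ n\<rfloor> / 2 ^ n\<bar> powr s) \<longlonglongrightarrow> \<bar>r\<bar> powr s"
    using s by (intro tendsto_powr' tendsto_rabs tendsto_const floor_lim) auto
  then show "(\<lambda>n. a (dy r n)) \<longlonglongrightarrow> \<bar>r\<bar> powr s" unfolding dy_def a_dyadic .
qed

lemma approx_hom_dy: "approx_hom s dy"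
  unfolding approx_hom_def using s by (auto simp: cau_dy dy_add dy_mult dy_one eqv_refl lav_dy)

lemma dy_uminus: "eqv (dy (- r)) (- dy r)"
proof -
  have "eqv (dy (- r) + dy r - dy r) (dy 0 - dy r)"
    using eqv_diff[OF eqv_sym[OF dy_add[of "- r" r]] eqv_refl[of "dy r"]] by simp
  then show ?thesis by (simp add: dy_zero)
qed

lemma dy_diff: "eqv (dy (r - t)) (dy r - dy t)"
  using eqv_trans[OF dy_add[of r "- t"] eqv_add[OF eqv_refl dy_uminus]] by simp

text \<open>Coefficients become sequences, and the polynomial is evaluated in the ring of all
  sequences with pointwise operations. Since \<open>dy\<close> is a homomorphism only up to
  \<open>eqv\<close>, so is \<open>ev x\<close>.\<close>

definition ev :: "'k \<Rightarrow> real poly \<Rightarrow> nat \<Rightarrow> 'k" where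
  "ev x P = poly (map_poly dy P) (\<lambda>_. x)"

lemma ev_0 [simp]: "ev x 0 = 0"
  unfolding ev_def by simp

lemma ev_pCons: "ev x (pCons r P) = dy r + (\<lambda>_. x) * ev x P"
  unfolding ev_def by (simp only: map_poly_pCons[where f = dy, OF dy_zero] poly_pCons)

lemma ev_const: "ev x [:r:] = dy r"
  unfolding ev_pCons by simp

lemma cau_ev: "cau (ev x P)"
proof (induction P)
  case 0
  then show ?case unfolding ev_0 by (rule cau_zero)
next
  case (pCons r P)
  then show ?case unfolding ev_pCons by (intro cau_intros cau_dy)
qed

lemma ev_add: "eqv (ev x (P + Q)) (ev x P + ev x Q)"
proof (induction P Q rule: poly_induct2)
  case 0
  then show ?case by (simp add: eqv_refl)
next
  case (pCons r P t Q)
  have "eqv (ev x (pCons (r + t) (P + Q))) ((dy r + dy t) + (\<lambda>_. x) * (ev x P + ev x Q))"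
    unfolding ev_pCons by (intro eqv_add eqv_mult dy_add eqv_refl pCons cau_const cau_add cau_ev)
  also have "(dy r + dy t) + (\<lambda>_. x) * (ev x P + ev x Q) = ev x (pCons r P) + ev x (pCons t Q)"
    unfolding ev_pCons distrib_left by (simp only: ac_simps)
  finally show ?case by simp
qed

lemma ev_smult: "eqv (ev x (Polynomial.smult r P)) (dy r * ev x P)"
proof (induction P)
  case 0
  then show ?case by (simp add: eqv_refl)
next
  case (pCons t P)
  have "eqv (ev x (pCons (r * t) (Polynomial.smult r P))) (dy r * dy t + (\<lambda>_. x) * (dy r * ev x P))"
    unfolding ev_pCons by (intro eqv_add eqv_mult dy_mult eqv_refl pCons cau_const cau_mult cau_ev cau_dy)
  also have "dy r * dy t + (\<lambda>_. x) * (dy r * ev x P) = dy r * ev x (pCons t P)"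
    unfolding ev_pCons distrib_left by (simp only: mult_ac)
  finally show ?case by simp
qed

lemma ev_mult: "eqv (ev x (P * Q)) (ev x P * ev x Q)"
proof (induction P)
  case 0
  then show ?case by (simp add: eqv_refl)
next
  case (pCons r P)
  have "eqv (ev x (Polynomial.smult r Q + pCons 0 (P * Q))) (ev x (Polynomial.smult r Q) + ev x (pCons 0 (P * Q)))" by (rule ev_add)
  also have "eqv \<dots> (dy r * ev x Q + (\<lambda>_. x) * (ev x P * ev x Q))"
    unfolding ev_pCons dy_zero add_0_left by (intro eqv_add eqv_mult ev_smult eqv_refl pCons cau_const cau_mult cau_ev)
  also have "dy r * ev x Q + (\<lambda>_. x) * (ev x P * ev x Q) = ev x (pCons r P) * ev x Q"
    unfolding ev_pCons distrib_right by (simp only: mult_ac)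
  finally show ?case by (simp only: mult_pCons_left)
qed

lemma polynorm_ev: "polynorm (\<lambda>P. lav (ev x P)) s"
proof
  show "lav (ev x (P * Q)) = lav (ev x P) * lav (ev x Q)" for P Q
    using eqv_lav[OF ev_mult cau_ev cau_mult[OF cau_ev cau_ev]] lav_mult[OF cau_ev cau_ev] by simp
  show "lav (ev x (P + Q)) \<le> lav (ev x P) + lav (ev x Q)" for P Q
    using eqv_lav[OF ev_add cau_ev cau_add[OF cau_ev cau_ev]] lav_add[OF cau_ev cau_ev] by simp
qed (simp_all add: s lav_nonneg cau_ev ev_const lav_dy)

lemma quadratic_relation:
  obtains z where "lav (ev x (quad z)) = 0"
  using polynorm.ex_quad_zero[OF polynorm_ev] by blast

text \<open>With \<open>z\<close> real, \<open>quad z\<close> is the square of a linear polynomial,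
  which therefore already vanishes at \<open>x\<close>.\<close>

lemma real_quadratic:
  assumes z: "lav (ev x (quad z)) = 0" "Im z = 0"
  shows "eqv (\<lambda>_. x) (dy (Re z))"
proof -
  interpret N: polynorm "\<lambda>P. lav (ev x P)" s by (rule polynorm_ev)
  have "quad z = [:- Re z, 1:] * [:- Re z, 1:]" unfolding quad_def cmod_power2 using z(2) by (simp add: power2_eq_square)
  then have "lav (ev x [:- Re z, 1:]) = 0" using z(1) N.mult[of "[:- Re z, 1:]" "[:- Re z, 1:]"] by simp
  then have "nul (ev x [:- Re z, 1:])" by (simp only: lav_zero_iff[OF cau_ev])
  then have "eqv (dy (- Re z) + (\<lambda>_. x)) 0"
    unfolding eqv_zero ev_pCons by (simp only: dy_one ev_0 mult_zero_right add_0_right mult_1_right)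
  moreover have "eqv (- dy (Re z) + (\<lambda>_. x)) (dy (- Re z) + (\<lambda>_. x))"
    by (intro eqv_add eqv_sym[OF dy_uminus] eqv_refl)
  ultimately have "eqv (- dy (Re z) + (\<lambda>_. x)) 0" using eqv_trans by blast
  then have "eqv (dy (Re z) + (- dy (Re z) + (\<lambda>_. x))) (dy (Re z) + 0)" by (intro eqv_add eqv_refl)
  then show ?thesis by (simp add: fun_eq_iff plus_fun_def fun_Compl_def)
qed

lemma ev_quad: "eqv (ev x (quad z)) ((\<lambda>_. x) * (\<lambda>_. x) - (dy (Re z) + dy (Re z)) * (\<lambda>_. x) + dy ((cmod z)\<^sup>2))"
proof -
  have e: "ev x (quad z) = dy ((cmod z)\<^sup>2) + (\<lambda>_. x) * (dy (- (Re z + Re z)) + (\<lambda>_. x))"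
    unfolding quad_def ev_pCons by (simp only: dy_one ev_0 mult_zero_right add_0_right mult_1_right mult_2 minus_mult_left[symmetric])
  have "eqv (ev x (quad z)) (dy ((cmod z)\<^sup>2) + (\<lambda>_. x) * (- (dy (Re z) + dy (Re z)) + (\<lambda>_. x)))"
    unfolding e by (intro eqv_add eqv_mult eqv_refl eqv_trans[OF dy_uminus] eqv_uminus dy_add cau_const cau_add cau_uminus cau_dy)
  moreover have "D + X * (- (U + U) + X) = X * X - (U + U) * X + D" for D X U :: "nat \<Rightarrow> 'k"
    by (simp add: algebra_simps)
  ultimately show ?thesis by metis
qed

text \<open>Completing the square in a quadratic relation without real root produces a square root of \<open>-1\<close>.\<close>

lemma imaginary_unit:
  assumes z: "lav (ev x (quad z)) = 0" "Im z \<noteq> 0"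
  obtains J where "cau J" "eqv (J * J) (- 1)"
proof -
  define X where "X = (\<lambda>_::nat. x)"
  define U where "U = dy (Re z)"
  define W where "W = dy (Im z)"
  define I where "I = dy (1 / Im z)"
  note c = cau_const[of x, folded X_def] cau_dy[of "Re z", folded U_def] cau_dy[of "Im z", folded W_def] cau_dy[of "1 / Im z", folded I_def]
  have UW: "eqv (dy ((cmod z)\<^sup>2)) (U * U + W * W)"
  proof -
    have e: "(cmod z)\<^sup>2 = Re z * Re z + Im z * Im z" unfolding cmod_power2 by (simp only: power2_eq_square)
    show ?thesis unfolding e U_def W_def by (rule eqv_trans[OF dy_add]) (intro eqv_add dy_mult)
  qed
  have WI: "eqv (W * I) 1"
  proof -
    have "eqv (dy (Im z * (1 / Im z))) (W * I)" unfolding W_def I_def by (rule dy_mult)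
    then show ?thesis using z(2) by (simp add: dy_one eqv_sym)
  qed
  have "eqv (ev x (quad z)) 0" using z(1) lav_zero_iff[OF cau_ev] unfolding eqv_zero by simp
  then have "eqv (X * X - (U + U) * X + dy ((cmod z)\<^sup>2)) 0"
    using eqv_trans[OF eqv_sym[OF ev_quad]] unfolding X_def U_def by blast
  then have "eqv (X * X - (U + U) * X + (U * U + W * W)) 0"
    using eqv_trans[OF eqv_add[OF eqv_refl eqv_sym[OF UW]]] by blast
  then have "eqv (X * X - (U + U) * X + (U * U + W * W) - W * W) (0 - W * W)" by (intro eqv_diff eqv_refl)
  then have "eqv ((X - U) * (X - U)) (- (W * W))" by (simp add: algebra_simps)
  then have "eqv ((X - U) * (X - U) * (I * I)) (- (W * W) * (I * I))" by (intro eqv_mult eqv_refl cau_intros c)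
  also have "- (W * W) * (I * I) = - ((W * I) * (W * I))" by (simp add: mult_ac)
  also have "eqv \<dots> (- (1 * 1))" by (intro eqv_uminus eqv_mult WI cau_intros c)
  finally have "eqv ((X - U) * (X - U) * (I * I)) (- 1)" unfolding mult_1_left .
  moreover have "A * A * (I * I) = (A * I) * (A * I)" for A by (simp only: mult_ac)
  then have "(X - U) * (X - U) * (I * I) = ((X - U) * I) * ((X - U) * I)" .
  ultimately have "eqv (((X - U) * I) * ((X - U) * I)) (- 1)" by (rule back_subst[of "\<lambda>T. eqv T (- 1)"])
  then show ?thesis by (rule that[rotated]) (intro cau_intros c)
qed

section \<open>The complex numbers inside the completion\<close>

definition cx :: "(nat \<Rightarrow> 'k) \<Rightarrow> complex \<Rightarrow> nat \<Rightarrow> 'k" where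
  "cx J z = dy (Re z) + dy (Im z) * J"

context
  fixes J assumes J: "cau J" "eqv (J * J) (- 1)"
begin

lemma cau_cx: "cau (cx J z)"
  unfolding cx_def by (intro cau_intros cau_dy J)

lemma cx_add: "eqv (cx J (z + w)) (cx J z + cx J w)"
proof -
  have "eqv (cx J (z + w)) ((dy (Re z) + dy (Re w)) + (dy (Im z) + dy (Im w)) * J)"
    unfolding cx_def plus_complex.sel by (intro eqv_add eqv_mult dy_add eqv_refl cau_dy J)
  also have "(dy (Re z) + dy (Re w)) + (dy (Im z) + dy (Im w)) * J = cx J z + cx J w"
    unfolding cx_def by (simp only: algebra_simps)
  finally show ?thesis .
qed

lemma cx_mult: "eqv (cx J (z * w)) (cx J z * cx J w)"
proof -
  define X where "X = dy (Re z) * dy (Re w)"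
  define Y where "Y = dy (Re z) * dy (Im w) + dy (Im z) * dy (Re w)"
  define Z where "Z = dy (Im z) * dy (Im w)"
  have c: "cau X" "cau Y" "cau Z" unfolding X_def Y_def Z_def by (intro cau_intros cau_dy)+
  have "eqv (cx J (z * w)) ((X - Z) + Y * J)"
    unfolding cx_def times_complex.sel X_def Y_def Z_def
    by (intro eqv_add eqv_mult eqv_trans[OF dy_add] eqv_trans[OF dy_diff] eqv_diff dy_mult eqv_refl cau_dy J)
  moreover have "eqv (X + Y * J + Z * (J * J)) (X + Y * J + Z * (- 1))"
    by (intro eqv_add eqv_mult eqv_refl J c cau_uminus cau_one)
  moreover have "X + Y * J + Z * (- 1) = (X - Z) + Y * J" by simp
  moreover have "X + Y * J + Z * (J * J) = cx J z * cx J w"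
    unfolding cx_def X_def Y_def Z_def by (simp only: algebra_simps)
  ultimately show ?thesis using eqv_trans eqv_sym by metis
qed

lemma cx_real: "cx J (of_real r) = dy r"
  unfolding cx_def by (simp add: dy_zero)

text \<open>\<open>lav (cx J z)\<close> is multiplicative in \<open>z\<close> and at most
  \<open>2 * cmod z powr s\<close>. Applying this bound to powers removes the factor two, and the
  inverse of \<open>z\<close> gives the opposite inequality.\<close>

lemma lav_cx: "lav (cx J z) = cmod z powr s"
proof -
  define f where "f z = lav (cx J z)" for z
  have f0: "0 \<le> f z" for z unfolding f_def by (rule lav_nonneg[OF cau_cx])
  have fm: "f (z * w) = f z * f w" for z w
    unfolding f_def using eqv_lav[OF cx_mult cau_cx cau_mult[OF cau_cx cau_cx]] lav_mult[OF cau_cx cau_cx] by simp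
  have f1: "f 1 = 1" unfolding f_def using cx_real[of 1] lav_dy[of 1] by simp
  have fp: "f (z ^ n) = f z ^ n" for z n by (induction n) (simp_all add: fm f1)
  have "lav J * lav J = 1"
    using eqv_lav[OF J(2) cau_mult[OF J(1) J(1)] cau_uminus[OF cau_one]] lav_mult[OF J(1) J(1)] by (simp add: lav_uminus)
  then have lJ: "lav J = 1" using lav_nonneg[OF J(1)] by (metis abs_of_nonneg abs_mult_self_eq real_sqrt_abs2 real_sqrt_one)
  have up: "f z \<le> 2 * cmod z powr s" for z
  proof -
    have "f z \<le> lav (dy (Re z)) + lav (dy (Im z) * J)" unfolding f_def cx_def by (intro lav_add cau_intros cau_dy J)
    also have "\<dots> = \<bar>Re z\<bar> powr s + \<bar>Im z\<bar> powr s" by (simp add: lav_mult[OF cau_dy J(1)] lJ lav_dy)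
    also have "\<dots> \<le> cmod z powr s + cmod z powr s"
      using s abs_Re_le_cmod abs_Im_le_cmod by (intro add_mono powr_mono2) auto
    finally show ?thesis by simp
  qed
  have le: "f z \<le> cmod z powr s" if z: "z \<noteq> 0" for z
  proof -
    have "(f z / cmod z powr s) ^ n \<le> real n * 0 + 2" for n
    proof -
      have "f z ^ n \<le> 2 * cmod (z ^ n) powr s" using up[of "z ^ n"] fp by simp
      also have "cmod (z ^ n) powr s = (cmod z powr s) ^ n"
        using z by (simp add: norm_power powr_realpow[symmetric] powr_powr mult.commute)
      finally show ?thesis using z by (simp add: power_divide pos_divide_le_eq)
    qed
    then have "f z / cmod z powr s \<le> 1" by (rule le_one_of_power_le_linear)
    then show ?thesis using z by (simp add: pos_divide_le_eq)
  qed
  show ?thesis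
  proof (cases "z = 0")
    case True
    then show ?thesis using cx_real[of 0] lav_dy[of 0] s by simp
  next
    case False
    have "f z * f (inverse z) = 1" using fm[of z "inverse z"] False f1 by simp
    moreover have "f (inverse z) \<le> inverse (cmod z powr s)"
      using le[of "inverse z"] False by (simp add: norm_divide inverse_eq_divide powr_divide)
    ultimately have "1 \<le> f z * inverse (cmod z powr s)" using mult_left_mono[OF _ f0] by metis
    then have "cmod z powr s \<le> f z" using False by (simp add: field_simps)
    then show ?thesis using le[OF False] unfolding f_def by simp
  qed
qed

lemma approx_hom_cx: "approx_hom s (cx J)"
proof -
  have "cx J 1 = 1" using cx_real[of 1] dy_one by simp
  then show ?thesis
    unfolding approx_hom_def using s by (auto simp: cau_cx cx_add cx_mult eqv_refl lav_cx)
qed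

text \<open>The quadratic relation of \<open>x\<close> factors over the copy of the complex numbers,
  with roots \<open>z\<close> and \<open>cnj z\<close>. As \<open>lav\<close> is multiplicative, one
  of the two factors is null.\<close>

lemma cx_onto: "\<exists>w. eqv (\<lambda>_. x) (cx J w)"
proof -
  obtain z where z: "lav (ev x (quad z)) = 0" by (rule quadratic_relation)
  define X where "X = (\<lambda>_::nat. x)"
  have cX: "cau X" unfolding X_def by (rule cau_const)
  have "eqv (cx J z + cx J (cnj z)) (cx J (of_real (Re z) + of_real (Re z)))"
    using eqv_sym[OF cx_add[of z "cnj z"]] by (simp add: complex_add_cnj)
  moreover have "eqv (cx J (of_real (Re z) + of_real (Re z))) (dy (Re z) + dy (Re z))"
    unfolding of_real_add[symmetric] cx_real by (rule dy_add)
  ultimately have sm: "eqv (cx J z + cx J (cnj z)) (dy (Re z) + dy (Re z))" by (rule eqv_trans)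
  have pr: "eqv (cx J z * cx J (cnj z)) (dy ((cmod z)\<^sup>2))"
    using eqv_sym[OF cx_mult[of z "cnj z"]] unfolding complex_norm_square[symmetric] cx_real .
  have "eqv (X * X - (cx J z + cx J (cnj z)) * X + cx J z * cx J (cnj z)) (X * X - (dy (Re z) + dy (Re z)) * X + dy ((cmod z)\<^sup>2))"
    by (intro eqv_add eqv_diff eqv_mult sm pr eqv_refl cX cau_add cau_cx)
  moreover have "(X - cx J z) * (X - cx J (cnj z)) = X * X - (cx J z + cx J (cnj z)) * X + cx J z * cx J (cnj z)"
    by (simp only: algebra_simps)
  ultimately have "eqv ((X - cx J z) * (X - cx J (cnj z))) (ev x (quad z))"
    using eqv_trans[OF _ eqv_sym[OF ev_quad[of x z]]] unfolding X_def by simp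
  then have "lav ((X - cx J z) * (X - cx J (cnj z))) = 0"
    using z eqv_lav[OF _ _ cau_ev[of x "quad z"]] by (simp add: cau_intros cX cau_cx)
  then have "lav (X - cx J z) = 0 \<or> lav (X - cx J (cnj z)) = 0"
    by (simp add: lav_mult cau_diff cX cau_cx)
  then have "eqv X (cx J z) \<or> eqv X (cx J (cnj z))"
    unfolding eqv_def by (simp add: lav_zero_iff cau_diff cX cau_cx)
  then show ?thesis unfolding X_def by blast
qed

end

lemma completion_cases:
  "(\<exists>\<sigma> :: 'k \<Rightarrow> real. \<sigma> 1 = 1 \<and> (\<forall>x y. \<sigma> (x + y) = \<sigma> x + \<sigma> y) \<and> (\<forall>x y. \<sigma> (x * y) = \<sigma> x * \<sigma> y) \<and>
      (\<forall>x. norm (\<sigma> x) = a x powr (1 / s)) \<and> closure (range \<sigma>) = UNIV) \<or>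
   (\<exists>\<sigma> :: 'k \<Rightarrow> complex. \<sigma> 1 = 1 \<and> (\<forall>x y. \<sigma> (x + y) = \<sigma> x + \<sigma> y) \<and> (\<forall>x y. \<sigma> (x * y) = \<sigma> x * \<sigma> y) \<and>
      (\<forall>x. norm (\<sigma> x) = a x powr (1 / s)) \<and> closure (range \<sigma>) = UNIV)"
proof (cases "\<forall>x. \<exists>r. eqv (\<lambda>_. x) (dy r)")
  case True
  then obtain \<sigma> :: "'k \<Rightarrow> real" where "\<sigma> 1 = 1" "\<And>x y. \<sigma> (x + y) = \<sigma> x + \<sigma> y" "\<And>x y. \<sigma> (x * y) = \<sigma> x * \<sigma> y"
    "\<And>x. norm (\<sigma> x) = a x powr (1 / s)" "closure (range \<sigma>) = UNIV"
    using approx_hom_onto[OF approx_hom_dy] by metis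
  then show ?thesis by blast
next
  case False
  then obtain x where x: "\<not> (\<exists>r. eqv (\<lambda>_. x) (dy r))" by blast
  obtain z where z: "lav (ev x (quad z)) = 0" by (rule quadratic_relation)
  then have "Im z \<noteq> 0" using real_quadratic x by blast
  then obtain J where J: "cau J" "eqv (J * J) (- 1)" using imaginary_unit[OF z] by blast
  obtain \<sigma> :: "'k \<Rightarrow> complex" where "\<sigma> 1 = 1" "\<And>x y. \<sigma> (x + y) = \<sigma> x + \<sigma> y" "\<And>x y. \<sigma> (x * y) = \<sigma> x * \<sigma> y"
    "\<And>x. norm (\<sigma> x) = a x powr (1 / s)" "closure (range \<sigma>) = UNIV"
    using approx_hom_onto[OF approx_hom_cx[OF J] cx_onto[OF J]] by metis
  then show ?thesis by blast
qed

end

text \<open>The embedding from \<open>completion_cases\<close> has as norm a positive power of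
  \<open>a\<close>, which is again a member of the place, as \<open>completion_map\<close>
  demands.\<close>

theorem infinite_place_cases:
  fixes p :: "'k::field place"
  assumes p: "infinite_place p"
  shows "real_place p \<or> complex_place p"
proof -
  have pl: "p \<in> places" using p unfolding infinite_place_def by simp
  obtain a where a: "a \<in> p" "\<not> ultrametric_av a" using p unfolding infinite_place_def by blast
  interpret absval a by unfold_locales (rule place_props(1)[OF pl a(1)])
  obtain s where s: "0 < s" "\<And>n. a (of_nat n) = real n powr s" by (rule archimedean_of_nat[OF a(2)]) blast
  interpret archimedean a s by unfold_locales (use s in auto)
  have mem: "(\<lambda>x. norm (\<sigma> x)) \<in> p"
    if \<sigma>: "\<sigma> 1 = 1" "\<forall>x y. \<sigma> (x + y) = \<sigma> x + \<sigma> y" "\<forall>x y. \<sigma> (x * y) = \<sigma> x * \<sigma> y" "\<forall>x. norm (\<sigma> x) = a x powr (1 / s)"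
    for \<sigma> :: "'k \<Rightarrow> 'c::real_normed_field"
  proof -
    have "norm (\<sigma> x) = 0 \<longleftrightarrow> x = 0" for x using \<sigma>(4) by simp
    then have "absolute_value (\<lambda>x. norm (\<sigma> x))"
      unfolding absolute_value_def using \<sigma>(2,3) by (auto simp: norm_mult norm_triangle_ineq)
    moreover have "equiv_av a (\<lambda>x. norm (\<sigma> x))"
      unfolding equiv_av_def using \<sigma>(4) s(1) by (intro exI[of _ "1 / s"]) auto
    ultimately show ?thesis using place_props(3)[OF pl a(1)] by blast
  qed
  show ?thesis
    using completion_cases
  proof (elim disjE exE conjE)
    fix \<sigma> :: "'k \<Rightarrow> real"
    assume "\<sigma> 1 = 1" "\<forall>x y. \<sigma> (x + y) = \<sigma> x + \<sigma> y" "\<forall>x y. \<sigma> (x * y) = \<sigma> x * \<sigma> y"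
      "\<forall>x. norm (\<sigma> x) = a x powr (1 / s)" "closure (range \<sigma>) = UNIV"
    then have "completion_map p \<sigma>" unfolding completion_map_def using mem[of \<sigma>] by blast
    then show ?thesis unfolding real_place_def using p by blast
  next
    fix \<sigma> :: "'k \<Rightarrow> complex"
    assume "\<sigma> 1 = 1" "\<forall>x y. \<sigma> (x + y) = \<sigma> x + \<sigma> y" "\<forall>x y. \<sigma> (x * y) = \<sigma> x * \<sigma> y"
      "\<forall>x. norm (\<sigma> x) = a x powr (1 / s)" "closure (range \<sigma>) = UNIV"
    then have "completion_map p \<sigma>" unfolding completion_map_def using mem[of \<sigma>] by blast
    then show ?thesis unfolding complex_place_def using p by blast
  qed
qed

theorem theorem5p6:
  fixes S0 S1 :: "'k::field place set"
  assumes "S1 \<subseteq> S0" and "S0 \<subseteq> places'" and "S0 \<noteq> {}"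
  shows "((\<forall>p\<in>S0. \<not> complex_place p) \<and> (\<forall>p\<in>S1. \<not> infinite_place p) \<longrightarrow>
            model_complete TYPE('u) (lang_kS S0 S1) (T_kS S0 S1) \<and>
            complete_theory TYPE('u) (lang_kS S0 S1) (T_kS S0 S1)) \<and>
         ((\<forall>p\<in>S0. \<not> complex_place p) \<and> S1 = {} \<longrightarrow>
            quantifier_elimination TYPE('u) (lang_kS S0 S1) (T_kS S0 S1))"
proof -
  have adm: "admissible S0 S1" if "\<forall>p\<in>S0. \<not> complex_place p" "\<forall>p\<in>S1. \<not> infinite_place p"
  proof
    show "finite_place p \<and> discrete_place p" if p: "p \<in> S0" "\<not> real_place p" for p
      using p infinite_place_cases[of p] assms(2) \<open>\<forall>p\<in>S0. \<not> complex_place p\<close> unfolding places'_def by blast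
    show "\<not> real_place p" if "p \<in> S1" for p
      using that \<open>\<forall>p\<in>S1. \<not> infinite_place p\<close> unfolding real_place_def by blast
  qed (rule assms(1))
  have pl: "S0 \<subseteq> places" using assms(2) unfolding places'_def infinite_place_def finite_place_def by blast
  show ?thesis
  proof (intro conjI impI; elim conjE)
    assume a: "\<forall>p\<in>S0. \<not> complex_place p" "\<forall>p\<in>S1. \<not> infinite_place p"
    interpret admissible S0 S1 by (rule adm[OF a])
    show "model_complete TYPE('u) (lang_kS S0 S1) (T_kS S0 S1)" by (rule model_completeness[OF assms(3)])
    show "complete_theory TYPE('u) (lang_kS S0 S1) (T_kS S0 S1)"
      by (rule completeness[OF assms(3) kmod_model[OF pl]]) (use kmod_embeds[OF pl assms(3)] in blast)
  next
    assume a: "\<forall>p\<in>S0. \<not> complex_place p" "S1 = {}"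
    interpret admissible S0 S1 by (rule adm) (use a in auto)
    show "quantifier_elimination TYPE('u) (lang_kS S0 S1) (T_kS S0 S1)" by (rule quantifier_elim[OF assms(3) a(2)])
  qed
qed

end
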